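(* Let $\Omega=(-1,1)^2$, let $\xi>0$ be fixed, and let $\varepsilon_n\to0$ with $\varepsilon_n>0$. Let $k_n\in W^{1,2}(\Omega;\mathbb{R}^2)$ and $B_n\in H_{\mathrm{curl}}(\Omega;\mathbb{R}^{2\times2})$ satisfy $$B_n\equiv0\text{ in }\Omega\setminus L_{\varepsilon_n,\xi},\qquad\left|\int_\Omega\mathrm{curl}\,B_n\,dx\right|=2,$$ and have uniformly bounded energy, that is, $E_{\varepsilon_n,\xi}[k_n,B_n]\le C<\infty$ for all $n$. Define on $L_\xi$ the rescaled fields $\tilde k_n(x_1,x_2):=k_n(x_1,\varepsilon_nx_2)$ and $\tilde B_n(x_1,x_2):=\varepsilon_nB_n(x_1,\varepsilon_nx_2)$. Then the following hold. (i) Outside the layer, $k_n\chi_{(L_{\varepsilon_n,\xi})^c}\to k$ strongly in $L^2(\Omega;\mathbb{R}^2)$, where $k\in SBV(\Omega;S^1)$. Furthermore, the jump set of $k$ is contained in $\overline{L^0_\xi}$. (ii) In the layer, $$\tilde k_n\rightharpoonup\tilde k\ \text{ weakly in }L^2(L_\xi;\mathbb{R}^2),\qquad\tilde B_n\rightharpoonup B\ \text{ weakly in }L^2(L_\xi;\mathbb{R}^{2\times2}),\qquad\mathrm{curl}_{\varepsilon_n}\tilde B_n\rightharpoonup\alpha\ \text{ weakly in }L^2(L_\xi;\mathbb{R}^2),$$ for some $\tilde k\in L^2(L_\xi;\mathbb{R}^2)$, $\alpha\in L^2(L_\xi;\mathbb{R}^2)$, and $$B:=\begin{bmatrix}0&\partial_2\tilde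 k_1\\0&\partial_2\tilde k_2\end{bmatrix},$$ where $\tilde k_1,\tilde k_2$ here denote the components of $\tilde k$. (iii) Further, for almost every $x_1\in(-\xi,1)$, $\tilde k(x_1,\cdot)\in W^{1,2}\left(-\frac\xi2,\frac\xi2\right)$, and one may define $[\tilde k]:(-\xi,1)\to\mathbb{R}^2$ by $$[\tilde k](x_1):=\int_{-\xi/2}^{\xi/2}\partial_2\tilde k(x_1,x_2)\,dx_2.$$ The following compatibility condition between $\tilde k$ and $\alpha$ holds: $$[\tilde k](s)=\int_{-\xi}^{s}\int_{-\xi/2}^{\xi/2}\alpha\,dx_2\,dx_1\quad\text{for }s\in(-\xi,1),\qquad|[\tilde k](1)|=2 .$$
   Context: For $\varepsilon,\xi>0$, $L_{\varepsilon,\xi}:=(-\xi,1)\times\left(-\frac{\varepsilon\xi}{2},\frac{\varepsilon\xi}{2}\right)$; $L_\xi:=L_{1,\xi}=(-\xi,1)\times\left(-\frac\xi2,\frac\xi2\right)$; $L^0_\xi:=(-\xi,1)\times\{0\}$, and $\overline{L^0_\xi}$ is its closure. The energy is $$E_{\varepsilon,\xi}[k,B]:=\int_\Omega\left[\frac{(|k|-1)^2}{\varepsilon\xi^2}+|\nabla k-B|^2+\varepsilon\xi^2|\mathrm{curl}\,B|^2+\frac{1}{\varepsilon\xi^2}W(\varepsilon\xi|B|)\right]dx,$$ where $W:[0,\infty)\to[0,\infty)$ is a nonconvex continuous potential with $\frac1C|x|^2-C\le W(x)\le C(1+|x|^2)$ for all $x\in[0,\infty)$ and some $C>0$, and $\{x\in[0,\infty):W(x)=0\}=\{0,2\}$.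 The curl of a $2\times2$ matrix field is taken row-wise and distributionally: for a row $g=(g_1,g_2)$, $\mathrm{curl}\,g=\partial_1g_2-\partial_2g_1$, so $\mathrm{curl}\,B$ is $\mathbb{R}^2$-valued. The scaled curl of a row is $\mathrm{curl}_\varepsilon g:=\partial_1g_2-\frac1\varepsilon\partial_2g_1$, also applied row-wise. $H_{\mathrm{curl}}(\Omega;\mathbb{R}^{2\times2})$ is the space of $L^2$ matrix fields whose row-wise distributional curl is also in $L^2$. $\chi_A$ is the characteristic function of $A$, and $(L_{\varepsilon_n,\xi})^c$ is the complement of $L_{\varepsilon_n,\xi}$ (in $\Omega$). $SBV(\Omega;S^1)$ denotes the special functions of bounded variation on $\Omega$ with values in the unit circle $S^1$ almost everywhere. The values $[\tilde k](s)$ and $[\tilde k](1)$ are those of the continuous representative of $[\tilde k]$ on $[-\xi,1]$.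
   Formalization: All convergences are proved along a common subsequence (full-sequence convergence fails, as signs of (k_n,B_n) may alternate), and ξ<1 is assumed (for ξ>1 the rescaled fields are undefined on part of L_ξ; for ξ=1 the compatibility condition can fail). *)

theory Defs
  imports "HOL-Analysis.Analysis"
begin

text \<open>Points of the planar domain have type \<^typ>\<open>real \<times> real\<close> (so that Fubini applies directly),
  vector values have type \<^typ>\<open>real^2\<close>, and matrix values have type \<^typ>\<open>real^2^2\<close>, where
  \<open>B x $ i $ j\<close> is the entry in row \<open>i\<close> and column \<open>j\<close>; the norm on \<^typ>\<open>real^2^2\<close> is the
  Frobenius norm. Elements of Lebesgue spaces are represented by Borel functions, and only their
  values almost everywhere on the relevant set matter.\<close>

type_synonym plane = "real \<times> real"

definition coord :: "2 \<Rightarrow> plane" where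
  "coord j = (if j = 1 then (1, 0) else (0, 1))"

subsection \<open>Test functions and weak derivatives\<close>

text \<open>\<open>D [v\<^sub>m, \<dots>, v\<^sub>1]\<close> is the iterated directional derivative of \<open>\<phi>\<close> along
  \<open>v\<^sub>1, \<dots>, v\<^sub>m\<close>; all of these are required to be Frechet differentiable everywhere.\<close>

definition smooth_fun :: "('a::euclidean_space \<Rightarrow> real) \<Rightarrow> bool" where
  "smooth_fun \<phi> \<longleftrightarrow> (\<exists>D :: 'a list \<Rightarrow> 'a \<Rightarrow> real. D [] = \<phi> \<and>
     (\<forall>vs x. (D vs has_derivative (\<lambda>h. D (h # vs) x)) (at x)))"

definition test_fun :: "'a::euclidean_space set \<Rightarrow> ('a \<Rightarrow> real) \<Rightarrow> bool" where
  "test_fun U \<phi> \<longleftrightarrow> smooth_fun \<phi> \<and> (\<exists>K. compact K \<and> K \<subseteq> U \<and> (\<forall>x. x \<notin> K \<longrightarrow> \<phi> x = 0))"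

definition dir_deriv :: "'a::euclidean_space \<Rightarrow> ('a \<Rightarrow> real) \<Rightarrow> 'a \<Rightarrow> real" where
  "dir_deriv v \<phi> x = frechet_derivative \<phi> (at x) v"

definition loc_integrable :: "'a::euclidean_space set \<Rightarrow> ('a \<Rightarrow> 'b::euclidean_space) \<Rightarrow> bool" where
  "loc_integrable U f \<longleftrightarrow> (\<forall>K. compact K \<and> K \<subseteq> U \<longrightarrow> set_integrable lborel K f)"

definition has_weak_deriv ::
  "'a::euclidean_space set \<Rightarrow> 'a \<Rightarrow> ('a \<Rightarrow> 'b::euclidean_space) \<Rightarrow> ('a \<Rightarrow> 'b) \<Rightarrow> bool" where
  "has_weak_deriv U v f g \<longleftrightarrow> loc_integrable U f \<and> loc_integrable U g \<and>
     (\<forall>\<phi>. test_fun U \<phi> \<longrightarrow>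
        (LINT x:U|lborel. dir_deriv v \<phi> x *\<^sub>R f x) = - (LINT x:U|lborel. \<phi> x *\<^sub>R g x))"

text \<open>Weak derivatives are unique almost everywhere, so for open \<open>U\<close> the choice in
  \<open>weak_deriv\<close>, and below in \<open>weak_curl\<close>, is immaterial whenever one exists.\<close>

definition weak_deriv ::
  "'a::euclidean_space set \<Rightarrow> 'a \<Rightarrow> ('a \<Rightarrow> 'b::euclidean_space) \<Rightarrow> 'a \<Rightarrow> 'b" where
  "weak_deriv U v f = (SOME g. has_weak_deriv U v f g)"

definition weak_grad :: "plane set \<Rightarrow> (plane \<Rightarrow> real^2) \<Rightarrow> plane \<Rightarrow> real^2^2" where
  "weak_grad U k x = (\<chi> i j. weak_deriv U (coord j) k x $ i)"

subsection \<open>Function spaces and modes of convergence\<close>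

definition L1 :: "'a::euclidean_space set \<Rightarrow> ('a \<Rightarrow> 'b::euclidean_space) set" where
  "L1 U = {f. set_integrable lborel U f}"

definition L2 :: "'a::euclidean_space set \<Rightarrow> ('a \<Rightarrow> 'b::euclidean_space) set" where
  "L2 U = {f. set_borel_measurable lborel U f \<and> set_integrable lborel U (\<lambda>x. (norm (f x))\<^sup>2)}"

definition W12 :: "'a::euclidean_space set \<Rightarrow> ('a \<Rightarrow> 'b::euclidean_space) set" where
  "W12 U = {f \<in> L2 U. \<forall>v\<in>Basis. \<exists>g\<in>L2 U. has_weak_deriv U v f g}"

definition strong_L2 ::
  "'a::euclidean_space set \<Rightarrow> (nat \<Rightarrow> 'a \<Rightarrow> 'b::euclidean_space) \<Rightarrow> ('a \<Rightarrow> 'b) \<Rightarrow> bool" where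
  "strong_L2 U f f0 \<longleftrightarrow> (\<forall>n. f n \<in> L2 U) \<and> f0 \<in> L2 U \<and>
     (\<lambda>n. LINT x:U|lborel. (norm (f n x - f0 x))\<^sup>2) \<longlonglongrightarrow> 0"

definition weak_L2 ::
  "'a::euclidean_space set \<Rightarrow> (nat \<Rightarrow> 'a \<Rightarrow> 'b::euclidean_space) \<Rightarrow> ('a \<Rightarrow> 'b) \<Rightarrow> bool" where
  "weak_L2 U f f0 \<longleftrightarrow> (\<forall>n. f n \<in> L2 U) \<and> f0 \<in> L2 U \<and>
     (\<forall>\<psi>\<in>L2 U. (\<lambda>n. LINT x:U|lborel. f n x \<bullet> \<psi> x) \<longlonglongrightarrow> (LINT x:U|lborel. f0 x \<bullet> \<psi> x))"

subsection \<open>The row-wise scaled distributional curl\<close>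

text \<open>For a row \<open>g = (g\<^sub>1, g\<^sub>2)\<close> the scaled curl is \<open>\<partial>\<^sub>1 g\<^sub>2 - (1/\<epsilon>) \<partial>\<^sub>2 g\<^sub>1\<close>; the ordinary curl is
  the case \<open>\<epsilon> = 1\<close>.\<close>

definition has_weak_row_curl ::
  "real \<Rightarrow> plane set \<Rightarrow> (plane \<Rightarrow> real^2) \<Rightarrow> (plane \<Rightarrow> real) \<Rightarrow> bool" where
  "has_weak_row_curl \<epsilon> U g c \<longleftrightarrow> loc_integrable U g \<and> loc_integrable U c \<and>
     (\<forall>\<phi>. test_fun U \<phi> \<longrightarrow>
        (LINT x:U|lborel. \<phi> x * c x) =
        - (LINT x:U|lborel. dir_deriv (coord 1) \<phi> x * g x $ 2
             - (1 / \<epsilon>) * (dir_deriv (coord 2) \<phi> x * g x $ 1)))"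

definition has_weak_curl ::
  "real \<Rightarrow> plane set \<Rightarrow> (plane \<Rightarrow> real^2^2) \<Rightarrow> (plane \<Rightarrow> real^2) \<Rightarrow> bool" where
  "has_weak_curl \<epsilon> U B c \<longleftrightarrow> (\<forall>i. has_weak_row_curl \<epsilon> U (\<lambda>x. B x $ i) (\<lambda>x. c x $ i))"

definition weak_curl :: "real \<Rightarrow> plane set \<Rightarrow> (plane \<Rightarrow> real^2^2) \<Rightarrow> plane \<Rightarrow> real^2" where
  "weak_curl \<epsilon> U B = (SOME c. has_weak_curl \<epsilon> U B c)"

definition Hcurl :: "real \<Rightarrow> plane set \<Rightarrow> (plane \<Rightarrow> real^2^2) set" where
  "Hcurl \<epsilon> U = {B \<in> L2 U. \<exists>c\<in>L2 U. has_weak_curl \<epsilon> U B c}"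

subsection \<open>Special functions of bounded variation\<close>

definition half_ball :: "plane \<Rightarrow> real \<Rightarrow> plane \<Rightarrow> plane set" where
  "half_ball x r \<nu> = {y \<in> ball x r. (y - x) \<bullet> \<nu> > 0}"

definition one_sided_approx_limit ::
  "(plane \<Rightarrow> real^2) \<Rightarrow> plane \<Rightarrow> plane \<Rightarrow> real^2 \<Rightarrow> bool" where
  "one_sided_approx_limit u x \<nu> a \<longleftrightarrow>
     ((\<lambda>r. (LINT y:half_ball x r \<nu>|lborel. norm (u y - a)) / measure lborel (half_ball x r \<nu>))
        \<longlongrightarrow> 0) (at_right 0)"

definition jump_set :: "plane set \<Rightarrow> (plane \<Rightarrow> real^2) \<Rightarrow> plane set" where
  "jump_set U u = {x \<in> U. \<exists>a b \<nu>. a \<noteq> b \<and> norm \<nu> = 1 \<and>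
     one_sided_approx_limit u x \<nu> a \<and> one_sided_approx_limit u x (- \<nu>) b}"

text \<open>\<open>has_BV_deriv U u G \<mu> \<sigma>\<close> says that the distributional derivative of \<open>u\<close> on \<open>U\<close> is the finite
  matrix-valued measure \<open>Du = G dx + \<sigma> \<mu>\<close>. This is its Lebesgue decomposition: \<open>\<mu>\<close> is singular with
  respect to Lebesgue measure, and since \<open>\<sigma>\<close> is a unit field, \<open>\<sigma> \<mu>\<close> is the polar decomposition of
  the singular part \<open>D\<^sup>su\<close>, i.e. \<open>\<mu>\<close> is the total variation of \<open>D\<^sup>su\<close>.\<close>

definition has_BV_deriv ::
  "plane set \<Rightarrow> (plane \<Rightarrow> real^2) \<Rightarrow> (plane \<Rightarrow> real^2^2) \<Rightarrow> plane measure \<Rightarrow> (plane \<Rightarrow> real^2^2) \<Rightarrow> bool"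
  where
  "has_BV_deriv U u G \<mu> \<sigma> \<longleftrightarrow>
     G \<in> L1 U \<and>
     sets \<mu> = sets borel \<and> finite_measure \<mu> \<and> (AE x in \<mu>. x \<in> U) \<and>
     (\<exists>S\<in>null_sets lborel. AE x in \<mu>. x \<in> S) \<and>
     \<sigma> \<in> borel_measurable borel \<and> (AE x in \<mu>. norm (\<sigma> x) = 1) \<and>
     (\<forall>\<phi> j. test_fun U \<phi> \<longrightarrow>
        (LINT x:U|lborel. dir_deriv (coord j) \<phi> x *\<^sub>R u x) =
        - ((LINT x:U|lborel. \<phi> x *\<^sub>R column j (G x)) + (LINT x|\<mu>. \<phi> x *\<^sub>R column j (\<sigma> x))))"

text \<open>A function of bounded variation is in SBV if the Cantor part of its derivative, the
  restriction of \<open>D\<^sup>su\<close> to the complement of the jump set, vanishes.\<close>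

definition SBV :: "plane set \<Rightarrow> (real^2) set \<Rightarrow> (plane \<Rightarrow> real^2) set" where
  "SBV U S = {u \<in> L1 U. (\<exists>G \<mu> \<sigma>. has_BV_deriv U u G \<mu> \<sigma> \<and> (AE x in \<mu>. x \<in> jump_set U u)) \<and>
     (AE x in lborel. x \<in> U \<longrightarrow> u x \<in> S)}"

subsection \<open>The model\<close>

definition Omega :: "plane set" where
  "Omega = {-1<..<1} \<times> {-1<..<1}"

definition layer :: "real \<Rightarrow> real \<Rightarrow> plane set" where
  "layer \<epsilon> \<xi> = {-\<xi><..<1} \<times> {-(\<epsilon> * \<xi> / 2)<..<\<epsilon> * \<xi> / 2}"

definition layer0 :: "real \<Rightarrow> plane set" where
  "layer0 \<xi> = {-\<xi><..<1} \<times> {0}"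

definition admissible_potential :: "(real \<Rightarrow> real) \<Rightarrow> bool" where
  "admissible_potential W \<longleftrightarrow>
     (\<forall>x\<ge>0. W x \<ge> 0) \<and> continuous_on {0..} W \<and> \<not> convex_on {0..} W \<and>
     (\<exists>C>0. \<forall>x\<ge>0. x\<^sup>2 / C - C \<le> W x \<and> W x \<le> C * (1 + x\<^sup>2)) \<and>
     {x \<in> {0..}. W x = 0} = {0, 2}"

definition energy ::
  "(real \<Rightarrow> real) \<Rightarrow> real \<Rightarrow> real \<Rightarrow> (plane \<Rightarrow> real^2) \<Rightarrow> (plane \<Rightarrow> real^2^2) \<Rightarrow> ennreal" where
  "energy W \<epsilon> \<xi> k B = (\<integral>\<^sup>+x\<in>Omega. ennreal (
      (norm (k x) - 1)\<^sup>2 / (\<epsilon> * \<xi>\<^sup>2)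
      + (norm (weak_grad Omega k x - B x))\<^sup>2
      + \<epsilon> * \<xi>\<^sup>2 * (norm (weak_curl 1 Omega B x))\<^sup>2
      + 1 / (\<epsilon> * \<xi>\<^sup>2) * W (\<epsilon> * \<xi> * norm (B x))) \<partial>lborel)"

definition rescale :: "real \<Rightarrow> (plane \<Rightarrow> 'b) \<Rightarrow> plane \<Rightarrow> 'b" where
  "rescale \<epsilon> f x = f (fst x, \<epsilon> * snd x)"

text \<open>The matrix field with vanishing first column and second column \<open>d\<close>.\<close>

definition second_column :: "(plane \<Rightarrow> real^2) \<Rightarrow> plane \<Rightarrow> real^2^2" where
  "second_column d x = (\<chi> i j. if j = 2 then d x $ i else 0)"

end

theory Submission
  imports Defs "HOL-Library.Diagonal_Subsequence"
begin

text \<open>The energy bounds \<open>H\<^sub>n = \<nabla>k\<^sub>n - B\<^sub>n\<close> in \<open>L\<^sup>2(\<Omega>)\<close> and, through the growth of \<open>W\<close> and the area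
  \<open>O(\<epsilon>\<^sub>n)\<close> of the layer, also the rescaled \<open>k\<^sub>n\<close>, \<open>B\<^sub>n\<close> and curls, so a subsequence has weak limits
  \<open>k0\<close>, \<open>H0\<close>, \<open>kt\<close>, \<open>B\<close>, \<open>\<alpha>\<close>. The gradient identity in the layer forces the first column of \<open>B\<close> to vanish and
  the second to be \<open>\<partial>\<^sub>2 kt\<close>. Testing the curl with functions of \<open>x\<^sub>1\<close> alone, which is legitimate since \<open>B\<^sub>n\<close>
  vanishes left of \<open>-\<xi>\<close>, shows that the fibre integral \<open>J\<close> of \<open>\<partial>\<^sub>2 kt\<close> is the primitive of the fibre integral
  of \<open>\<alpha>\<close>. On \<open>\<Omega>\<close> the layer then contributes a line measure to the limit gradient:
  \<open>D k0 = H0 dx + J \<otimes> e\<^sub>2\<close> on the segment. Poincare's inequality on small squares off the axis upgrades weak to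
  strong convergence, concentration at the axis being excluded by \<open>|k\<^sub>n| \<approx> 1\<close>. Poincare's inequality also excludes
  jumps off the closed segment, while the representation of \<open>k0\<close> by integration along vertical lines produces both
  traces at almost every point of the segment where \<open>J \<noteq> 0\<close>, so that the singular part lives on the jump set.\<close>

subsection \<open>Square-integrable functions\<close>

text \<open>On the thin layer \<open>B n\<close> is bounded only by a multiple of
  \<open>\<epsilon>^(-1/2)\<close> in L2, so nothing there passes to the limit before rescaling.
  Composing a field with \<open>stretch \<epsilon>\<close> and multiplying it by
  \<open>\<epsilon>\<close> gives a squared norm on the fixed layer equal to
  \<open>\<epsilon>\<close> times the squared norm on the thin one: \<open>Bt\<close> and
  \<open>ct\<close> stay bounded, while \<open>Ht\<close> tends to zero because \<open>H\<close> was
  bounded already. The rescaled gradient has columns \<open>\<epsilon>\<close> times the first and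
  once the second partial derivative of \<open>kt\<close>, and this asymmetry is what kills the
  first column of the limit. The jump \<open>J\<close> is built from \<alpha> and not from
  \<open>kt\<close>. It is then continuous and has the right value at 1 by construction, and the
  curl test only has to identify it almost everywhere with the fibre integral. Two obstacles shape
  the rest. The constraint of unit modulus is nonconvex, so it survives only under strong
  convergence. And membership in \<open>SBV\<close> asks for honest one-sided limits at almost every
  point charged by the line measure, which is the reason for the Vitali argument and the Lebesgue
  points.\<close>

definition sqint :: "'a measure \<Rightarrow> ('a \<Rightarrow> 'b::euclidean_space) \<Rightarrow> bool" where
  "sqint M f \<longleftrightarrow> f \<in> borel_measurable M \<and> integrable M (\<lambda>x. (norm (f x))\<^sup>2)"

definition ip :: "'a measure \<Rightarrow> ('a \<Rightarrow> 'b::euclidean_space) \<Rightarrow> ('a \<Rightarrow> 'b) \<Rightarrow> real" where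
  "ip M f g = (\<integral>x. f x \<bullet> g x \<partial>M)"

definition nsq :: "'a measure \<Rightarrow> ('a \<Rightarrow> 'b::euclidean_space) \<Rightarrow> real" where
  "nsq M f = (\<integral>x. (norm (f x))\<^sup>2 \<partial>M)"

lemma sqint_measurable [measurable_dest]: "sqint M f \<Longrightarrow> f \<in> borel_measurable M"
  by (simp add: sqint_def)

lemma sqint_integrable: "sqint M f \<Longrightarrow> integrable M (\<lambda>x. (norm (f x))\<^sup>2)"
  by (simp add: sqint_def)

lemma nsq_nonneg [simp]: "nsq M f \<ge> 0"
  by (simp add: nsq_def)

lemma nsq_eq_ip: "nsq M f = ip M f f"
  by (simp add: nsq_def ip_def power2_norm_eq_inner)

lemma ip_commute: "ip M f g = ip M g f"
  by (simp add: ip_def inner_commute)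

lemma sqintI_bound:
  assumes "f \<in> borel_measurable M" "integrable M h" "\<And>x. (norm (f x))\<^sup>2 \<le> h x"
  shows "sqint M f"
  unfolding sqint_def
proof
  show "integrable M (\<lambda>x. (norm (f x))\<^sup>2)"
    by (rule Bochner_Integration.integrable_bound[OF assms(2)]) (use assms in \<open>auto intro!: order_trans[OF _ abs_ge_self]\<close>)
qed (fact assms)

lemma norm_add_power2_le: "(norm (a + b))\<^sup>2 \<le> 2 * (norm a)\<^sup>2 + 2 * (norm (b::'b::real_inner))\<^sup>2"
proof -
  have "0 \<le> (norm (a - b))\<^sup>2" by simp
  then show ?thesis by (simp add: power2_norm_eq_inner inner_add inner_diff inner_commute)
qed

lemma abs_inner_le_power2: "\<bar>a \<bullet> (b::'b::real_inner)\<bar> \<le> (norm a)\<^sup>2 + (norm b)\<^sup>2"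
proof -
  have "\<bar>a \<bullet> b\<bar> \<le> norm a * norm b" by (rule Cauchy_Schwarz_ineq2)
  also have "\<dots> \<le> (norm a)\<^sup>2 + (norm b)\<^sup>2"
    using sum_squares_bound[of "norm a" "norm b"] mult_nonneg_nonneg[OF norm_ge_zero[of a] norm_ge_zero[of b]]
    by linarith
  finally show ?thesis .
qed

lemma sqint_add:
  assumes "sqint M f" "sqint M g" shows "sqint M (\<lambda>x. f x + g x)"
proof (rule sqintI_bound)
  show "integrable M (\<lambda>x. 2 * (norm (f x))\<^sup>2 + 2 * (norm (g x))\<^sup>2)"
    using assms by (intro Bochner_Integration.integrable_add integrable_mult_right) (auto simp: sqint_def)
qed (use assms in \<open>auto simp: norm_add_power2_le\<close>)

lemma sqint_scaleR: "sqint M f \<Longrightarrow> sqint M (\<lambda>x. c *\<^sub>R f x)"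
  by (auto simp: sqint_def power_mult_distrib)

lemma sqint_diff: "sqint M f \<Longrightarrow> sqint M g \<Longrightarrow> sqint M (\<lambda>x. f x - g x)"
  using sqint_add[of M f "\<lambda>x. (-1) *\<^sub>R g x"] sqint_scaleR[of M g "-1"] by simp

lemma sqint_zero [simp]: "sqint M (\<lambda>x. 0)"
  by (simp add: sqint_def)

lemma sqint_cong_AE:
  assumes "f \<in> borel_measurable M" "sqint M g" "AE x in M. f x = g x"
  shows "sqint M f"
proof -
  have "integrable M (\<lambda>x. (norm (f x))\<^sup>2) \<longleftrightarrow> integrable M (\<lambda>x. (norm (g x))\<^sup>2)"
    using assms by (intro integrable_cong_AE) auto
  with assms show ?thesis by (simp add: sqint_def)
qed

lemma integrable_ip:
  assumes "sqint M f" "sqint M g" shows "integrable M (\<lambda>x. f x \<bullet> g x)"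
proof (rule Bochner_Integration.integrable_bound)
  show "integrable M (\<lambda>x. (norm (f x))\<^sup>2 + (norm (g x))\<^sup>2)"
    using assms by (auto simp: sqint_def)
  show "(\<lambda>x. f x \<bullet> g x) \<in> borel_measurable M" using assms by auto
  show "AE x in M. norm (f x \<bullet> g x) \<le> norm ((norm (f x))\<^sup>2 + (norm (g x))\<^sup>2)"
  proof (intro AE_I2)
    fix x
    show "norm (f x \<bullet> g x) \<le> norm ((norm (f x))\<^sup>2 + (norm (g x))\<^sup>2)"
      using abs_inner_le_power2[of "f x" "g x"] by simp
  qed
qed

lemma ip_add_left: "\<lbrakk>sqint M f; sqint M g; sqint M h\<rbrakk> \<Longrightarrow> ip M (\<lambda>x. f x + g x) h = ip M f h + ip M g h"
  by (simp add: ip_def inner_add integrable_ip)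

lemma ip_diff_left: "\<lbrakk>sqint M f; sqint M g; sqint M h\<rbrakk> \<Longrightarrow> ip M (\<lambda>x. f x - g x) h = ip M f h - ip M g h"
  by (simp add: ip_def inner_diff integrable_ip)

lemma ip_scaleR_left: "ip M (\<lambda>x. c *\<^sub>R f x) h = c * ip M f h"
  by (simp add: ip_def)

lemma nsq_add:
  assumes "sqint M f" "sqint M g"
  shows "nsq M (\<lambda>x. f x + g x) = nsq M f + 2 * ip M f g + nsq M g"
proof -
  let ?h = "\<lambda>x. f x + g x"
  have "nsq M ?h = ip M f ?h + ip M g ?h"
    unfolding nsq_eq_ip using assms by (intro ip_add_left sqint_add)
  also have "ip M f ?h = nsq M f + ip M f g"
    unfolding nsq_eq_ip using assms by (subst ip_commute) (simp add: ip_add_left ip_commute[of M g])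
  also have "ip M g ?h = ip M f g + nsq M g"
    unfolding nsq_eq_ip using assms by (subst ip_commute) (simp add: ip_add_left)
  finally show ?thesis by simp
qed

lemma nsq_scaleR: "nsq M (\<lambda>x. c *\<^sub>R f x) = c\<^sup>2 * nsq M f"
  by (simp add: nsq_def power_mult_distrib)

lemma nsq_diff:
  assumes "sqint M f" "sqint M g"
  shows "nsq M (\<lambda>x. f x - g x) = nsq M f - 2 * ip M f g + nsq M g"
  using nsq_add[OF assms(1) sqint_scaleR[OF assms(2), of "-1"]] nsq_scaleR[of M "-1" g]
    ip_scaleR_left[of M "-1" g f] ip_commute[of M f g] ip_commute[of M f "\<lambda>x. (-1) *\<^sub>R g x"]
  by simp

lemma nsq_add_le:
  assumes "sqint M f" "sqint M g"
  shows "nsq M (\<lambda>x. f x + g x) \<le> 2 * nsq M f + 2 * nsq M g"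
proof -
  have "nsq M (\<lambda>x. f x - g x) \<ge> 0" by simp
  with nsq_diff[OF assms] nsq_add[OF assms] show ?thesis by linarith
qed

lemma nsq_diff_le:
  assumes "sqint M f" "sqint M g"
  shows "nsq M (\<lambda>x. f x - g x) \<le> 2 * nsq M f + 2 * nsq M g"
proof -
  have "nsq M (\<lambda>x. f x + g x) \<ge> 0" by simp
  with nsq_diff[OF assms] nsq_add[OF assms] show ?thesis by linarith
qed

text \<open>The squared norm of \<open>f + t g\<close> is a polynomial of degree two in
  \<open>t\<close> that is never negative; evaluating it at one well chosen \<open>t\<close> gives
  the discriminant inequality. If \<open>g\<close> has norm zero the polynomial is affine and its
  slope must vanish.\<close>

lemma ip_Cauchy_Schwarz:
  assumes "sqint M f" "sqint M g"
  shows "(ip M f g)\<^sup>2 \<le> nsq M f * nsq M g"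
proof -
  have "0 \<le> nsq M f + 2 * t * ip M f g + t\<^sup>2 * nsq M g" for t
    using nsq_add[OF assms(1) sqint_scaleR[OF assms(2), of t]] nsq_nonneg[of M "\<lambda>x. f x + t *\<^sub>R g x"]
      ip_scaleR_left[of M t g f] ip_commute[of M f g] ip_commute[of M f "\<lambda>x. t *\<^sub>R g x"]
    by (simp add: nsq_scaleR)
  note * = this
  note * = this
  define i p where "i = ip M f g" and "p = nsq M g"
  show ?thesis
  proof (cases "p = 0")
    case True
    have "i = 0"
    proof (rule ccontr)
      assume n: "i \<noteq> 0"
      \<comment> \<open>The point at which the affine function would take the value -1.\<close>
      define t where "t = - (nsq M f + 1) / (2 * i)"
      have "2 * t * i = - (nsq M f + 1)" using n by (simp add: t_def)
      with *[of t] True show False by (simp add: i_def p_def)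
    qed
    then show ?thesis by (simp add: i_def)
  next
    case False
    then have p: "p > 0" using nsq_nonneg[of M g] by (simp add: p_def less_le)
    \<comment> \<open>The minimiser of the quadratic.\<close>
    define t where "t = - i / p"
    have "t * p = - i" using p by (simp add: t_def)
    then have "2 * t * i + t\<^sup>2 * p = t * i"
      by (simp add: power2_eq_square mult.assoc)
    then have "0 \<le> nsq M f + t * i" using *[of t] by (simp add: i_def p_def)
    then have "0 \<le> (nsq M f + t * i) * p" using p by simp
    also have "\<dots> = nsq M f * p + i * (t * p)" by (simp add: algebra_simps)
    also have "\<dots> = nsq M f * p - i\<^sup>2" by (simp add: \<open>t * p = - i\<close> power2_eq_square)
    finally show ?thesis by (simp add: i_def p_def)
  qed
qed

lemma abs_ip_le: "\<lbrakk>sqint M f; sqint M g\<rbrakk> \<Longrightarrow> \<bar>ip M f g\<bar> \<le> sqrt (nsq M f) * sqrt (nsq M g)"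
  using ip_Cauchy_Schwarz[of M f g] by (metis real_sqrt_abs real_sqrt_le_iff real_sqrt_mult)

lemma nsq_zero_AE:
  assumes "sqint M f" "nsq M f = 0" shows "AE x in M. f x = 0"
  using assms integral_nonneg_eq_0_iff_AE[of M "\<lambda>x. (norm (f x))\<^sup>2"] by (simp add: sqint_def nsq_def)

lemma ip_cong_AE:
  assumes "f \<in> borel_measurable M" "g \<in> borel_measurable M" "h \<in> borel_measurable M" "AE x in M. f x = g x"
  shows "ip M f h = ip M g h"
  unfolding ip_def using assms by (intro integral_cong_AE) auto

section \<open>Completeness and weak sequential compactness over an arbitrary measure\<close>

lemma nn_integral_nsq: "sqint M f \<Longrightarrow> (\<integral>\<^sup>+x. ennreal ((norm (f x))\<^sup>2) \<partial>M) = ennreal (nsq M f)"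
  unfolding nsq_def by (intro nn_integral_eq_integral) (auto simp: sqint_def)

lemma sqintI_nn_integral:
  assumes "f \<in> borel_measurable M" "(\<integral>\<^sup>+x. ennreal ((norm (f x))\<^sup>2) \<partial>M) \<le> ennreal c" "0 \<le> c"
  shows "sqint M f" "nsq M f \<le> c"
proof -
  show s: "sqint M f" unfolding sqint_def
    using assms by (auto intro!: integrableI_nonneg simp: less_top[symmetric] top_unique)
  show "nsq M f \<le> c" using nn_integral_nsq[OF s] assms by (simp add: ennreal_le_iff)
qed

text \<open>The Riesz-Fischer argument at a geometric rate. The weight \<open>4^i\<close> still
  leaves a summable series of integrals, and its finiteness at almost every point eventually bounds
  the increments there by \<open>(1/2)^i\<close>. Fatou's lemma then transfers the rate to the
  limit.\<close>

lemma sqint_complete_fast: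
  assumes f: "\<And>n. sqint M (f n)" and fast: "\<And>i j. i \<le> j \<Longrightarrow> nsq M (\<lambda>x. f i x - f j x) \<le> (1/16)^i"
  shows "\<exists>g. sqint M g \<and> (\<lambda>n. nsq M (\<lambda>x. f n x - g x)) \<longlonglongrightarrow> 0"
proof -
  note [measurable] = sqint_measurable[OF f]
  have d: "sqint M (\<lambda>x. f i x - f j x)" for i j by (intro sqint_diff f)
  define S where "S x = (\<Sum>i. ennreal (4^i * (norm (f i x - f (Suc i) x))\<^sup>2))" for x
  have [measurable]: "S \<in> borel_measurable M" unfolding S_def by measurable
  have "(\<integral>\<^sup>+x. S x \<partial>M) = (\<Sum>i. \<integral>\<^sup>+x. ennreal (4^i * (norm (f i x - f (Suc i) x))\<^sup>2) \<partial>M)"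
    unfolding S_def by (rule nn_integral_suminf) measurable
  also have "\<dots> \<le> (\<Sum>i. ennreal ((1/4)^i))"
  proof (rule suminf_le)
    fix i
    have "(\<integral>\<^sup>+x. ennreal (4^i * (norm (f i x - f (Suc i) x))\<^sup>2) \<partial>M)
        = ennreal (4^i) * (\<integral>\<^sup>+x. ennreal ((norm (f i x - f (Suc i) x))\<^sup>2) \<partial>M)"
      by (subst nn_integral_cmult[symmetric]) (auto simp: ennreal_mult')
    also have "\<dots> = ennreal (4^i * nsq M (\<lambda>x. f i x - f (Suc i) x))"
      by (subst nn_integral_nsq[OF d]) (simp add: ennreal_mult')
    also have "\<dots> \<le> ennreal (4^i * (1/16)^i)"
      by (intro ennreal_leI mult_left_mono fast) auto
    also have "4^i * (1/16::real)^i = (1/4)^i"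
      by (simp add: power_mult_distrib[symmetric])
    finally show "(\<integral>\<^sup>+x. ennreal (4^i * (norm (f i x - f (Suc i) x))\<^sup>2) \<partial>M) \<le> ennreal ((1/4)^i)" .
  qed auto
  also have "\<dots> = ennreal (\<Sum>i. (1/4)^i)"
    by (rule suminf_ennreal2) auto
  also have "\<dots> < \<infinity>" by simp
  finally have "AE x in M. S x \<noteq> \<infinity>"
    by (intro nn_integral_PInf_AE) auto
  moreover have "convergent (\<lambda>n. f n x)" if "S x \<noteq> \<infinity>" for x
  proof -
    have "summable (\<lambda>i. 4^i * (norm (f i x - f (Suc i) x))\<^sup>2)"
      using that unfolding S_def by (intro summable_suminf_not_top) (auto simp: top_unique)
    then have "(\<lambda>i. 4^i * (norm (f i x - f (Suc i) x))\<^sup>2) \<longlonglongrightarrow> 0" by (rule summable_LIMSEQ_zero)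
    then have "eventually (\<lambda>i. 4^i * (norm (f i x - f (Suc i) x))\<^sup>2 < 1) sequentially"
      by (rule order_tendstoD) simp
    then have "eventually (\<lambda>i. norm (f (Suc i) x - f i x) \<le> (1/2)^i) sequentially"
    proof (rule eventually_mono)
      fix i assume "4^i * (norm (f i x - f (Suc i) x))\<^sup>2 < 1"
      moreover have "(2^i)\<^sup>2 = (4::real)^i" by (simp add: power2_eq_square flip: power_mult_distrib)
      ultimately have "(2^i * norm (f i x - f (Suc i) x))\<^sup>2 < 1\<^sup>2"
        by (simp add: power_mult_distrib)
      then have "2^i * norm (f i x - f (Suc i) x) < 1"
        by (rule power_less_imp_less_base) simp
      then show "norm (f (Suc i) x - f i x) \<le> (1/2)^i"
        by (simp add: field_simps norm_minus_commute)
    qed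
    then have "summable (\<lambda>i. f (Suc i) x - f i x)"
      by (rule summable_comparison_test_ev) (simp add: summable_geometric)
    then have "summable (\<lambda>i. f (Suc i) x - f i x)" .
    from summable_LIMSEQ[OF this] have "(\<lambda>n. \<Sum>i<n. f (Suc i) x - f i x) \<longlonglongrightarrow> (\<Sum>i. f (Suc i) x - f i x)" .
    moreover have "(\<Sum>i<n. f (Suc i) x - f i x) = f n x - f 0 x" for n
      by (rule sum_lessThan_telescope)
    ultimately have "(\<lambda>n. f n x - f 0 x + f 0 x) \<longlonglongrightarrow> (\<Sum>i. f (Suc i) x - f i x) + f 0 x"
      by (intro tendsto_intros) simp
    then show ?thesis by (auto simp: convergent_def)
  qed
  ultimately have conv: "AE x in M. convergent (\<lambda>n. f n x)" by (elim eventually_mono) auto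
  define g where "g x = lim (\<lambda>n. f n x)" for x
  have [measurable]: "g \<in> borel_measurable M" unfolding g_def by measurable
  have lim: "AE x in M. (\<lambda>n. f n x) \<longlonglongrightarrow> g x"
    using conv by (elim eventually_mono) (simp add: g_def convergent_LIMSEQ_iff)
  have est: "(\<integral>\<^sup>+x. ennreal ((norm (f n x - g x))\<^sup>2) \<partial>M) \<le> ennreal ((1/16)^n)" for n
  proof -
    have "(\<integral>\<^sup>+x. ennreal ((norm (f n x - g x))\<^sup>2) \<partial>M)
       = (\<integral>\<^sup>+x. liminf (\<lambda>m. ennreal ((norm (f n x - f m x))\<^sup>2)) \<partial>M)"
    proof (rule nn_integral_cong_AE)
      show "AE x in M. ennreal ((norm (f n x - g x))\<^sup>2) = liminf (\<lambda>m. ennreal ((norm (f n x - f m x))\<^sup>2))"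
        using lim
      proof (elim eventually_mono)
        fix x assume "(\<lambda>n. f n x) \<longlonglongrightarrow> g x"
        then have "(\<lambda>m. ennreal ((norm (f n x - f m x))\<^sup>2)) \<longlonglongrightarrow> ennreal ((norm (f n x - g x))\<^sup>2)"
          by (intro tendsto_intros)
        then show "ennreal ((norm (f n x - g x))\<^sup>2) = liminf (\<lambda>m. ennreal ((norm (f n x - f m x))\<^sup>2))"
          by (metis lim_imp_Liminf sequentially_bot)
      qed
    qed
    also have "\<dots> \<le> liminf (\<lambda>m. \<integral>\<^sup>+x. ennreal ((norm (f n x - f m x))\<^sup>2) \<partial>M)"
      by (rule nn_integral_liminf) measurable
    also have "\<dots> \<le> ennreal ((1/16)^n)"
    proof (rule Liminf_le)
      show "eventually (\<lambda>m. (\<integral>\<^sup>+x. ennreal ((norm (f n x - f m x))\<^sup>2) \<partial>M) \<le> ennreal ((1/16)^n)) sequentially"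
        using eventually_ge_at_top[of n]
        by eventually_elim (simp only: nn_integral_nsq[OF d], intro ennreal_leI fast)
    qed simp
    finally show ?thesis .
  qed
  have dg: "sqint M (\<lambda>x. f n x - g x)" "nsq M (\<lambda>x. f n x - g x) \<le> (1/16)^n" for n
    using sqintI_nn_integral[OF _ est[of n]] by auto
  \<comment> \<open>Only differences with the limit are known to be square-integrable, so
    \<open>g\<close> is recovered from one of them.\<close>
  have "sqint M (\<lambda>x. f 0 x - (f 0 x - g x))" by (intro sqint_diff f dg)
  then have "sqint M g" by simp
  moreover have "(\<lambda>n. nsq M (\<lambda>x. f n x - g x)) \<longlonglongrightarrow> 0"
  proof (rule tendsto_sandwich[of "\<lambda>_. 0" _ _ "\<lambda>n. (1/16)^n"])
    show "(\<lambda>n. (1 / 16::real) ^ n) \<longlonglongrightarrow> 0" by (rule LIMSEQ_realpow_zero) auto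
  qed (use dg in auto)
  ultimately show ?thesis by blast
qed

text \<open>The dyadic convex hull: closure under midpoints is all that the parallelogram law needs.\<close>

inductive_set midhull :: "(nat \<Rightarrow> 'a \<Rightarrow> 'b::real_vector) \<Rightarrow> nat \<Rightarrow> ('a \<Rightarrow> 'b) set" for f j where
  base: "j \<le> n \<Longrightarrow> f n \<in> midhull f j"
| mid: "u \<in> midhull f j \<Longrightarrow> v \<in> midhull f j \<Longrightarrow> (\<lambda>x. (1/2) *\<^sub>R (u x + v x)) \<in> midhull f j"

lemma midhull_antimono: "u \<in> midhull f j \<Longrightarrow> i \<le> j \<Longrightarrow> u \<in> midhull f i"
  by (induction rule: midhull.induct) (auto intro: midhull.intros)

lemma midhull_sqint: "u \<in> midhull f j \<Longrightarrow> (\<And>n. sqint M (f n)) \<Longrightarrow> sqint M u"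
  by (induction rule: midhull.induct) (auto intro: sqint_scaleR sqint_add)

lemma midhull_ip_bound:
  assumes "u \<in> midhull f j" "\<And>n. sqint M (f n)" "sqint M h" "\<And>n. n \<ge> j \<Longrightarrow> \<bar>ip M (f n) h - c\<bar> \<le> e"
  shows "\<bar>ip M u h - c\<bar> \<le> e"
  using assms(1)
proof induction
  case (mid u v)
  have eq: "ip M (\<lambda>x. (1/2) *\<^sub>R (u x + v x)) h = (ip M u h + ip M v h) / 2"
    using midhull_sqint[OF mid(1) assms(2)] midhull_sqint[OF mid(2) assms(2)] assms(3)
    by (subst ip_scaleR_left) (auto simp: ip_add_left)
  show ?case unfolding eq using mid by (auto simp: abs_le_iff field_simps)
qed (use assms in auto)

text \<open>A norm-minimising form of Mazur's lemma. Smaller hulls have larger infima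
  \<open>d j\<close>, which stay below \<open>K\<close> and so converge to \<open>D\<close>. Two
  elements of one hull with squared norm near \<open>D\<close> have a midpoint of squared norm at
  least \<open>d j\<close>, and the parallelogram law forces them to be close.\<close>

lemma midhull_limit:
  assumes f: "\<And>n. sqint M (f n)" and K: "\<And>n. nsq M (f n) \<le> K"
  shows "\<exists>g G. sqint M g \<and> (\<forall>j. G j \<in> midhull f j) \<and> (\<lambda>j. nsq M (\<lambda>x. G j x - g x)) \<longlonglongrightarrow> 0"
proof -
  define d where "d j = Inf (nsq M ` midhull f j)" for j
  have bdd: "bdd_below (nsq M ` midhull f j)" for j by (rule bdd_belowI[of _ 0]) auto
  have ne: "midhull f j \<noteq> {}" for j using midhull.base[of j j f] by auto
  have d_le: "d j \<le> nsq M u" if "u \<in> midhull f j" for u j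
    unfolding d_def using that bdd by (intro cInf_lower) auto
  have dK: "d j \<le> K" for j using d_le[OF midhull.base[of j j f]] K[of j] by simp
  have inc: "incseq d"
    unfolding incseq_def d_def
    by (auto intro!: cInf_superset_mono bdd image_mono simp: ne intro: midhull_antimono)
  obtain D where D: "d \<longlonglongrightarrow> D" "\<And>j. d j \<le> D"
    using incseq_convergent[OF inc, of K] dK by blast
  have "\<exists>u\<in>midhull f j. nsq M u < d j + e" if "e > 0" for j e
  proof -
    have "Inf (nsq M ` midhull f j) < d j + e" using that by (simp add: d_def)
    then show ?thesis using cInf_lessD[of "nsq M ` midhull f j" "d j + e"] ne by auto
  qed
  then have ex: "\<exists>u\<in>midhull f j. nsq M u < D + e" if "e > 0" for j e
    using that D(2)[of j] by (meson add_le_cancel_right less_le_trans)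
  have close: "nsq M (\<lambda>x. u x - v x) \<le> 4 * ((D + e) - d j)"
    if u: "u \<in> midhull f j" "nsq M u < D + e" and v: "v \<in> midhull f j" "nsq M v < D + e" for u v j e
  proof -
    have su: "sqint M u" and sv: "sqint M v" using u v midhull_sqint f by blast+
    have "d j \<le> nsq M (\<lambda>x. (1/2) *\<^sub>R (u x + v x))" using u v by (intro d_le midhull.mid)
    also have "\<dots> = (nsq M u + 2 * ip M u v + nsq M v) / 4"
      unfolding nsq_scaleR nsq_add[OF su sv] by (simp add: power2_eq_square)
    finally show ?thesis using nsq_diff[OF su sv] u v by (simp add: field_simps)
  qed
  \<comment> \<open>The eighths make the factor \<open>4 * (1/8 + 1/8)\<close> of the final estimate
    equal to 1.\<close>
  have "\<exists>J. J \<ge> i \<and> D - d J < (1/16)^i / 8" for i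
  proof -
    have "eventually (\<lambda>j. d j > D - (1/16)^i / 8) sequentially"
      using D(1) by (rule order_tendstoD) simp
    with eventually_ge_at_top[of i] have "eventually (\<lambda>j. d j > D - (1/16)^i / 8 \<and> j \<ge> i) sequentially"
      by eventually_elim auto
    then obtain j where "d j > D - (1/16)^i / 8 \<and> j \<ge> i" by (auto simp: eventually_sequentially)
    then show ?thesis by (intro exI[of _ j]) auto
  qed
  then obtain J0 where J0: "\<And>i. J0 i \<ge> i" "\<And>i. D - d (J0 i) < (1/16)^i / 8" by metis
  \<comment> \<open>The running maximum makes the indices monotone, so that later choices lie in
    earlier hulls.\<close>
  define J where "J i = Max (J0 ` {..i})" for i
  have J: "J0 i \<le> J i" "J i \<ge> i" "i \<le> j \<Longrightarrow> J i \<le> J j" for i j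
  proof -
    show 1: "J0 i \<le> J i" for i unfolding J_def by (intro Max_ge) auto
    show "J i \<ge> i" using 1[of i] J0(1)[of i] by linarith
    show "i \<le> j \<Longrightarrow> J i \<le> J j" unfolding J_def by (intro Max_mono) auto
  qed
  have dJ: "D - d (J i) < (1/16)^i / 8" for i
    using J0(2)[of i] incseqD[OF inc J(1)[of i]] by linarith
  have "\<exists>u\<in>midhull f (J i). nsq M u < D + (1/16)^i/8" for i by (rule ex) simp
  then obtain G where G: "\<And>i. G i \<in> midhull f (J i)" "\<And>i. nsq M (G i) < D + (1/16)^i/8" by metis
  have "nsq M (\<lambda>x. G i x - G j x) \<le> (1/16)^i" if "i \<le> j" for i j
  proof -
    have "(1/16::real)^j \<le> (1/16)^i" using that by (intro power_decreasing) auto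
    then have "nsq M (G j) < D + (1/16)^i/8" using G(2)[of j] by linarith
    moreover have "G j \<in> midhull f (J i)" using G(1) J(3)[OF that] by (rule midhull_antimono)
    ultimately have "nsq M (\<lambda>x. G i x - G j x) \<le> 4 * ((D + (1/16)^i/8) - d (J i))"
      using G by (intro close) auto
    also have "\<dots> \<le> (1/16)^i" using dJ[of i] by argo
    finally show ?thesis .
  qed
  moreover have "sqint M (G i)" for i using midhull_sqint[OF G(1)] f by blast
  ultimately obtain g where g: "sqint M g" "(\<lambda>n. nsq M (\<lambda>x. G n x - g x)) \<longlonglongrightarrow> 0"
    using sqint_complete_fast[of M G] by blast
  have "G j \<in> midhull f j" for j using G(1) J(2) by (rule midhull_antimono)
  with g show ?thesis by blast
qed

lemma tendsto_ip_strong: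
  assumes "\<And>n. sqint M (G n)" "sqint M g" "sqint M h" "(\<lambda>n. nsq M (\<lambda>x. G n x - g x)) \<longlonglongrightarrow> 0"
  shows "(\<lambda>n. ip M (G n) h) \<longlonglongrightarrow> ip M g h"
proof -
  have "(\<lambda>n. ip M (G n) h - ip M g h) \<longlonglongrightarrow> 0"
  proof (rule Lim_null_comparison)
    show "eventually (\<lambda>n. norm (ip M (G n) h - ip M g h) \<le> sqrt (nsq M (\<lambda>x. G n x - g x)) * sqrt (nsq M h)) sequentially"
      using assms by (auto simp: ip_diff_left[symmetric] intro!: always_eventually abs_ip_le sqint_diff)
    have "(\<lambda>n. sqrt (nsq M (\<lambda>x. G n x - g x)) * sqrt (nsq M h)) \<longlonglongrightarrow> sqrt 0 * sqrt (nsq M h)"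
      by (intro tendsto_intros assms)
    then show "(\<lambda>n. sqrt (nsq M (\<lambda>x. G n x - g x)) * sqrt (nsq M h)) \<longlonglongrightarrow> 0" by simp
  qed
  then show ?thesis by (simp add: LIM_zero_iff)
qed

text \<open>Being within \<open>e\<close> of \<open>c\<close> when paired with \<open>h\<close> is
  preserved by midpoints, so the tail hulls see the same limit as the tails, and strong convergence
  carries it to \<open>g\<close>.\<close>

lemma midhull_limit_ip:
  assumes f: "\<And>n. sqint M (f n)" and G: "\<And>j. G j \<in> midhull f j" and g: "sqint M g"
    and lim: "(\<lambda>j. nsq M (\<lambda>x. G j x - g x)) \<longlonglongrightarrow> 0" and h: "sqint M h" and c: "(\<lambda>n. ip M (f n) h) \<longlonglongrightarrow> c"
  shows "ip M g h = c"
proof -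
  have sG: "sqint M (G j)" for j using midhull_sqint[OF G f] .
  have "(\<lambda>n. ip M (G n) h) \<longlonglongrightarrow> c"
  proof (rule LIMSEQ_I)
    fix e :: real assume "e > 0"
    then have "e/2 > 0" by simp
    from LIMSEQ_D[OF c this] obtain n0 where n0: "\<And>n. n \<ge> n0 \<Longrightarrow> norm (ip M (f n) h - c) < e/2" by blast
    have "norm (ip M (G n) h - c) < e" if "n \<ge> n0" for n
    proof -
      have "\<bar>ip M (G n) h - c\<bar> \<le> e/2"
        using n0 that by (intro midhull_ip_bound[OF G f h]) (auto intro!: less_imp_le)
      then show ?thesis using \<open>e > 0\<close> by simp
    qed
    then show "\<exists>no. \<forall>n\<ge>no. norm (ip M (G n) h - c) < e" by blast
  qed
  with tendsto_ip_strong[OF sG g h lim] show ?thesis by (rule LIMSEQ_unique)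
qed

lemma bounded_real_seq_diagonal:
  fixes A :: "nat \<Rightarrow> nat \<Rightarrow> real"
  assumes "\<And>n m. \<bar>A n m\<bar> \<le> K m"
  shows "\<exists>r. strict_mono r \<and> (\<forall>m. convergent (\<lambda>n. A (r n) m))"
proof -
  interpret subseqs "\<lambda>m s. convergent (\<lambda>n. A (s n) m)"
  proof
    fix m and s :: "nat \<Rightarrow> nat"
    have "bounded (range (\<lambda>n. A (s n) m))"
      using assms by (intro boundedI[of _ "K m"]) auto
    from bounded_imp_convergent_subsequence[OF this]
    show "\<exists>r. strict_mono r \<and> convergent (\<lambda>n. A ((s \<circ> r) n) m)"
      by (auto simp: convergent_def o_def)
  qed
  \<comment> \<open>The diagonal sequence is a subsequence of the m-th one only from some index on;
    convergence is insensitive to that shift.\<close>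
  have "convergent (\<lambda>n. A (diagseq n) m)" for m
  proof -
    have "convergent (\<lambda>n. A ((diagseq \<circ> (+) (Suc m)) n) m)"
      by (rule diagseq_holds) (auto simp: convergent_def o_def dest: LIMSEQ_subseq_LIMSEQ[unfolded o_def])
    then have "convergent (\<lambda>n. A (diagseq (n + Suc m)) m)" by (simp add: o_def add.commute)
    then show ?thesis by (rule convergent_ignore_initial_segment[THEN iffD1])
  qed
  then show ?thesis using subseq_diagseq by blast
qed

text \<open>The members of the sequence themselves serve as the countable family of test functions,
  which is what makes the argument work over an arbitrary measure. For a general \<open>h\<close>, a
  subsequence whose pairings with \<open>h\<close> stay away from that of \<open>g\<close> has a
  hull limit \<open>g'\<close> with the same pairings against every \<open>f m\<close>. Then
  \<open>g' - g\<close> is orthogonal to all \<open>f m\<close>, hence to both limits, hence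
  zero.\<close>

theorem weak_compactness:
  fixes f :: "nat \<Rightarrow> 'a \<Rightarrow> 'b::euclidean_space"
  assumes f: "\<And>n. sqint M (f n)" and K: "\<And>n. nsq M (f n) \<le> K"
  shows "\<exists>r g. strict_mono (r::nat \<Rightarrow> nat) \<and> sqint M g \<and> (\<forall>h. sqint M h \<longrightarrow> (\<lambda>n. ip M (f (r n)) h) \<longlonglongrightarrow> ip M g h)"
proof -
  have ipb: "\<bar>ip M (f n) h\<bar> \<le> sqrt K * sqrt (nsq M h)" if "sqint M h" for n h
    using abs_ip_le[OF f that, of n] K[of n]
    by (meson mult_right_mono nsq_nonneg order_trans real_sqrt_ge_zero real_sqrt_le_mono)
  obtain r :: "nat \<Rightarrow> nat" where r: "strict_mono r" and "\<And>m. convergent (\<lambda>n. ip M (f (r n)) (f m))"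
    using bounded_real_seq_diagonal[of "\<lambda>n m. ip M (f n) (f m)" "\<lambda>m. sqrt K * sqrt (nsq M (f m))"] ipb[OF f]
    by blast
  then obtain c where c: "\<And>m. (\<lambda>n. ip M (f (r n)) (f m)) \<longlonglongrightarrow> c m" unfolding convergent_def by metis
  obtain g G where g: "sqint M g" and G: "\<And>j. G j \<in> midhull (\<lambda>n. f (r n)) j"
    and Gg: "(\<lambda>j. nsq M (\<lambda>x. G j x - g x)) \<longlonglongrightarrow> 0"
    using midhull_limit[of M "\<lambda>n. f (r n)" K] f K by blast
  have gc: "ip M g (f m) = c m" for m
    by (rule midhull_limit_ip[OF _ G g Gg f c]) (rule f)
  have "(\<lambda>n. ip M (f (r n)) h) \<longlonglongrightarrow> ip M g h" if h: "sqint M h" for h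
  proof (rule ccontr)
    assume "\<not> (\<lambda>n. ip M (f (r n)) h) \<longlonglongrightarrow> ip M g h"
    then obtain e where e: "e > 0" "\<And>n0. \<exists>n\<ge>n0. \<bar>ip M (f (r n)) h - ip M g h\<bar> \<ge> e"
      unfolding LIMSEQ_iff by (force simp: not_less)
    then have "infinite {n. \<bar>ip M (f (r n)) h - ip M g h\<bar> \<ge> e}"
      unfolding infinite_nat_iff_unbounded_le by blast
    then obtain s :: "nat \<Rightarrow> nat" where s: "strict_mono s" "\<And>n. \<bar>ip M (f (r (s n))) h - ip M g h\<bar> \<ge> e"
      using infinite_enumerate[of "{n. \<bar>ip M (f (r n)) h - ip M g h\<bar> \<ge> e}"] by auto
    have "bounded (range (\<lambda>n. ip M (f (r (s n))) h))"
      using ipb[OF h] by (intro boundedI) auto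
    from bounded_imp_convergent_subsequence[OF this] obtain l t where
      t: "strict_mono (t::nat\<Rightarrow>nat)" "(\<lambda>n. ip M (f (r (s (t n)))) h) \<longlonglongrightarrow> l" by (auto simp: o_def)
    define q where "q n = r (s (t n))" for n
    have "(\<lambda>n. \<bar>ip M (f (r (s (t n)))) h - ip M g h\<bar>) \<longlonglongrightarrow> \<bar>l - ip M g h\<bar>"
      by (intro tendsto_intros t)
    then have "\<bar>l - ip M g h\<bar> \<ge> e"
      by (rule LIMSEQ_le_const) (use s in auto)
    obtain g' G' where g': "sqint M g'" and G': "\<And>j. G' j \<in> midhull (\<lambda>n. f (q n)) j"
      and Gg': "(\<lambda>j. nsq M (\<lambda>x. G' j x - g' x)) \<longlonglongrightarrow> 0"
      using midhull_limit[of M "\<lambda>n. f (q n)" K] f K by blast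
    have g'h: "ip M g' h = l"
      by (rule midhull_limit_ip[OF _ G' g' Gg' h]) (use f t in \<open>auto simp: q_def\<close>)
    have gc': "ip M g' (f m) = c m" for m
    proof (rule midhull_limit_ip[OF _ G' g' Gg' f])
      have "strict_mono (s \<circ> t)" using s(1) t(1) by (rule strict_mono_o)
      from LIMSEQ_subseq_LIMSEQ[OF c this] show "(\<lambda>n. ip M (f (q n)) (f m)) \<longlonglongrightarrow> c m"
        by (simp add: o_def q_def)
    qed (rule f)
    let ?d = "\<lambda>x. g' x - g x"
    have d: "sqint M ?d" by (intro sqint_diff g g')
    \<comment> \<open>Orthogonality to every \<open>f m\<close> passes to the hulls and to their
      strong limits, in particular to \<open>g\<close> and \<open>g'\<close>.\<close>
    have dm: "ip M (f m) ?d = 0" for m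
      using gc[of m] gc'[of m] g g' f by (subst ip_commute) (simp add: ip_diff_left)
    have "(\<lambda>n. ip M (f (r n)) ?d) \<longlonglongrightarrow> 0" "(\<lambda>n. ip M (f (q n)) ?d) \<longlonglongrightarrow> 0" by (simp_all add: dm)
    then have "ip M g ?d = 0" "ip M g' ?d = 0"
      using midhull_limit_ip[OF _ G g Gg d] midhull_limit_ip[OF _ G' g' Gg' d] f by blast+
    then have "nsq M ?d = 0"
      unfolding nsq_eq_ip using d g g' by (subst ip_diff_left) auto
    then have "AE x in M. g' x = g x" using nsq_zero_AE[OF d] by auto
    then have "ip M g' h = ip M g h" using g g' h by (intro ip_cong_AE) auto
    with g'h \<open>\<bar>l - ip M g h\<bar> \<ge> e\<close> \<open>e > 0\<close> show False by simp
  qed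
  with r g show ?thesis by blast
qed

text \<open>The defect \<open>h n - h0\<close> tends to zero strongly and is paired with a bounded
  sequence; what remains is a fixed test function.\<close>

lemma tendsto_ip_weak_strong:
  assumes f: "\<And>n. sqint M (f n)" "sqint M f0" and K: "\<And>n. nsq M (f n) \<le> K"
    and w: "\<And>h. sqint M h \<Longrightarrow> (\<lambda>n. ip M (f n) h) \<longlonglongrightarrow> ip M f0 h"
    and h: "\<And>n. sqint M (h n)" "sqint M h0" and s: "(\<lambda>n. nsq M (\<lambda>x. h n x - h0 x)) \<longlonglongrightarrow> 0"
  shows "(\<lambda>n. ip M (f n) (h n)) \<longlonglongrightarrow> ip M f0 h0"
proof -
  have "(\<lambda>n. ip M (f n) (\<lambda>x. h n x - h0 x)) \<longlonglongrightarrow> 0"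
  proof (rule Lim_null_comparison)
    show "eventually (\<lambda>n. norm (ip M (f n) (\<lambda>x. h n x - h0 x)) \<le> sqrt K * sqrt (nsq M (\<lambda>x. h n x - h0 x))) sequentially"
    proof (intro always_eventually allI)
      fix n
      have "\<bar>ip M (f n) (\<lambda>x. h n x - h0 x)\<bar> \<le> sqrt (nsq M (f n)) * sqrt (nsq M (\<lambda>x. h n x - h0 x))"
        by (intro abs_ip_le f sqint_diff h)
      also have "\<dots> \<le> sqrt K * sqrt (nsq M (\<lambda>x. h n x - h0 x))"
        by (intro mult_right_mono real_sqrt_le_mono K) auto
      finally show "norm (ip M (f n) (\<lambda>x. h n x - h0 x)) \<le> sqrt K * sqrt (nsq M (\<lambda>x. h n x - h0 x))" by simp
    qed
    have "(\<lambda>n. sqrt K * sqrt (nsq M (\<lambda>x. h n x - h0 x))) \<longlonglongrightarrow> sqrt K * sqrt 0"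
      by (intro tendsto_intros s)
    then show "(\<lambda>n. sqrt K * sqrt (nsq M (\<lambda>x. h n x - h0 x))) \<longlonglongrightarrow> 0" by simp
  qed
  from tendsto_add[OF this w[OF h(2)]]
  show ?thesis using f h by (simp add: ip_commute[of M "f _"] ip_diff_left)
qed

subsection \<open>Smooth functions and test functions\<close>

lemma has_derivative_smooth:
  "smooth_fun f \<Longrightarrow> (f has_derivative (\<lambda>v. dir_deriv v f x)) (at x)"
  unfolding smooth_fun_def dir_deriv_def
  by (metis (no_types, lifting) frechet_derivative_at)

lemma dir_derivI: "(f has_derivative f') (at x) \<Longrightarrow> dir_deriv v f x = f' v"
  by (simp add: dir_deriv_def frechet_derivative_at[symmetric])

lemma smooth_fun_dir_deriv:
  assumes "smooth_fun f" shows "smooth_fun (dir_deriv v f)"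
proof -
  obtain D where D: "D [] = f" "\<And>vs x. (D vs has_derivative (\<lambda>h. D (h # vs) x)) (at x)"
    using assms unfolding smooth_fun_def by blast
  have "D [v] = dir_deriv v f"
    using dir_derivI[OF D(2)[of "[]"]] by (auto simp: D(1))
  then show ?thesis
    unfolding smooth_fun_def using D(2) by (intro exI[of _ "\<lambda>vs. D (vs @ [v])"]) auto
qed

text \<open>A coinductive handle on smoothness: it is enough to exhibit a family that contains
  \<open>f\<close> and is closed under directional derivatives, since iterated Frechet
  differentiation then never leaves it. Closure proofs thus avoid formulas for higher
  derivatives.\<close>

lemma smooth_fun_coinduct:
  assumes "f \<in> S"
    and step: "\<And>g. g \<in> S \<Longrightarrow> \<exists>g'. (\<forall>x. (g has_derivative g' x) (at x)) \<and> (\<forall>v. (\<lambda>x. g' x v) \<in> S)"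
  shows "smooth_fun f"
proof -
  define D where "D = rec_list f (\<lambda>v vs r x. frechet_derivative r (at x) v)"
  have DS: "D vs \<in> S" for vs
  proof (induction vs)
    case Nil
    show ?case using assms(1) by (simp add: D_def)
  next
    case (Cons v vs)
    from step[OF Cons] obtain g' where g': "\<And>x. (D vs has_derivative g' x) (at x)" "(\<lambda>x. g' x v) \<in> S"
      by blast
    have "D (v # vs) = (\<lambda>x. g' x v)"
      using frechet_derivative_at[OF g'(1)] by (simp add: D_def)
    with g'(2) show ?case by simp
  qed
  have "(D vs has_derivative (\<lambda>h. D (h # vs) x)) (at x)" for vs x
  proof -
    from step[OF DS[of vs]] obtain g' where g': "\<And>x. (D vs has_derivative g' x) (at x)"
      by blast
    have "(\<lambda>h. D (h # vs) x) = g' x"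
      using frechet_derivative_at[OF g'(1)] by (simp add: D_def)
    with g' show ?thesis by simp
  qed
  moreover have "D [] = f" by (simp add: D_def)
  ultimately show ?thesis unfolding smooth_fun_def by blast
qed

lemma smooth_fun_const [simp]: "smooth_fun (\<lambda>x. c)"
  by (rule smooth_fun_coinduct[of _ "range (\<lambda>c x. c)"]) (auto intro!: exI[of _ "\<lambda>x v. 0"])

lemma smooth_fun_add:
  assumes "smooth_fun f" "smooth_fun g" shows "smooth_fun (\<lambda>x. f x + g x)"
proof (rule smooth_fun_coinduct[of _ "{\<lambda>x. f x + g x |f g. smooth_fun f \<and> smooth_fun g}"])
  show "(\<lambda>x. f x + g x) \<in> {\<lambda>x. f x + g x |f g. smooth_fun f \<and> smooth_fun g}" using assms by blast
next
  fix h :: "'a \<Rightarrow> real" assume "h \<in> {\<lambda>x. f x + g x |f g. smooth_fun f \<and> smooth_fun g}"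
  then obtain f g where *: "h = (\<lambda>x. f x + g x)" "smooth_fun f" "smooth_fun g" by blast
  show "\<exists>g'. (\<forall>x. (h has_derivative g' x) (at x)) \<and>
         (\<forall>v. (\<lambda>x. g' x v) \<in> {\<lambda>x. f x + g x |f g. smooth_fun f \<and> smooth_fun g})"
    unfolding * using *(2,3) smooth_fun_dir_deriv
    by (intro exI[of _ "\<lambda>x v. dir_deriv v f x + dir_deriv v g x"])
       (auto intro!: has_derivative_add has_derivative_smooth)
qed

text \<open>Single products are not closed under the Leibniz rule, but finite sums of products
  are.\<close>

inductive_set smooth_products :: "('a::euclidean_space \<Rightarrow> real) set" where
  prod: "smooth_fun f \<Longrightarrow> smooth_fun g \<Longrightarrow> (\<lambda>x. f x * g x) \<in> smooth_products"
| add: "h1 \<in> smooth_products \<Longrightarrow> h2 \<in> smooth_products \<Longrightarrow> (\<lambda>x. h1 x + h2 x) \<in> smooth_products"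

lemma smooth_fun_mult:
  assumes "smooth_fun f" "smooth_fun g" shows "smooth_fun (\<lambda>x. f x * g x)"
proof (rule smooth_fun_coinduct[of _ smooth_products])
  show "(\<lambda>x. f x * g x) \<in> smooth_products" using assms by (rule smooth_products.prod)
next
  fix h :: "'a \<Rightarrow> real" assume "h \<in> smooth_products"
  then show "\<exists>h'. (\<forall>x. (h has_derivative h' x) (at x)) \<and> (\<forall>v. (\<lambda>x. h' x v) \<in> smooth_products)"
  proof induction
    case (prod f g)
    show ?case
      using prod smooth_fun_dir_deriv
      by (intro exI[of _ "\<lambda>x v. f x * dir_deriv v g x + dir_deriv v f x * g x"])
         (auto intro!: has_derivative_mult has_derivative_smooth smooth_products.intros)
  next
    case (add h1 h2)
    from add.IH obtain h1' h2' where
      "\<forall>x. (h1 has_derivative h1' x) (at x)" "\<forall>v. (\<lambda>x. h1' x v) \<in> smooth_products"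
      "\<forall>x. (h2 has_derivative h2' x) (at x)" "\<forall>v. (\<lambda>x. h2' x v) \<in> smooth_products" by blast
    then show ?case
      by (intro exI[of _ "\<lambda>x v. h1' x v + h2' x v"])
         (auto intro!: has_derivative_add smooth_products.intros)
  qed
qed

lemma smooth_fun_cmult: "smooth_fun f \<Longrightarrow> smooth_fun (\<lambda>x. c * f x)"
  by (rule smooth_fun_mult) auto

lemma smooth_fun_diff: "smooth_fun f \<Longrightarrow> smooth_fun g \<Longrightarrow> smooth_fun (\<lambda>x. f x - g x)"
  using smooth_fun_add[of f "\<lambda>x. (-1) * g x"] smooth_fun_cmult[of g "-1"] by simp

lemma smooth_fun_prod:
  "finite I \<Longrightarrow> (\<And>i. i \<in> I \<Longrightarrow> smooth_fun (f i)) \<Longrightarrow> smooth_fun (\<lambda>x. \<Prod>i\<in>I. f i x)"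
  by (induction rule: finite_induct) (auto intro: smooth_fun_mult)

lemma has_derivative_compose_affine:
  assumes "smooth_fun f" "bounded_linear L"
  shows "((\<lambda>x. f (c + L x)) has_derivative (\<lambda>v. dir_deriv (L v) f (c + L x))) (at x)"
proof -
  have "((\<lambda>x. c + L x) has_derivative L) (at x)"
    using assms(2) by (auto intro!: derivative_eq_intros bounded_linear_imp_has_derivative)
  from diff_chain_at[OF this has_derivative_smooth[OF assms(1)]] show ?thesis by (simp add: o_def)
qed

lemma smooth_fun_compose_affine:
  fixes L :: "'b::euclidean_space \<Rightarrow> 'a::euclidean_space"
  assumes "smooth_fun f" "bounded_linear L" shows "smooth_fun (\<lambda>x. f (c + L x))"
proof (rule smooth_fun_coinduct[of _ "{\<lambda>x. f (c + L x) |f. smooth_fun f}"])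
  show "(\<lambda>x. f (c + L x)) \<in> {\<lambda>x. f (c + L x) |f. smooth_fun f}" using assms by blast
next
  fix h :: "'b \<Rightarrow> real" assume "h \<in> {\<lambda>x. f (c + L x) |f. smooth_fun f}"
  then obtain f where *: "h = (\<lambda>x. f (c + L x))" "smooth_fun f" by blast
  show "\<exists>g'. (\<forall>x. (h has_derivative g' x) (at x)) \<and> (\<forall>v. (\<lambda>x. g' x v) \<in> {\<lambda>x. f (c + L x) |f. smooth_fun f})"
    unfolding *(1) using *(2) smooth_fun_dir_deriv assms(2)
    by (intro exI[of _ "\<lambda>x v. dir_deriv (L v) f (c + L x)"]) (auto intro!: has_derivative_compose_affine)
qed

text \<open>Adding \<open>F\<close> to the smooth functions keeps the family closed, because each
  directional derivative of \<open>F\<close> is a multiple of the smooth \<open>g\<close>.\<close>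

lemma smooth_fun_antideriv:
  fixes F g :: "real \<Rightarrow> real"
  assumes "smooth_fun g" and F: "\<And>x. (F has_real_derivative g x) (at x)"
  shows "smooth_fun F"
proof (rule smooth_fun_coinduct[of _ "insert F {f. smooth_fun f}"])
  fix h assume "h \<in> insert F {f. smooth_fun f}"
  then consider "h = F" | "smooth_fun h" by blast
  then show "\<exists>g'. (\<forall>x. (h has_derivative g' x) (at x)) \<and> (\<forall>v. (\<lambda>x. g' x v) \<in> insert F {f. smooth_fun f})"
  proof cases
    case 1
    then show ?thesis using F assms(1) smooth_fun_mult[OF assms(1) smooth_fun_const]
      by (intro exI[of _ "\<lambda>x v. g x * v"]) (auto simp: has_field_derivative_def)
  next
    case 2
    then show ?thesis using has_derivative_smooth smooth_fun_dir_deriv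
      by (intro exI[of _ "\<lambda>x v. dir_deriv v h x"]) auto
  qed
qed simp

subsection \<open>Bump functions\<close>

text \<open>The powers of \<open>1/x\<close> are carried along because differentiating
  \<open>exp (- (1/x))\<close> produces them; with every \<open>n\<close> present, derivatives are
  linear combinations of members of the family.\<close>

definition expinv :: "nat \<Rightarrow> real \<Rightarrow> real" where
  "expinv n x = (if x > 0 then (1/x)^n * exp (- (1/x)) else 0)"

lemma expinv_tendsto_0: "(expinv n \<longlongrightarrow> 0) (at 0)"
proof (rule filterlim_split_at)
  show "(expinv n \<longlongrightarrow> 0) (at_left 0)"
    by (rule tendsto_eventually) (auto simp: expinv_def eventually_at_filter)
  have "((\<lambda>x::real. x^n / exp x) \<longlongrightarrow> 0) at_top" by (rule tendsto_power_div_exp_0)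
  from filterlim_compose[OF this filterlim_inverse_at_top_right]
  have "((\<lambda>x. (inverse x)^n / exp (inverse x)) \<longlongrightarrow> 0) (at_right (0::real))" .
  then show "(expinv n \<longlongrightarrow> 0) (at_right 0)"
    by (rule Lim_transform_eventually)
       (auto simp: expinv_def eventually_at_filter exp_minus field_simps inverse_eq_divide)
qed

lemma expinv_deriv:
  "(expinv n has_real_derivative expinv (n+2) x - real n * expinv (n+1) x) (at x)"
proof -
  consider "x < 0" | "x = 0" | "x > 0" by linarith
  then show ?thesis
  proof cases
    case 1
    have "((\<lambda>x. 0) has_real_derivative 0) (at x)" by simp
    then have "(expinv n has_real_derivative 0) (at x)"
      by (rule has_field_derivative_transform_within_open[of _ _ _ "{..<0}"]) (use 1 in \<open>auto simp: expinv_def\<close>)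
    then show ?thesis using 1 by (simp add: expinv_def)
  next
    case 2
    \<comment> \<open>At the origin the difference quotient of \<open>expinv n\<close> is
      \<open>expinv (n+1)\<close>, which tends to 0.\<close>
    have "((\<lambda>y. (expinv n y - expinv n 0) / (y - 0)) \<longlongrightarrow> 0) (at 0)"
      using expinv_tendsto_0[of "n+1"]
      by (rule Lim_transform_eventually) (auto simp: expinv_def eventually_at_filter)
    then have "(expinv n has_real_derivative 0) (at 0)" by (simp add: has_field_derivative_iff)
    then show ?thesis using 2 by (simp add: expinv_def)
  next
    case 3
    have "((\<lambda>x. (1/x)^n * exp (- (1/x))) has_real_derivative expinv (n+2) x - real n * expinv (n+1) x) (at x)"
    proof (cases n)
      case 0
      then show ?thesis using 3
        by (auto intro!: derivative_eq_intros simp: expinv_def power2_eq_square field_simps)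
    next
      case (Suc m)
      then show ?thesis using 3
        by (auto intro!: derivative_eq_intros simp: expinv_def power2_eq_square field_simps) (cases m; simp)
    qed
    then show ?thesis
      by (rule has_field_derivative_transform_within_open[of _ _ _ "{0<..}"]) (use 3 in \<open>auto simp: expinv_def\<close>)
  qed
qed

inductive_set expinv_span :: "(real \<Rightarrow> real) set" where
  base: "(\<lambda>x. c * expinv n x) \<in> expinv_span"
| add: "h1 \<in> expinv_span \<Longrightarrow> h2 \<in> expinv_span \<Longrightarrow> (\<lambda>x. h1 x + h2 x) \<in> expinv_span"

lemma smooth_fun_expinv: "smooth_fun (expinv n)"
proof (rule smooth_fun_coinduct[of _ expinv_span])
  show "expinv n \<in> expinv_span" using expinv_span.base[of 1 n] by simp
next
  fix h assume "h \<in> expinv_span"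
  then show "\<exists>h'. (\<forall>x. (h has_derivative h' x) (at x)) \<and> (\<forall>v. (\<lambda>x. h' x v) \<in> expinv_span)"
  proof induction
    case (base c n)
    have "((\<lambda>x. c * expinv n x) has_derivative (\<lambda>v. (c * v) * expinv (n+2) x + (- c * real n * v) * expinv (n+1) x)) (at x)" for x
    proof -
      have "((\<lambda>x. c * expinv n x) has_real_derivative (c * (expinv (n+2) x - real n * expinv (n+1) x))) (at x)"
        by (intro DERIV_cmult expinv_deriv)
      then show ?thesis
        by (auto simp: has_field_derivative_def algebra_simps elim!: has_derivative_eq_rhs)
    qed
    then show ?case
      by (intro exI[of _ "\<lambda>x v. (c * v) * expinv (n+2) x + (- c * real n * v) * expinv (n+1) x"] conjI allI
          expinv_span.add expinv_span.base)
  next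
    case (add h1 h2)
    from add.IH obtain h1' h2' where
      "\<forall>x. (h1 has_derivative h1' x) (at x)" "\<forall>v. (\<lambda>x. h1' x v) \<in> expinv_span"
      "\<forall>x. (h2 has_derivative h2' x) (at x)" "\<forall>v. (\<lambda>x. h2' x v) \<in> expinv_span" by blast
    then show ?case
      by (intro exI[of _ "\<lambda>x v. h1' x v + h2' x v"])
         (auto intro!: has_derivative_add expinv_span.intros)
  qed
qed

text \<open>The index \<open>m\<close> only sharpens the profile: every \<open>bump a b m\<close>
  lives on the same box, and as \<open>m\<close> grows the values tend to the indicator of that box,
  so dominated convergence recovers box integrals from integrals against test functions.\<close>

definition bump :: "'a::euclidean_space \<Rightarrow> 'a \<Rightarrow> nat \<Rightarrow> 'a \<Rightarrow> real" where
  "bump a b m x = (\<Prod>i\<in>Basis. expinv 0 (real (Suc m) * (x \<bullet> i - a \<bullet> i)) * expinv 0 (real (Suc m) * (b \<bullet> i - x \<bullet> i)))"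

lemma expinv0_bounds: "0 \<le> expinv 0 x" "expinv 0 x \<le> 1"
  by (auto simp: expinv_def)

lemma bump_bounds: "0 \<le> bump a b m x" "bump a b m x \<le> 1"
  unfolding bump_def
  by (auto intro!: prod_nonneg prod_le_1 mult_nonneg_nonneg expinv0_bounds mult_le_one)

lemma bump_eq_0: "x \<notin> box a b \<Longrightarrow> bump a b m x = 0"
proof -
  assume "x \<notin> box a b"
  then obtain i where i: "i \<in> Basis" "x \<bullet> i - a \<bullet> i \<le> 0 \<or> b \<bullet> i - x \<bullet> i \<le> 0"
    by (auto simp: box_def not_less)
  have *: "expinv 0 (real (Suc m) * t) = 0" if "t \<le> 0" for t
    using mult_nonneg_nonpos[of "real (Suc m)" t] that by (simp add: expinv_def not_less del: of_nat_Suc)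
  have "expinv 0 (real (Suc m) * (x \<bullet> i - a \<bullet> i)) * expinv 0 (real (Suc m) * (b \<bullet> i - x \<bullet> i)) = 0"
    using i(2) * by auto
  with i(1) show ?thesis unfolding bump_def by (intro prod_zero) auto
qed

lemma bump_pos: "x \<in> box a b \<Longrightarrow> bump a b m x > 0"
  unfolding bump_def box_def by (auto simp: expinv_def intro!: prod_pos)

lemma smooth_fun_bump: "smooth_fun (bump a b m)"
proof -
  have 1: "smooth_fun (\<lambda>x::'a. expinv 0 (real (Suc m) * (x \<bullet> i - a \<bullet> i)))" for i
  proof -
    have "smooth_fun (\<lambda>x::'a. expinv 0 (- (real (Suc m) * (a \<bullet> i)) + real (Suc m) * (x \<bullet> i)))"
      by (intro smooth_fun_compose_affine[OF smooth_fun_expinv] bounded_linear_const_mult bounded_linear_inner_left)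
    then show ?thesis by (simp only: right_diff_distrib) (simp add: algebra_simps)
  qed
  have 2: "smooth_fun (\<lambda>x::'a. expinv 0 (real (Suc m) * (b \<bullet> i - x \<bullet> i)))" for i
  proof -
    have "smooth_fun (\<lambda>x::'a. expinv 0 ((real (Suc m) * (b \<bullet> i)) + (- real (Suc m)) * (x \<bullet> i)))"
      by (intro smooth_fun_compose_affine[OF smooth_fun_expinv] bounded_linear_const_mult bounded_linear_inner_left)
    then show ?thesis by (simp only: right_diff_distrib) (simp add: algebra_simps)
  qed
  show ?thesis unfolding bump_def[abs_def] by (intro smooth_fun_prod smooth_fun_mult 1 2) auto
qed

lemma test_fun_bump: "cbox a b \<subseteq> U \<Longrightarrow> test_fun U (bump a b m)"
  unfolding test_fun_def using smooth_fun_bump bump_eq_0 box_subset_cbox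
  by (intro conjI exI[of _ "cbox a b"]) (auto, blast)

lemma expinv0_tendsto_1:
  assumes "t > 0" shows "(\<lambda>m. expinv 0 (real (Suc m) * t)) \<longlonglongrightarrow> 1"
proof -
  have "(\<lambda>m. exp (- (1 / t * inverse (real (Suc m))))) \<longlonglongrightarrow> exp (- (1 / t * 0))"
    by (intro tendsto_intros LIMSEQ_inverse_real_of_nat)
  moreover have "expinv 0 (real (Suc m) * t) = exp (- (1 / t * inverse (real (Suc m))))" for m
    using assms by (simp add: expinv_def field_simps del: of_nat_Suc)
  ultimately show ?thesis by simp
qed

lemma bump_tendsto: "(\<lambda>m. bump a b m x) \<longlonglongrightarrow> indicator (box a b) x"
proof (cases "x \<in> box a b")
  case True
  have "(\<lambda>m. bump a b m x) \<longlonglongrightarrow> (\<Prod>i\<in>(Basis::'a set). 1 * 1)"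
    unfolding bump_def using True by (intro tendsto_prod tendsto_mult expinv0_tendsto_1) (auto simp: box_def)
  with True show ?thesis by simp
qed (simp add: bump_eq_0)

lemma smooth_fun_continuous: "smooth_fun f \<Longrightarrow> continuous_on A f"
  by (meson continuous_at_imp_continuous_on has_derivative_continuous has_derivative_smooth)

lemma test_fun_continuous: "test_fun U f \<Longrightarrow> continuous_on A f"
  by (simp add: test_fun_def smooth_fun_continuous)

lemma test_fun_measurable: "test_fun U f \<Longrightarrow> f \<in> borel_measurable borel"
  by (intro borel_measurable_continuous_onI test_fun_continuous)

lemma test_fun_mono: "test_fun U f \<Longrightarrow> U \<subseteq> V \<Longrightarrow> test_fun V f"
  unfolding test_fun_def by blast

lemma test_fun_smooth: "test_fun U f \<Longrightarrow> smooth_fun f"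
  by (simp add: test_fun_def)

lemma test_fun_dir_deriv:
  assumes "test_fun U f" shows "test_fun U (dir_deriv v f)"
proof -
  obtain K where K: "compact K" "K \<subseteq> U" "\<And>x. x \<notin> K \<Longrightarrow> f x = 0"
    using assms unfolding test_fun_def by blast
  have "dir_deriv v f x = 0" if "x \<notin> K" for x
  proof -
    have "((\<lambda>x. 0) has_derivative (\<lambda>v. 0)) (at x)" by simp
    then have "(f has_derivative (\<lambda>v. 0)) (at x)"
      by (rule has_derivative_transform_within_open[of _ _ _ _ "- K"])
         (use K that compact_imp_closed in auto)
    from dir_derivI[OF this] show ?thesis .
  qed
  with K show ?thesis
    using assms smooth_fun_dir_deriv unfolding test_fun_def by blast
qed

lemma test_fun_bounded:
  assumes "test_fun U f" shows "\<exists>C>0. \<forall>x. \<bar>f x\<bar> \<le> C"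
proof -
  obtain K where K: "compact K" "K \<subseteq> U" "\<And>x. x \<notin> K \<Longrightarrow> f x = 0"
    using assms unfolding test_fun_def by blast
  have "bounded (f ` K)"
    using K test_fun_continuous[OF assms] by (intro compact_imp_bounded compact_continuous_image)
  then obtain B where B: "B > 0" "\<And>x. x \<in> K \<Longrightarrow> norm (f x) \<le> B" unfolding bounded_pos by auto
  with K show ?thesis by (intro exI[of _ B]) (metis abs_zero less_imp_le real_norm_def)
qed

lemma test_fun_mult:
  assumes "test_fun U f" "smooth_fun g" shows "test_fun U (\<lambda>x. f x * g x)"
proof -
  obtain K where K: "compact K" "K \<subseteq> U" "\<And>x. x \<notin> K \<Longrightarrow> f x = 0"
    using assms unfolding test_fun_def by blast
  then show ?thesis
    unfolding test_fun_def using smooth_fun_mult[OF test_fun_smooth[OF assms(1)] assms(2)]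
    by (intro conjI exI[of _ K]) auto
qed

text \<open>On tensor products a planar weak derivative decouples into a derivative in one variable
  and a weight in the other, which is the form in which all arguments on lines use it.\<close>

lemma test_fun_product:
  fixes f g :: "real \<Rightarrow> real"
  assumes "test_fun A f" "test_fun B g"
  shows "test_fun (A \<times> B) (\<lambda>x. f (fst x) * g (snd x))"
    and "dir_deriv (coord 1) (\<lambda>x. f (fst x) * g (snd x)) x = dir_deriv 1 f (fst x) * g (snd x)"
    and "dir_deriv (coord 2) (\<lambda>x. f (fst x) * g (snd x)) x = f (fst x) * dir_deriv 1 g (snd x)"
proof -
  obtain K where K: "compact K" "K \<subseteq> A" "\<And>x. x \<notin> K \<Longrightarrow> f x = 0"
    using assms unfolding test_fun_def by blast
  obtain L where L: "compact L" "L \<subseteq> B" "\<And>x. x \<notin> L \<Longrightarrow> g x = 0"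
    using assms unfolding test_fun_def by blast
  note s = test_fun_smooth[OF assms(1)] test_fun_smooth[OF assms(2)]
  have "smooth_fun (\<lambda>x::plane. f (0 + fst x))" "smooth_fun (\<lambda>x::plane. g (0 + snd x))"
    by (intro smooth_fun_compose_affine s bounded_linear_fst bounded_linear_snd)+
  then have "smooth_fun (\<lambda>x::plane. f (fst x) * g (snd x))" using smooth_fun_mult by simp
  moreover have "compact (K \<times> L)" "K \<times> L \<subseteq> A \<times> B" using K L by (auto intro: compact_Times)
  ultimately show "test_fun (A \<times> B) (\<lambda>x. f (fst x) * g (snd x))"
    unfolding test_fun_def using K L
    by (intro conjI exI[of _ "K \<times> L"] allI impI) (auto simp: mem_Times_iff)
  have d0: "dir_deriv 0 f y = 0" "dir_deriv 0 g y = 0" for y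
    using has_derivative_smooth[OF s(1)] has_derivative_smooth[OF s(2)] linear_0 has_derivative_linear by blast+
  have d: "((\<lambda>x. f (fst x) * g (snd x)) has_derivative
       (\<lambda>v. f (fst x) * dir_deriv (snd v) g (snd x) + dir_deriv (fst v) f (fst x) * g (snd x))) (at x)"
    using has_derivative_mult[OF has_derivative_compose_affine[OF s(1) bounded_linear_fst, of 0]
       has_derivative_compose_affine[OF s(2) bounded_linear_snd, of 0], of x] by simp
  show "dir_deriv (coord 1) (\<lambda>x. f (fst x) * g (snd x)) x = dir_deriv 1 f (fst x) * g (snd x)"
    by (subst dir_derivI[OF d]) (simp add: coord_def d0)
  show "dir_deriv (coord 2) (\<lambda>x. f (fst x) * g (snd x)) x = f (fst x) * dir_deriv 1 g (snd x)"
    by (subst dir_derivI[OF d]) (simp add: coord_def d0)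
qed

lemma has_real_derivative_smooth:
  "smooth_fun f \<Longrightarrow> (f has_real_derivative dir_deriv 1 f x) (at x)"
proof -
  assume f: "smooth_fun f"
  have "(f has_derivative (\<lambda>v. dir_deriv v f x)) (at x)" using f by (rule has_derivative_smooth)
  moreover have "dir_deriv v f x = dir_deriv 1 f x * v" for v
    using linear_scale[OF has_derivative_linear[OF calculation], of v 1] by (simp add: mult.commute)
  then have "(\<lambda>v. dir_deriv v f x) = (*) (dir_deriv 1 f x)" by (rule ext)
  ultimately show ?thesis by (simp only: has_field_derivative_def)
qed

subsection \<open>The fundamental lemma of the calculus of variations\<close>

lemma AE_zero_if_set_integrals_zero:
  fixes f :: "'a \<Rightarrow> 'b::euclidean_space"
  assumes f: "integrable M f" and z: "\<And>A. A \<in> sets M \<Longrightarrow> (LINT x:A|M. f x) = 0"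
  shows "AE x in M. f x = 0"
proof -
  have meas [measurable]: "f \<in> borel_measurable M" using f by auto
  have half: "AE x in M. s * (f x \<bullet> b) \<le> 0" for b and s :: real
  proof -
    \<comment> \<open>On this set the integrand is positive while its integral vanishes by
      hypothesis; taking \<open>s\<close> as 1 and as -1 excludes both half-spaces.\<close>
    define A where "A = {x\<in>space M. s * (f x \<bullet> b) > 0}"
    have A[measurable]: "A \<in> sets M" unfolding A_def by measurable
    have i: "integrable M (\<lambda>x. indicator A x *\<^sub>R f x)"
      using f A by (rule integrable_mult_indicator[rotated])
    have "(\<integral>x. s * ((indicator A x *\<^sub>R f x) \<bullet> b) \<partial>M) = s * ((LINT x:A|M. f x) \<bullet> b)"
      unfolding set_lebesgue_integral_def by (simp only: integral_mult_right_zero integral_inner_left[OF i])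
    also have "\<dots> = 0" using z[OF A] by simp
    finally have "(\<integral>x. s * ((indicator A x *\<^sub>R f x) \<bullet> b) \<partial>M) = 0" .
    moreover have "integrable M (\<lambda>x. s * ((indicator A x *\<^sub>R f x) \<bullet> b))"
      using i by (intro integrable_mult_right integrable_inner_left)
    ultimately have "AE x in M. s * ((indicator A x *\<^sub>R f x) \<bullet> b) = 0"
      by (subst (asm) integral_nonneg_eq_0_iff_AE) (auto simp: A_def indicator_def)
    then show ?thesis by (rule AE_mp) (auto simp: A_def indicator_def intro!: AE_I2 split: if_splits)
  qed
  have "AE x in M. f x \<bullet> b = 0" for b
    using half[of 1 b] half[of "-1" b] by eventually_elim auto
  then have "AE x in M. \<forall>b\<in>Basis. f x \<bullet> b = 0"
    by (subst AE_finite_all) auto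
  then show ?thesis by eventually_elim (auto intro: euclidean_eqI)
qed

text \<open>Boxes are stable under intersection and generate the Borel sets, so Dynkin's lemma
  extends the vanishing to all Borel sets. After extension by zero the integral over the whole space
  is one over a box, which settles complements.\<close>

lemma AE_zero_if_box_integrals_zero:
  fixes f :: "'a::euclidean_space \<Rightarrow> 'b::euclidean_space"
  assumes f: "set_integrable lborel (box c d) f"
    and z: "\<And>a b. cbox a b \<subseteq> cbox c d \<Longrightarrow> (LBINT x:box a b. f x) = 0"
  shows "AE x in lborel. x \<in> box c d \<longrightarrow> f x = 0"
proof -
  define F where "F x = indicator (box c d) x *\<^sub>R f x" for x
  have F: "integrable lborel F" using f unfolding set_integrable_def F_def .
  have boxes: "(LBINT x:box a b. F x) = 0" for a b
  proof -
    have "(LBINT x:box a b. F x) = (LBINT x:box a b \<inter> box c d. f x)"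
      unfolding set_lebesgue_integral_def F_def by (simp add: indicator_inter_arith)
    moreover obtain a' b' where ab: "box a b \<inter> box c d = box a' b'"
      using box_Int_box[of a b c d] by metis
    moreover have "(LBINT x:box a' b'. f x) = 0"
    proof (cases "box a' b' = {}")
      case False
      \<comment> \<open>A nonempty open box is dense in its closed box, which puts the latter inside
        \<open>cbox c d\<close>, as the hypothesis demands.\<close>
      have "box a' b' \<subseteq> cbox c d" using ab box_subset_cbox by blast
      then have "cbox a' b' \<subseteq> cbox c d"
        using False by (metis closed_cbox closure_box closure_minimal)
      then show ?thesis by (rule z)
    qed (simp add: set_lebesgue_integral_def)
    ultimately show ?thesis by simp
  qed
  have "(LBINT x:A. F x) = 0" if "A \<in> sets lborel" for A
  proof -
    have A: "A \<in> sigma_sets UNIV (range (\<lambda>(a, b). box a b :: 'a set))"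
      using that by (simp add: borel_eq_box)
    have I: "Int_stable (range (\<lambda>(a, b). box a b :: 'a set))"
      by (rule Int_stableI) (auto simp: box_Int_box image_iff, blast)
    have "range (\<lambda>(a, b). box a b :: 'a set) \<subseteq> Pow UNIV" by simp
    from I this A show ?thesis
    proof (induction rule: sigma_sets_induct_disjoint)
      case (basic A)
      then show ?case using boxes by auto
    next
      case empty
      show ?case by (simp add: set_lebesgue_integral_def)
    next
      case (compl A)
      then have A: "A \<in> sets borel" by (simp add: borel_eq_box)
      then have A': "UNIV - A \<in> sets borel" by (intro sets.Diff) auto
      have "(LBINT x:UNIV. F x) = 0"
        using boxes[of c d] unfolding set_lebesgue_integral_def F_def
        by (simp flip: indicator_inter_arith)
      moreover have "(LBINT x:UNIV. F x) = (LBINT x:A. F x) + (LBINT x:UNIV - A. F x)"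
        using F A A' by (subst set_integral_Un[symmetric])
          (auto simp: set_integrable_def intro!: integrable_mult_indicator)
      ultimately show ?case using compl by simp
    next
      case (union A)
      then have A: "A i \<in> sets borel" for i by (auto simp: borel_eq_box)
      have "(LBINT x:(\<Union>i. A i). F x) = (\<Sum>i. (LBINT x:A i. F x))"
        using union F A by (intro lebesgue_integral_countable_add)
          (auto simp: disjoint_family_on_def set_integrable_def intro!: integrable_mult_indicator)
      with union show ?case by simp
    qed
  qed
  from AE_zero_if_set_integrals_zero[OF F this] have "AE x in lborel. F x = 0" by simp
  then show ?thesis by eventually_elim (auto simp: F_def)
qed

text \<open>Bumps converge boundedly to indicators of open boxes, which reduces the claim to
  integrals over boxes. Countably many closed boxes exhaust \<open>U\<close>, and their faces are
  null.\<close>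

lemma AE_zero_if_bump_integrals_zero:
  fixes f :: "'a::euclidean_space \<Rightarrow> 'b::euclidean_space"
  assumes U: "open U" and f: "loc_integrable U f"
    and z: "\<And>a b m. cbox a b \<subseteq> U \<Longrightarrow> (LBINT x:U. bump a b m x *\<^sub>R f x) = 0"
  shows "AE x in lborel. x \<in> U \<longrightarrow> f x = 0"
proof -
  have box0: "(LBINT x:box a b. f x) = 0" if sub: "cbox a b \<subseteq> U" for a b
  proof -
    have fi: "integrable lborel (\<lambda>x. indicator (cbox a b) x *\<^sub>R f x)"
      using f sub compact_cbox[of a b] unfolding loc_integrable_def set_integrable_def by blast
    have fm [measurable]: "(\<lambda>x. indicator (cbox a b) x *\<^sub>R f x) \<in> borel_measurable borel"
      using borel_measurable_integrable[OF fi] by simp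
    have [measurable]: "bump a b m \<in> borel_measurable borel" for m
      by (intro borel_measurable_continuous_onI smooth_fun_continuous smooth_fun_bump)
    have "(\<lambda>m. LINT x|lborel. bump a b m x *\<^sub>R (indicator (cbox a b) x *\<^sub>R f x))
       \<longlonglongrightarrow> (LINT x|lborel. indicator (box a b) x *\<^sub>R (indicator (cbox a b) x *\<^sub>R f x))"
    proof (rule integral_dominated_convergence[where w="\<lambda>x. norm (indicator (cbox a b) x *\<^sub>R f x)"])
      show "integrable lborel (\<lambda>x. norm (indicator (cbox a b) x *\<^sub>R f x))" using fi by (rule integrable_norm)
      show "AE x in lborel. (\<lambda>m. bump a b m x *\<^sub>R (indicator (cbox a b) x *\<^sub>R f x))
         \<longlonglongrightarrow> indicator (box a b) x *\<^sub>R (indicator (cbox a b) x *\<^sub>R f x)"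
        by (intro AE_I2 tendsto_intros bump_tendsto)
      show "AE x in lborel. norm (bump a b m x *\<^sub>R (indicator (cbox a b) x *\<^sub>R f x)) \<le> norm (indicator (cbox a b) x *\<^sub>R f x)" for m
        using bump_bounds[of a b m] by (intro AE_I2, subst norm_scaleR) (simp add: mult_left_le_one_le del: norm_scaleR)
    qed measurable
    moreover have "(LINT x|lborel. bump a b m x *\<^sub>R (indicator (cbox a b) x *\<^sub>R f x)) = 0" for m
    proof -
      have "bump a b m x *\<^sub>R (indicator (cbox a b) x *\<^sub>R f x) = indicator U x *\<^sub>R (bump a b m x *\<^sub>R f x)" for x
        using sub bump_eq_0[of x a b m] box_subset_cbox[of a b] by (auto simp: indicator_def)
      then show ?thesis using z[OF sub, of m] unfolding set_lebesgue_integral_def by (simp only:)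
    qed
    ultimately have "(LINT x|lborel. indicator (box a b) x *\<^sub>R (indicator (cbox a b) x *\<^sub>R f x)) = 0"
      by (simp add: LIMSEQ_const_iff)
    moreover have "indicator (box a b) x *\<^sub>R (indicator (cbox a b) x *\<^sub>R f x) = indicator (box a b) x *\<^sub>R f x" for x
      using box_subset_cbox[of a b] by (auto simp: indicator_def)
    ultimately show ?thesis unfolding set_lebesgue_integral_def by (simp only:)
  qed
  obtain D where D: "countable D" "D \<subseteq> Pow U" "\<And>X. X \<in> D \<Longrightarrow> \<exists>a b. X = cbox a b" "\<Union>D = U"
    using open_countable_Union_open_cbox[OF U] by metis
  have "AE x in lborel. x \<in> X \<longrightarrow> f x = 0" if X: "X \<in> D" for X
  proof -
    obtain a b where ab: "X = cbox a b" using D X by blast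
    then have sub: "cbox a b \<subseteq> U" using D X by blast
    have "set_integrable lborel (cbox a b) f" using f sub compact_cbox unfolding loc_integrable_def by blast
    then have "set_integrable lborel (box a b) f"
      by (rule set_integrable_subset) (auto simp: box_subset_cbox)
    then have "AE x in lborel. x \<in> box a b \<longrightarrow> f x = 0"
      using box0 sub by (intro AE_zero_if_box_integrals_zero) auto
    moreover have "AE x in lborel. x \<notin> cbox a b - box a b"
    proof (rule AE_not_in)
      have "emeasure lborel (cbox a b - box a b) = emeasure lborel (cbox a b) - emeasure lborel (box a b)"
        by (intro emeasure_Diff) (auto simp: box_subset_cbox emeasure_lborel_box_eq)
      also have "\<dots> = 0" by (simp add: emeasure_lborel_box_eq emeasure_lborel_cbox_eq)
      finally show "cbox a b - box a b \<in> null_sets lborel" by (simp add: null_sets_def)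
    qed
    ultimately show ?thesis unfolding ab by eventually_elim auto
  qed
  then have "AE x in lborel. \<forall>X\<in>D. x \<in> X \<longrightarrow> f x = 0" using D(1) by (subst AE_ball_countable) auto
  then show ?thesis by eventually_elim (unfold D(4)[symmetric], blast)
qed

lemma fundamental_lemma:
  fixes f :: "'a::euclidean_space \<Rightarrow> 'b::euclidean_space"
  assumes "open U" "loc_integrable U f"
    and "\<And>\<phi>. test_fun U \<phi> \<Longrightarrow> (LBINT x:U. \<phi> x *\<^sub>R f x) = 0"
  shows "AE x in lborel. x \<in> U \<longrightarrow> f x = 0"
  by (rule AE_zero_if_bump_integrals_zero[OF assms(1,2)]) (rule assms(3)[OF test_fun_bump])

section \<open>Fubini in the plane and integration by parts in one variable\<close>

lemma measurable_fst_borel [measurable]: "fst \<in> borel_measurable (borel :: ('a::second_countable_topology \<times> 'b::second_countable_topology) measure)"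
  by (intro borel_measurable_continuous_onI continuous_intros)

lemma measurable_snd_borel [measurable]: "snd \<in> borel_measurable (borel :: ('a::second_countable_topology \<times> 'b::second_countable_topology) measure)"
  by (intro borel_measurable_continuous_onI continuous_intros)

lemma integrable_indicator_interval: "integrable lborel (\<lambda>t. indicator {c<..<d::real} t :: real)"
  by (rule integrable_real_indicator) (simp, cases "c \<le> d", simp_all)

lemma integrable_bounded_scaleR:
  fixes f :: "'a \<Rightarrow> 'b::{banach, second_countable_topology}"
  assumes "integrable M f" "\<phi> \<in> borel_measurable M" "\<And>x. \<bar>\<phi> x\<bar> \<le> C"
  shows "integrable M (\<lambda>x. \<phi> x *\<^sub>R f x)"
proof (rule Bochner_Integration.integrable_bound)
  show "integrable M (\<lambda>x. C * norm (f x))" using assms by auto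
  show "(\<lambda>x. \<phi> x *\<^sub>R f x) \<in> borel_measurable M" using assms by measurable
  have "0 \<le> C" using assms(3) abs_ge_zero order_trans by blast
  then show "AE x in M. norm (\<phi> x *\<^sub>R f x) \<le> norm (C * norm (f x))"
    using assms(3) by (auto intro!: AE_I2 mult_right_mono simp: abs_mult)
qed

lemma integrable_test_fun_scaleR:
  fixes f :: "'a::euclidean_space \<Rightarrow> 'b::euclidean_space"
  assumes "test_fun U \<phi>" "integrable lborel f"
  shows "integrable lborel (\<lambda>x. \<phi> x *\<^sub>R f x)"
  using test_fun_bounded[OF assms(1)] test_fun_measurable[OF assms(1)] assms(2)
  by (auto intro: integrable_bounded_scaleR)

lemma test_fun_integrable:
  assumes "test_fun U \<phi>" shows "integrable lborel \<phi>"
proof -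
  obtain K where K: "compact K" "K \<subseteq> U" "\<And>x. x \<notin> K \<Longrightarrow> \<phi> x = 0"
    using assms unfolding test_fun_def by blast
  have "integrable lborel (\<lambda>x. indicator K x *\<^sub>R \<phi> x)"
    by (rule borel_integrable_compact[OF K(1) test_fun_continuous[OF assms]])
  also have "(\<lambda>x. indicator K x *\<^sub>R \<phi> x) = \<phi>" using K(3) by (auto simp: indicator_def fun_eq_iff)
  finally show ?thesis .
qed

lemma integrable_product_plane:
  fixes h :: "real \<Rightarrow> 'b::euclidean_space"
  assumes e: "integrable lborel e" and h: "integrable lborel h"
  shows "integrable lborel (\<lambda>x::plane. e (fst x) *\<^sub>R h (snd x))"
proof -
  have [measurable]: "e \<in> borel_measurable borel" "h \<in> borel_measurable borel" using e h by auto
  have "integrable (lborel \<Otimes>\<^sub>M lborel) (\<lambda>x::plane. e (fst x) *\<^sub>R h (snd x))"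
    using e h by (intro lborel_pair.Fubini_integrable) (auto intro!: AE_I2)
  then show ?thesis by (simp add: lborel_prod)
qed

lemma plane_integral_iterated:
  fixes f :: "plane \<Rightarrow> 'b::euclidean_space"
  assumes "integrable lborel f"
  shows "(LBINT x. f x) = (LBINT s. (LBINT t. f (s, t)))"
    and "integrable lborel (\<lambda>s. LBINT t. f (s, t))"
    and "AE s in lborel. integrable lborel (\<lambda>t. f (s, t))"
  using lborel_pair.integral_fst'[of f] lborel_pair.integrable_fst'[of f] lborel_pair.AE_integrable_fst'[of f] assms
  by (simp_all add: lborel_prod)

lemma AE_plane_fst:
  assumes "AE s in lborel. P (s::real)" shows "AE x::plane in lborel. P (fst x)"
proof -
  from AE_E[OF assms] obtain N where N: "{x. \<not> P x} \<subseteq> N" "emeasure lborel N = 0" "N \<in> sets lborel" by auto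
  have "emeasure (lborel \<Otimes>\<^sub>M lborel) (N \<times> (UNIV :: real set)) = 0"
    using N by (subst lborel.emeasure_pair_measure_Times) auto
  moreover have "N \<times> (UNIV :: real set) \<in> sets (lborel \<Otimes>\<^sub>M lborel)" using N by (intro pair_measureI) auto
  ultimately have "N \<times> (UNIV :: real set) \<in> null_sets lborel" unfolding lborel_prod by (rule null_setsI)
  then show ?thesis by (rule AE_I') (use N in auto)
qed

text \<open>Fubini on the triangle \<open>t < x\<close>. When \<open>e\<close> is a derivative, the
  primitive of \<open>h\<close> is traded for a tail integral of \<open>e\<close>; this is how
  functions known only as primitives are integrated by parts.\<close>

lemma integral_triangle_swap:
  fixes h :: "real \<Rightarrow> 'b::euclidean_space" and e :: "real \<Rightarrow> real"
  assumes h: "integrable lborel h" and e: "integrable lborel e"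
  shows "(LBINT x. e x *\<^sub>R (LBINT t. indicator {..<x} t *\<^sub>R h t))
       = (LBINT t. (LBINT x. e x * indicator {t<..} x) *\<^sub>R h t)"
proof -
  have [measurable]: "e \<in> borel_measurable borel" "h \<in> borel_measurable borel" using e h by auto
  define F where "F x t = (e x * indicator {t<..} x) *\<^sub>R h t" for x t
  have m: "(\<lambda>x::plane. (indicator {x. snd x < fst x} x :: real)) \<in> borel_measurable borel"
    by (intro borel_measurable_indicator borel_open open_Collect_less continuous_intros)
  have "integrable lborel (\<lambda>x::plane. indicator {x. snd x < fst x} x *\<^sub>R (e (fst x) *\<^sub>R h (snd x)))"
    using m by (intro integrable_bounded_scaleR[where C=1] integrable_product_plane e h) (auto simp: indicator_def)
  moreover have "indicator {x. snd x < fst x} x *\<^sub>R (e (fst x) *\<^sub>R h (snd x)) = (\<lambda>(x,t). F x t) x" for x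
    by (auto simp: F_def indicator_def split: prod.splits)
  ultimately have F: "integrable (lborel \<Otimes>\<^sub>M lborel) (\<lambda>(x,t). F x t)" by (simp add: lborel_prod)
  have "(LBINT x. e x *\<^sub>R (LBINT t. indicator {..<x} t *\<^sub>R h t)) = (LBINT x. (LBINT t. F x t))"
    unfolding F_def
    by (auto intro!: Bochner_Integration.integral_cong simp: indicator_def simp flip: integral_scaleR_right)
  also have "\<dots> = (LBINT t. (LBINT x. F x t))"
    using lborel_pair.Fubini_integral[OF F] by simp
  also have "\<dots> = (LBINT t. (LBINT x. e x * indicator {t<..} x) *\<^sub>R h t)"
  proof (rule Bochner_Integration.integral_cong[OF refl])
    fix t
    have "integrable lborel (\<lambda>x. indicator {t<..} x *\<^sub>R e x)" using e by (intro integrable_mult_indicator) auto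
    then have "integrable lborel (\<lambda>x. e x * indicator {t<..} x)" by (simp add: mult.commute)
    then show "(LBINT x. F x t) = (LBINT x. e x * indicator {t<..} x) *\<^sub>R h t"
      unfolding F_def by (intro integral_scaleR_left)
  qed
  finally show ?thesis .
qed

lemma test_fun_interval_support:
  fixes c d :: real
  assumes "test_fun {c<..<d} \<theta>" "c < d"
  obtains p q where "c < p" "p \<le> q" "q < d" "\<And>x. x \<notin> {p..q} \<Longrightarrow> \<theta> x = 0"
proof -
  obtain K where K: "compact K" "K \<subseteq> {c<..<d}" "\<And>x. x \<notin> K \<Longrightarrow> \<theta> x = 0"
    using assms unfolding test_fun_def by blast
  show ?thesis
  proof (cases "K = {}")
    case True
    show ?thesis by (rule that[of "(c+d)/2" "(c+d)/2"]) (use assms K True in auto)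
  next
    case False
    obtain p q where pq: "p \<in> K" "\<And>x. x \<in> K \<Longrightarrow> p \<le> x" "q \<in> K" "\<And>x. x \<in> K \<Longrightarrow> x \<le> q"
      using compact_attains_inf[OF K(1) False] compact_attains_sup[OF K(1) False] by blast
    have "c < p" "q < d" using pq K(2) by auto
    moreover have "p \<le> q" using pq by blast
    moreover have "\<theta> x = 0" if "x \<notin> {p..q}" for x using that pq K(3) by auto
    ultimately show ?thesis using that by blast
  qed
qed

lemma smooth_primitive:
  fixes \<theta> :: "real \<Rightarrow> real"
  assumes "smooth_fun \<theta>"
  obtains F where "\<And>x. (F has_real_derivative \<theta> x) (at x)" "smooth_fun F"
proof -
  have "isCont \<theta> x" for x
    using smooth_fun_continuous[OF assms, of UNIV] by (simp add: continuous_on_eq_continuous_at)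
  then obtain F where "\<And>x. (F has_vector_derivative \<theta> x) (at x)"
    using einterval_antiderivative[of "-\<infinity>" "\<infinity>" \<theta>] by auto
  then have "\<And>x. (F has_real_derivative \<theta> x) (at x)" by (simp add: has_real_derivative_iff_has_vector_derivative)
  with smooth_fun_antideriv[OF assms] that show ?thesis by blast
qed

lemma dir_deriv_real: "(f has_real_derivative D) (at x) \<Longrightarrow> dir_deriv 1 f x = D"
  using dir_derivI[of f "(*) D" x 1] by (simp add: has_field_derivative_def)

text \<open>Mean zero makes the primitive return to its initial value, so that subtracting this
  constant leaves compact support.\<close>

lemma test_fun_primitive:
  fixes c d :: real
  assumes \<theta>: "test_fun {c<..<d} \<theta>" "c < d" and z: "(LBINT x. \<theta> x) = 0"
  obtains \<eta> where "test_fun {c<..<d} \<eta>" "\<And>x. dir_deriv 1 \<eta> x = \<theta> x"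
proof -
  obtain F where F: "\<And>x. (F has_real_derivative \<theta> x) (at x)" "smooth_fun F"
    using smooth_primitive test_fun_smooth[OF \<theta>(1)] by blast
  obtain p q where pq: "c < p" "p \<le> q" "q < d" "\<And>x. x \<notin> {p..q} \<Longrightarrow> \<theta> x = 0"
    using test_fun_interval_support[OF \<theta>] by blast
  have cF: "continuous_on A F" for A using smooth_fun_continuous F by blast
  have "F q - F p = (LBINT x. \<theta> x * indicator {p..q} x)"
    using test_fun_continuous[OF \<theta>(1), of UNIV] F
    by (subst integral_FTC_Icc_real[OF pq(2)]) (auto simp: continuous_on_eq_continuous_at)
  also have "(\<lambda>x. \<theta> x * indicator {p..q} x) = \<theta>" using pq(4) by (auto simp: indicator_def fun_eq_iff)
  finally have qp: "F q = F p" using z by simp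
  have left: "F x = F p" if "x < p" for x
  proof -
    have "(F has_real_derivative 0) (at y)" if "y < p" for y using F(1)[of y] pq(4)[of y] that by simp
    from DERIV_isconst_end[OF that cF this] show ?thesis by simp
  qed
  have right: "F x = F p" if "q < x" for x
  proof -
    have "(F has_real_derivative 0) (at y)" if "q < y" for y using F(1)[of y] pq(4)[of y] that by simp
    from DERIV_isconst_end[OF that cF this] show ?thesis using qp by simp
  qed
  show ?thesis
  proof (rule that[of "\<lambda>x. F x - F p"])
    show "test_fun {c<..<d} (\<lambda>x. F x - F p)" unfolding test_fun_def
      using F(2) pq left right by (intro conjI smooth_fun_diff exI[of _ "{p..q}"]) (auto simp: not_le)
    show "dir_deriv 1 (\<lambda>x. F x - F p) x = \<theta> x" for x
      by (rule dir_deriv_real) (auto intro!: derivative_eq_intros F)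
  qed
qed

lemma integral_deriv_tail:
  fixes c d :: real
  assumes \<eta>: "test_fun {c<..<d} \<eta>" "c < d"
  shows "(LBINT x. dir_deriv 1 \<eta> x * indicator {t<..} x) = - \<eta> t"
proof -
  obtain p q where pq: "c < p" "p \<le> q" "q < d" "\<And>x. x \<notin> {p..q} \<Longrightarrow> \<eta> x = 0"
    using test_fun_interval_support[OF \<eta>] by blast
  obtain p' q' where pq': "c < p'" "p' \<le> q'" "q' < d" "\<And>x. x \<notin> {p'..q'} \<Longrightarrow> dir_deriv 1 \<eta> x = 0"
    using test_fun_interval_support[OF test_fun_dir_deriv[OF \<eta>(1)] \<eta>(2)] by blast
  \<comment> \<open>An endpoint beyond both \<open>t\<close> and the support treats every position
    of \<open>t\<close> with a single use of the fundamental theorem.\<close>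
  define r where "r = max t d"
  have "(LBINT x. dir_deriv 1 \<eta> x * indicator {t..r} x) = \<eta> r - \<eta> t"
    using test_fun_continuous[OF test_fun_dir_deriv[OF \<eta>(1), of 1], of UNIV] has_real_derivative_smooth[OF test_fun_smooth[OF \<eta>(1)]]
    by (intro integral_FTC_Icc_real) (auto simp: continuous_on_eq_continuous_at r_def)
  moreover have "\<eta> r = 0" using pq by (auto simp: r_def)
  moreover have "(LBINT x. dir_deriv 1 \<eta> x * indicator {t..r} x) = (LBINT x. dir_deriv 1 \<eta> x * indicator {t<..} x)"
  proof (rule integral_cong_AE)
    have [measurable]: "dir_deriv 1 \<eta> \<in> borel_measurable borel"
      using test_fun_measurable test_fun_dir_deriv \<eta> by blast
    show "(\<lambda>x. dir_deriv 1 \<eta> x * indicator {t..r} x) \<in> borel_measurable lborel"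
      "(\<lambda>x. dir_deriv 1 \<eta> x * indicator {t<..} x) \<in> borel_measurable lborel" by measurable
    have "AE x in lborel. x \<noteq> t" by (rule AE_lborel_singleton)
    then show "AE x in lborel. dir_deriv 1 \<eta> x * indicator {t..r} x = dir_deriv 1 \<eta> x * indicator {t<..} x"
      by eventually_elim (use pq' in \<open>auto simp: indicator_def r_def max_def split: if_splits\<close>)
  qed
  ultimately show ?thesis by simp
qed

lemma ex_test_fun_mass1:
  fixes c d :: real
  assumes "c < d"
  obtains \<psi> where "test_fun {c<..<d} \<psi>" "(LBINT x. \<psi> x) = 1"
proof -
  \<comment> \<open>The middle third, so that the closed support stays inside the open
    interval.\<close>
  define p q where "p = (2*c+d)/3" and "q = (c+2*d)/3"
  have pq: "c < p" "p < q" "q < d" using assms by (auto simp: p_def q_def)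
  have t: "test_fun {c<..<d} (bump p q 0)" by (rule test_fun_bump) (use pq in \<open>auto simp: box_real\<close>)
  define m where "m = (LBINT x. bump p q 0 x)"
  have "m \<noteq> 0"
  proof
    assume "m = 0"
    then have "AE x in lborel. bump p q 0 x = 0"
      unfolding m_def using test_fun_integrable[OF t]
      by (subst (asm) integral_nonneg_eq_0_iff_AE) (auto intro!: AE_I2 bump_bounds)
    then have "AE x in lborel. x \<notin> {p<..<q}"
    proof eventually_elim
      case (elim x)
      then show ?case using bump_pos[of x p q 0] by (auto simp: box_real)
    qed
    then have "{p<..<q} \<in> null_sets lborel" by (subst AE_iff_null_sets) auto
    then show False using pq by (simp add: null_sets_def)
  qed
  show ?thesis
  proof (rule that[of "\<lambda>x. bump p q 0 x * (1/m)"])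
    show "test_fun {c<..<d} (\<lambda>x. bump p q 0 x * (1/m))" by (intro test_fun_mult t) simp
    have "(LBINT x. bump p q 0 x * (1/m)) = m * (1/m)"
      unfolding m_def by (rule integral_mult_left_zero)
    then show "(LBINT x. bump p q 0 x * (1/m)) = 1" using \<open>m \<noteq> 0\<close> by simp
  qed
qed

lemma bump_plane: "bump (a, c) (b, d) m (x::plane) = bump a b m (fst x) * bump c d m (snd x)"
  by (cases x) (simp add: bump_def Basis_prod_def prod.union_disjoint prod.reindex inner_Pair)

text \<open>Products suffice because the fundamental lemma was proved with bumps alone, and the bump
  of a planar box factorises.\<close>

lemma fundamental_lemma_product:
  fixes f :: "plane \<Rightarrow> 'b::euclidean_space"
  assumes f: "integrable lborel f"
    and z: "\<And>\<phi> \<psi>. test_fun {a<..<b} \<phi> \<Longrightarrow> test_fun {c<..<d} \<psi> \<Longrightarrow>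
       (LBINT x. (\<phi> (fst x) * \<psi> (snd x)) *\<^sub>R f x) = 0"
  shows "AE x in lborel. x \<in> {a<..<b} \<times> {c<..<d} \<longrightarrow> f x = 0"
proof (rule AE_zero_if_bump_integrals_zero)
  show "open ({a<..<b} \<times> {c<..<d})" by (intro open_Times) auto
  show "loc_integrable ({a<..<b} \<times> {c<..<d}) f"
    unfolding loc_integrable_def set_integrable_def using f
    by (auto intro!: integrable_mult_indicator borel_closed compact_imp_closed)
  fix A B :: plane and m :: nat assume sub: "cbox A B \<subseteq> {a<..<b} \<times> {c<..<d}"
  obtain p q r s where AB: "A = (p, r)" "B = (q, s)" by (cases A; cases B) auto
  show "(LBINT x:{a<..<b} \<times> {c<..<d}. bump A B m x *\<^sub>R f x) = 0"
  proof (cases "box A B = {}")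
    case True
    then show ?thesis by (simp add: bump_eq_0 set_lebesgue_integral_def)
  next
    case False
    then have "cbox A B \<noteq> {}" using box_subset_cbox by blast
    then have ne: "p \<le> q" "r \<le> s" by (auto simp: AB cbox_Pair_eq)
    have "(p, r) \<in> cbox A B" "(q, s) \<in> cbox A B" using ne by (auto simp: AB cbox_Pair_eq)
    then have "(p, r) \<in> {a<..<b} \<times> {c<..<d}" "(q, s) \<in> {a<..<b} \<times> {c<..<d}" using sub by blast+
    then have "cbox p q \<subseteq> {a<..<b}" "cbox r s \<subseteq> {c<..<d}" by auto
    then have "(LBINT x. (bump p q m (fst x) * bump r s m (snd x)) *\<^sub>R f x) = 0"
      by (intro z test_fun_bump)
    moreover have "indicator ({a<..<b} \<times> {c<..<d}) x *\<^sub>R (bump A B m x *\<^sub>R f x) = (bump p q m (fst x) * bump r s m (snd x)) *\<^sub>R f x" for x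
    proof (cases "x \<in> box A B")
      case True
      then have "x \<in> {a<..<b} \<times> {c<..<d}" using sub box_subset_cbox by blast
      then show ?thesis by (simp add: AB bump_plane)
    next
      case False
      from bump_eq_0[OF this, of m] show ?thesis by (simp add: AB bump_plane)
    qed
    ultimately show ?thesis unfolding set_lebesgue_integral_def by (simp only:)
  qed
qed

subsection \<open>Absolute continuity on lines\<close>

text \<open>The du Bois-Reymond argument in the second variable. With a fixed \<open>\<psi>0\<close>
  of mass one, \<open>\<psi>\<close> minus its mass times \<open>\<psi>0\<close> has mean zero and
  so is the derivative of a test function. The hypothesis then says that \<open>v\<close> tests like
  its weighted fibre average \<open>w\<close>.\<close>

lemma vertical_derivative_zero:
  fixes v :: "plane \<Rightarrow> 'b::euclidean_space"
  assumes cd: "c < d" and v: "integrable lborel v"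
    and out: "\<And>x. x \<notin> {a<..<b} \<times> {c<..<d} \<Longrightarrow> v x = 0"
    and z: "\<And>\<phi> \<eta>. test_fun {a<..<b} \<phi> \<Longrightarrow> test_fun {c<..<d} \<eta> \<Longrightarrow>
       (LBINT x. (\<phi> (fst x) * dir_deriv 1 \<eta> (snd x)) *\<^sub>R v x) = 0"
  shows "\<exists>w. integrable lborel w \<and> (AE x in lborel. x \<in> {a<..<b} \<times> {c<..<d} \<longrightarrow> v x = w (fst x))"
proof -
  obtain \<psi>0 where \<psi>0: "test_fun {c<..<d} \<psi>0" "(LBINT x. \<psi>0 x) = 1" using ex_test_fun_mass1[OF cd] .
  have meas [measurable]: "\<psi>0 \<in> borel_measurable borel" "v \<in> borel_measurable borel"
    using test_fun_measurable \<psi>0 v by auto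
  define w where "w s = (LBINT t. \<psi>0 t *\<^sub>R v (s, t))" for s
  obtain C where C: "\<And>x. \<bar>\<psi>0 x\<bar> \<le> C" using test_fun_bounded[OF \<psi>0(1)] by blast
  have int: "integrable lborel (\<lambda>x::plane. (\<phi> (fst x) * \<psi> (snd x)) *\<^sub>R v x)"
    if "test_fun U \<phi>" "test_fun V \<psi>" for U V \<phi> \<psi>
    by (rule integrable_test_fun_scaleR[OF test_fun_product(1)[OF that] v])
  have i0: "integrable lborel (\<lambda>x::plane. \<psi>0 (snd x) *\<^sub>R v x)"
    by (rule integrable_bounded_scaleR[OF v _ C]) measurable
  have w: "integrable lborel w"
    using plane_integral_iterated(2)[OF i0] by (simp add: w_def[abs_def])
  have [measurable]: "w \<in> borel_measurable borel" using w by auto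
  \<comment> \<open>The cut-off in the second variable keeps the subtracted function integrable over
    the plane.\<close>
  define v' where "v' x = v x - indicator {c<..<d} (snd x) *\<^sub>R w (fst x)" for x
  note iK = integrable_indicator_interval[of c d]
  have iw: "integrable lborel (\<lambda>x::plane. indicator {c<..<d} (snd x) *\<^sub>R w (fst x))"
  proof -
    have "integrable lborel (\<lambda>x::plane. indicator {c<..<d} (fst x) *\<^sub>R w (snd x))"
      by (rule integrable_product_plane[OF iK w])
    from lborel_pair.integrable_product_swap[of "\<lambda>x. indicator {c<..<d} (fst x) *\<^sub>R w (snd x)"] this
    show ?thesis by (simp add: lborel_prod case_prod_beta')
  qed
  have v': "integrable lborel v'" unfolding v'_def by (intro Bochner_Integration.integrable_diff v iw)
  have "AE x in lborel. x \<in> {a<..<b} \<times> {c<..<d} \<longrightarrow> v' x = 0"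
  proof (rule fundamental_lemma_product[OF v'])
    fix \<phi> \<psi> assume \<phi>: "test_fun {a<..<b} \<phi>" and \<psi>: "test_fun {c<..<d} \<psi>"
    define m where "m = (LBINT x. \<psi> x)"
    have t: "test_fun {c<..<d} (\<lambda>x. m * \<psi>0 x)" using test_fun_mult[OF \<psi>0(1), of "\<lambda>_. m"] by (simp add: mult.commute)
    obtain \<eta> where \<eta>: "test_fun {c<..<d} \<eta>" "\<And>x. dir_deriv 1 \<eta> x = \<psi> x - m * \<psi>0 x"
    proof (rule test_fun_primitive[OF _ cd])
      obtain K L where "compact K" "K \<subseteq> {c<..<d}" "\<And>x. x \<notin> K \<Longrightarrow> \<psi> x = 0"
        "compact L" "L \<subseteq> {c<..<d}" "\<And>x. x \<notin> L \<Longrightarrow> m * \<psi>0 x = 0"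
        using \<psi> t unfolding test_fun_def by blast
      then show "test_fun {c<..<d} (\<lambda>x. \<psi> x - m * \<psi>0 x)" unfolding test_fun_def
        using test_fun_smooth[OF \<psi>] test_fun_smooth[OF t] smooth_fun_diff
        by (intro conjI exI[of _ "K \<union> L"]) auto
      show "(LBINT x. \<psi> x - m * \<psi>0 x) = 0"
        using test_fun_integrable[OF \<psi>] test_fun_integrable[OF \<psi>0(1)] \<psi>0(2) by (simp add: m_def)
    qed blast
    have "(LBINT x. (\<phi> (fst x) * \<psi> (snd x)) *\<^sub>R v x) - m *\<^sub>R (LBINT x. (\<phi> (fst x) * \<psi>0 (snd x)) *\<^sub>R v x)
       = (LBINT x. (\<phi> (fst x) * \<psi> (snd x)) *\<^sub>R v x - m *\<^sub>R ((\<phi> (fst x) * \<psi>0 (snd x)) *\<^sub>R v x))"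
      using Bochner_Integration.integral_diff[OF int[OF \<phi> \<psi>] integrable_scaleR_right[OF int[OF \<phi> \<psi>0(1)], of m]]
      by (simp only: integral_scaleR_right)
    also have "\<dots> = (LBINT x. (\<phi> (fst x) * dir_deriv 1 \<eta> (snd x)) *\<^sub>R v x)"
      by (simp add: \<eta>(2) algebra_simps)
    also have "\<dots> = 0" by (rule z[OF \<phi> \<eta>(1)])
    also have "(LBINT x. (\<phi> (fst x) * \<psi>0 (snd x)) *\<^sub>R v x) = (LBINT s. \<phi> s *\<^sub>R w s)"
      unfolding plane_integral_iterated(1)[OF int[OF \<phi> \<psi>0(1)]] w_def
      by (simp flip: integral_scaleR_right)
    finally have eq: "(LBINT x. (\<phi> (fst x) * \<psi> (snd x)) *\<^sub>R v x) = m *\<^sub>R (LBINT s. \<phi> s *\<^sub>R w s)" by simp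
    have i2: "integrable lborel (\<lambda>x. (\<phi> (fst x) * \<psi> (snd x)) *\<^sub>R (indicator {c<..<d} (snd x) *\<^sub>R w (fst x)))"
      by (rule integrable_test_fun_scaleR[OF test_fun_product(1)[OF \<phi> \<psi>] iw])
    have \<psi>out: "\<psi> t * indicator {c<..<d} t = \<psi> t" for t
      using \<psi> unfolding test_fun_def by (auto simp: indicator_def)
    have "(LBINT x. (\<phi> (fst x) * \<psi> (snd x)) *\<^sub>R (indicator {c<..<d} (snd x) *\<^sub>R w (fst x)))
        = (LBINT s. (LBINT t. \<psi> t *\<^sub>R (\<phi> s *\<^sub>R w s)))"
      unfolding plane_integral_iterated(1)[OF i2] by (simp add: \<psi>out mult.assoc) (simp add: mult.commute)
    also have "\<dots> = (LBINT s. m *\<^sub>R (\<phi> s *\<^sub>R w s))"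
      unfolding m_def using test_fun_integrable[OF \<psi>] by (subst integral_scaleR_left) auto
    also have "\<dots> = m *\<^sub>R (LBINT s. \<phi> s *\<^sub>R w s)" by (rule integral_scaleR_right)
    finally have eq2: "(LBINT x. (\<phi> (fst x) * \<psi> (snd x)) *\<^sub>R (indicator {c<..<d} (snd x) *\<^sub>R w (fst x)))
       = m *\<^sub>R (LBINT s. \<phi> s *\<^sub>R w s)" .
    have "(LBINT x. (\<phi> (fst x) * \<psi> (snd x)) *\<^sub>R v' x) =
       (LBINT x. (\<phi> (fst x) * \<psi> (snd x)) *\<^sub>R v x)
       - (LBINT x. (\<phi> (fst x) * \<psi> (snd x)) *\<^sub>R (indicator {c<..<d} (snd x) *\<^sub>R w (fst x)))"
      unfolding v'_def scaleR_diff_right by (rule Bochner_Integration.integral_diff[OF int[OF \<phi> \<psi>] i2])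
    then show "(LBINT x. (\<phi> (fst x) * \<psi> (snd x)) *\<^sub>R v' x) = 0" using eq eq2 by simp
  qed
  then have "AE x in lborel. x \<in> {a<..<b} \<times> {c<..<d} \<longrightarrow> v x = w (fst x)"
    by eventually_elim (auto simp: v'_def mem_Times_iff)
  with w show ?thesis by blast
qed

text \<open>Subtracting the vertical primitive \<open>G\<close> of \<open>g\<close> leaves a
  function with vanishing weak vertical derivative, to which the du Bois-Reymond argument applies.
  Only derivatives in the second variable enter, so the lemma also serves functions such as
  \<open>kt0\<close> that are weakly differentiable in that direction alone.\<close>

lemma absolutely_continuous_vertical:
  fixes u g :: "plane \<Rightarrow> 'b::euclidean_space"
  assumes cd: "c < d"
    and u: "set_integrable lborel ({a<..<b} \<times> {c<..<d}) u" and g: "set_integrable lborel ({a<..<b} \<times> {c<..<d}) g"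
    and wd: "\<And>\<phi> \<eta>. test_fun {a<..<b} \<phi> \<Longrightarrow> test_fun {c<..<d} \<eta> \<Longrightarrow>
       (LBINT x:{a<..<b} \<times> {c<..<d}. (\<phi> (fst x) * dir_deriv 1 \<eta> (snd x)) *\<^sub>R u x) =
       - (LBINT x:{a<..<b} \<times> {c<..<d}. (\<phi> (fst x) * \<eta> (snd x)) *\<^sub>R g x)"
  shows "\<exists>w. integrable lborel w \<and>
    (AE x in lborel. x \<in> {a<..<b} \<times> {c<..<d} \<longrightarrow> u x = w (fst x) + (LBINT t:{c<..<snd x}. g (fst x, t)))"
proof -
  define R where "R = {a<..<b} \<times> {c<..<d}"
  define u0 where "u0 x = indicator R x *\<^sub>R u x" for x
  define g0 where "g0 x = indicator R x *\<^sub>R g x" for x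
  have u0: "integrable lborel u0" and g0: "integrable lborel g0"
    using u g unfolding set_integrable_def u0_def g0_def R_def .
  have [measurable]: "u0 \<in> borel_measurable borel" "g0 \<in> borel_measurable borel" using u0 g0 by auto
  have Rm [measurable]: "R \<in> sets borel" unfolding R_def by (intro borel_open open_Times) auto
  define G where "G x = indicator R x *\<^sub>R (LBINT t. indicator {..<snd x} t *\<^sub>R g0 (fst x, t))" for x
  have [measurable]: "G \<in> borel_measurable borel"
  proof -
    have m: "(\<lambda>x::plane \<times> real. (indicator {x. snd x < snd (fst x)} x :: real)) \<in> borel_measurable borel"
      by (intro borel_measurable_indicator borel_open open_Collect_less continuous_intros)
    have "(\<lambda>x::plane \<times> real. indicator {x. snd x < snd (fst x)} x *\<^sub>R g0 (fst (fst x), snd x)) \<in> borel_measurable (borel \<Otimes>\<^sub>M lborel)"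
      using m by (simp add: borel_prod[symmetric])
    then have "(\<lambda>(x::plane, t). indicator {..<snd x} t *\<^sub>R g0 (fst x, t)) \<in> borel_measurable (borel \<Otimes>\<^sub>M lborel)"
      by (simp add: case_prod_beta' indicator_def)
    from lborel.borel_measurable_lebesgue_integral[OF this]
    show ?thesis unfolding G_def by measurable
  qed
  \<comment> \<open>The full fibre integral of \<open>norm g0\<close> dominates every partial one
    and so controls \<open>G\<close> on the rectangle.\<close>
  have N: "integrable lborel (\<lambda>s. LBINT t. norm (g0 (s, t)))"
    by (rule plane_integral_iterated(2)[OF integrable_norm[OF g0]])
  have secg: "AE s in lborel. integrable lborel (\<lambda>t. g0 (s, t))" by (rule plane_integral_iterated(3)[OF g0])
  have G: "integrable lborel G"
  proof (rule Bochner_Integration.integrable_bound)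
    note iK = integrable_indicator_interval[of c d]
    have "integrable lborel (\<lambda>x::plane. (LBINT t. norm (g0 (fst x, t))) *\<^sub>R (indicator {c<..<d} (snd x) :: real))"
      by (rule integrable_product_plane[OF N iK])
    then show "integrable lborel (\<lambda>x::plane. (LBINT t. norm (g0 (fst x, t))) * (indicator {c<..<d} (snd x) :: real))" by simp
    show "G \<in> borel_measurable lborel" by measurable
    have "AE x::plane in lborel. integrable lborel (\<lambda>t. g0 (fst x, t))"
      using secg by (rule AE_plane_fst)
    then show "AE x in lborel. norm (G x) \<le> norm ((LBINT t. norm (g0 (fst x, t))) * (indicator {c<..<d} (snd x) :: real))"
    proof eventually_elim
      fix x :: plane assume i: "integrable lborel (\<lambda>t. g0 (fst x, t))"
      have "norm (LBINT t. indicator {..<snd x} t *\<^sub>R g0 (fst x, t)) \<le> (LBINT t. norm (g0 (fst x, t)))"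
        using i by (intro order_trans[OF integral_norm_bound] integral_mono integrable_norm integrable_mult_indicator)
          (auto simp: indicator_def)
      then show "norm (G x) \<le> norm ((LBINT t. norm (g0 (fst x, t))) * (indicator {c<..<d} (snd x) :: real))"
        by (auto simp: G_def R_def indicator_def)
    qed
  qed
  define v where "v x = u0 x - G x" for x
  have v: "integrable lborel v" unfolding v_def by (intro Bochner_Integration.integrable_diff u0 G)
  have "\<exists>w. integrable lborel w \<and> (AE x in lborel. x \<in> {a<..<b} \<times> {c<..<d} \<longrightarrow> v x = w (fst x))"
  proof (rule vertical_derivative_zero[OF cd v])
    show "x \<notin> {a<..<b} \<times> {c<..<d} \<Longrightarrow> v x = 0" for x by (simp add: v_def u0_def G_def R_def)
    fix \<phi> \<eta> assume \<phi>: "test_fun {a<..<b} \<phi>" and \<eta>: "test_fun {c<..<d} \<eta>"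
    define e where "e = dir_deriv 1 \<eta>"
    have te: "test_fun {c<..<d} e" unfolding e_def by (rule test_fun_dir_deriv[OF \<eta>])
    have eout: "indicator {c<..<d} t * e t = e t" for t
      using te unfolding test_fun_def by (auto simp: indicator_def)
    have g0out: "g0 (s, t) = 0" if "s \<notin> {a<..<b}" for s t using that by (auto simp: g0_def R_def)
    have iG: "integrable lborel (\<lambda>x. (\<phi> (fst x) * e (snd x)) *\<^sub>R G x)"
      by (rule integrable_test_fun_scaleR[OF test_fun_product(1)[OF \<phi> te] G])
    have iu: "integrable lborel (\<lambda>x. (\<phi> (fst x) * e (snd x)) *\<^sub>R u0 x)"
      by (rule integrable_test_fun_scaleR[OF test_fun_product(1)[OF \<phi> te] u0])
    have ig: "integrable lborel (\<lambda>x. (\<phi> (fst x) * \<eta> (snd x)) *\<^sub>R g0 x)"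
      by (rule integrable_test_fun_scaleR[OF test_fun_product(1)[OF \<phi> \<eta>] g0])
    have "(LBINT x. (\<phi> (fst x) * e (snd x)) *\<^sub>R G x)
       = (LBINT s. (LBINT y. (\<phi> s * e y) *\<^sub>R G (s, y)))"
      using plane_integral_iterated(1)[OF iG] by simp
    also have "\<dots> = (LBINT s. \<phi> s *\<^sub>R (LBINT y. e y *\<^sub>R (LBINT t. indicator {..<y} t *\<^sub>R g0 (s, t))))"
    proof (rule Bochner_Integration.integral_cong[OF refl])
      fix s
      have "(\<phi> s * e y) *\<^sub>R G (s, y) = \<phi> s *\<^sub>R (e y *\<^sub>R (LBINT t. indicator {..<y} t *\<^sub>R g0 (s, t)))" for y
      proof (cases "s \<in> {a<..<b}")
        case True
        then have "(\<phi> s * e y) *\<^sub>R G (s, y) = (\<phi> s * (indicator {c<..<d} y * e y)) *\<^sub>R (LBINT t. indicator {..<y} t *\<^sub>R g0 (s, t))"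
          by (simp add: G_def R_def indicator_times)
        then show ?thesis by (simp only: eout scaleR_scaleR)
      next
        case False
        then show ?thesis by (simp add: G_def g0out)
      qed
      then show "(LBINT y. (\<phi> s * e y) *\<^sub>R G (s, y)) = \<phi> s *\<^sub>R (LBINT y. e y *\<^sub>R (LBINT t. indicator {..<y} t *\<^sub>R g0 (s, t)))"
        by (simp only: integral_scaleR_right)
    qed
    also have "\<dots> = (LBINT s. - (LBINT t. (\<phi> s * \<eta> t) *\<^sub>R g0 (s, t)))"
    proof (rule integral_cong_AE)
      have [measurable]: "\<phi> \<in> borel_measurable borel" "e \<in> borel_measurable borel" using test_fun_measurable \<phi> te by auto
      note mI = lborel.borel_measurable_lebesgue_integral
      have m: "(\<lambda>x::plane \<times> real. (indicator {x. snd x < snd (fst x)} x :: real)) \<in> borel_measurable borel"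
        by (intro borel_measurable_indicator borel_open open_Collect_less continuous_intros)
      have "(\<lambda>x::plane \<times> real. indicator {x. snd x < snd (fst x)} x *\<^sub>R g0 (fst (fst x), snd x)) \<in> borel_measurable (borel \<Otimes>\<^sub>M lborel)"
        using m by (simp add: borel_prod[symmetric])
      then have "(\<lambda>(x::plane, t). indicator {..<snd x} t *\<^sub>R g0 (fst x, t)) \<in> borel_measurable (borel \<Otimes>\<^sub>M lborel)"
        by (simp add: case_prod_beta' indicator_def)
      from mI[OF this] have "(\<lambda>x::plane. e (snd x) *\<^sub>R (LBINT t. indicator {..<snd x} t *\<^sub>R g0 (fst x, t))) \<in> borel_measurable borel"
        by measurable
      then have "(\<lambda>(s, y). e y *\<^sub>R (LBINT t. indicator {..<y} t *\<^sub>R g0 (s, t))) \<in> borel_measurable (lborel \<Otimes>\<^sub>M lborel)"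
        by (simp add: case_prod_beta' lborel_prod)
      from mI[OF this]
      show "(\<lambda>s. \<phi> s *\<^sub>R (LBINT y. e y *\<^sub>R (LBINT t. indicator {..<y} t *\<^sub>R g0 (s, t)))) \<in> borel_measurable lborel"
        by measurable
      show "(\<lambda>s. - (LBINT t. (\<phi> s * \<eta> t) *\<^sub>R g0 (s, t))) \<in> borel_measurable lborel"
        using plane_integral_iterated(2)[OF ig] by auto
      show "AE s in lborel. \<phi> s *\<^sub>R (LBINT y. e y *\<^sub>R (LBINT t. indicator {..<y} t *\<^sub>R g0 (s, t)))
         = - (LBINT t. (\<phi> s * \<eta> t) *\<^sub>R g0 (s, t))"
        using secg
      proof eventually_elim
        fix s assume i: "integrable lborel (\<lambda>t. g0 (s, t))"
        show "\<phi> s *\<^sub>R (LBINT y. e y *\<^sub>R (LBINT t. indicator {..<y} t *\<^sub>R g0 (s, t)))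
         = - (LBINT t. (\<phi> s * \<eta> t) *\<^sub>R g0 (s, t))"
        proof -
          have "\<phi> s *\<^sub>R (LBINT y. e y *\<^sub>R (LBINT t. indicator {..<y} t *\<^sub>R g0 (s, t)))
             = \<phi> s *\<^sub>R (LBINT t. (- \<eta> t) *\<^sub>R g0 (s, t))"
            unfolding integral_triangle_swap[OF i test_fun_integrable[OF te]]
            unfolding e_def integral_deriv_tail[OF \<eta> cd] ..
          also have "\<dots> = (LBINT t. \<phi> s *\<^sub>R ((- \<eta> t) *\<^sub>R g0 (s, t)))"
            by (rule integral_scaleR_right[symmetric])
          also have "\<dots> = (LBINT t. - ((\<phi> s * \<eta> t) *\<^sub>R g0 (s, t)))" by simp
          finally show ?thesis by simp
        qed
      qed
    qed
    also have "\<dots> = - (LBINT x. (\<phi> (fst x) * \<eta> (snd x)) *\<^sub>R g0 x)"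
      using plane_integral_iterated(1)[OF ig] by simp
    also have "\<dots> = (LBINT x. (\<phi> (fst x) * e (snd x)) *\<^sub>R u0 x)"
      using wd[OF \<phi> \<eta>] unfolding set_lebesgue_integral_def u0_def g0_def R_def[symmetric] e_def
      by (simp add: mult.commute)
    finally show "(LBINT x. (\<phi> (fst x) * dir_deriv 1 \<eta> (snd x)) *\<^sub>R v x) = 0"
      unfolding v_def scaleR_diff_right e_def[symmetric] using iu iG by simp
  qed
  then obtain w where w: "integrable lborel w" "AE x in lborel. x \<in> {a<..<b} \<times> {c<..<d} \<longrightarrow> v x = w (fst x)" by blast
  from w(2) have "AE x in lborel. x \<in> {a<..<b} \<times> {c<..<d} \<longrightarrow> u x = w (fst x) + (LBINT t:{c<..<snd x}. g (fst x, t))"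
  proof eventually_elim
    fix x assume *: "x \<in> {a<..<b} \<times> {c<..<d} \<longrightarrow> v x = w (fst x)"
    show "x \<in> {a<..<b} \<times> {c<..<d} \<longrightarrow> u x = w (fst x) + (LBINT t:{c<..<snd x}. g (fst x, t))"
    proof
      assume x: "x \<in> {a<..<b} \<times> {c<..<d}"
      have "indicator {..<snd x} t *\<^sub>R g0 (fst x, t) = indicator {c<..<snd x} t *\<^sub>R g (fst x, t)" for t
        using x by (auto simp: g0_def R_def indicator_def)
      then have "G x = (LBINT t:{c<..<snd x}. g (fst x, t))"
        using x unfolding G_def set_lebesgue_integral_def by (simp add: R_def)
      moreover have "u0 x = u x" using x by (simp add: u0_def R_def)
      ultimately show "u x = w (fst x) + (LBINT t:{c<..<snd x}. g (fst x, t))"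
        using * x by (simp add: v_def algebra_simps)
    qed
  qed
  with w(1) show ?thesis by blast
qed

subsection \<open>Lebesgue points on the line\<close>

text \<open>Around each point of the exceptional set there are small balls charged at a rate above
  \<open>c\<close>. The covering lemma selects disjoint ones inside an open set of small measure
  \<open>\<nu>\<close>, and their fivefold enlargements cover the exceptional set.\<close>

lemma Vitali_concentration_null:
  fixes \<nu> :: "real measure"
  assumes fin: "finite_measure \<nu>" and sets: "sets \<nu> = sets borel"
    and A: "A \<in> sets borel" "emeasure \<nu> A = 0" and c: "c > 0"
  shows "\<exists>N\<in>null_sets lborel. {x\<in>A. \<forall>\<delta>>0. \<exists>r. 0 < r \<and> r < \<delta> \<and> measure \<nu> (cball x r) > c * r} \<subseteq> N"
proof -
  interpret finite_measure \<nu> by fact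
  define S where "S = {x\<in>A. \<forall>\<delta>>0. \<exists>r. 0 < r \<and> r < \<delta> \<and> measure \<nu> (cball x r) > c * r}"
  have cover: "\<exists>T\<in>sets lborel. S \<subseteq> T \<and> emeasure lborel T \<le> ennreal e" if e: "e > 0" for e
  proof -
    have "emeasure \<nu> A = (INF U\<in>{U. A \<subseteq> U \<and> open U}. emeasure \<nu> U)"
      by (rule outer_regular) (use sets A in \<open>auto simp: emeasure_eq_measure\<close>)
    \<comment> \<open>An enlarged ball has length \<open>10 * r\<close>, which is below
      \<open>10 / c\<close> times the mass of the original ball; this fixes the tolerance.\<close>
    then have "(INF U\<in>{U. A \<subseteq> U \<and> open U}. emeasure \<nu> U) < ennreal (e * c / 10)" using A e c by simp
    then obtain U where U: "A \<subseteq> U" "open U" "emeasure \<nu> U < ennreal (e * c / 10)"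
      unfolding INF_less_iff by auto
    have "\<exists>r. 0 < r \<and> r < 1 \<and> cball x r \<subseteq> U \<and> measure \<nu> (cball x r) > c * r" if x: "x \<in> S" for x
    proof -
      have "x \<in> U" using x U by (auto simp: S_def)
      then obtain d where d: "d > 0" "cball x d \<subseteq> U" using U(2) open_contains_cball by blast
      have "min d 1 > 0" using d by simp
      moreover have "\<forall>\<delta>>0. \<exists>r. 0 < r \<and> r < \<delta> \<and> measure \<nu> (cball x r) > c * r" using x by (simp add: S_def)
      ultimately obtain r where r: "0 < r" "r < min d 1" "measure \<nu> (cball x r) > c * r" by blast
      moreover have "cball x r \<subseteq> cball x d" using r by (intro subset_cball) simp
      then have "cball x r \<subseteq> U" using d by blast
      ultimately show ?thesis by auto
    qed
    then obtain r where r: "\<And>x. x \<in> S \<Longrightarrow> 0 < r x" "\<And>x. x \<in> S \<Longrightarrow> r x < 1"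
      "\<And>x. x \<in> S \<Longrightarrow> cball x (r x) \<subseteq> U" "\<And>x. x \<in> S \<Longrightarrow> measure \<nu> (cball x (r x)) > c * r x" by metis
    have "x \<in> cball x (r x)" if "x \<in> S" for x using r(1)[OF that] by simp
    then have SC: "S \<subseteq> (\<Union>i\<in>S. cball i (r i))" by blast
    have rB: "0 < r i \<and> r i \<le> 1" if "i \<in> S" for i using r(1,2)[OF that] by simp
    obtain C where C: "countable C" "C \<subseteq> S" "pairwise (\<lambda>i j. disjnt (cball i (r i)) (cball j (r j))) C"
      "S \<subseteq> (\<Union>i\<in>C. cball i (5 * r i))"
      by (rule Vitali_covering_lemma_cballs[of S "\<lambda>x. x" r S 1, OF SC rB])
    \<comment> \<open>The countable family is re-indexed by the naturals, with empty sets at the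
      remaining indices, so that countable additivity applies whether \<open>C\<close> is finite or
      infinite.\<close>
    define g where "g = from_nat_into C"
    define N0 where "N0 = to_nat_on C ` C"
    define X where "X n = (if n \<in> N0 then cball (g n) (5 * r (g n)) else {})" for n
    define Y where "Y n = (if n \<in> N0 then cball (g n) (r (g n)) else {})" for n
    have gC: "g n \<in> C" if "n \<in> N0" for n using that C(1) by (auto simp: N0_def g_def)
    have ginj: "n = m" if "n \<in> N0" "m \<in> N0" "g n = g m" for n m
      using that C(1) by (auto simp: N0_def g_def)
    have gsurj: "\<exists>n\<in>N0. g n = x" if "x \<in> C" for x
      using that C(1) by (auto simp: N0_def g_def)
    have disj: "disjoint_family Y"
      unfolding disjoint_family_on_def
    proof (intro ballI impI)
      fix m n :: nat assume "m \<noteq> n"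
      show "Y m \<inter> Y n = {}"
      proof (cases "m \<in> N0 \<and> n \<in> N0")
        case True
        then have "g m \<noteq> g n" using ginj \<open>m \<noteq> n\<close> by blast
        then show ?thesis using C(3) gC True unfolding pairwise_def disjnt_def Y_def by auto
      qed (auto simp: Y_def)
    qed
    have le: "emeasure lborel (X n) \<le> ennreal (10 / c) * emeasure \<nu> (Y n)" for n
    proof (cases "n \<in> N0")
      case True
      then have gS: "g n \<in> S" using gC C(2) by blast
      have "emeasure lborel (X n) = ennreal (10 * r (g n))"
        using True r(1)[OF gS] by (simp add: X_def cball_eq_atLeastAtMost)
      also have "\<dots> \<le> ennreal ((10 / c) * measure \<nu> (Y n))"
        using r(4)[OF gS] True c by (intro ennreal_leI) (simp add: Y_def field_simps)
      also have "\<dots> = ennreal (10 / c) * emeasure \<nu> (Y n)"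
        unfolding emeasure_eq_measure using c by (intro ennreal_mult') simp
      finally show ?thesis .
    qed (simp add: X_def)
    have Xm: "X n \<in> sets lborel" for n by (simp add: X_def)
    have Ym: "Y n \<in> sets \<nu>" for n using sets by (simp add: Y_def)
    have "emeasure lborel (\<Union>n. X n) \<le> (\<Sum>n. emeasure lborel (X n))"
      using Xm by (intro emeasure_subadditive_countably) auto
    also have "\<dots> \<le> (\<Sum>n. ennreal (10 / c) * emeasure \<nu> (Y n))" by (intro suminf_le le) auto
    also have "\<dots> = ennreal (10 / c) * (\<Sum>n. emeasure \<nu> (Y n))" by (rule ennreal_suminf_cmult)
    also have "(\<Sum>n. emeasure \<nu> (Y n)) = emeasure \<nu> (\<Union>n. Y n)"
      using Ym disj by (intro suminf_emeasure) auto
    also have "\<dots> \<le> emeasure \<nu> U"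
    proof (rule emeasure_mono)
      show "(\<Union>n. Y n) \<subseteq> U" using r(3) gC C(2) by (auto simp: Y_def split: if_splits)
      show "U \<in> sets \<nu>" using U(2) sets by simp
    qed
    also have "\<dots> \<le> ennreal (e * c / 10)" using U(3) by simp
    also have "ennreal (10 / c) * ennreal (e * c / 10) = ennreal e"
      using c e by (simp add: ennreal_mult'[symmetric])
    finally have "emeasure lborel (\<Union>n. X n) \<le> ennreal e" by (simp add: mult_left_mono)
    moreover have "S \<subseteq> (\<Union>n. X n)"
    proof
      fix x assume "x \<in> S"
      then obtain i where i: "i \<in> C" "x \<in> cball i (5 * r i)" using C(4) by blast
      then obtain n where "n \<in> N0" "g n = i" using gsurj by blast
      then show "x \<in> (\<Union>n. X n)" using i by (auto simp: X_def intro!: exI[of _ n])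
    qed
    moreover have "(\<Union>n. X n) \<in> sets lborel" using Xm by blast
    ultimately show ?thesis by blast
  qed
  have "\<exists>T\<in>sets lborel. S \<subseteq> T \<and> emeasure lborel T \<le> ennreal (1 / Suc n)" for n by (rule cover) simp
  then obtain T where T: "\<And>n. T n \<in> sets lborel" "\<And>n. S \<subseteq> T n" "\<And>n. emeasure lborel (T n) \<le> ennreal (1 / Suc n)" by metis
  have "emeasure lborel (\<Inter>n. T n) \<le> ennreal (1 / Suc n)" for n
    by (rule order_trans[OF emeasure_mono T(3)[of n]]) (use T in auto)
  moreover have "(\<lambda>n. ennreal (1 / Suc n)) \<longlonglongrightarrow> ennreal 0"
    using LIMSEQ_inverse_real_of_nat by (intro tendsto_ennrealI) (simp add: inverse_eq_divide)
  ultimately have "emeasure lborel (\<Inter>n. T n) \<le> 0"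
    by (intro LIMSEQ_le_const) auto
  moreover have "(\<Inter>n. T n) \<in> sets lborel" using T(1) by blast
  ultimately have "(\<Inter>n. T n) \<in> null_sets lborel" by (simp add: null_sets_def)
  moreover have "S \<subseteq> (\<Inter>n. T n)" using T(2) by blast
  ultimately show ?thesis unfolding S_def by blast
qed

abbreviation vanishing_density :: "(real \<Rightarrow> real) \<Rightarrow> real \<Rightarrow> bool" where
  "vanishing_density h x \<equiv> \<forall>e>0. \<exists>\<delta>>0. \<forall>r. 0 < r \<and> r < \<delta> \<longrightarrow> (LBINT y. indicator {x-r..x+r} y * h y) \<le> e * r"

text \<open>The measure with density \<open>h\<close> gives no mass to the zero set of
  \<open>h\<close>, so each threshold \<open>1 / Suc n\<close> excludes only a null set of points,
  and countably many thresholds suffice.\<close>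

lemma vanishing_density_AE:
  fixes h :: "real \<Rightarrow> real"
  assumes h: "integrable lborel h" "\<And>x. h x \<ge> 0"
  shows "AE x in lborel. h x = 0 \<longrightarrow> vanishing_density h x"
proof -
  have hm [measurable]: "h \<in> borel_measurable borel" using h by auto
  define \<nu> where "\<nu> = density lborel (\<lambda>x. ennreal (h x))"
  define A where "A = {x. h x = 0}"
  have A: "A \<in> sets borel" unfolding A_def by measurable
  have em: "emeasure \<nu> B = ennreal (LBINT y. indicator B y * h y)" if [measurable]: "B \<in> sets borel" for B
  proof -
    have i: "integrable lborel (\<lambda>y. indicator B y * h y)"
      using integrable_mult_indicator[of B lborel h] h by simp
    have "emeasure \<nu> B = (\<integral>\<^sup>+y. ennreal (h y) * indicator B y \<partial>lborel)"
      unfolding \<nu>_def by (rule emeasure_density) auto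
    also have "\<dots> = (\<integral>\<^sup>+y. ennreal (indicator B y * h y) \<partial>lborel)"
      by (intro nn_integral_cong) (auto simp: indicator_def)
    also have "\<dots> = ennreal (LBINT y. indicator B y * h y)"
      using h i by (intro nn_integral_eq_integral) auto
    finally show ?thesis .
  qed
  have fin: "finite_measure \<nu>"
    by (rule finite_measureI) (use em[of UNIV] in \<open>simp add: \<nu>_def\<close>)
  have sets: "sets \<nu> = sets borel" by (simp add: \<nu>_def)
  have me: "measure \<nu> (cball x r) = (LBINT y. indicator {x-r..x+r} y * h y)" for x r
    using em[of "cball x r"] h(2) by (simp add: measure_def cball_eq_atLeastAtMost Bochner_Integration.integral_nonneg)
  have "emeasure \<nu> A = 0"
  proof -
    have "indicator A y * h y = 0" for y by (simp add: A_def indicator_def)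
    then show ?thesis unfolding em[OF A] by (simp only: Bochner_Integration.integral_zero ennreal_0)
  qed
  then have "\<exists>N\<in>null_sets lborel. {x\<in>A. \<forall>\<delta>>0. \<exists>r. 0 < r \<and> r < \<delta> \<and> measure \<nu> (cball x r) > (1 / Suc n) * r} \<subseteq> N" for n
    by (intro Vitali_concentration_null fin sets A) auto
  then have "\<forall>n. \<exists>N. N \<in> null_sets lborel \<and> {x\<in>A. \<forall>\<delta>>0. \<exists>r. 0 < r \<and> r < \<delta> \<and> measure \<nu> (cball x r) > (1 / Suc n) * r} \<subseteq> N"
    by blast
  from choice[OF this] obtain N where N: "\<And>n. N n \<in> null_sets lborel"
    "\<And>n. {x\<in>A. \<forall>\<delta>>0. \<exists>r. 0 < r \<and> r < \<delta> \<and> measure \<nu> (cball x r) > (1 / Suc n) * r} \<subseteq> N n" by blast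
  have "AE x in lborel. \<forall>n. x \<notin> N n"
    using N(1) by (intro AE_all_countable[THEN iffD2] allI AE_not_in)
  then show ?thesis
  proof eventually_elim
    fix x assume x: "\<forall>n. x \<notin> N n"
    show "h x = 0 \<longrightarrow> vanishing_density h x"
    proof (intro impI allI)
      fix e :: real assume hx: "h x = 0" and e: "e > 0"
      obtain n where n: "1 / real (Suc n) < e" using e nat_approx_posE by blast
      have "\<not> (\<forall>\<delta>>0. \<exists>r. 0 < r \<and> r < \<delta> \<and> measure \<nu> (cball x r) > (1 / Suc n) * r)"
        using N(2)[of n] x hx unfolding A_def by blast
      then obtain \<delta> where d: "\<delta> > 0" "\<And>r. 0 < r \<Longrightarrow> r < \<delta> \<Longrightarrow> measure \<nu> (cball x r) \<le> (1 / Suc n) * r"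
        unfolding not_all not_ex not_imp de_Morgan_conj not_less by (meson not_le)
      show "\<exists>\<delta>>0. \<forall>r. 0 < r \<and> r < \<delta> \<longrightarrow> (LBINT y. indicator {x-r..x+r} y * h y) \<le> e * r"
      proof (intro exI[of _ \<delta>] conjI allI impI d(1))
        fix r assume r: "0 < r \<and> r < \<delta>"
        have "measure \<nu> (cball x r) \<le> (1 / Suc n) * r" using d(2) r by blast
        also have "\<dots> \<le> e * r" using n r by (intro mult_right_mono) auto
        finally show "(LBINT y. indicator {x-r..x+r} y * h y) \<le> e * r" by (simp add: me)
      qed
    qed
  qed
qed

text \<open>For rational \<open>q\<close> the excesses of \<open>f\<close> above and below
  \<open>q\<close> are non-negative and vanish where \<open>f\<close> lies on the other side of
  \<open>q\<close>, so the previous lemma applies to countably many functions at once. Rationals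
  just above and just below \<open>f x\<close> then trap the oscillation of \<open>f\<close> at
  \<open>x\<close>.\<close>

lemma Lebesgue_point_real:
  fixes f :: "real \<Rightarrow> real"
  assumes f: "integrable lborel f"
  shows "AE x in lborel. x \<in> {a<..<b} \<longrightarrow> vanishing_density (\<lambda>y. \<bar>f y - f x\<bar>) x"
proof -
  have [measurable]: "f \<in> borel_measurable borel" using f by auto
  \<comment> \<open>Restriction to \<open>{a..b}\<close> is what makes the constant part
    integrable.\<close>
  define hp where "hp q y = indicator {a..b} y * max 0 (f y - real_of_rat q)" for q y
  define hm where "hm q y = indicator {a..b} y * max 0 (real_of_rat q - f y)" for q y
  have ic: "integrable lborel (\<lambda>y. indicator {a..b} y * c)" for c :: real
    by (intro integrable_mult_left integrable_real_indicator) (auto simp: emeasure_lborel_Icc_eq)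
  have ihp: "integrable lborel (hp q)" for q
  proof (rule Bochner_Integration.integrable_bound)
    show "integrable lborel (\<lambda>y. \<bar>f y\<bar> + indicator {a..b} y * \<bar>real_of_rat q\<bar>)"
      by (intro Bochner_Integration.integrable_add integrable_abs f ic)
    show "hp q \<in> borel_measurable lborel" unfolding hp_def by measurable
    show "AE y in lborel. norm (hp q y) \<le> norm (\<bar>f y\<bar> + indicator {a..b} y * \<bar>real_of_rat q\<bar>)"
    proof (rule AE_I2)
      fix y
      have "norm (hp q y) \<le> \<bar>f y\<bar> + indicator {a..b} y * \<bar>real_of_rat q\<bar>"
        unfolding hp_def by (cases "y \<in> {a..b}") (auto simp del: abs_of_rat)
      then show "norm (hp q y) \<le> norm (\<bar>f y\<bar> + indicator {a..b} y * \<bar>real_of_rat q\<bar>)" by simp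
    qed
  qed
  have ihm: "integrable lborel (hm q)" for q
  proof (rule Bochner_Integration.integrable_bound)
    show "integrable lborel (\<lambda>y. \<bar>f y\<bar> + indicator {a..b} y * \<bar>real_of_rat q\<bar>)"
      by (intro Bochner_Integration.integrable_add integrable_abs f ic)
    show "hm q \<in> borel_measurable lborel" unfolding hm_def by measurable
    show "AE y in lborel. norm (hm q y) \<le> norm (\<bar>f y\<bar> + indicator {a..b} y * \<bar>real_of_rat q\<bar>)"
    proof (rule AE_I2)
      fix y
      have "norm (hm q y) \<le> \<bar>f y\<bar> + indicator {a..b} y * \<bar>real_of_rat q\<bar>"
        unfolding hm_def by (cases "y \<in> {a..b}") (auto simp del: abs_of_rat)
      then show "norm (hm q y) \<le> norm (\<bar>f y\<bar> + indicator {a..b} y * \<bar>real_of_rat q\<bar>)" by simp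
    qed
  qed
  have "AE x in lborel. \<forall>q. hp q x = 0 \<longrightarrow> vanishing_density (hp q) x"
    by (intro AE_all_countable[THEN iffD2] allI vanishing_density_AE ihp) (auto simp: hp_def)
  moreover have "AE x in lborel. \<forall>q. hm q x = 0 \<longrightarrow> vanishing_density (hm q) x"
    by (intro AE_all_countable[THEN iffD2] allI vanishing_density_AE ihm) (auto simp: hm_def)
  ultimately show ?thesis
  proof eventually_elim
    fix x
    assume P: "\<forall>q. hp q x = 0 \<longrightarrow> vanishing_density (hp q) x"
      and M: "\<forall>q. hm q x = 0 \<longrightarrow> vanishing_density (hm q) x"
    show "x \<in> {a<..<b} \<longrightarrow> vanishing_density (\<lambda>y. \<bar>f y - f x\<bar>) x"
    proof (intro impI allI)
      fix e :: real assume x: "x \<in> {a<..<b}" and e: "e > 0"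
      \<comment> \<open>Each excess costs \<open>d * r\<close> and the constant costs
        \<open>2 * r * d\<close>, four quarters in all.\<close>
      define d where "d = e / 4"
      have d: "d > 0" using e by (simp add: d_def)
      obtain q1 where q1: "f x < real_of_rat q1" "real_of_rat q1 < f x + d" using of_rat_dense[of "f x" "f x + d"] d by auto
      obtain q2 where q2: "f x - d < real_of_rat q2" "real_of_rat q2 < f x" using of_rat_dense[of "f x - d" "f x"] d by auto
      have "hp q1 x = 0" "hm q2 x = 0" using q1 q2 by (auto simp: hp_def hm_def)
      then obtain \<delta>1 \<delta>2 where
        d1: "\<delta>1 > 0" "\<And>r. 0 < r \<Longrightarrow> r < \<delta>1 \<Longrightarrow> (LBINT y. indicator {x-r..x+r} y * hp q1 y) \<le> d * r" and
        d2: "\<delta>2 > 0" "\<And>r. 0 < r \<Longrightarrow> r < \<delta>2 \<Longrightarrow> (LBINT y. indicator {x-r..x+r} y * hm q2 y) \<le> d * r"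
        using P[rule_format, of q1 d] M[rule_format, of q2 d] d by blast
      define \<delta> where "\<delta> = min (min \<delta>1 \<delta>2) (min (x - a) (b - x))"
      have "\<delta> > 0" using d1 d2 x by (auto simp: \<delta>_def)
      moreover have "(LBINT y. indicator {x-r..x+r} y * \<bar>f y - f x\<bar>) \<le> e * r" if r: "0 < r" "r < \<delta>" for r
      proof -
        have im: "integrable lborel (\<lambda>y. indicator {x-r..x+r} y * g y)" if "integrable lborel g" for g :: "real \<Rightarrow> real"
          using integrable_mult_indicator[of "{x-r..x+r}" lborel g] that by simp
        have ir: "integrable lborel (\<lambda>y. indicator {x-r..x+r} y * c)" for c :: real
          by (intro integrable_mult_left integrable_real_indicator) (auto simp: emeasure_lborel_Icc_eq)
        have "(LBINT y. indicator {x-r..x+r} y * \<bar>f y - f x\<bar>)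
           \<le> (LBINT y. indicator {x-r..x+r} y * hp q1 y + indicator {x-r..x+r} y * hm q2 y + indicator {x-r..x+r} y * d)"
        proof (rule integral_mono_AE')
          show "integrable lborel (\<lambda>y. indicator {x-r..x+r} y * hp q1 y + indicator {x-r..x+r} y * hm q2 y + indicator {x-r..x+r} y * d)"
            by (intro Bochner_Integration.integrable_add im ihp ihm ir)
          show "AE y in lborel. indicator {x-r..x+r} y * \<bar>f y - f x\<bar> \<le>
              indicator {x-r..x+r} y * hp q1 y + indicator {x-r..x+r} y * hm q2 y + indicator {x-r..x+r} y * d"
          proof (intro AE_I2)
            fix y
            show "indicator {x-r..x+r} y * \<bar>f y - f x\<bar> \<le>
              indicator {x-r..x+r} y * hp q1 y + indicator {x-r..x+r} y * hm q2 y + indicator {x-r..x+r} y * d"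
            proof (cases "y \<in> {x-r..x+r}")
              case True
              then have "y \<in> {a..b}" using r by (auto simp: \<delta>_def)
              then show ?thesis using True q1 q2 by (simp add: hp_def hm_def)
            qed simp
          qed
          show "AE y in lborel. 0 \<le> indicator {x-r..x+r} y * hp q1 y + indicator {x-r..x+r} y * hm q2 y + indicator {x-r..x+r} y * d"
            using d by (intro AE_I2) (auto simp: hp_def hm_def indicator_def)
        qed
        also have "\<dots> = (LBINT y. indicator {x-r..x+r} y * hp q1 y) + (LBINT y. indicator {x-r..x+r} y * hm q2 y)
           + (LBINT y. indicator {x-r..x+r} y * d)"
          using im[OF ihp[of q1]] im[OF ihm[of q2]] ir[of d] by simp
        also have "(LBINT y. indicator {x-r..x+r} y * d) = 2 * r * d" using r by simp
        also have "(LBINT y. indicator {x-r..x+r} y * hp q1 y) \<le> d * r" using d1(2) r by (auto simp: \<delta>_def)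
        also have "(LBINT y. indicator {x-r..x+r} y * hm q2 y) \<le> d * r" using d2(2) r by (auto simp: \<delta>_def)
        finally show ?thesis by (simp add: d_def)
      qed
      ultimately show "\<exists>\<delta>>0. \<forall>r. 0 < r \<and> r < \<delta> \<longrightarrow> (LBINT y. indicator {x-r..x+r} y * \<bar>f y - f x\<bar>) \<le> e * r"
        by blast
    qed
  qed
qed

lemma Lebesgue_point:
  fixes f :: "real \<Rightarrow> 'b::euclidean_space"
  assumes f: "integrable lborel f"
  shows "AE x in lborel. x \<in> {a<..<b} \<longrightarrow> vanishing_density (\<lambda>y. norm (f y - f x)) x"
proof -
  have fm [measurable]: "f \<in> borel_measurable borel" using f by auto
  have "AE x in lborel. x \<in> {a<..<b} \<longrightarrow> vanishing_density (\<lambda>y. \<bar>f y \<bullet> i - f x \<bullet> i\<bar>) x" for i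
    using f by (intro Lebesgue_point_real integrable_inner_left)
  then have "AE x in lborel. \<forall>i\<in>Basis. x \<in> {a<..<b} \<longrightarrow> vanishing_density (\<lambda>y. \<bar>f y \<bullet> i - f x \<bullet> i\<bar>) x"
    by (subst AE_finite_all) auto
  then show ?thesis
  proof eventually_elim
    fix x assume H: "\<forall>i\<in>Basis. x \<in> {a<..<b} \<longrightarrow> vanishing_density (\<lambda>y. \<bar>f y \<bullet> i - f x \<bullet> i\<bar>) x"
    show "x \<in> {a<..<b} \<longrightarrow> vanishing_density (\<lambda>y. norm (f y - f x)) x"
    proof (intro impI allI)
      fix e :: real assume x: "x \<in> {a<..<b}" and e: "e > 0"
      define d where "d = e / DIM('b)"
      have "d > 0" using e by (simp add: d_def)
      then have "\<forall>i\<in>Basis. \<exists>\<delta>>0. \<forall>r. 0 < r \<and> r < \<delta> \<longrightarrow> (LBINT y. indicator {x-r..x+r} y * \<bar>f y \<bullet> i - f x \<bullet> i\<bar>) \<le> d * r"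
        using H x by blast
      from bchoice[OF this] obtain D where D: "\<And>i. i \<in> Basis \<Longrightarrow> D i > 0"
        "\<And>i r. i \<in> Basis \<Longrightarrow> 0 < r \<Longrightarrow> r < D i \<Longrightarrow> (LBINT y. indicator {x-r..x+r} y * \<bar>f y \<bullet> i - f x \<bullet> i\<bar>) \<le> d * r"
        by blast
      define \<delta> where "\<delta> = Min (D ` Basis)"
      have "\<delta> > 0" using D(1) by (auto simp: \<delta>_def Min_gr_iff)
      moreover have "(LBINT y. indicator {x-r..x+r} y * norm (f y - f x)) \<le> e * r" if r: "0 < r" "r < \<delta>" for r
      proof -
        have rD: "r < D i" if "i \<in> Basis" for i using r that by (simp add: \<delta>_def Min_gr_iff)
        have im: "integrable lborel (\<lambda>y. indicator {x-r..x+r} y * \<bar>f y \<bullet> i - f x \<bullet> i\<bar>)" for i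
        proof -
          have c: "integrable lborel (\<lambda>y. indicator {x-r..x+r} y *\<^sub>R (f x \<bullet> i))"
            by (intro integrable_scaleR_left integrable_real_indicator) (auto simp: emeasure_lborel_Icc_eq)
          have "integrable lborel (\<lambda>y. \<bar>indicator {x-r..x+r} y *\<^sub>R (f y \<bullet> i) - indicator {x-r..x+r} y *\<^sub>R (f x \<bullet> i)\<bar>)"
            using f by (intro integrable_abs Bochner_Integration.integrable_diff c integrable_mult_indicator integrable_inner_left) auto
          moreover have "\<bar>indicator {x-r..x+r} y *\<^sub>R (f y \<bullet> i) - indicator {x-r..x+r} y *\<^sub>R (f x \<bullet> i)\<bar> = indicator {x-r..x+r} y * \<bar>f y \<bullet> i - f x \<bullet> i\<bar>" for y
            by (simp add: indicator_def)
          ultimately show ?thesis by simp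
        qed
        have "(LBINT y. indicator {x-r..x+r} y * norm (f y - f x))
          \<le> (LBINT y. (\<Sum>i\<in>Basis. indicator {x-r..x+r} y * \<bar>f y \<bullet> i - f x \<bullet> i\<bar>))"
        proof (rule integral_mono_AE')
          show "integrable lborel (\<lambda>y. \<Sum>i\<in>Basis. indicator {x-r..x+r} y * \<bar>f y \<bullet> i - f x \<bullet> i\<bar>)"
            by (intro Bochner_Integration.integrable_sum im)
          show "AE y in lborel. indicator {x-r..x+r} y * norm (f y - f x) \<le> (\<Sum>i\<in>Basis. indicator {x-r..x+r} y * \<bar>f y \<bullet> i - f x \<bullet> i\<bar>)"
            using norm_le_l1 by (intro AE_I2) (auto simp: indicator_def inner_diff_left[symmetric])
        qed (auto intro!: sum_nonneg)
        also have "\<dots> = (\<Sum>i\<in>Basis. (LBINT y. indicator {x-r..x+r} y * \<bar>f y \<bullet> i - f x \<bullet> i\<bar>))"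
          by (rule Bochner_Integration.integral_sum) (rule im)
        also have "\<dots> \<le> (\<Sum>i\<in>(Basis::'b set). d * r)"
          using D(2) rD r by (intro sum_mono) auto
        also have "\<dots> = e * r" by (simp add: d_def)
        finally show ?thesis .
      qed
      ultimately show "\<exists>\<delta>>0. \<forall>r. 0 < r \<and> r < \<delta> \<longrightarrow> (LBINT y. indicator {x-r..x+r} y * norm (f y - f x)) \<le> e * r"
        by blast
    qed
  qed
qed

subsection \<open>The Poincare inequality on a square\<close>

abbreviation lborel_on :: "'a::euclidean_space set \<Rightarrow> 'a measure" where
  "lborel_on U \<equiv> restrict_space lborel U"

lemma L2_iff_sqint: "U \<in> sets borel \<Longrightarrow> f \<in> L2 U \<longleftrightarrow> sqint (lborel_on U) f"
  by (simp add: L2_def sqint_def set_borel_measurable_def set_integrable_def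
      borel_measurable_restrict_space_iff integrable_restrict_space)

lemma set_integral_lborel_on: "U \<in> sets borel \<Longrightarrow> (LBINT x:U. f x) = integral\<^sup>L (lborel_on U) f"
  for f :: "_ \<Rightarrow> 'b::euclidean_space"
  by (simp add: set_lebesgue_integral_def integral_restrict_space)

lemma set_integrable_lborel_on: "U \<in> sets borel \<Longrightarrow> set_integrable lborel U f \<longleftrightarrow> integrable (lborel_on U) f"
  for f :: "_ \<Rightarrow> 'b::euclidean_space"
  by (simp add: set_integrable_def integrable_restrict_space)

lemma AE_lborel_on: "U \<in> sets borel \<Longrightarrow> (AE x in lborel_on U. P x) \<longleftrightarrow> (AE x in lborel. x \<in> U \<longrightarrow> P x)"
  by (simp add: AE_restrict_space_iff)

lemma sqint_lborel_on:
  "U \<in> sets borel \<Longrightarrow> sqint (lborel_on U) f \<longleftrightarrow> sqint lborel (\<lambda>x. indicator U x *\<^sub>R f x)"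
proof -
  have "(norm (indicator U x *\<^sub>R f x))\<^sup>2 = indicator U x *\<^sub>R (norm (f x))\<^sup>2" for x
    by (simp add: indicator_def)
  then show "U \<in> sets borel \<Longrightarrow> ?thesis"
    unfolding sqint_def by (simp only:) (simp add: borel_measurable_restrict_space_iff integrable_restrict_space)
qed

lemma nsq_lborel_on:
  "U \<in> sets borel \<Longrightarrow> nsq (lborel_on U) f = nsq lborel (\<lambda>x. indicator U x *\<^sub>R f x)"
proof -
  have "(norm (indicator U x *\<^sub>R f x))\<^sup>2 = indicator U x *\<^sub>R (norm (f x))\<^sup>2" for x
    by (simp add: indicator_def)
  then show "U \<in> sets borel \<Longrightarrow> ?thesis"
    unfolding nsq_def by (simp only:) (simp add: integral_restrict_space)
qed

lemma sqint_integrable_finite: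
  assumes "sqint M f" "finite_measure M" shows "integrable M f"
proof (rule Bochner_Integration.integrable_bound)
  interpret finite_measure M by fact
  show "integrable M (\<lambda>x. (norm (f x))\<^sup>2 + 1)" using assms(1) by (auto simp: sqint_def)
  show "f \<in> borel_measurable M" using assms(1) by auto
  show "AE x in M. norm (f x) \<le> norm ((norm (f x))\<^sup>2 + 1)"
  proof (rule AE_I2)
    fix x
    have "0 \<le> (norm (f x) - 1)\<^sup>2" by simp
    then have "2 * norm (f x) \<le> (norm (f x))\<^sup>2 + 1" by (simp add: power2_diff)
    then have "norm (f x) \<le> (norm (f x))\<^sup>2 + 1" using norm_ge_zero[of "f x"] by linarith
    then show "norm (f x) \<le> norm ((norm (f x))\<^sup>2 + 1)" by simp
  qed
qed

lemma integral_norm_Cauchy_Schwarz: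
  assumes "sqint M f" "finite_measure M"
  shows "(\<integral>x. norm (f x) \<partial>M)\<^sup>2 \<le> measure M (space M) * nsq M f"
proof -
  interpret finite_measure M by fact
  have "sqint M (\<lambda>x. norm (f x))" "sqint M (\<lambda>x. 1::real)" using assms(1) by (auto simp: sqint_def)
  from ip_Cauchy_Schwarz[OF this] show ?thesis by (simp add: ip_def nsq_def mult.commute)
qed

lemma finite_measure_lborel_on: "bounded U \<Longrightarrow> U \<in> sets borel \<Longrightarrow> finite_measure (lborel_on U)"
  using emeasure_bounded_finite[of U] by (intro finite_measureI) (auto simp: emeasure_restrict_space space_restrict_space)

lemma has_weak_derivD:
  "has_weak_deriv U v f g \<Longrightarrow> test_fun U \<phi> \<Longrightarrow>
    (LBINT x:U. dir_deriv v \<phi> x *\<^sub>R f x) = - (LBINT x:U. \<phi> x *\<^sub>R g x)"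
  by (simp add: has_weak_deriv_def)

text \<open>Two values of a primitive differ by at most the integral of \<open>norm h\<close> over
  the interval, whose square is at most \<open>s * N\<close> by Cauchy-Schwarz; the integrations
  over both points contribute \<open>s\<close> each.\<close>

lemma oscillation_on_line:
  fixes f h :: "real \<Rightarrow> 'b::euclidean_space"
  assumes s: "s > 0" and h: "integrable lborel h"
    and f: "AE t in lborel. t \<in> {q<..<q+s} \<longrightarrow> f t = c + (LBINT r:{q<..<t}. h r)"
  shows "(\<integral>\<^sup>+x. \<integral>\<^sup>+y. indicator {q<..<q+s} x * indicator {q<..<q+s} y * ennreal ((norm (f x - f y))\<^sup>2) \<partial>lborel \<partial>lborel)
     \<le> ennreal (s^3) * (\<integral>\<^sup>+t. ennreal ((norm (h t))\<^sup>2) \<partial>lborel)"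
proof (cases "(\<integral>\<^sup>+t. ennreal ((norm (h t))\<^sup>2) \<partial>lborel) = \<infinity>")
  case True
  have "ennreal (s^3) \<noteq> 0" using s by simp
  then show ?thesis using True by (simp add: ennreal_mult_top)
next
  case False
  define K where "K = {q<..<q+s}"
  have Km [measurable, simp]: "K \<in> sets borel" by (simp add: K_def)
  have [measurable]: "h \<in> borel_measurable borel" using h by auto
  define N where "N = enn2real (\<integral>\<^sup>+t. ennreal ((norm (h t))\<^sup>2) \<partial>lborel)"
  have N: "(\<integral>\<^sup>+t. ennreal ((norm (h t))\<^sup>2) \<partial>lborel) = ennreal N" "0 \<le> N"
    using False by (simp_all add: N_def ennreal_enn2real_if)
  have sq: "sqint lborel h" "nsq lborel h \<le> N"
    using sqintI_nn_integral[of h lborel N] N by auto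
  have fin: "finite_measure (lborel_on K)" by (intro finite_measure_lborel_on) (auto simp: K_def)
  have mK: "measure (lborel_on K) (space (lborel_on K)) = s"
    using s by (simp add: space_restrict_space measure_restrict_space K_def)
  have sqK: "sqint (lborel_on K) h"
    using integrable_mult_indicator[of K lborel "\<lambda>x. (norm (h x))\<^sup>2"] sqint_integrable[OF sq(1)]
    by (auto simp: sqint_def integrable_restrict_space K_def intro: measurable_restrict_space1)
  have nK: "nsq (lborel_on K) h \<le> N"
  proof -
    have "nsq (lborel_on K) h = (LBINT x. indicator K x *\<^sub>R (norm (h x))\<^sup>2)"
      unfolding nsq_def by (simp add: integral_restrict_space K_def)
    also have "\<dots> \<le> nsq lborel h" unfolding nsq_def
      using sqint_integrable[OF sq(1)]
      by (intro integral_mono integrable_mult_indicator) (auto simp: indicator_def K_def)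
    finally show ?thesis using sq(2) by simp
  qed
  define D where "D = (\<integral>x. norm (h x) \<partial>lborel_on K)"
  have D2: "D\<^sup>2 \<le> s * N"
    using integral_norm_Cauchy_Schwarz[OF sqK fin] nK s unfolding mK D_def
    by (meson mult_left_mono less_imp_le order_trans)
  have Dl: "D = (LBINT x. indicator K x *\<^sub>R norm (h x))"
    unfolding D_def by (simp add: integral_restrict_space K_def)
  have bd: "norm (f x - f y) \<le> D"
    if "x \<in> K" "y \<in> K" "f x = c + (LBINT r:{q<..<x}. h r)" "f y = c + (LBINT r:{q<..<y}. h r)" for x y
  proof -
    have i: "integrable lborel (\<lambda>t. indicator {q<..<z} t *\<^sub>R h t)" for z using h by (intro integrable_mult_indicator) auto
    have "f x - f y = (LBINT t. indicator {q<..<x} t *\<^sub>R h t - indicator {q<..<y} t *\<^sub>R h t)"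
      using that i unfolding set_lebesgue_integral_def by simp
    also have "norm \<dots> \<le> (LBINT t. indicator K t *\<^sub>R norm (h t))"
    proof (rule order_trans[OF integral_norm_bound], rule integral_mono)
      show "integrable lborel (\<lambda>t. norm (indicator {q<..<x} t *\<^sub>R h t - indicator {q<..<y} t *\<^sub>R h t))"
        by (intro integrable_norm Bochner_Integration.integrable_diff i)
      show "integrable lborel (\<lambda>t. indicator K t *\<^sub>R norm (h t))"
        using h by (intro integrable_mult_indicator integrable_norm) (auto simp: K_def)
      show "norm (indicator {q<..<x} t *\<^sub>R h t - indicator {q<..<y} t *\<^sub>R h t) \<le> indicator K t *\<^sub>R norm (h t)" for t
        using that(1,2) by (auto simp: indicator_def K_def)
    qed
    finally show ?thesis by (simp add: Dl)
  qed
  have ineq: "AE x in lborel. AE y in lborel. indicator K x * indicator K y * ennreal ((norm (f x - f y))\<^sup>2)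
      \<le> indicator K x * indicator K y * ennreal (s * N)"
    using f
  proof eventually_elim
    fix x assume x: "x \<in> {q<..<q+s} \<longrightarrow> f x = c + (LBINT r:{q<..<x}. h r)"
    show "AE y in lborel. indicator K x * indicator K y * ennreal ((norm (f x - f y))\<^sup>2)
      \<le> indicator K x * indicator K y * ennreal (s * N)"
      using f
    proof eventually_elim
      fix y assume y: "y \<in> {q<..<q+s} \<longrightarrow> f y = c + (LBINT r:{q<..<y}. h r)"
      show "indicator K x * indicator K y * ennreal ((norm (f x - f y))\<^sup>2)
        \<le> indicator K x * indicator K y * ennreal (s * N)"
      proof (cases "x \<in> K \<and> y \<in> K")
        case True
        then have "norm (f x - f y) \<le> D" using bd x y by (simp add: K_def)
        then have "(norm (f x - f y))\<^sup>2 \<le> D\<^sup>2" by (intro power_mono) auto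
        then show ?thesis using D2 True by (simp add: ennreal_leI)
      qed (auto simp: indicator_def)
    qed
  qed
  have eK: "(\<integral>\<^sup>+y. indicator K y \<partial>lborel) = ennreal s" using s by (simp add: K_def)
  have "(\<integral>\<^sup>+x. \<integral>\<^sup>+y. indicator K x * indicator K y * ennreal ((norm (f x - f y))\<^sup>2) \<partial>lborel \<partial>lborel)
     \<le> (\<integral>\<^sup>+x. \<integral>\<^sup>+y. indicator K x * indicator K y * ennreal (s * N) \<partial>lborel \<partial>lborel)"
    using ineq by (intro nn_integral_mono_AE) (auto elim!: eventually_mono intro: nn_integral_mono_AE)
  also have "\<dots> = (\<integral>\<^sup>+x. indicator K x * (ennreal s * ennreal (s * N)) \<partial>lborel)"
  proof (rule nn_integral_cong)
    fix x
    have "(\<integral>\<^sup>+y. indicator K x * indicator K y * ennreal (s * N) \<partial>lborel)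
       = (\<integral>\<^sup>+y. indicator K y * (indicator K x * ennreal (s * N)) \<partial>lborel)"
      by (intro nn_integral_cong) (simp add: ac_simps)
    also have "\<dots> = ennreal s * (indicator K x * ennreal (s * N))"
      by (subst nn_integral_multc) (auto simp: eK)
    finally show "(\<integral>\<^sup>+y. indicator K x * indicator K y * ennreal (s * N) \<partial>lborel) = indicator K x * (ennreal s * ennreal (s * N))"
      by (simp add: ac_simps)
  qed
  also have "\<dots> = ennreal s * (ennreal s * ennreal (s * N))"
    by (subst nn_integral_multc) (auto simp: eK)
  also have "\<dots> = ennreal (s^3) * ennreal N"
    using s N(2) by (simp add: ennreal_mult'[symmetric] power3_eq_cube mult.assoc)
  finally show ?thesis unfolding N K_def .
qed

lemma vertical_oscillation:
  fixes u g :: "plane \<Rightarrow> 'b::euclidean_space"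
  assumes s: "s > 0" and u: "integrable lborel u" and g: "integrable lborel g"
    and wd: "\<And>\<phi> \<eta>. test_fun {a<..<b} \<phi> \<Longrightarrow> test_fun {q<..<q+s} \<eta> \<Longrightarrow>
       (LBINT x:{a<..<b} \<times> {q<..<q+s}. (\<phi> (fst x) * dir_deriv 1 \<eta> (snd x)) *\<^sub>R u x) =
       - (LBINT x:{a<..<b} \<times> {q<..<q+s}. (\<phi> (fst x) * \<eta> (snd x)) *\<^sub>R g x)"
  shows "(\<integral>\<^sup>+z. \<integral>\<^sup>+x. \<integral>\<^sup>+y. indicator {a<..<b} z * (indicator {q<..<q+s} x * indicator {q<..<q+s} y * ennreal ((norm (u (z, x) - u (z, y)))\<^sup>2)) \<partial>lborel \<partial>lborel \<partial>lborel)
     \<le> ennreal (s^3) * (\<integral>\<^sup>+x. ennreal ((norm (g x))\<^sup>2) \<partial>lborel)"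
proof -
  have [measurable]: "u \<in> borel_measurable borel" "g \<in> borel_measurable borel" using u g by auto
  have Rm: "{a<..<b} \<times> {q<..<q+s} \<in> sets (borel :: plane measure)"
    by (intro borel_open open_Times) auto
  have i: "set_integrable lborel ({a<..<b} \<times> {q<..<q+s}) u" "set_integrable lborel ({a<..<b} \<times> {q<..<q+s}) g"
    unfolding set_integrable_def using Rm u g by (auto intro: integrable_mult_indicator)
  have "q < q + s" using s by simp
  from absolutely_continuous_vertical[OF this i wd]
  obtain w where w: "AE x in lborel. x \<in> {a<..<b} \<times> {q<..<q+s} \<longrightarrow> u x = w (fst x) + (LBINT t:{q<..<snd x}. g (fst x, t))"
    by blast
  then have "AE x in lborel \<Otimes>\<^sub>M lborel. x \<in> {a<..<b} \<times> {q<..<q+s} \<longrightarrow> u x = w (fst x) + (LBINT t:{q<..<snd x}. g (fst x, t))"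
    unfolding lborel_prod .
  then have "AE z in lborel. AE t in lborel. (z, t) \<in> {a<..<b} \<times> {q<..<q+s} \<longrightarrow> u (z, t) = w z + (LBINT r:{q<..<t}. g (z, r))"
    using lborel_pair.AE_pair by fastforce
  moreover have "AE z in lborel. integrable lborel (\<lambda>t. g (z, t))" by (rule plane_integral_iterated(3)[OF g])
  ultimately have "AE z in lborel.
      (\<integral>\<^sup>+x. \<integral>\<^sup>+y. indicator {a<..<b} z * (indicator {q<..<q+s} x * indicator {q<..<q+s} y * ennreal ((norm (u (z, x) - u (z, y)))\<^sup>2)) \<partial>lborel \<partial>lborel)
      \<le> ennreal (s^3) * (\<integral>\<^sup>+t. ennreal ((norm (g (z, t)))\<^sup>2) \<partial>lborel)"
  proof eventually_elim
    fix z assume 1: "AE t in lborel. (z, t) \<in> {a<..<b} \<times> {q<..<q+s} \<longrightarrow> u (z, t) = w z + (LBINT r:{q<..<t}. g (z, r))"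
      and 2: "integrable lborel (\<lambda>t. g (z, t))"
    show "(\<integral>\<^sup>+x. \<integral>\<^sup>+y. indicator {a<..<b} z * (indicator {q<..<q+s} x * indicator {q<..<q+s} y * ennreal ((norm (u (z, x) - u (z, y)))\<^sup>2)) \<partial>lborel \<partial>lborel)
      \<le> ennreal (s^3) * (\<integral>\<^sup>+t. ennreal ((norm (g (z, t)))\<^sup>2) \<partial>lborel)"
    proof (cases "z \<in> {a<..<b}")
      case True
      with 1 have "AE t in lborel. t \<in> {q<..<q+s} \<longrightarrow> u (z, t) = w z + (LBINT r:{q<..<t}. g (z, r))" by simp
      from oscillation_on_line[OF s 2 this] True show ?thesis by simp
    qed simp
  qed
  then have "(\<integral>\<^sup>+z. \<integral>\<^sup>+x. \<integral>\<^sup>+y. indicator {a<..<b} z * (indicator {q<..<q+s} x * indicator {q<..<q+s} y * ennreal ((norm (u (z, x) - u (z, y)))\<^sup>2)) \<partial>lborel \<partial>lborel \<partial>lborel)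
     \<le> (\<integral>\<^sup>+z. ennreal (s^3) * (\<integral>\<^sup>+t. ennreal ((norm (g (z, t)))\<^sup>2) \<partial>lborel) \<partial>lborel)"
    by (rule nn_integral_mono_AE)
  also have "\<dots> = ennreal (s^3) * (\<integral>\<^sup>+z. (\<integral>\<^sup>+t. ennreal ((norm (g (z, t)))\<^sup>2) \<partial>lborel) \<partial>lborel)"
    by (rule nn_integral_cmult) measurable
  also have "(\<integral>\<^sup>+z. (\<integral>\<^sup>+t. ennreal ((norm (g (z, t)))\<^sup>2) \<partial>lborel) \<partial>lborel) = (\<integral>\<^sup>+x. ennreal ((norm (g x))\<^sup>2) \<partial>lborel)"
    by (subst lborel.nn_integral_fst) (simp_all add: lborel_prod)
  finally show ?thesis .
qed

lemma plane_swap: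
  fixes f :: "plane \<Rightarrow> 'b::euclidean_space"
  shows "integrable lborel f \<Longrightarrow> integrable lborel (\<lambda>x. f (snd x, fst x))"
    and "f \<in> borel_measurable borel \<Longrightarrow> (LBINT x. f (snd x, fst x)) = (LBINT x. f x)"
  using lborel_pair.integrable_product_swap[of f] lborel_pair.integral_product_swap[of f]
  by (simp_all add: lborel_prod case_prod_beta')

lemma plane_nn_integral_swap:
  fixes f :: "plane \<Rightarrow> ennreal"
  assumes [measurable]: "f \<in> borel_measurable borel"
  shows "(\<integral>\<^sup>+x. f (snd x, fst x) \<partial>lborel) = (\<integral>\<^sup>+x. f x \<partial>lborel)"
proof -
  have "(\<integral>\<^sup>+x. f (snd x, fst x) \<partial>lborel) = (\<integral>\<^sup>+s. \<integral>\<^sup>+t. f (t, s) \<partial>lborel \<partial>lborel)"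
    using lborel.nn_integral_fst[of "\<lambda>x. f (snd x, fst x)" lborel] by (simp add: lborel_prod)
  also have "\<dots> = (\<integral>\<^sup>+t. \<integral>\<^sup>+s. f (t, s) \<partial>lborel \<partial>lborel)"
    by (rule lborel_pair.Fubini') (simp add: lborel_prod)
  also have "\<dots> = (\<integral>\<^sup>+x. f x \<partial>lborel)"
    by (subst lborel.nn_integral_fst) (simp_all add: lborel_prod)
  finally show ?thesis .
qed

text \<open>Pass from \<open>(x1, x2)\<close> to \<open>(y1, y2)\<close> through the corner
  \<open>(x1, y2)\<close>. Each leg is a one-dimensional oscillation costing \<open>s^3\<close>, the
  coordinate it does not involve adds a factor \<open>s\<close>, and splitting the square of the sum
  costs the factor 2.\<close>

lemma Poincare_double_integral:
  fixes u g1 g2 :: "plane \<Rightarrow> 'b::euclidean_space"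
  assumes s: "s > 0" and u: "integrable lborel u" and g1: "integrable lborel g1" and g2: "integrable lborel g2"
    and Q: "Q = {p<..<p+s} \<times> {q<..<q+s}"
    and wd1: "has_weak_deriv Q (coord 1) u g1" and wd2: "has_weak_deriv Q (coord 2) u g2"
  shows "(\<integral>\<^sup>+x. \<integral>\<^sup>+y. indicator Q x * indicator Q y * ennreal ((norm (u x - u y))\<^sup>2) \<partial>lborel \<partial>lborel)
    \<le> ennreal (2 * s^4) * ((\<integral>\<^sup>+x. ennreal ((norm (g1 x))\<^sup>2) \<partial>lborel) + (\<integral>\<^sup>+x. ennreal ((norm (g2 x))\<^sup>2) \<partial>lborel))"
proof -
  define I K where "I = {p<..<p+s}" and "K = {q<..<q+s}"
  have [measurable]: "I \<in> sets borel" "K \<in> sets borel" by (auto simp: I_def K_def)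
  have [measurable]: "u \<in> borel_measurable borel" "g1 \<in> borel_measurable borel" "g2 \<in> borel_measurable borel"
    using u g1 g2 by auto
  have iQ: "(indicator Q x :: ennreal) = indicator I (fst x) * indicator K (snd x)" for x
    by (cases x) (simp add: Q I_def K_def indicator_times)
  define N1 N2 where "N1 = (\<integral>\<^sup>+x. ennreal ((norm (g1 x))\<^sup>2) \<partial>lborel)" and "N2 = (\<integral>\<^sup>+x. ennreal ((norm (g2 x))\<^sup>2) \<partial>lborel)"
  define A where "A z x y = indicator I z * (indicator K x * indicator K y * ennreal ((norm (u (z, x) - u (z, y)))\<^sup>2))" for z x y
  define B where "B z x y = indicator K z * (indicator I x * indicator I y * ennreal ((norm (u (x, z) - u (y, z)))\<^sup>2))" for z x y
  have VA: "(\<integral>\<^sup>+z. \<integral>\<^sup>+x. \<integral>\<^sup>+y. A z x y \<partial>lborel \<partial>lborel \<partial>lborel) \<le> ennreal (s^3) * N2"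
    unfolding A_def I_def K_def N2_def
  proof (rule vertical_oscillation[OF s u g2])
    fix \<phi> \<eta> assume *: "test_fun {p<..<p+s} \<phi>" "test_fun {q<..<q+s} \<eta>"
    show "(LBINT x:{p<..<p+s} \<times> {q<..<q+s}. (\<phi> (fst x) * dir_deriv 1 \<eta> (snd x)) *\<^sub>R u x) =
       - (LBINT x:{p<..<p+s} \<times> {q<..<q+s}. (\<phi> (fst x) * \<eta> (snd x)) *\<^sub>R g2 x)"
      using has_weak_derivD[OF wd2[unfolded Q] test_fun_product(1)[OF *]] unfolding test_fun_product(3)[OF *] .
  qed
  \<comment> \<open>The horizontal leg is the vertical estimate applied after exchanging the
    coordinates.\<close>
  have VB: "(\<integral>\<^sup>+z. \<integral>\<^sup>+x. \<integral>\<^sup>+y. B z x y \<partial>lborel \<partial>lborel \<partial>lborel) \<le> ennreal (s^3) * N1"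
  proof -
    define u' where "u' x = u (snd x, fst x)" for x
    define g' where "g' x = g1 (snd x, fst x)" for x
    have u': "integrable lborel u'" and g': "integrable lborel g'"
      unfolding u'_def g'_def by (intro plane_swap u g1)+
    have "(\<integral>\<^sup>+z. \<integral>\<^sup>+x. \<integral>\<^sup>+y. indicator K z * (indicator I x * indicator I y * ennreal ((norm (u' (z, x) - u' (z, y)))\<^sup>2)) \<partial>lborel \<partial>lborel \<partial>lborel)
      \<le> ennreal (s^3) * (\<integral>\<^sup>+x. ennreal ((norm (g' x))\<^sup>2) \<partial>lborel)"
      unfolding I_def K_def
    proof (rule vertical_oscillation[OF s u' g'])
      fix \<phi> \<eta> assume *: "test_fun {q<..<q+s} \<phi>" "test_fun {p<..<p+s} \<eta>"
      have m: "\<phi> \<in> borel_measurable borel" "\<eta> \<in> borel_measurable borel" "dir_deriv 1 \<eta> \<in> borel_measurable borel"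
        using test_fun_measurable test_fun_dir_deriv * by blast+
      note [measurable] = m
      have ind: "indicator ({q<..<q+s} \<times> {p<..<p+s}) x = (indicator Q (snd x, fst x) :: real)" for x
        by (cases x) (auto simp: Q indicator_def)
      have Qm [measurable]: "Q \<in> sets borel" unfolding Q by (intro borel_open open_Times) auto
      have "(LBINT x:{q<..<q+s} \<times> {p<..<p+s}. (\<phi> (fst x) * dir_deriv 1 \<eta> (snd x)) *\<^sub>R u' x)
        = (LBINT x:Q. (dir_deriv 1 \<eta> (fst x) * \<phi> (snd x)) *\<^sub>R u x)"
        unfolding set_lebesgue_integral_def ind u'_def
        by (subst plane_swap(2)[symmetric]) (simp_all add: mult.commute)
      moreover have "(LBINT x:{q<..<q+s} \<times> {p<..<p+s}. (\<phi> (fst x) * \<eta> (snd x)) *\<^sub>R g' x)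
        = (LBINT x:Q. (\<eta> (fst x) * \<phi> (snd x)) *\<^sub>R g1 x)"
        unfolding set_lebesgue_integral_def ind g'_def
        by (subst plane_swap(2)[symmetric]) (simp_all add: mult.commute)
      ultimately show "(LBINT x:{q<..<q+s} \<times> {p<..<p+s}. (\<phi> (fst x) * dir_deriv 1 \<eta> (snd x)) *\<^sub>R u' x) =
       - (LBINT x:{q<..<q+s} \<times> {p<..<p+s}. (\<phi> (fst x) * \<eta> (snd x)) *\<^sub>R g' x)"
        using has_weak_derivD[OF wd1[unfolded Q] test_fun_product(1)[OF *(2,1)]]
        unfolding test_fun_product(2)[OF *(2,1)] Q by (simp only:)
    qed
    moreover have "(\<integral>\<^sup>+x. ennreal ((norm (g' x))\<^sup>2) \<partial>lborel) = N1"
      unfolding N1_def g'_def by (rule plane_nn_integral_swap) measurable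
    ultimately show ?thesis unfolding B_def u'_def by simp
  qed
  have eI: "(\<integral>\<^sup>+y. indicator I y \<partial>lborel) = ennreal s" and eK: "(\<integral>\<^sup>+y. indicator K y \<partial>lborel) = ennreal s"
    using s by (simp_all add: I_def K_def)
  have pt: "indicator Q (x1, x2) * indicator Q (y1, y2) * ennreal ((norm (u (x1, x2) - u (y1, y2)))\<^sup>2)
     \<le> 2 * (indicator I y1 * A x1 x2 y2) + 2 * (indicator K x2 * B y2 x1 y1)" for x1 x2 y1 y2
  proof (cases "x1 \<in> I \<and> x2 \<in> K \<and> y1 \<in> I \<and> y2 \<in> K")
    case True
    have "(norm (u (x1, x2) - u (y1, y2)))\<^sup>2 \<le> 2 * (norm (u (x1, x2) - u (x1, y2)))\<^sup>2 + 2 * (norm (u (x1, y2) - u (y1, y2)))\<^sup>2"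
      using norm_add_power2_le[of "u (x1, x2) - u (x1, y2)" "u (x1, y2) - u (y1, y2)"] by simp
    then have "ennreal ((norm (u (x1, x2) - u (y1, y2)))\<^sup>2) \<le> ennreal (2 * (norm (u (x1, x2) - u (x1, y2)))\<^sup>2 + 2 * (norm (u (x1, y2) - u (y1, y2)))\<^sup>2)"
      by (rule ennreal_leI)
    then show ?thesis using True by (simp add: iQ A_def B_def ennreal_mult'')
  qed (auto simp: Q I_def K_def indicator_def)
  have "(\<integral>\<^sup>+x. \<integral>\<^sup>+y. indicator Q x * indicator Q y * ennreal ((norm (u x - u y))\<^sup>2) \<partial>lborel \<partial>lborel)
    = (\<integral>\<^sup>+x1. \<integral>\<^sup>+x2. \<integral>\<^sup>+y. indicator Q (x1, x2) * indicator Q y * ennreal ((norm (u (x1, x2) - u y))\<^sup>2) \<partial>lborel \<partial>lborel \<partial>lborel)"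
  proof -
    have Qm [measurable]: "Q \<in> sets borel" unfolding Q by (intro borel_open open_Times) auto
    show ?thesis
      by (subst lborel.nn_integral_fst[of "\<lambda>x. \<integral>\<^sup>+y. indicator Q x * indicator Q y * ennreal ((norm (u x - u y))\<^sup>2) \<partial>lborel" lborel])
        (simp_all add: lborel_prod)
  qed
  also have "\<dots> = (\<integral>\<^sup>+x1. \<integral>\<^sup>+x2. \<integral>\<^sup>+y1. \<integral>\<^sup>+y2. indicator Q (x1, x2) * indicator Q (y1, y2) * ennreal ((norm (u (x1, x2) - u (y1, y2)))\<^sup>2) \<partial>lborel \<partial>lborel \<partial>lborel \<partial>lborel)"
  proof (intro nn_integral_cong)
    fix x1 x2 :: real
    have Qm [measurable]: "Q \<in> sets borel" unfolding Q by (intro borel_open open_Times) auto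
    show "(\<integral>\<^sup>+y. indicator Q (x1, x2) * indicator Q y * ennreal ((norm (u (x1, x2) - u y))\<^sup>2) \<partial>lborel)
     = (\<integral>\<^sup>+y1. \<integral>\<^sup>+y2. indicator Q (x1, x2) * indicator Q (y1, y2) * ennreal ((norm (u (x1, x2) - u (y1, y2)))\<^sup>2) \<partial>lborel \<partial>lborel)"
      by (subst lborel.nn_integral_fst[of "\<lambda>y. indicator Q (x1, x2) * indicator Q y * ennreal ((norm (u (x1, x2) - u y))\<^sup>2)" lborel])
        (simp_all add: lborel_prod)
  qed
  also have "\<dots> \<le> (\<integral>\<^sup>+x1. \<integral>\<^sup>+x2. \<integral>\<^sup>+y1. \<integral>\<^sup>+y2. 2 * (indicator I y1 * A x1 x2 y2) + 2 * (indicator K x2 * B y2 x1 y1) \<partial>lborel \<partial>lborel \<partial>lborel \<partial>lborel)"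
    by (intro nn_integral_mono pt)
  also have "\<dots> = (\<integral>\<^sup>+x1. \<integral>\<^sup>+x2. 2 * (ennreal s * (\<integral>\<^sup>+y2. A x1 x2 y2 \<partial>lborel)) + 2 * (indicator K x2 * (\<integral>\<^sup>+y1. \<integral>\<^sup>+y2. B y2 x1 y1 \<partial>lborel \<partial>lborel)) \<partial>lborel \<partial>lborel)"
  proof (intro nn_integral_cong)
    fix x1 x2 :: real
    have "(\<integral>\<^sup>+y1. \<integral>\<^sup>+y2. 2 * (indicator I y1 * A x1 x2 y2) + 2 * (indicator K x2 * B y2 x1 y1) \<partial>lborel \<partial>lborel)
       = (\<integral>\<^sup>+y1. indicator I y1 * (2 * (\<integral>\<^sup>+y2. A x1 x2 y2 \<partial>lborel)) + (2 * indicator K x2) * (\<integral>\<^sup>+y2. B y2 x1 y1 \<partial>lborel) \<partial>lborel)"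
    proof (intro nn_integral_cong)
      fix y1
      have [measurable]: "(\<lambda>y2. A x1 x2 y2) \<in> borel_measurable borel" "(\<lambda>y2. B y2 x1 y1) \<in> borel_measurable borel"
        unfolding A_def B_def by measurable
      show "(\<integral>\<^sup>+y2. 2 * (indicator I y1 * A x1 x2 y2) + 2 * (indicator K x2 * B y2 x1 y1) \<partial>lborel)
        = indicator I y1 * (2 * (\<integral>\<^sup>+y2. A x1 x2 y2 \<partial>lborel)) + (2 * indicator K x2) * (\<integral>\<^sup>+y2. B y2 x1 y1 \<partial>lborel)"
        by (simp add: nn_integral_add nn_integral_cmult ac_simps)
    qed
    also have "\<dots> = ennreal s * (2 * (\<integral>\<^sup>+y2. A x1 x2 y2 \<partial>lborel)) + (2 * indicator K x2) * (\<integral>\<^sup>+y1. \<integral>\<^sup>+y2. B y2 x1 y1 \<partial>lborel \<partial>lborel)"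
    proof -
      have [measurable]: "(\<lambda>y1. \<integral>\<^sup>+y2. B y2 x1 y1 \<partial>lborel) \<in> borel_measurable borel"
        unfolding B_def by measurable
      show ?thesis by (simp add: nn_integral_add nn_integral_cmult nn_integral_multc eI)
    qed
    finally show "(\<integral>\<^sup>+y1. \<integral>\<^sup>+y2. 2 * (indicator I y1 * A x1 x2 y2) + 2 * (indicator K x2 * B y2 x1 y1) \<partial>lborel \<partial>lborel)
      = 2 * (ennreal s * (\<integral>\<^sup>+y2. A x1 x2 y2 \<partial>lborel)) + 2 * (indicator K x2 * (\<integral>\<^sup>+y1. \<integral>\<^sup>+y2. B y2 x1 y1 \<partial>lborel \<partial>lborel))"
      by (simp add: ac_simps)
  qed
  also have "\<dots> = (\<integral>\<^sup>+x1. (2 * ennreal s) * (\<integral>\<^sup>+x2. \<integral>\<^sup>+y2. A x1 x2 y2 \<partial>lborel \<partial>lborel) + (2 * ennreal s) * (\<integral>\<^sup>+y1. \<integral>\<^sup>+y2. B y2 x1 y1 \<partial>lborel \<partial>lborel) \<partial>lborel)"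
  proof (intro nn_integral_cong)
    fix x1 :: real
    have [measurable]: "(\<lambda>x2. \<integral>\<^sup>+y2. A x1 x2 y2 \<partial>lborel) \<in> borel_measurable borel" unfolding A_def by measurable
    show "(\<integral>\<^sup>+x2. 2 * (ennreal s * (\<integral>\<^sup>+y2. A x1 x2 y2 \<partial>lborel)) + 2 * (indicator K x2 * (\<integral>\<^sup>+y1. \<integral>\<^sup>+y2. B y2 x1 y1 \<partial>lborel \<partial>lborel)) \<partial>lborel)
      = (2 * ennreal s) * (\<integral>\<^sup>+x2. \<integral>\<^sup>+y2. A x1 x2 y2 \<partial>lborel \<partial>lborel) + (2 * ennreal s) * (\<integral>\<^sup>+y1. \<integral>\<^sup>+y2. B y2 x1 y1 \<partial>lborel \<partial>lborel)"
      by (simp add: nn_integral_add nn_integral_cmult nn_integral_multc eK ac_simps)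
  qed
  also have "\<dots> = (2 * ennreal s) * (\<integral>\<^sup>+x1. \<integral>\<^sup>+x2. \<integral>\<^sup>+y2. A x1 x2 y2 \<partial>lborel \<partial>lborel \<partial>lborel)
      + (2 * ennreal s) * (\<integral>\<^sup>+x1. \<integral>\<^sup>+y1. \<integral>\<^sup>+y2. B y2 x1 y1 \<partial>lborel \<partial>lborel \<partial>lborel)"
  proof -
    have [measurable]: "(\<lambda>x1. \<integral>\<^sup>+x2. \<integral>\<^sup>+y2. A x1 x2 y2 \<partial>lborel \<partial>lborel) \<in> borel_measurable borel"
      "(\<lambda>x1. \<integral>\<^sup>+y1. \<integral>\<^sup>+y2. B y2 x1 y1 \<partial>lborel \<partial>lborel) \<in> borel_measurable borel"
      unfolding A_def B_def by measurable
    show ?thesis by (simp add: nn_integral_add nn_integral_cmult)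
  qed
  also have "(\<integral>\<^sup>+x1. \<integral>\<^sup>+y1. \<integral>\<^sup>+y2. B y2 x1 y1 \<partial>lborel \<partial>lborel \<partial>lborel) = (\<integral>\<^sup>+x1. \<integral>\<^sup>+y2. \<integral>\<^sup>+y1. B y2 x1 y1 \<partial>lborel \<partial>lborel \<partial>lborel)"
  proof (rule nn_integral_cong)
    fix x1
    have "(\<lambda>(y2, y1). B y2 x1 y1) \<in> borel_measurable (lborel \<Otimes>\<^sub>M lborel)"
      unfolding B_def by measurable
    from lborel_pair.Fubini'[OF this] show "(\<integral>\<^sup>+y1. \<integral>\<^sup>+y2. B y2 x1 y1 \<partial>lborel \<partial>lborel) = (\<integral>\<^sup>+y2. \<integral>\<^sup>+y1. B y2 x1 y1 \<partial>lborel \<partial>lborel)" .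
  qed
  also have "\<dots> = (\<integral>\<^sup>+y2. \<integral>\<^sup>+x1. \<integral>\<^sup>+y1. B y2 x1 y1 \<partial>lborel \<partial>lborel \<partial>lborel)"
  proof -
    have "(\<lambda>(y2, x1). \<integral>\<^sup>+y1. B y2 x1 y1 \<partial>lborel) \<in> borel_measurable (lborel \<Otimes>\<^sub>M lborel)"
      unfolding B_def by measurable
    from lborel_pair.Fubini'[OF this] show ?thesis .
  qed
  also have "(2 * ennreal s) * (\<integral>\<^sup>+x1. \<integral>\<^sup>+x2. \<integral>\<^sup>+y2. A x1 x2 y2 \<partial>lborel \<partial>lborel \<partial>lborel)
      + (2 * ennreal s) * (\<integral>\<^sup>+y2. \<integral>\<^sup>+x1. \<integral>\<^sup>+y1. B y2 x1 y1 \<partial>lborel \<partial>lborel \<partial>lborel)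
      \<le> (2 * ennreal s) * (ennreal (s^3) * N2) + (2 * ennreal s) * (ennreal (s^3) * N1)"
    by (intro add_mono mult_left_mono VA VB) auto
  also have "\<dots> = (2 * (ennreal s * ennreal (s^3))) * (N1 + N2)" by (simp add: algebra_simps)
  also have "2 * (ennreal s * ennreal (s^3)) = ennreal (2 * s^4)"
  proof -
    have "ennreal (2 * s^4) = ennreal (2 * (s * s^3))" by (simp add: power4_eq_xxxx power3_eq_cube mult.assoc)
    also have "\<dots> = ennreal 2 * ennreal (s * s^3)" by (rule ennreal_mult') simp
    also have "ennreal (s * s^3) = ennreal s * ennreal (s^3)" by (rule ennreal_mult') (use s in simp)
    finally show ?thesis by simp
  qed
  finally show ?thesis unfolding N1_def N2_def .
qed

text \<open>Expanding the square turns the symmetric double integral into a variance, which is how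
  the mean enters the Poincare inequality.\<close>

lemma double_integral_identity:
  fixes u :: "'a \<Rightarrow> 'b::euclidean_space"
  assumes "sqint M u" "finite_measure M"
  shows "(\<integral>\<^sup>+x. \<integral>\<^sup>+y. ennreal ((norm (u x - u y))\<^sup>2) \<partial>M \<partial>M)
    = ennreal (2 * measure M (space M) * nsq M u - 2 * (norm (\<integral>x. u x \<partial>M))\<^sup>2)"
proof -
  interpret finite_measure M by fact
  have i: "integrable M u" by (rule sqint_integrable_finite[OF assms])
  have i2: "integrable M (\<lambda>x. (norm (u x))\<^sup>2)" using assms by (auto simp: sqint_def)
  define m where "m = measure M (space M)"
  define U where "U = (\<integral>x. u x \<partial>M)"
  have c: "sqint M (\<lambda>y. c - u y)" for c using assms(1) by (intro sqint_diff) (auto simp: sqint_def)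
  have exp: "(norm (a - b))\<^sup>2 = (norm a)\<^sup>2 - 2 * (a \<bullet> b) + (norm b)\<^sup>2" for a b :: 'b
    by (simp add: power2_norm_eq_inner inner_diff inner_commute)
  have in1: "(\<integral>y. (norm (u x - u y))\<^sup>2 \<partial>M) = m * (norm (u x))\<^sup>2 - 2 * (u x \<bullet> U) + nsq M u" for x
    unfolding exp nsq_def U_def m_def using i i2 by simp
  have "(\<integral>\<^sup>+y. ennreal ((norm (u x - u y))\<^sup>2) \<partial>M) = ennreal (m * (norm (u x))\<^sup>2 - 2 * (u x \<bullet> U) + nsq M u)" for x
    unfolding in1[symmetric] using c by (intro nn_integral_eq_integral) (auto simp: sqint_def)
  moreover have "m * (norm (u x))\<^sup>2 - 2 * (u x \<bullet> U) + nsq M u \<ge> 0" for x unfolding in1[symmetric] by simp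
  ultimately have "(\<integral>\<^sup>+x. \<integral>\<^sup>+y. ennreal ((norm (u x - u y))\<^sup>2) \<partial>M \<partial>M)
     = ennreal (\<integral>x. m * (norm (u x))\<^sup>2 - 2 * (u x \<bullet> U) + nsq M u \<partial>M)"
    using i i2 by (simp only:) (intro nn_integral_eq_integral, auto)
  also have "(\<integral>x. m * (norm (u x))\<^sup>2 - 2 * (u x \<bullet> U) + nsq M u \<partial>M) = 2 * m * nsq M u - 2 * (norm U)\<^sup>2"
    using i i2 unfolding nsq_def by (simp add: power2_norm_eq_inner m_def U_def)
  finally show ?thesis by (simp add: m_def U_def)
qed

lemma has_weak_deriv_cong_on:
  assumes "\<And>x. x \<in> U \<Longrightarrow> f x = f' x" "\<And>x. x \<in> U \<Longrightarrow> g x = g' x" "has_weak_deriv U v f g"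
  shows "has_weak_deriv U v f' g'"
proof -
  have 1: "indicator U x *\<^sub>R (c x *\<^sub>R f x) = indicator U x *\<^sub>R (c x *\<^sub>R f' x)" 
       "indicator U x *\<^sub>R (c x *\<^sub>R g x) = indicator U x *\<^sub>R (c x *\<^sub>R g' x)" for c x
    using assms(1,2) by (auto simp: indicator_def)
  have "indicator K x *\<^sub>R f x = indicator K x *\<^sub>R f' x" "indicator K x *\<^sub>R g x = indicator K x *\<^sub>R g' x" if "K \<subseteq> U" for K x
    using assms(1,2) that by (auto simp: indicator_def)
  then have "loc_integrable U f' \<longleftrightarrow> loc_integrable U f" "loc_integrable U g' \<longleftrightarrow> loc_integrable U g"
    unfolding loc_integrable_def set_integrable_def by (metis (no_types, lifting) ext)+
  with assms(3) show ?thesis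
    unfolding has_weak_deriv_def set_lebesgue_integral_def 1 by simp
qed

text \<open>Both forms are used: the double integral compares opposite half balls when jumps are
  excluded, and the form with the mean upgrades weak to strong convergence.\<close>

lemma Poincare_square:
  fixes u g1 g2 :: "plane \<Rightarrow> 'b::euclidean_space"
  assumes s: "s > 0" and Q: "Q = {p<..<p+s} \<times> {q<..<q+s}"
    and L2: "sqint (lborel_on Q) u" "sqint (lborel_on Q) g1" "sqint (lborel_on Q) g2"
    and wd: "has_weak_deriv Q (coord 1) u g1" "has_weak_deriv Q (coord 2) u g2"
  shows "(\<integral>\<^sup>+x. \<integral>\<^sup>+y. ennreal ((norm (u x - u y))\<^sup>2) \<partial>lborel_on Q \<partial>lborel_on Q)
     \<le> ennreal (2 * s^4 * (nsq (lborel_on Q) g1 + nsq (lborel_on Q) g2))"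
    and "s\<^sup>2 * nsq (lborel_on Q) u - (norm (\<integral>x. u x \<partial>lborel_on Q))\<^sup>2 \<le> s^4 * (nsq (lborel_on Q) g1 + nsq (lborel_on Q) g2)"
proof -
  have Qm [measurable]: "Q \<in> sets borel" unfolding Q by (intro borel_open open_Times) auto
  have Qb: "bounded Q" unfolding Q by (intro bounded_Times) auto
  note fin = finite_measure_lborel_on[OF Qb Qm]
  define e where "e f x = indicator Q x *\<^sub>R f x" for f :: "plane \<Rightarrow> 'b" and x
  have ie: "integrable lborel (e f)" if "sqint (lborel_on Q) f" for f
    using sqint_integrable_finite[OF that fin] by (simp add: e_def[abs_def] integrable_restrict_space)
  have nne: "(\<integral>\<^sup>+x. ennreal ((norm (e f x))\<^sup>2) \<partial>lborel) = ennreal (nsq (lborel_on Q) f)" if "sqint (lborel_on Q) f" for f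
  proof -
    have "sqint lborel (e f)" using that sqint_lborel_on[OF Qm, of f] unfolding e_def[abs_def] by blast
    from nn_integral_nsq[OF this] nsq_lborel_on[OF Qm, of f] show ?thesis unfolding e_def[abs_def] by (simp only:)
  qed
  have "has_weak_deriv Q (coord 1) (e u) (e g1)" "has_weak_deriv Q (coord 2) (e u) (e g2)"
    by (rule has_weak_deriv_cong_on[OF _ _ wd(1)] has_weak_deriv_cong_on[OF _ _ wd(2)]; simp add: e_def)+
  from Poincare_double_integral[OF s ie[OF L2(1)] ie[OF L2(2)] ie[OF L2(3)] Q this]
  have "(\<integral>\<^sup>+x. \<integral>\<^sup>+y. indicator Q x * indicator Q y * ennreal ((norm (e u x - e u y))\<^sup>2) \<partial>lborel \<partial>lborel)
     \<le> ennreal (2 * s^4 * (nsq (lborel_on Q) g1 + nsq (lborel_on Q) g2))"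
    using s L2 by (simp add: nne ennreal_mult'[symmetric] ennreal_plus[symmetric] del: ennreal_plus)
  moreover have "(\<integral>\<^sup>+x. \<integral>\<^sup>+y. indicator Q x * indicator Q y * ennreal ((norm (e u x - e u y))\<^sup>2) \<partial>lborel \<partial>lborel)
    = (\<integral>\<^sup>+x. \<integral>\<^sup>+y. ennreal ((norm (u x - u y))\<^sup>2) \<partial>lborel_on Q \<partial>lborel_on Q)"
  proof -
    have "(\<integral>\<^sup>+x. \<integral>\<^sup>+y. ennreal ((norm (u x - u y))\<^sup>2) \<partial>lborel_on Q \<partial>lborel_on Q)
      = (\<integral>\<^sup>+x. (\<integral>\<^sup>+y. ennreal ((norm (u x - u y))\<^sup>2) * indicator Q y \<partial>lborel) * indicator Q x \<partial>lborel)"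
      by (simp add: nn_integral_restrict_space)
    also have "\<dots> = (\<integral>\<^sup>+x. \<integral>\<^sup>+y. indicator Q x * indicator Q y * ennreal ((norm (e u x - e u y))\<^sup>2) \<partial>lborel \<partial>lborel)"
    proof (rule nn_integral_cong)
      fix x
      show "(\<integral>\<^sup>+y. ennreal ((norm (u x - u y))\<^sup>2) * indicator Q y \<partial>lborel) * indicator Q x
        = (\<integral>\<^sup>+y. indicator Q x * indicator Q y * ennreal ((norm (e u x - e u y))\<^sup>2) \<partial>lborel)"
        by (cases "x \<in> Q") (auto simp: e_def indicator_def intro!: nn_integral_cong)
    qed
    finally show ?thesis by simp
  qed
  ultimately show 1: "(\<integral>\<^sup>+x. \<integral>\<^sup>+y. ennreal ((norm (u x - u y))\<^sup>2) \<partial>lborel_on Q \<partial>lborel_on Q)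
     \<le> ennreal (2 * s^4 * (nsq (lborel_on Q) g1 + nsq (lborel_on Q) g2))" by simp
  have "measure (lborel_on Q) (space (lborel_on Q)) = s\<^sup>2"
  proof -
    have "emeasure (lborel \<Otimes>\<^sub>M lborel) ({p<..<p+s} \<times> {q<..<q+s}) = ennreal s * ennreal s"
      using s by (subst lborel.emeasure_pair_measure_Times) auto
    then have "emeasure lborel Q = ennreal (s\<^sup>2)"
      using s by (simp add: lborel_prod Q power2_eq_square ennreal_mult')
    then show ?thesis by (simp add: space_restrict_space measure_def emeasure_restrict_space)
  qed
  with 1 double_integral_identity[OF L2(1) fin] s
  have "2 * s\<^sup>2 * nsq (lborel_on Q) u - 2 * (norm (\<integral>x. u x \<partial>lborel_on Q))\<^sup>2
     \<le> 2 * s^4 * (nsq (lborel_on Q) g1 + nsq (lborel_on Q) g2)"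
    by (simp add: ennreal_le_iff)
  then show "s\<^sup>2 * nsq (lborel_on Q) u - (norm (\<integral>x. u x \<partial>lborel_on Q))\<^sup>2 \<le> s^4 * (nsq (lborel_on Q) g1 + nsq (lborel_on Q) g2)"
    by simp
qed

subsection \<open>Strong convergence away from a line\<close>

lemma AE_plane_snd:
  assumes "AE s in lborel. P (s::real)" shows "AE x::plane in lborel. P (snd x)"
proof -
  from AE_E[OF assms] obtain N where N: "{x. \<not> P x} \<subseteq> N" "emeasure lborel N = 0" "N \<in> sets lborel" by auto
  have "emeasure (lborel \<Otimes>\<^sub>M lborel) ((UNIV :: real set) \<times> N) = 0"
    using N by (subst lborel.emeasure_pair_measure_Times) auto
  moreover have "(UNIV :: real set) \<times> N \<in> sets (lborel \<Otimes>\<^sub>M lborel)" using N by (intro pair_measureI) auto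
  ultimately have "(UNIV :: real set) \<times> N \<in> null_sets lborel" unfolding lborel_prod by (rule null_setsI)
  then show ?thesis by (rule AE_I') (use N in auto)
qed

lemma AE_not_grid:
  assumes "N > 0" shows "AE s in lborel. real N * s \<notin> \<int>"
proof -
  have "countable ((\<lambda>i::int. real_of_int i / real N) ` UNIV)" by simp
  then have "(\<lambda>i::int. real_of_int i / real N) ` UNIV \<in> null_sets lborel"
    by (rule countable_imp_null_set_lborel)
  then have "AE s in lborel. s \<notin> (\<lambda>i::int. real_of_int i / real N) ` UNIV" by (rule AE_not_in)
  then show ?thesis
  proof eventually_elim
    case (elim s)
    show ?case
    proof
      assume "real N * s \<in> \<int>"
      then obtain i where "real N * s = of_int i" by (auto elim: Ints_cases)
      then have "s = real_of_int i / real N" using assms by (simp add: field_simps)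
      with elim show False by blast
    qed
  qed
qed

lemma Omega_borel [simp, measurable]: "Omega \<in> sets borel"
  unfolding Omega_def by (intro borel_open open_Times) auto

lemma open_Omega: "open Omega" unfolding Omega_def by (intro open_Times) auto

lemma bounded_Omega: "bounded Omega" unfolding Omega_def by (intro bounded_Times) auto

text \<open>The first part splits a norm over a strip and grid squares that cover up to a null set;
  the second reassembles the gradient energies of the disjoint squares.\<close>

lemma nsq_lborel_on_cong_sum:
  assumes U: "U \<in> sets borel" and V: "V \<in> sets borel" and fS: "finite S" and Q: "\<And>i. i \<in> S \<Longrightarrow> Q i \<in> sets borel" "\<And>i. i \<in> S \<Longrightarrow> Q i \<subseteq> U"
    and VU: "V \<subseteq> U" and f: "sqint (lborel_on U) f"
  shows "(AE x in lborel. x \<in> U \<longrightarrow> x \<in> V \<or> (\<exists>i\<in>S. x \<in> Q i)) \<Longrightarrow>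
       nsq (lborel_on U) f \<le> nsq (lborel_on V) f + (\<Sum>i\<in>S. nsq (lborel_on (Q i)) f)"
    and "disjoint_family_on Q S \<Longrightarrow> (\<Sum>i\<in>S. nsq (lborel_on (Q i)) f) \<le> nsq (lborel_on U) f"
proof -
  define h where "h x = indicator U x * (norm (f x))\<^sup>2" for x
  have h: "integrable lborel h" using f U by (simp add: sqint_def integrable_restrict_space h_def[abs_def])
  have n: "nsq (lborel_on A) f = (LBINT x. indicator A x * h x)" "integrable lborel (\<lambda>x. indicator A x * h x)"
    if "A \<in> sets borel" "A \<subseteq> U" for A
  proof -
    have "nsq (lborel_on A) f = (LBINT x. indicator A x *\<^sub>R (norm (f x))\<^sup>2)"
      unfolding nsq_def using that by (simp add: integral_restrict_space)
    also have "\<dots> = (LBINT x. indicator A x * h x)"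
      using that by (intro Bochner_Integration.integral_cong) (auto simp: h_def indicator_def)
    finally show "nsq (lborel_on A) f = (LBINT x. indicator A x * h x)" .
    show "integrable lborel (\<lambda>x. indicator A x * h x)"
      using integrable_mult_indicator[of A lborel h] h that by simp
  qed
  have hn: "h x \<ge> 0" for x by (simp add: h_def)
  have Uh: "indicator U x * h x = h x" for x by (simp add: h_def indicator_def)
  have sumI: "integrable lborel (\<lambda>x. \<Sum>i\<in>S. indicator (Q i) x * h x)"
    using n(2) Q by (intro Bochner_Integration.integrable_sum) auto
  have sumE: "(\<Sum>i\<in>S. nsq (lborel_on (Q i)) f) = (LBINT x. (\<Sum>i\<in>S. indicator (Q i) x * h x))"
    using n Q by (subst Bochner_Integration.integral_sum) auto
  show "nsq (lborel_on U) f \<le> nsq (lborel_on V) f + (\<Sum>i\<in>S. nsq (lborel_on (Q i)) f)"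
    if cov: "AE x in lborel. x \<in> U \<longrightarrow> x \<in> V \<or> (\<exists>i\<in>S. x \<in> Q i)"
  proof -
    have "nsq (lborel_on U) f = (LBINT x. h x)" using n(1)[OF U order_refl] by (simp only: Uh)
    also have "\<dots> \<le> (LBINT x. indicator V x * h x + (\<Sum>i\<in>S. indicator (Q i) x * h x))"
    proof (rule integral_mono_AE[OF h])
      show "integrable lborel (\<lambda>x. indicator V x * h x + (\<Sum>i\<in>S. indicator (Q i) x * h x))"
        by (intro Bochner_Integration.integrable_add n(2) V VU sumI)
      show "AE x in lborel. h x \<le> indicator V x * h x + (\<Sum>i\<in>S. indicator (Q i) x * h x)"
        using cov
      proof eventually_elim
        case (elim x)
        have s0: "(\<Sum>i\<in>S. indicator (Q i) x * h x) \<ge> 0" by (intro sum_nonneg mult_nonneg_nonneg hn) auto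
        consider "x \<notin> U" | "x \<in> V" | i where "i \<in> S" "x \<in> Q i" using elim by blast
        then show ?case
        proof cases
          case 1
          then have "h x = 0" by (simp add: h_def)
          then show ?thesis by simp
        next
          case 2
          then show ?thesis using s0 by simp
        next
          case 3
          have "indicator (Q i) x * h x \<le> (\<Sum>i\<in>S. indicator (Q i) x * h x)"
            by (rule member_le_sum[OF 3(1)]) (auto intro!: mult_nonneg_nonneg hn fS)
          moreover have "0 \<le> indicator V x * h x" by (intro mult_nonneg_nonneg hn) auto
          ultimately show ?thesis using 3 by simp
        qed
      qed
    qed
    also have "\<dots> = nsq (lborel_on V) f + (\<Sum>i\<in>S. nsq (lborel_on (Q i)) f)"
      unfolding sumE n(1)[OF V VU] by (rule Bochner_Integration.integral_add[OF n(2)[OF V VU] sumI])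
    finally show ?thesis .
  qed
  show "(\<Sum>i\<in>S. nsq (lborel_on (Q i)) f) \<le> nsq (lborel_on U) f" if d: "disjoint_family_on Q S"
  proof -
    have "(LBINT x. (\<Sum>i\<in>S. indicator (Q i) x * h x)) \<le> (LBINT x. h x)"
    proof (rule integral_mono[OF sumI h])
      fix x
      have "(\<Sum>i\<in>S. indicator (Q i) x * h x) = indicator (\<Union>i\<in>S. Q i) x * h x"
        unfolding indicator_UN_disjoint[OF fS d] by (simp add: sum_distrib_right)
      also have "\<dots> \<le> h x" using hn[of x] by (simp add: indicator_def)
      finally show "(\<Sum>i\<in>S. indicator (Q i) x * h x) \<le> h x" .
    qed
    also have "\<dots> = nsq (lborel_on U) f" using n(1)[OF U order_refl] by (simp only: Uh)
    finally show ?thesis by (simp only: sumE)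
  qed
qed

lemma sqint_lborel_on_subset:
  assumes "sqint (lborel_on U) f" "V \<subseteq> U" "U \<in> sets borel" "V \<in> sets borel"
  shows "sqint (lborel_on V) f" "nsq (lborel_on V) f \<le> nsq (lborel_on U) f"
proof -
  have e: "indicator V x *\<^sub>R f x = indicator V x *\<^sub>R (indicator U x *\<^sub>R f x)" for x using assms(2) by (auto simp: indicator_def)
  have e2: "indicator V x *\<^sub>R (norm (f x))\<^sup>2 = indicator V x *\<^sub>R (indicator U x *\<^sub>R (norm (f x))\<^sup>2)" for x using assms(2) by (auto simp: indicator_def)
  have m: "(\<lambda>x. indicator U x *\<^sub>R f x) \<in> borel_measurable lborel" and i: "integrable lborel (\<lambda>x. indicator U x *\<^sub>R (norm (f x))\<^sup>2)"
    using assms by (auto simp: sqint_def borel_measurable_restrict_space_iff integrable_restrict_space)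
  have "(\<lambda>x. indicator V x *\<^sub>R f x) \<in> borel_measurable lborel"
    unfolding e using m assms(4) by measurable
  moreover have "integrable lborel (\<lambda>x. indicator V x *\<^sub>R (norm (f x))\<^sup>2)"
    unfolding e2 by (rule integrable_mult_indicator[OF _ i]) (use assms(4) in simp)
  ultimately show s: "sqint (lborel_on V) f"
    using assms(4) by (simp add: sqint_def borel_measurable_restrict_space_iff integrable_restrict_space)
  show "nsq (lborel_on V) f \<le> nsq (lborel_on U) f"
    using nsq_lborel_on_cong_sum(2)[of U V "{()}" "\<lambda>_. V" f] assms by (simp add: disjoint_family_on_def)
qed

lemma quartic_bound:
  fixes s n X a b :: real
  assumes "s > 0" and *: "s\<^sup>2 * n - X \<le> s^4 * (a + b)"
  shows "n \<le> s\<^sup>2 * a + s\<^sup>2 * b + (1/s\<^sup>2) * X"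
proof -
  define t where "t = s\<^sup>2"
  have t: "t > 0" using assms by (simp add: t_def)
  have "s^4 = t * t" by (simp add: t_def power4_eq_xxxx power2_eq_square)
  then have "t * n \<le> t * (t * a + t * b) + X" using * by (simp add: t_def[symmetric] algebra_simps)
  also have "\<dots> = t * (t * a + t * b + (1/t) * X)" using t by (simp add: distrib_left)
  finally have "n \<le> t * a + t * b + (1/t) * X" using t by (rule mult_left_le_imp_le)
  then show ?thesis by (simp add: t_def)
qed

text \<open>On each grid square Poincare's inequality bounds the norm by \<open>s\<^sup>2\<close>
  times the gradient energy, small by the choice of \<open>s\<close>, plus the mean, which tends to
  zero on each of the finitely many squares. Weak derivatives are demanded only eventually because,
  in the application, a given square is free of the layer only for large \<open>n\<close>.\<close>

lemma strong_convergence_off_line: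
  fixes d g1 g2 :: "nat \<Rightarrow> plane \<Rightarrow> 'b::euclidean_space"
  assumes d: "\<And>n. sqint (lborel_on Omega) (d n)"
    and g: "\<And>n. sqint (lborel_on Omega) (g1 n)" "\<And>n. sqint (lborel_on Omega) (g2 n)"
    and M: "\<And>n. nsq (lborel_on Omega) (g1 n) + nsq (lborel_on Omega) (g2 n) \<le> M"
    and wd: "\<And>p q s. 0 < s \<Longrightarrow> {p<..<p+s} \<times> {q<..<q+s} \<subseteq> Omega \<Longrightarrow> 0 < q \<or> q + s < 0 \<Longrightarrow>
       eventually (\<lambda>n. has_weak_deriv ({p<..<p+s} \<times> {q<..<q+s}) (coord 1) (d n) (g1 n) \<and>
                       has_weak_deriv ({p<..<p+s} \<times> {q<..<q+s}) (coord 2) (d n) (g2 n)) sequentially"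
    and mean: "\<And>p q s. 0 < s \<Longrightarrow> {p<..<p+s} \<times> {q<..<q+s} \<subseteq> Omega \<Longrightarrow>
       (\<lambda>n. \<integral>x. d n x \<partial>lborel_on ({p<..<p+s} \<times> {q<..<q+s})) \<longlonglongrightarrow> 0"
    and tight: "\<And>e. e > 0 \<Longrightarrow> \<exists>\<delta>>0. eventually (\<lambda>n. nsq (lborel_on (Omega \<inter> {x. \<bar>snd x\<bar> < \<delta>})) (d n) \<le> e) sequentially"
  shows "(\<lambda>n. nsq (lborel_on Omega) (d n)) \<longlonglongrightarrow> 0"
proof (rule tendstoI)
  fix e :: real assume e: "e > 0"
  obtain \<delta> where \<delta>: "\<delta> > 0" "eventually (\<lambda>n. nsq (lborel_on (Omega \<inter> {x. \<bar>snd x\<bar> < \<delta>})) (d n) \<le> e/4) sequentially"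
    using tight[of "e/4"] e by auto
  have "((\<lambda>N. 1 / real (Suc N)) \<longlongrightarrow> 0) sequentially" using LIMSEQ_inverse_real_of_nat by (simp add: inverse_eq_divide)
  then have "((\<lambda>N. (1 / real (Suc N))\<^sup>2 * M) \<longlongrightarrow> 0\<^sup>2 * M) sequentially" by (intro tendsto_intros)
  then have "eventually (\<lambda>N. (1 / real (Suc N))\<^sup>2 * M < e/4) sequentially"
    using e by (intro order_tendstoD) auto
  moreover have "eventually (\<lambda>N. 1 / real (Suc N) < \<delta>) sequentially"
    using \<open>((\<lambda>N. 1 / real (Suc N)) \<longlongrightarrow> 0) sequentially\<close> \<delta>(1) by (rule order_tendstoD)
  ultimately have "eventually (\<lambda>N. (1 / real (Suc N))\<^sup>2 * M < e/4 \<and> 1 / real (Suc N) < \<delta>) sequentially"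
    by eventually_elim auto
  then obtain N0 where N0: "(1 / real (Suc N0))\<^sup>2 * M < e/4" "1 / real (Suc N0) < \<delta>"
    by (auto simp: eventually_sequentially)
  define N where "N = Suc N0"
  define s where "s = 1 / real N"
  have N: "N > 0" and s: "s > 0" "s\<^sup>2 * M < e/4" "s < \<delta>" using N0 by (simp_all add: N_def s_def)
  have Ns: "real N * s = 1" using N by (simp add: s_def)
  define Q where "Q = (\<lambda>(i::int, j::int). {of_int i * s<..<of_int i * s + s} \<times> {of_int j * s<..<of_int j * s + s})"
  \<comment> \<open>The two rows of squares next to the axis are left out; they lie in the strip of
    half-width \<open>\<delta>\<close> because \<open>s < \<delta>\<close>.\<close>
  define S where "S = {- int N..<int N} \<times> ({- int N..<int N} - {-1, 0})"
  have fS: "finite S" by (simp add: S_def)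
  have Qm [measurable]: "Q i \<in> sets borel" for i unfolding Q_def by (cases i) (auto intro!: borel_open open_Times)
  have inQ: "x \<in> Q (i, j) \<longleftrightarrow> of_int i < real N * fst x \<and> real N * fst x < of_int i + 1 \<and> of_int j < real N * snd x \<and> real N * snd x < of_int j + 1" for x i j
    using N by (cases x) (simp add: Q_def s_def field_simps)
  have inO: "x \<in> Omega \<longleftrightarrow> - real N < real N * fst x \<and> real N * fst x < real N \<and> - real N < real N * snd x \<and> real N * snd x < real N" for x
  proof -
    have *: "- real N < real N * t \<longleftrightarrow> -1 < t" "real N * t < real N \<longleftrightarrow> t < 1" for t
      using N mult_less_cancel_left_pos[of "real N" "-1" t] mult_less_cancel_left_pos[of "real N" t 1] by auto
    show ?thesis unfolding * by (cases x) (auto simp: Omega_def)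
  qed
  have QO: "Q i \<subseteq> Omega" if "i \<in> S" for i
  proof
    fix x assume "x \<in> Q i"
    moreover obtain a b where i: "i = (a, b)" by (cases i)
    moreover have "- int N \<le> a" "a + 1 \<le> int N" "- int N \<le> b" "b + 1 \<le> int N" using that i by (auto simp: S_def)
    then have "- real N \<le> of_int a" "of_int a + 1 \<le> real N" "- real N \<le> of_int b" "of_int b + 1 \<le> real N" by linarith+
    moreover have "of_int a < real N * fst x" "real N * fst x < of_int a + 1" "of_int b < real N * snd x" "real N * snd x < of_int b + 1"
      using calculation(1,2) inQ[of x a b] by blast+
    ultimately show "x \<in> Omega" unfolding inO by linarith
  qed
  have disj: "disjoint_family_on Q S"
    unfolding disjoint_family_on_def
  proof (intro ballI impI)
    fix m n :: "int \<times> int" assume "m \<noteq> n"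
    obtain a b a' b' where mn: "m = (a, b)" "n = (a', b')" by (cases m; cases n) auto
    show "Q m \<inter> Q n = {}"
    proof (rule ccontr)
      assume "Q m \<inter> Q n \<noteq> {}"
      then obtain x where "x \<in> Q (a, b)" "x \<in> Q (a', b')" using mn by blast
      then have "of_int a < real N * fst x \<and> real N * fst x < of_int a + 1 \<and> of_int b < real N * snd x \<and> real N * snd x < of_int b + 1"
        "of_int a' < real N * fst x \<and> real N * fst x < of_int a' + 1 \<and> of_int b' < real N * snd x \<and> real N * snd x < of_int b' + 1"
        using inQ by blast+
      then have "a = a'" "b = b'" by linarith+
      with \<open>m \<noteq> n\<close> mn show False by simp
    qed
  qed
  define V where "V = Omega \<inter> {x. \<bar>snd x\<bar> < \<delta>}"
  have Vm [measurable]: "V \<in> sets borel" unfolding V_def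
    by (intro sets.Int Omega_borel borel_open open_Collect_less continuous_intros)
  have cov: "AE x in lborel. x \<in> Omega \<longrightarrow> x \<in> V \<or> (\<exists>i\<in>S. x \<in> Q i)"
    using AE_plane_fst[OF AE_not_grid[OF N]] AE_plane_snd[OF AE_not_grid[OF N]]
  proof eventually_elim
    case (elim x)
    show ?case
    proof (intro impI)
      assume x: "x \<in> Omega"
      define i j where "i = \<lfloor>real N * fst x\<rfloor>" and "j = \<lfloor>real N * snd x\<rfloor>"
      have i: "of_int i \<le> real N * fst x" "real N * fst x < of_int i + 1" "of_int i \<noteq> real N * fst x"
        using elim(1) unfolding i_def by (linarith, linarith, metis Ints_of_int)
      have j: "of_int j \<le> real N * snd x" "real N * snd x < of_int j + 1" "of_int j \<noteq> real N * snd x"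
        using elim(2) unfolding j_def by (linarith, linarith, metis Ints_of_int)
      have xQ: "x \<in> Q (i, j)" unfolding inQ using i j by linarith
      have xb: "- real N < real N * fst x" "real N * fst x < real N" "- real N < real N * snd x" "real N * snd x < real N"
        using x inO by blast+
      have b: "- int N \<le> i" "i < int N" "- int N \<le> j" "j < int N" using i j xb by linarith+
      show "x \<in> V \<or> (\<exists>i\<in>S. x \<in> Q i)"
      proof (cases "j = -1 \<or> j = 0")
        case True
        then have "\<bar>real N * snd x\<bar> \<le> 1" using j by auto
        then have "real N * \<bar>snd x\<bar> \<le> real N * s" by (simp add: Ns abs_mult)
        then have "\<bar>snd x\<bar> \<le> s" using N by simp
        then show ?thesis using x s by (simp add: V_def)
      next
        case False
        then have "(i, j) \<in> S" using b by (simp add: S_def)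
        then show ?thesis using xQ by blast
      qed
    qed
  qed
  have VO: "V \<subseteq> Omega" by (simp add: V_def)
  have ev1: "eventually (\<lambda>n. \<forall>i\<in>S. has_weak_deriv (Q i) (coord 1) (d n) (g1 n) \<and> has_weak_deriv (Q i) (coord 2) (d n) (g2 n)) sequentially"
  proof (rule eventually_ball_finite[OF fS], intro ballI)
    fix i assume i: "i \<in> S"
    obtain a b where ab: "i = (a, b)" by (cases i)
    have "b \<ge> 1 \<or> b + 1 \<le> -1" using i ab by (auto simp: S_def)
    then have "0 < of_int b * s \<or> of_int b * s + s < 0"
    proof
      assume "b \<ge> 1" then show ?thesis using s by simp
    next
      assume "b + 1 \<le> -1"
      then have "of_int b + 1 \<le> (-1::real)" by linarith
      then have "(of_int b + 1) * s \<le> -1 * s" using s by (intro mult_right_mono) auto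
      then show ?thesis using s by (simp add: algebra_simps)
    qed
    from wd[OF s(1) _ this, of "of_int a * s"] QO[OF i]
    show "eventually (\<lambda>n. has_weak_deriv (Q i) (coord 1) (d n) (g1 n) \<and> has_weak_deriv (Q i) (coord 2) (d n) (g2 n)) sequentially"
      by (simp add: ab Q_def)
  qed
  have "(\<lambda>n. \<Sum>i\<in>S. (1/s\<^sup>2) * (norm (\<integral>x. d n x \<partial>lborel_on (Q i)))\<^sup>2) \<longlonglongrightarrow> (\<Sum>i\<in>S. (1/s\<^sup>2) * (norm (0::'b))\<^sup>2)"
  proof (intro tendsto_intros)
    fix i assume i: "i \<in> S"
    show "(\<lambda>n. \<integral>x. d n x \<partial>lborel_on (Q i)) \<longlonglongrightarrow> 0"
      using mean[OF s(1), of "of_int (fst i) * s" "of_int (snd i) * s"] QO[OF i] by (simp add: Q_def case_prod_beta)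
  qed
  then have ev2: "eventually (\<lambda>n. (\<Sum>i\<in>S. (1/s\<^sup>2) * (norm (\<integral>x. d n x \<partial>lborel_on (Q i)))\<^sup>2) < e/4) sequentially"
    using e by (intro order_tendstoD(2)) auto
  show "eventually (\<lambda>n. dist (nsq (lborel_on Omega) (d n)) 0 < e) sequentially"
    using ev1 ev2 \<delta>(2)
  proof eventually_elim
    case (elim n)
    have "nsq (lborel_on (Q i)) (d n) \<le> s\<^sup>2 * nsq (lborel_on (Q i)) (g1 n) + s\<^sup>2 * nsq (lborel_on (Q i)) (g2 n) + (1/s\<^sup>2) * (norm (\<integral>x. d n x \<partial>lborel_on (Q i)))\<^sup>2"
      if i: "i \<in> S" for i
    proof -
      note sub = sqint_lborel_on_subset(1)[OF _ QO[OF i] Omega_borel Qm]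
      have "s\<^sup>2 * nsq (lborel_on (Q i)) (d n) - (norm (\<integral>x. d n x \<partial>lborel_on (Q i)))\<^sup>2
          \<le> s^4 * (nsq (lborel_on (Q i)) (g1 n) + nsq (lborel_on (Q i)) (g2 n))"
        using elim(1) i
        by (intro Poincare_square(2)[OF s(1), of "Q i" "of_int (fst i) * s" "of_int (snd i) * s"] sub d g)
           (auto simp: Q_def case_prod_beta)
      then show ?thesis by (rule quartic_bound[OF s(1)])
    qed
    then have "(\<Sum>i\<in>S. nsq (lborel_on (Q i)) (d n)) \<le>
       (\<Sum>i\<in>S. s\<^sup>2 * nsq (lborel_on (Q i)) (g1 n) + s\<^sup>2 * nsq (lborel_on (Q i)) (g2 n) + (1/s\<^sup>2) * (norm (\<integral>x. d n x \<partial>lborel_on (Q i)))\<^sup>2)"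
      by (rule sum_mono)
    also have "\<dots> = s\<^sup>2 * (\<Sum>i\<in>S. nsq (lborel_on (Q i)) (g1 n)) + s\<^sup>2 * (\<Sum>i\<in>S. nsq (lborel_on (Q i)) (g2 n))
        + (\<Sum>i\<in>S. (1/s\<^sup>2) * (norm (\<integral>x. d n x \<partial>lborel_on (Q i)))\<^sup>2)"
      by (simp add: sum.distrib sum_distrib_left)
    also have "\<dots> \<le> s\<^sup>2 * nsq (lborel_on Omega) (g1 n) + s\<^sup>2 * nsq (lborel_on Omega) (g2 n) + e/4"
      using elim(2)
      by (intro add_mono mult_left_mono nsq_lborel_on_cong_sum(2)[OF Omega_borel Vm fS Qm QO VO _ disj] g) auto
    also have "\<dots> \<le> s\<^sup>2 * M + e/4"
      using mult_left_mono[OF M[of n], of "s\<^sup>2"] by (simp add: algebra_simps)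
    finally have 1: "(\<Sum>i\<in>S. nsq (lborel_on (Q i)) (d n)) \<le> s\<^sup>2 * M + e/4" .
    have "nsq (lborel_on Omega) (d n) \<le> nsq (lborel_on V) (d n) + (\<Sum>i\<in>S. nsq (lborel_on (Q i)) (d n))"
      by (rule nsq_lborel_on_cong_sum(1)[OF Omega_borel Vm fS Qm QO VO d cov])
    also have "nsq (lborel_on V) (d n) \<le> e/4" using elim(3) by (simp add: V_def)
    finally have "nsq (lborel_on Omega) (d n) < e" using 1 s(2) e by linarith
    then show ?case by simp
  qed
qed

subsection \<open>Rescaling\<close>

definition stretch :: "real \<Rightarrow> plane \<Rightarrow> plane" where
  "stretch \<epsilon> x = (fst x, \<epsilon> * snd x)"

lemma rescale_eq: "rescale \<epsilon> f = (\<lambda>x. f (stretch \<epsilon> x))"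
  by (simp add: rescale_def stretch_def fun_eq_iff)

lemma stretch_measurable [measurable]: "stretch \<epsilon> \<in> borel_measurable borel"
  unfolding stretch_def[abs_def] by measurable

lemma lborel_stretch:
  assumes "\<epsilon> > 0" shows "(lborel :: plane measure) = density (distr lborel borel (stretch \<epsilon>)) (\<lambda>_. ennreal \<epsilon>)"
proof -
  define c where "c j = (if j = ((1, 0) :: plane) then 1 else \<epsilon>)" for j
  have B: "(Basis :: plane set) = {(1, 0), (0, 1)}" by (auto simp: Basis_prod_def)
  have "(\<Sum>j\<in>Basis. (c j * (x \<bullet> j)) *\<^sub>R j) = stretch \<epsilon> x" for x :: plane
    by (cases x) (simp add: B c_def stretch_def)
  then have T: "(\<lambda>x. 0 + (\<Sum>j\<in>Basis. (c j * (x \<bullet> j)) *\<^sub>R j)) = stretch \<epsilon>" by (simp add: fun_eq_iff)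
  have p: "(\<Prod>j\<in>(Basis :: plane set). \<bar>c j\<bar>) = \<epsilon>" using assms by (simp add: B c_def)
  have "c j \<noteq> 0" for j using assms by (simp add: c_def)
  from lborel_affine_euclidean[of c 0, OF this] show ?thesis unfolding T p .
qed

lemma integrable_stretch_iff:
  fixes f :: "plane \<Rightarrow> 'b::euclidean_space"
  assumes "\<epsilon> > 0" and that: "f \<in> borel_measurable borel"
  shows "integrable lborel (\<lambda>x. f (stretch \<epsilon> x)) \<longleftrightarrow> integrable lborel f"
proof -
  have "integrable lborel f \<longleftrightarrow> integrable (density (distr lborel borel (stretch \<epsilon>)) (\<lambda>_. ennreal \<epsilon>)) f"
    by (subst lborel_stretch[OF assms(1)]) simp
  also have "\<dots> \<longleftrightarrow> integrable (distr lborel borel (stretch \<epsilon>)) (\<lambda>x. \<epsilon> *\<^sub>R f x)"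
    using assms that by (intro integrable_density) auto
  also have "\<dots> \<longleftrightarrow> integrable lborel (\<lambda>x. \<epsilon> *\<^sub>R f (stretch \<epsilon> x))"
    using that by (intro integrable_distr_eq) measurable
  also have "\<dots> \<longleftrightarrow> integrable lborel (\<lambda>x. f (stretch \<epsilon> x))"
  proof
    assume "integrable lborel (\<lambda>x. \<epsilon> *\<^sub>R f (stretch \<epsilon> x))"
    from integrable_scaleR_right[OF this, of "1/\<epsilon>"] show "integrable lborel (\<lambda>x. f (stretch \<epsilon> x))"
      using assms by simp
  qed (rule integrable_scaleR_right)
  finally show ?thesis by simp
qed

lemma integral_stretch:
  fixes f :: "plane \<Rightarrow> 'b::euclidean_space"
  assumes "\<epsilon> > 0" "f \<in> borel_measurable borel"
  shows "(LBINT x. f x) = \<epsilon> *\<^sub>R (LBINT x. f (stretch \<epsilon> x))"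
proof -
  have "(LBINT x. f x) = (\<integral>x. f x \<partial>density (distr lborel borel (stretch \<epsilon>)) (\<lambda>_. ennreal \<epsilon>))"
    by (subst lborel_stretch[OF assms(1)]) simp
  also have "\<dots> = (\<integral>x. \<epsilon> *\<^sub>R f x \<partial>distr lborel borel (stretch \<epsilon>))"
    using assms by (intro integral_density) auto
  also have "\<dots> = (LBINT x. \<epsilon> *\<^sub>R f (stretch \<epsilon> x))"
    using assms by (intro integral_distr) measurable
  finally show ?thesis by simp
qed

lemma layer_borel [simp, measurable]: "layer \<epsilon> \<xi> \<in> sets borel"
  unfolding layer_def by (intro borel_open open_Times) auto

lemma open_layer: "open (layer \<epsilon> \<xi>)" unfolding layer_def by (intro open_Times) auto

lemma bounded_layer: "bounded (layer \<epsilon> \<xi>)" unfolding layer_def by (intro bounded_Times) auto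

lemma stretch_in_layer: "\<epsilon> > 0 \<Longrightarrow> stretch \<epsilon> x \<in> layer \<epsilon> \<xi> \<longleftrightarrow> x \<in> layer 1 \<xi>"
proof -
  assume e: "\<epsilon> > 0"
  have "- (\<epsilon> * \<xi> / 2) < \<epsilon> * t \<longleftrightarrow> - (1 * \<xi> / 2) < t" "\<epsilon> * t < \<epsilon> * \<xi> / 2 \<longleftrightarrow> t < 1 * \<xi> / 2" for t
    using e mult_less_cancel_left_pos[of \<epsilon> "- (\<xi> / 2)" t] mult_less_cancel_left_pos[of \<epsilon> t "\<xi> / 2"] by auto
  then show ?thesis by (cases x) (simp add: stretch_def layer_def)
qed

subsection \<open>Columns of matrix fields\<close>

text \<open>The adjoint of \<open>column j\<close>: it turns a test field for a column into a test
  field for the matrix.\<close>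

definition colmat :: "2 \<Rightarrow> real^2 \<Rightarrow> real^2^2" where
  "colmat j v = (\<chi> i l. if l = j then v $ i else 0)"

lemma bounded_linear_colmat: "bounded_linear (colmat j)"
  by (intro linear_conv_bounded_linear[THEN iffD1] linearI) (auto simp: colmat_def vec_eq_iff)

lemma bounded_linear_column: "bounded_linear (\<lambda>A::real^2^2. column j A)"
  by (intro linear_conv_bounded_linear[THEN iffD1] linearI) (auto simp: column_def vec_eq_iff)

lemma column_measurable [measurable (raw)]:
  "f \<in> borel_measurable M \<Longrightarrow> (\<lambda>x. column j (f x :: real^2^2)) \<in> borel_measurable M"
  using bounded_linear_column by (rule borel_measurable_continuous_on[OF linear_continuous_on])

lemma colmat_measurable [measurable (raw)]:
  "f \<in> borel_measurable M \<Longrightarrow> (\<lambda>x. colmat j (f x)) \<in> borel_measurable M"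
  using bounded_linear_colmat by (rule borel_measurable_continuous_on[OF linear_continuous_on])

lemma inner_colmat: "A \<bullet> colmat j v = column j A \<bullet> v"
proof -
  have "A \<bullet> colmat j v = (\<Sum>i\<in>UNIV. \<Sum>l\<in>UNIV. A $ i $ l * (if l = j then v $ i else 0))"
    by (simp add: inner_vec_def colmat_def)
  also have "\<dots> = (\<Sum>i\<in>UNIV. A $ i $ j * v $ i)"
    by (intro sum.cong refl) (simp add: if_distrib cong: if_cong)
  finally show ?thesis by (simp add: inner_vec_def column_def)
qed

lemma norm_matrix_columns: "(norm (A::real^2^2))\<^sup>2 = (norm (column 1 A))\<^sup>2 + (norm (column 2 A))\<^sup>2"
  by (simp add: power2_norm_eq_inner inner_vec_def column_def sum_2)

lemma norm_column_le: "norm (column j (A::real^2^2)) \<le> norm A"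
proof -
  have "(norm (column j A))\<^sup>2 \<le> (norm A)\<^sup>2"
    unfolding norm_matrix_columns using exhaust_2[of j] by auto
  then show ?thesis by (rule power2_le_imp_le) simp
qed

lemma norm_colmat: "norm (colmat j v) = norm v"
proof -
  have "(norm (colmat j v))\<^sup>2 = (norm v)\<^sup>2"
    using exhaust_2[of j] unfolding norm_matrix_columns
    by (auto simp: power2_norm_eq_inner inner_vec_def column_def colmat_def)
  then show ?thesis by simp
qed

lemma second_column_eq: "second_column d x = colmat 2 (d x)"
  by (simp add: second_column_def colmat_def)

lemma weak_grad_columns:
  "weak_grad U k x = colmat 1 (weak_deriv U (coord 1) k x) + colmat 2 (weak_deriv U (coord 2) k x)"
  by (simp add: weak_grad_def colmat_def vec_eq_iff forall_2)

lemma column_weak_grad: "column j (weak_grad U k x) = weak_deriv U (coord j) k x"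
  by (simp add: weak_grad_def column_def vec_eq_iff)

lemma sqint_column:
  assumes "sqint M (A :: _ \<Rightarrow> real^2^2)" shows "sqint M (\<lambda>x. column j (A x))" "nsq M (\<lambda>x. column j (A x)) \<le> nsq M A"
proof -
  show "sqint M (\<lambda>x. column j (A x))"
    using assms norm_column_le by (intro sqintI_bound[OF _ sqint_integrable[OF assms]]) (auto intro!: power_mono)
  then show "nsq M (\<lambda>x. column j (A x)) \<le> nsq M A"
    unfolding nsq_def using assms norm_column_le
    by (intro integral_mono) (auto simp: sqint_def intro!: power_mono)
qed

subsection \<open>Changing the domain of integration\<close>

lemma integral_lborel_on_subset:
  fixes h :: "'a::euclidean_space \<Rightarrow> 'b::euclidean_space"
  assumes VU: "V \<subseteq> U" and [measurable]: "U \<in> sets borel" "V \<in> sets borel"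
    and h: "h \<in> borel_measurable (lborel_on U)" and z: "AE x in lborel. x \<in> U \<longrightarrow> x \<notin> V \<longrightarrow> h x = 0"
  shows "integral\<^sup>L (lborel_on U) h = integral\<^sup>L (lborel_on V) h"
proof -
  have m: "(\<lambda>x. indicator U x *\<^sub>R h x) \<in> borel_measurable lborel"
    using h by (simp add: borel_measurable_restrict_space_iff)
  have e: "indicator V x *\<^sub>R h x = indicator V x *\<^sub>R (indicator U x *\<^sub>R h x)" for x using VU by (auto simp: indicator_def)
  have "(LBINT x. indicator U x *\<^sub>R h x) = (LBINT x. indicator V x *\<^sub>R h x)"
  proof (rule integral_cong_AE)
    show "(\<lambda>x. indicator U x *\<^sub>R h x) \<in> borel_measurable lborel" by (rule m)
    show "(\<lambda>x. indicator V x *\<^sub>R h x) \<in> borel_measurable lborel" unfolding e using m by measurable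
    show "AE x in lborel. indicator U x *\<^sub>R h x = indicator V x *\<^sub>R h x"
      using z by eventually_elim (use VU in \<open>auto simp: indicator_def\<close>)
  qed
  then show ?thesis by (simp add: integral_restrict_space)
qed

lemma test_fun_outside: "test_fun V \<phi> \<Longrightarrow> x \<notin> V \<Longrightarrow> \<phi> x = 0"
  unfolding test_fun_def by blast

lemma set_integral_test_fun_subset:
  fixes f :: "'a::euclidean_space \<Rightarrow> 'b::euclidean_space"
  assumes "test_fun V \<phi>" "V \<subseteq> U"
  shows "(LBINT x:U. \<phi> x *\<^sub>R f x) = (LBINT x:V. \<phi> x *\<^sub>R f x)"
proof -
  have "indicator U x *\<^sub>R (\<phi> x *\<^sub>R f x) = indicator V x *\<^sub>R (\<phi> x *\<^sub>R f x)" for x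
    using assms test_fun_outside[OF assms(1), of x] by (auto simp: indicator_def)
  then show ?thesis by (simp only: set_lebesgue_integral_def)
qed

lemma loc_integrable_subset: "loc_integrable U f \<Longrightarrow> V \<subseteq> U \<Longrightarrow> loc_integrable V f"
  unfolding loc_integrable_def by blast

text \<open>Local integrability speaks only about compact sets, so measurability is assembled from
  countably many closed boxes that exhaust \<open>U\<close>.\<close>

lemma loc_integrable_measurable:
  fixes f :: "'a::euclidean_space \<Rightarrow> 'b::euclidean_space"
  assumes U: "open U" and f: "loc_integrable U f"
  shows "f \<in> borel_measurable (lborel_on U)"
proof -
  obtain D where D: "countable D" "D \<subseteq> Pow U" "\<And>X. X \<in> D \<Longrightarrow> \<exists>a b. X = cbox a b" "\<Union>D = U"
    using open_countable_Union_open_cbox[OF U] by metis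
  show ?thesis
  proof (rule measurable_piecewise_restrict[OF D(1)])
    show "space (lborel_on U) \<subseteq> \<Union>D" using D(4) by (simp add: space_restrict_space)
    fix X assume X: "X \<in> D"
    then obtain a b where ab: "X = cbox a b" using D(3) by blast
    have XU: "X \<subseteq> U" using X D(2) by blast
    have Xm: "X \<in> sets borel" by (simp add: ab)
    show "X \<inter> space (lborel_on U) \<in> sets (lborel_on U)"
      using XU Xm U by (simp add: space_restrict_space sets_restrict_space Int_absorb2 image_iff) (metis Int_absorb1)
    have "set_integrable lborel X f" using f XU unfolding loc_integrable_def ab by (simp add: compact_cbox)
    then have "f \<in> borel_measurable (lborel_on X)"
      using Xm by (auto simp: set_integrable_lborel_on)
    moreover have "restrict_space (lborel_on U) X = lborel_on X"
      using XU Xm U by (simp add: restrict_restrict_space Int_absorb1)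
    ultimately show "f \<in> borel_measurable (restrict_space (lborel_on U) X)" by simp
  qed
qed

lemma sqint_loc_integrable:
  fixes f :: "'a::euclidean_space \<Rightarrow> 'b::euclidean_space"
  assumes f: "sqint (lborel_on U) f" and U: "U \<in> sets borel" "bounded U"
  shows "loc_integrable U f" "integrable (lborel_on U) f" "set_integrable lborel U f"
proof -
  show i: "integrable (lborel_on U) f"
    by (rule sqint_integrable_finite[OF f finite_measure_lborel_on[OF U(2,1)]])
  then show s: "set_integrable lborel U f" using U by (simp add: set_integrable_lborel_on)
  show "loc_integrable U f" unfolding loc_integrable_def
  proof (intro allI impI)
    fix K assume K: "compact K \<and> K \<subseteq> U"
    show "set_integrable lborel K f"
      using s by (rule set_integrable_subset) (use K in \<open>auto intro: borel_closed compact_imp_closed\<close>)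
  qed
qed

text \<open>Besides shrinking the domain, the derivative may be changed on a null set; this is used
  where \<open>B\<close> vanishes almost everywhere.\<close>

lemma has_weak_deriv_restrict:
  assumes wd: "has_weak_deriv U v f g" and VU: "V \<subseteq> U" and V: "open V" and g: "AE x in lborel. x \<in> V \<longrightarrow> g x = g' x"
    and g': "loc_integrable V g'"
  shows "has_weak_deriv V v f g'"
  unfolding has_weak_deriv_def
proof (intro conjI allI impI)
  show "loc_integrable V f" "loc_integrable V g'"
    using wd VU g' unfolding has_weak_deriv_def by (auto intro: loc_integrable_subset)
  fix \<phi> assume \<phi>: "test_fun V \<phi>"
  have Vb [measurable]: "V \<in> sets borel" using V by simp
  have gV: "loc_integrable V g" using wd VU unfolding has_weak_deriv_def by (auto intro: loc_integrable_subset)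
  have pm [measurable]: "\<phi> \<in> borel_measurable borel" by (rule test_fun_measurable[OF \<phi>])
  have "(LBINT x:V. dir_deriv v \<phi> x *\<^sub>R f x) = (LBINT x:U. dir_deriv v \<phi> x *\<^sub>R f x)"
    by (rule set_integral_test_fun_subset[OF test_fun_dir_deriv[OF \<phi>] VU, symmetric])
  also have "\<dots> = - (LBINT x:U. \<phi> x *\<^sub>R g x)" by (rule has_weak_derivD[OF wd test_fun_mono[OF \<phi> VU]])
  also have "(LBINT x:U. \<phi> x *\<^sub>R g x) = (LBINT x:V. \<phi> x *\<^sub>R g x)"
    by (rule set_integral_test_fun_subset[OF \<phi> VU])
  also have "\<dots> = (LBINT x:V. \<phi> x *\<^sub>R g' x)"
    unfolding set_integral_lborel_on[OF Vb]
  proof (rule integral_cong_AE)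
    have [measurable]: "g \<in> borel_measurable (lborel_on V)" "g' \<in> borel_measurable (lborel_on V)"
      using loc_integrable_measurable[OF V] gV g' by auto
    have [measurable]: "\<phi> \<in> borel_measurable (lborel_on V)" by (rule measurable_restrict_space1) simp
    show "(\<lambda>x. \<phi> x *\<^sub>R g x) \<in> borel_measurable (lborel_on V)" "(\<lambda>x. \<phi> x *\<^sub>R g' x) \<in> borel_measurable (lborel_on V)"
      by measurable
    show "AE x in lborel_on V. \<phi> x *\<^sub>R g x = \<phi> x *\<^sub>R g' x"
      using g by (auto simp: AE_lborel_on elim!: eventually_mono)
  qed
  finally show "(LBINT x:V. dir_deriv v \<phi> x *\<^sub>R f x) = - (LBINT x:V. \<phi> x *\<^sub>R g' x)" .
qed

lemma integral_lborel_on_stretch: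
  fixes f :: "plane \<Rightarrow> 'b::euclidean_space"
  assumes e: "\<epsilon> > 0" and f: "f \<in> borel_measurable (lborel_on (layer \<epsilon> \<xi>))"
  shows "integral\<^sup>L (lborel_on (layer \<epsilon> \<xi>)) f = \<epsilon> *\<^sub>R (\<integral>x. f (stretch \<epsilon> x) \<partial>lborel_on (layer 1 \<xi>))"
    and "integrable (lborel_on (layer \<epsilon> \<xi>)) f \<longleftrightarrow> integrable (lborel_on (layer 1 \<xi>)) (\<lambda>x. f (stretch \<epsilon> x))"
    and "(\<lambda>x. f (stretch \<epsilon> x)) \<in> borel_measurable (lborel_on (layer 1 \<xi>))"
proof -
  define F where "F x = indicator (layer \<epsilon> \<xi>) x *\<^sub>R f x" for x
  have F [measurable]: "F \<in> borel_measurable borel"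
    using f by (simp add: borel_measurable_restrict_space_iff F_def[abs_def])
  have i: "indicator (layer 1 \<xi>) x *\<^sub>R f (stretch \<epsilon> x) = F (stretch \<epsilon> x)" for x
    using stretch_in_layer[OF e, of x \<xi>] by (simp add: F_def indicator_def)
  show "integral\<^sup>L (lborel_on (layer \<epsilon> \<xi>)) f = \<epsilon> *\<^sub>R (\<integral>x. f (stretch \<epsilon> x) \<partial>lborel_on (layer 1 \<xi>))"
    using integral_stretch[OF e F] by (simp add: integral_restrict_space i F_def[abs_def])
  show "integrable (lborel_on (layer \<epsilon> \<xi>)) f \<longleftrightarrow> integrable (lborel_on (layer 1 \<xi>)) (\<lambda>x. f (stretch \<epsilon> x))"
    using integrable_stretch_iff[OF e F] by (simp add: integrable_restrict_space i F_def[abs_def])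
  show "(\<lambda>x. f (stretch \<epsilon> x)) \<in> borel_measurable (lborel_on (layer 1 \<xi>))"
    by (subst borel_measurable_restrict_space_iff) (simp_all add: i)
qed

lemma sqint_stretch:
  assumes e: "\<epsilon> > 0" and f: "sqint (lborel_on (layer \<epsilon> \<xi>)) f"
  shows "sqint (lborel_on (layer 1 \<xi>)) (rescale \<epsilon> f)"
    and "nsq (lborel_on (layer \<epsilon> \<xi>)) f = \<epsilon> * nsq (lborel_on (layer 1 \<xi>)) (rescale \<epsilon> f)"
proof -
  have f': "f \<in> borel_measurable (lborel_on (layer \<epsilon> \<xi>))" using f by auto
  have m: "(\<lambda>x. (norm (f x))\<^sup>2) \<in> borel_measurable (lborel_on (layer \<epsilon> \<xi>))" using f by measurable
  show "sqint (lborel_on (layer 1 \<xi>)) (rescale \<epsilon> f)"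
    using f integral_lborel_on_stretch(2)[OF e m] integral_lborel_on_stretch(3)[OF e f'] by (simp add: sqint_def rescale_eq)
  show "nsq (lborel_on (layer \<epsilon> \<xi>)) f = \<epsilon> * nsq (lborel_on (layer 1 \<xi>)) (rescale \<epsilon> f)"
    using integral_lborel_on_stretch(1)[OF e m] by (simp add: nsq_def rescale_eq)
qed

lemma bounded_linear_stretch: "bounded_linear (stretch \<epsilon>)"
  by (intro linear_conv_bounded_linear[THEN iffD1] linearI) (auto simp: stretch_def algebra_simps)

text \<open>The factor \<open>1/\<epsilon>\<close> on the second derivative is the origin both of
  the scaled curl and of the different scaling of the two columns of the rescaled gradient.\<close>

lemma test_fun_stretch:
  assumes e: "\<epsilon> > 0" and \<phi>: "test_fun (layer 1 \<xi>) \<phi>"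
  shows "test_fun (layer \<epsilon> \<xi>) (\<lambda>x. \<phi> (stretch (1/\<epsilon>) x))"
    and "dir_deriv (coord 1) (\<lambda>x. \<phi> (stretch (1/\<epsilon>) x)) x = dir_deriv (coord 1) \<phi> (stretch (1/\<epsilon>) x)"
    and "dir_deriv (coord 2) (\<lambda>x. \<phi> (stretch (1/\<epsilon>) x)) x = (1/\<epsilon>) * dir_deriv (coord 2) \<phi> (stretch (1/\<epsilon>) x)"
proof -
  note s = test_fun_smooth[OF \<phi>]
  have inv: "stretch \<epsilon> (stretch (1/\<epsilon>) x) = x" "stretch (1/\<epsilon>) (stretch \<epsilon> x) = x" for x
    using e by (simp_all add: stretch_def)
  obtain K where K: "compact K" "K \<subseteq> layer 1 \<xi>" "\<And>x. x \<notin> K \<Longrightarrow> \<phi> x = 0"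
    using \<phi> unfolding test_fun_def by blast
  have sm: "smooth_fun (\<lambda>x. \<phi> (stretch (1/\<epsilon>) x))"
    using smooth_fun_compose_affine[OF s bounded_linear_stretch, of 0] by simp
  have "compact (stretch \<epsilon> ` K)"
    by (intro compact_continuous_image K linear_continuous_on bounded_linear_stretch)
  moreover have "stretch \<epsilon> ` K \<subseteq> layer \<epsilon> \<xi>" using K(2) stretch_in_layer[OF e] by blast
  moreover have "\<phi> (stretch (1/\<epsilon>) x) = 0" if "x \<notin> stretch \<epsilon> ` K" for x
    using that K(3)[of "stretch (1/\<epsilon>) x"] inv by (metis image_eqI)
  ultimately show "test_fun (layer \<epsilon> \<xi>) (\<lambda>x. \<phi> (stretch (1/\<epsilon>) x))"
    unfolding test_fun_def using sm by blast
  have d: "((\<lambda>x. \<phi> (stretch (1/\<epsilon>) x)) has_derivative (\<lambda>v. dir_deriv (stretch (1/\<epsilon>) v) \<phi> (stretch (1/\<epsilon>) x))) (at x)"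
    using has_derivative_compose_affine[OF s bounded_linear_stretch, of 0] by simp
  show "dir_deriv (coord 1) (\<lambda>x. \<phi> (stretch (1/\<epsilon>) x)) x = dir_deriv (coord 1) \<phi> (stretch (1/\<epsilon>) x)"
    by (subst dir_derivI[OF d]) (simp add: coord_def stretch_def)
  have "stretch (1/\<epsilon>) (coord 2) = (1/\<epsilon>) *\<^sub>R coord 2" by (simp add: coord_def stretch_def)
  moreover have "dir_deriv ((1/\<epsilon>) *\<^sub>R coord 2) \<phi> y = (1/\<epsilon>) * dir_deriv (coord 2) \<phi> y" for y
    using linear_scale[OF has_derivative_linear[OF has_derivative_smooth[OF s]]] by simp
  ultimately show "dir_deriv (coord 2) (\<lambda>x. \<phi> (stretch (1/\<epsilon>) x)) x = (1/\<epsilon>) * dir_deriv (coord 2) \<phi> (stretch (1/\<epsilon>) x)"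
    by (subst dir_derivI[OF d]) simp
qed

lemma dir_deriv_cong_open:
  assumes "open S" "x \<in> S" "\<And>y. y \<in> S \<Longrightarrow> f y = g y" "smooth_fun g"
  shows "dir_deriv v f x = dir_deriv v g x"
proof -
  have "(f has_derivative (\<lambda>v. dir_deriv v g x)) (at x)"
    using has_derivative_smooth[OF assms(4)] assms(1,2)
    by (rule has_derivative_transform_within_open) (simp add: assms(3))
  then show ?thesis by (rule dir_derivI)
qed

text \<open>A normalised primitive of a test function of mass one.\<close>

lemma smooth_step:
  fixes a b :: real
  assumes "a < b"
  obtains \<theta> where "smooth_fun \<theta>" "\<And>s. s \<le> a \<Longrightarrow> \<theta> s = 0" "\<And>s. b \<le> s \<Longrightarrow> \<theta> s = 1"
proof -
  obtain \<psi> where \<psi>: "test_fun {a<..<b} \<psi>" "(LBINT x. \<psi> x) = 1" using ex_test_fun_mass1[OF assms] .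
  obtain F where F: "\<And>x. (F has_real_derivative \<psi> x) (at x)" "smooth_fun F"
    using smooth_primitive[OF test_fun_smooth[OF \<psi>(1)]] by blast
  have cF: "continuous_on A F" for A using smooth_fun_continuous F by blast
  have c\<psi>: "isCont \<psi> x" for x
    using test_fun_continuous[OF \<psi>(1), of UNIV] by (simp add: continuous_on_eq_continuous_at)
  have "F b - F a = (LBINT x. \<psi> x * indicator {a..b} x)"
    using F c\<psi> assms by (subst integral_FTC_Icc_real) auto
  also have "(\<lambda>x. \<psi> x * indicator {a..b} x) = \<psi>"
  proof
    show "\<psi> x * indicator {a..b} x = \<psi> x" for x
      using test_fun_outside[OF \<psi>(1), of x] by (cases "x \<in> {a<..<b}") auto
  qed
  finally have ab: "F b = F a + 1" using \<psi>(2) by simp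
  show ?thesis
  proof (rule that[of "\<lambda>s. F s - F a"])
    show "smooth_fun (\<lambda>s. F s - F a)" by (intro smooth_fun_diff F smooth_fun_const)
    fix s
    show "F s - F a = 0" if "s \<le> a"
    proof (cases "s = a")
      case False
      then have "s < a" using that by simp
      moreover have "(F has_real_derivative 0) (at y)" if "y < a" for y
        using F(1)[of y] test_fun_outside[OF \<psi>(1), of y] that by simp
      ultimately show ?thesis using DERIV_isconst_end[OF _ cF, of s a] by simp
    qed simp
    show "F s - F a = 1" if "b \<le> s"
    proof (cases "s = b")
      case False
      then have "b < s" using that by simp
      moreover have "(F has_real_derivative 0) (at y)" if "b < y" for y
        using F(1)[of y] test_fun_outside[OF \<psi>(1), of y] that by simp
      ultimately show ?thesis using DERIV_isconst_end[OF _ cF, of b s] ab by simp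
    qed (simp add: ab)
  qed
qed

lemma set_integrable_test_fun:
  fixes f :: "'a::euclidean_space \<Rightarrow> 'b::euclidean_space"
  assumes \<phi>: "test_fun U \<phi>" and f: "loc_integrable U f"
  shows "set_integrable lborel U (\<lambda>x. \<phi> x *\<^sub>R f x)"
proof -
  obtain K where K: "compact K" "K \<subseteq> U" "\<And>x. x \<notin> K \<Longrightarrow> \<phi> x = 0"
    using \<phi> unfolding test_fun_def by blast
  have "integrable lborel (\<lambda>x. indicator K x *\<^sub>R f x)"
    using f K unfolding loc_integrable_def set_integrable_def by blast
  from integrable_test_fun_scaleR[OF \<phi> this]
  have "integrable lborel (\<lambda>x. \<phi> x *\<^sub>R (indicator K x *\<^sub>R f x))" .
  moreover have "\<phi> x *\<^sub>R (indicator K x *\<^sub>R f x) = indicator U x *\<^sub>R (\<phi> x *\<^sub>R f x)" for x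
    using K(2) K(3)[of x] by (auto simp: indicator_def)
  ultimately show ?thesis unfolding set_integrable_def by (simp only:)
qed

text \<open>\<open>weak_curl\<close> merely chooses some curl; uniqueness identifies the chosen one
  with an explicitly computed candidate.\<close>

lemma has_weak_curl_unique:
  assumes U: "open U" and c: "has_weak_curl \<epsilon> U B c" "has_weak_curl \<epsilon> U B c'"
  shows "AE x in lborel. x \<in> U \<longrightarrow> c x = c' x"
proof -
  have "AE x in lborel. x \<in> U \<longrightarrow> c x $ i - c' x $ i = 0" for i
  proof (rule fundamental_lemma[OF U])
    have l: "loc_integrable U (\<lambda>x. c x $ i)" "loc_integrable U (\<lambda>x. c' x $ i)"
      using c unfolding has_weak_curl_def has_weak_row_curl_def by blast+
    then show "loc_integrable U (\<lambda>x. c x $ i - c' x $ i)"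
      unfolding loc_integrable_def by (auto intro: set_integral_diff)
    fix \<phi> assume \<phi>: "test_fun U \<phi>"
    note int = set_integrable_test_fun[OF \<phi>, unfolded real_scaleR_def]
    have "(LBINT x:U. \<phi> x * c x $ i) = (LBINT x:U. \<phi> x * c' x $ i)"
      using c \<phi> unfolding has_weak_curl_def has_weak_row_curl_def by simp
    then show "(LBINT x:U. \<phi> x *\<^sub>R (c x $ i - c' x $ i)) = 0"
      using set_integral_diff(2)[OF int[OF l(1)] int[OF l(2)]] by (simp add: right_diff_distrib)
  qed
  then have "AE x in lborel. \<forall>i. x \<in> U \<longrightarrow> c x $ i - c' x $ i = 0" by (subst AE_all_countable) auto
  then show ?thesis by eventually_elim (auto simp: vec_eq_iff)
qed

subsection \<open>A single configuration of bounded energy\<close>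

text \<open>One index of the sequence is treated in isolation, so that every bound is explicit in
  \<open>C\<close>, \<open>C0\<close>, \<open>\<xi>\<close> and \<open>\<epsilon>\<close> and its
  uniformity along the sequence can be read off. The bounds \<open>\<xi> < 1\<close> and
  \<open>\<epsilon> < 1\<close> keep the layer inside \<open>Omega\<close>, and the former also
  leaves room to its left.\<close>

locale layer_state =
  fixes W :: "real \<Rightarrow> real" and \<xi> C C0 \<epsilon> :: real
    and k :: "plane \<Rightarrow> real^2" and B :: "plane \<Rightarrow> real^2^2"
  assumes W_nonneg: "\<And>x. x \<ge> 0 \<Longrightarrow> W x \<ge> 0" and W_cont: "continuous_on {0..} W"
    and C0: "C0 > 0" and W_growth: "\<And>x. x \<ge> 0 \<Longrightarrow> x\<^sup>2 / C0 - C0 \<le> W x"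
    and xi: "0 < \<xi>" "\<xi> < 1" and eps: "0 < \<epsilon>" "\<epsilon> < 1" and C: "0 \<le> C"
    and k: "k \<in> W12 Omega" and B: "B \<in> Hcurl 1 Omega"
    and off: "AE x in lborel. x \<in> Omega - layer \<epsilon> \<xi> \<longrightarrow> B x = 0"
    and energy: "energy W \<epsilon> \<xi> k B \<le> ennreal C"
begin

abbreviation N :: "plane measure" where "N \<equiv> lborel_on (layer 1 \<xi>)"

abbreviation energy_density :: "plane \<Rightarrow> real" where
  "energy_density x \<equiv> (norm (k x) - 1)\<^sup>2 / (\<epsilon> * \<xi>\<^sup>2) + (norm (weak_grad Omega k x - B x))\<^sup>2
      + \<epsilon> * \<xi>\<^sup>2 * (norm (weak_curl 1 Omega B x))\<^sup>2 + 1 / (\<epsilon> * \<xi>\<^sup>2) * W (\<epsilon> * \<xi> * norm (B x))"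

definition H :: "plane \<Rightarrow> real^2^2" where "H x = weak_grad Omega k x - B x"
definition c :: "plane \<Rightarrow> real^2" where "c = weak_curl 1 Omega B"
definition kt :: "plane \<Rightarrow> real^2" where "kt = rescale \<epsilon> k"
text \<open>The factor \<open>\<epsilon>\<close> in this and the next two fields is the one for
  which the squared norm on the fixed layer is \<open>\<epsilon>\<close> times that on the thin
  layer.\<close>

definition Bt :: "plane \<Rightarrow> real^2^2" where "Bt x = \<epsilon> *\<^sub>R rescale \<epsilon> B x"
definition ct :: "plane \<Rightarrow> real^2" where "ct x = \<epsilon> *\<^sub>R rescale \<epsilon> c x"
definition Ht :: "plane \<Rightarrow> real^2^2" where "Ht x = \<epsilon> *\<^sub>R rescale \<epsilon> H x"

lemma layer_subset: "layer \<epsilon> \<xi> \<subseteq> Omega"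
proof -
  have "\<epsilon> * \<xi> < 1 * 1" using xi eps by (intro mult_strict_mono) auto
  then show ?thesis using xi by (auto simp: layer_def Omega_def)
qed

lemma off_AE: "AE x in lborel. x \<in> Omega \<longrightarrow> x \<notin> layer \<epsilon> \<xi> \<longrightarrow> B x = 0"
  using off by eventually_elim auto

lemma sqint_k: "sqint (lborel_on Omega) k" and sqint_B: "sqint (lborel_on Omega) B"
  using k B by (auto simp: W12_def Hcurl_def L2_iff_sqint)

lemma weak_deriv_k: "has_weak_deriv Omega (coord j) k (weak_deriv Omega (coord j) k)"
proof -
  have "coord j \<in> Basis" by (auto simp: coord_def Basis_prod_def)
  then have "\<exists>g. has_weak_deriv Omega (coord j) k g" using k unfolding W12_def by blast
  then show ?thesis unfolding weak_deriv_def by (rule someI_ex)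
qed

lemma weak_deriv_k_measurable: "weak_deriv Omega (coord j) k \<in> borel_measurable (lborel_on Omega)"
  using weak_deriv_k[of j] unfolding has_weak_deriv_def by (blast intro: loc_integrable_measurable open_Omega)

lemma weak_curl_B: "has_weak_curl 1 Omega B c"
proof -
  have "\<exists>c. has_weak_curl 1 Omega B c" using B unfolding Hcurl_def by blast
  then show ?thesis unfolding c_def weak_curl_def by (rule someI_ex)
qed

lemma c_measurable [measurable]: "c \<in> borel_measurable (lborel_on Omega)"
proof -
  have cm: "(\<lambda>x. c x $ i) \<in> borel_measurable (lborel_on Omega)" for i
    using weak_curl_B unfolding has_weak_curl_def has_weak_row_curl_def
    by (blast intro: loc_integrable_measurable open_Omega)
  have "(\<lambda>x. \<Sum>i\<in>UNIV. (c x $ i) *\<^sub>R axis i (1::real)) \<in> borel_measurable (lborel_on Omega)"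
    by (intro borel_measurable_sum borel_measurable_scaleR cm borel_measurable_const)
  moreover have "(\<Sum>i\<in>UNIV. (c x $ i) *\<^sub>R axis i (1::real)) = c x" for x
    by (simp add: vec_eq_iff axis_def if_distrib cong: if_cong)
  ultimately show ?thesis by simp
qed

lemma H_measurable [measurable]: "H \<in> borel_measurable (lborel_on Omega)"
proof -
  note [measurable] = weak_deriv_k_measurable sqint_measurable[OF sqint_B]
  show ?thesis unfolding H_def[abs_def] weak_grad_columns by measurable
qed

lemma column_H: "column j (H x) = weak_deriv Omega (coord j) k x - column j (B x)"
  using bounded_linear.linear[OF bounded_linear_column, of j]
  by (simp add: H_def linear_diff column_weak_grad)

lemma terms_nonneg:
  "0 \<le> (norm (k x) - 1)\<^sup>2 / (\<epsilon> * \<xi>\<^sup>2)" "0 \<le> (norm (weak_grad Omega k x - B x))\<^sup>2"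
  "0 \<le> \<epsilon> * \<xi>\<^sup>2 * (norm (weak_curl 1 Omega B x))\<^sup>2" "0 \<le> 1 / (\<epsilon> * \<xi>\<^sup>2) * W (\<epsilon> * \<xi> * norm (B x))"
  using xi eps by (auto intro!: mult_nonneg_nonneg W_nonneg divide_nonneg_nonneg)

lemma energy_terms:
  assumes "\<And>x. 0 \<le> f x"
    and "\<And>x. f x \<le> energy_density x"
  shows "(\<integral>\<^sup>+x. ennreal (f x) \<partial>lborel_on Omega) \<le> ennreal C"
proof -
  have "(\<integral>\<^sup>+x. ennreal (f x) \<partial>lborel_on Omega) = (\<integral>\<^sup>+x. ennreal (f x) * indicator Omega x \<partial>lborel)"
    by (simp add: nn_integral_restrict_space)
  also have "\<dots> \<le> energy W \<epsilon> \<xi> k B" unfolding energy_def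
    using assms(2) by (intro nn_integral_mono mult_right_mono ennreal_leI) auto
  finally show ?thesis using energy by (rule order_trans)
qed

lemma sqint_modulus: "sqint (lborel_on Omega) (\<lambda>x. norm (k x) - 1)" "nsq (lborel_on Omega) (\<lambda>x. norm (k x) - 1) \<le> C * (\<epsilon> * \<xi>\<^sup>2)"
proof -
  note [measurable] = sqint_measurable[OF sqint_k]
  have p: "\<epsilon> * \<xi>\<^sup>2 > 0" using xi eps by simp
  have "(\<integral>\<^sup>+x. ennreal ((norm (k x) - 1)\<^sup>2 / (\<epsilon> * \<xi>\<^sup>2)) \<partial>lborel_on Omega) \<le> ennreal C"
  proof (rule energy_terms)
    show "0 \<le> (norm (k x) - 1)\<^sup>2 / (\<epsilon> * \<xi>\<^sup>2)" for x using p by simp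
    show "(norm (k x) - 1)\<^sup>2 / (\<epsilon> * \<xi>\<^sup>2) \<le> energy_density x" for x
      using terms_nonneg[of x] by linarith
  qed
  then have "ennreal (\<epsilon> * \<xi>\<^sup>2) * (\<integral>\<^sup>+x. ennreal ((norm (k x) - 1)\<^sup>2 / (\<epsilon> * \<xi>\<^sup>2)) \<partial>lborel_on Omega) \<le> ennreal (\<epsilon> * \<xi>\<^sup>2) * ennreal C"
    by (rule mult_left_mono) simp
  also have "ennreal (\<epsilon> * \<xi>\<^sup>2) * (\<integral>\<^sup>+x. ennreal ((norm (k x) - 1)\<^sup>2 / (\<epsilon> * \<xi>\<^sup>2)) \<partial>lborel_on Omega)
     = (\<integral>\<^sup>+x. ennreal ((norm (norm (k x) - 1))\<^sup>2) \<partial>lborel_on Omega)"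
    using p by (subst nn_integral_cmult[symmetric]) (auto intro!: nn_integral_cong simp: ennreal_mult'[symmetric])
  also have "ennreal (\<epsilon> * \<xi>\<^sup>2) * ennreal C = ennreal (C * (\<epsilon> * \<xi>\<^sup>2))" using p by (subst mult.commute[of C]) (rule ennreal_mult'[symmetric], simp)
  finally show "sqint (lborel_on Omega) (\<lambda>x. norm (k x) - 1)" "nsq (lborel_on Omega) (\<lambda>x. norm (k x) - 1) \<le> C * (\<epsilon> * \<xi>\<^sup>2)"
    using p C by (auto intro: sqintI_nn_integral)
qed

lemma sqint_H: "sqint (lborel_on Omega) H" "nsq (lborel_on Omega) H \<le> C"
proof -
  have "(\<integral>\<^sup>+x. ennreal ((norm (H x))\<^sup>2) \<partial>lborel_on Omega) \<le> ennreal C"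
  proof (rule energy_terms)
    show "(norm (H x))\<^sup>2 \<le> energy_density x" for x
      using terms_nonneg[of x] unfolding H_def by linarith
  qed simp
  then show "sqint (lborel_on Omega) H" "nsq (lborel_on Omega) H \<le> C"
    using C by (auto intro: sqintI_nn_integral)
qed

lemma sqint_c: "sqint (lborel_on Omega) c" "\<epsilon> * \<xi>\<^sup>2 * nsq (lborel_on Omega) c \<le> C"
proof -
  have p: "\<epsilon> * \<xi>\<^sup>2 > 0" using xi eps by simp
  have "(\<integral>\<^sup>+x. ennreal (\<epsilon> * \<xi>\<^sup>2 * (norm (c x))\<^sup>2) \<partial>lborel_on Omega) \<le> ennreal C"
  proof (rule energy_terms)
    show "0 \<le> \<epsilon> * \<xi>\<^sup>2 * (norm (c x))\<^sup>2" for x using terms_nonneg(3)[of x] by (simp only: c_def)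
    show "\<epsilon> * \<xi>\<^sup>2 * (norm (c x))\<^sup>2 \<le> energy_density x" for x
      using terms_nonneg[of x] unfolding c_def by linarith
  qed
  \<comment> \<open>The weight is absorbed into the field, so that one criterion yields both
    integrability and the bound.\<close>
  moreover have "(\<integral>\<^sup>+x. ennreal (\<epsilon> * \<xi>\<^sup>2 * (norm (c x))\<^sup>2) \<partial>lborel_on Omega) = (\<integral>\<^sup>+x. ennreal ((norm (sqrt (\<epsilon> * \<xi>\<^sup>2) *\<^sub>R c x))\<^sup>2) \<partial>lborel_on Omega)"
    using p by (intro nn_integral_cong) (simp add: power_mult_distrib)
  ultimately have "sqint (lborel_on Omega) (\<lambda>x. sqrt (\<epsilon> * \<xi>\<^sup>2) *\<^sub>R c x)" and le: "nsq (lborel_on Omega) (\<lambda>x. sqrt (\<epsilon> * \<xi>\<^sup>2) *\<^sub>R c x) \<le> C"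
    using C by (auto intro!: sqintI_nn_integral)
  from sqint_scaleR[OF this(1), of "1 / sqrt (\<epsilon> * \<xi>\<^sup>2)"] show "sqint (lborel_on Omega) c"
    using xi eps by simp
  have "(sqrt (\<epsilon> * \<xi>\<^sup>2))\<^sup>2 = \<epsilon> * \<xi>\<^sup>2" using p by simp
  with le show "\<epsilon> * \<xi>\<^sup>2 * nsq (lborel_on Omega) c \<le> C" by (simp only: nsq_scaleR)
qed

lemma emeasure_layer: "emeasure lborel (layer \<epsilon> \<xi>) = ennreal ((1 + \<xi>) * (\<epsilon> * \<xi>))"
proof -
  have "emeasure (lborel \<Otimes>\<^sub>M lborel) (layer \<epsilon> \<xi>) = ennreal (1 + \<xi>) * ennreal (\<epsilon> * \<xi>)"
    unfolding layer_def using xi eps by (subst lborel.emeasure_pair_measure_Times) auto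
  then show ?thesis using xi eps by (simp add: lborel_prod ennreal_mult')
qed

lemma measure_layer: "measure lborel (layer \<epsilon> \<xi>) = (1 + \<xi>) * (\<epsilon> * \<xi>)"
  using emeasure_layer xi eps by (simp add: measure_def)

text \<open>Quadratic growth bounds
  \<open>\<epsilon>\<^sup>2 * \<xi>\<^sup>2 * (norm (B x))\<^sup>2\<close> by
  \<open>C0\<^sup>2 + C0 * W (\<epsilon> * \<xi> * norm (B x))\<close>. Integrating over the layer,
  of area \<open>(1 + \<xi>) * (\<epsilon> * \<xi>)\<close>, and dividing by
  \<open>\<epsilon> * \<xi>\<^sup>2\<close> produces this constant.\<close>

definition KB :: real where "KB = C0\<^sup>2 * (1 + \<xi>) / \<xi> + C0 * C"

lemma nsq_B_layer: "\<epsilon> * nsq (lborel_on (layer \<epsilon> \<xi>)) B \<le> KB"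
proof -
  let ?L = "layer \<epsilon> \<xi>"
  have p: "\<epsilon> * \<xi>\<^sup>2 > 0" using xi eps by simp
  note [measurable] = sqint_measurable[OF sqint_B]
  define w where "w x = 1 / (\<epsilon> * \<xi>\<^sup>2) * W (\<epsilon> * \<xi> * norm (B x))" for x
  have wm: "w \<in> borel_measurable (lborel_on Omega)"
  proof -
    \<comment> \<open>Continuity of \<open>W\<close> is available only on the half-line, so it is
      extended by the value \<open>W 0\<close> before composing.\<close>
    have "continuous_on UNIV (\<lambda>x. W (max 0 x))"
      by (rule continuous_on_compose2[OF W_cont]) (auto intro!: continuous_intros)
    then have [measurable]: "(\<lambda>x. W (max 0 x)) \<in> borel_measurable borel" by (rule borel_measurable_continuous_onI)
    have weq: "w = (\<lambda>x. 1 / (\<epsilon> * \<xi>\<^sup>2) * W (max 0 (\<epsilon> * \<xi> * norm (B x))))"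
      using xi eps by (simp add: w_def max_absorb2 fun_eq_iff)
    show ?thesis unfolding weq by measurable
  qed
  have wn: "0 \<le> w x" for x unfolding w_def by (rule terms_nonneg(4))
  have nw: "(\<integral>\<^sup>+x. ennreal (w x) \<partial>lborel_on Omega) \<le> ennreal C"
  proof (rule energy_terms[OF wn])
    show "w x \<le> energy_density x" for x
      using terms_nonneg[of x] unfolding w_def by linarith
  qed
  have iw: "integrable (lborel_on Omega) w"
    using wm wn nw by (intro integrableI_nonneg) (auto simp: less_top[symmetric] top_unique)
  have Iw: "integral\<^sup>L (lborel_on Omega) w \<le> C"
    using nn_integral_eq_integral[OF iw] wn nw C by (simp add: ennreal_le_iff)
  have iwL: "integrable lborel (\<lambda>x. indicator ?L x * w x)" and IwL: "(LBINT x. indicator ?L x * w x) \<le> C"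
  proof -
    have i1: "integrable lborel (\<lambda>x. indicator Omega x *\<^sub>R w x)" using iw by (simp add: integrable_restrict_space)
    from integrable_mult_indicator[OF _ this, of ?L]
    have "integrable lborel (\<lambda>x. indicator ?L x *\<^sub>R (indicator Omega x *\<^sub>R w x))" by simp
    moreover have "indicator ?L x *\<^sub>R (indicator Omega x *\<^sub>R w x) = indicator ?L x * w x" for x
      using layer_subset by (auto simp: indicator_def)
    ultimately show i2: "integrable lborel (\<lambda>x. indicator ?L x * w x)" by (simp only:)
    have "(LBINT x. indicator ?L x * w x) \<le> (LBINT x. indicator Omega x *\<^sub>R w x)"
      using i1 i2 wn layer_subset by (intro integral_mono) (auto simp: indicator_def)
    then show "(LBINT x. indicator ?L x * w x) \<le> C" using Iw by (simp add: integral_restrict_space)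
  qed
  have pt: "\<epsilon>\<^sup>2 * \<xi>\<^sup>2 * (norm (B x))\<^sup>2 \<le> C0\<^sup>2 + C0 * (\<epsilon> * \<xi>\<^sup>2) * w x" for x
  proof -
    have "(\<epsilon> * \<xi> * norm (B x))\<^sup>2 / C0 - C0 \<le> W (\<epsilon> * \<xi> * norm (B x))" using xi eps by (intro W_growth) auto
    also have "W (\<epsilon> * \<xi> * norm (B x)) = (\<epsilon> * \<xi>\<^sup>2) * w x" using xi eps by (simp add: w_def)
    finally have "C0 * ((\<epsilon> * \<xi> * norm (B x))\<^sup>2 / C0) \<le> C0 * (C0 + (\<epsilon> * \<xi>\<^sup>2) * w x)"
      using C0 by (intro mult_left_mono) auto
    then show ?thesis using C0 by (simp add: power_mult_distrib power2_eq_square algebra_simps)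
  qed
  have iL: "integrable lborel (\<lambda>x. indicator ?L x * C0\<^sup>2)"
    by (intro integrable_mult_left integrable_real_indicator) (simp_all add: emeasure_layer)
  have sB: "sqint (lborel_on ?L) B" by (rule sqint_lborel_on_subset(1)[OF sqint_B layer_subset]) auto
  have "\<epsilon>\<^sup>2 * \<xi>\<^sup>2 * nsq (lborel_on ?L) B = (LBINT x. \<epsilon>\<^sup>2 * \<xi>\<^sup>2 * (indicator ?L x * (norm (B x))\<^sup>2))"
    by (simp add: nsq_def integral_restrict_space)
  also have "\<dots> \<le> (LBINT x. indicator ?L x * C0\<^sup>2 + C0 * (\<epsilon> * \<xi>\<^sup>2) * (indicator ?L x * w x))"
  proof (rule integral_mono)
    show "integrable lborel (\<lambda>x. \<epsilon>\<^sup>2 * \<xi>\<^sup>2 * (indicator ?L x * (norm (B x))\<^sup>2))"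
      using sB by (intro integrable_mult_right) (simp add: sqint_def integrable_restrict_space)
    show "integrable lborel (\<lambda>x. indicator ?L x * C0\<^sup>2 + C0 * (\<epsilon> * \<xi>\<^sup>2) * (indicator ?L x * w x))"
      by (intro Bochner_Integration.integrable_add iL integrable_mult_right iwL)
    show "\<epsilon>\<^sup>2 * \<xi>\<^sup>2 * (indicator ?L x * (norm (B x))\<^sup>2) \<le> indicator ?L x * C0\<^sup>2 + C0 * (\<epsilon> * \<xi>\<^sup>2) * (indicator ?L x * w x)" for x
      using pt[of x] by (simp add: indicator_def)
  qed
  also have "\<dots> = measure lborel ?L * C0\<^sup>2 + C0 * (\<epsilon> * \<xi>\<^sup>2) * (LBINT x. indicator ?L x * w x)"
    using iL iwL by simp
  also have "\<dots> \<le> (1 + \<xi>) * (\<epsilon> * \<xi>) * C0\<^sup>2 + C0 * (\<epsilon> * \<xi>\<^sup>2) * C"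
    using IwL C0 p by (intro add_mono mult_left_mono) (auto simp: measure_layer)
  also have "\<dots> = (\<epsilon> * \<xi>\<^sup>2) * KB"
    using xi by (simp add: KB_def power2_eq_square field_simps)
  finally have "(\<epsilon> * \<xi>\<^sup>2) * (\<epsilon> * nsq (lborel_on ?L) B) \<le> (\<epsilon> * \<xi>\<^sup>2) * KB"
    by (simp add: power2_eq_square ac_simps)
  then show ?thesis using p by (rule mult_left_le_imp_le)
qed

lemma sqint_Bt: "sqint N Bt" "nsq N Bt \<le> KB"
proof -
  have s: "sqint (lborel_on (layer \<epsilon> \<xi>)) B" by (rule sqint_lborel_on_subset(1)[OF sqint_B layer_subset]) auto
  show "sqint N Bt"
    unfolding Bt_def[abs_def] by (intro sqint_scaleR sqint_stretch(1)[OF eps(1) s])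
  have "nsq N Bt = \<epsilon>\<^sup>2 * nsq N (rescale \<epsilon> B)"
    unfolding Bt_def[abs_def] by (rule nsq_scaleR)
  also have "\<dots> = \<epsilon> * nsq (lborel_on (layer \<epsilon> \<xi>)) B"
    unfolding sqint_stretch(2)[OF eps(1) s] by (simp add: power2_eq_square)
  finally show "nsq N Bt \<le> KB" using nsq_B_layer by simp
qed

lemma sqint_ct: "sqint N ct" "nsq N ct \<le> C / \<xi>\<^sup>2"
proof -
  have s: "sqint (lborel_on (layer \<epsilon> \<xi>)) c" by (rule sqint_lborel_on_subset(1)[OF sqint_c(1) layer_subset]) auto
  show "sqint N ct"
    unfolding ct_def[abs_def] by (intro sqint_scaleR sqint_stretch(1)[OF eps(1) s])
  have "nsq N ct = \<epsilon>\<^sup>2 * nsq N (rescale \<epsilon> c)"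
    unfolding ct_def[abs_def] by (rule nsq_scaleR)
  also have "\<dots> = \<epsilon> * nsq (lborel_on (layer \<epsilon> \<xi>)) c"
    unfolding sqint_stretch(2)[OF eps(1) s] by (simp add: power2_eq_square)
  also have "\<dots> \<le> \<epsilon> * nsq (lborel_on Omega) c"
    using eps by (intro mult_left_mono sqint_lborel_on_subset(2)[OF sqint_c(1) layer_subset]) auto
  also have "\<dots> \<le> C / \<xi>\<^sup>2" using sqint_c(2) xi by (simp add: field_simps)
  finally show "nsq N ct \<le> C / \<xi>\<^sup>2" .
qed

text \<open>The unscaled \<open>H\<close> is already bounded on \<open>Omega\<close>, so the factor
  from rescaling survives and makes \<open>Ht\<close> vanish in the limit.\<close>

lemma sqint_Ht: "sqint N Ht" "nsq N Ht \<le> \<epsilon> * C"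
proof -
  have s: "sqint (lborel_on (layer \<epsilon> \<xi>)) H" by (rule sqint_lborel_on_subset(1)[OF sqint_H(1) layer_subset]) auto
  show "sqint N Ht"
    unfolding Ht_def[abs_def] by (intro sqint_scaleR sqint_stretch(1)[OF eps(1) s])
  have "nsq N Ht = \<epsilon>\<^sup>2 * nsq N (rescale \<epsilon> H)"
    unfolding Ht_def[abs_def] by (rule nsq_scaleR)
  also have "\<dots> = \<epsilon> * nsq (lborel_on (layer \<epsilon> \<xi>)) H"
    unfolding sqint_stretch(2)[OF eps(1) s] by (simp add: power2_eq_square)
  also have "\<dots> \<le> \<epsilon> * nsq (lborel_on Omega) H"
    using eps by (intro mult_left_mono sqint_lborel_on_subset(2)[OF sqint_H(1) layer_subset]) auto
  also have "\<dots> \<le> \<epsilon> * C" using sqint_H(2) eps by (intro mult_left_mono) auto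
  finally show "nsq N Ht \<le> \<epsilon> * C" .
qed

text \<open>Writing \<open>norm (k x)\<close> as \<open>(norm (k x) - 1) + 1\<close> bounds the mass
  of \<open>k\<close> on a set by its area up to a term of order \<open>\<epsilon>\<close>. This
  serves both the bound on the rescaled field and the exclusion of concentration near the
  axis.\<close>

lemma nsq_k_subset:
  assumes "V \<subseteq> Omega" "V \<in> sets borel"
  shows "nsq (lborel_on V) k \<le> 2 * (C * (\<epsilon> * \<xi>\<^sup>2)) + 2 * measure lborel V"
proof -
  have fin: "emeasure lborel V < \<infinity>" using assms bounded_subset[OF bounded_Omega] by (intro emeasure_bounded_finite)
  have 1: "sqint (lborel_on V) (\<lambda>x. norm (k x) - 1)" "nsq (lborel_on V) (\<lambda>x. norm (k x) - 1) \<le> C * (\<epsilon> * \<xi>\<^sup>2)"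
    using sqint_lborel_on_subset[OF sqint_modulus(1) assms(1) _ assms(2)] sqint_modulus(2) by auto
  have 2: "sqint (lborel_on V) (\<lambda>x. 1 :: real)" "nsq (lborel_on V) (\<lambda>x. 1 :: real) = measure lborel V"
    using fin assms(2) by (simp_all add: sqint_def nsq_def integrable_restrict_space integral_restrict_space
        measure_def emeasure_restrict_space)
  have "nsq (lborel_on V) k = nsq (lborel_on V) (\<lambda>x. (norm (k x) - 1) + 1)" by (simp add: nsq_def)
  also have "\<dots> \<le> 2 * nsq (lborel_on V) (\<lambda>x. norm (k x) - 1) + 2 * nsq (lborel_on V) (\<lambda>x. 1::real)"
    by (rule nsq_add_le[OF 1(1) 2(1)])
  finally show ?thesis using 1(2) 2(2) by linarith
qed

lemma sqint_kt: "sqint N kt" "nsq N kt \<le> 2 * C * \<xi>\<^sup>2 + 2 * ((1 + \<xi>) * \<xi>)"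
proof -
  have s: "sqint (lborel_on (layer \<epsilon> \<xi>)) k" by (rule sqint_lborel_on_subset(1)[OF sqint_k layer_subset]) auto
  show "sqint N kt"
    unfolding kt_def by (rule sqint_stretch(1)[OF eps(1) s])
  have "\<epsilon> * nsq N kt = nsq (lborel_on (layer \<epsilon> \<xi>)) k"
    unfolding kt_def by (rule sqint_stretch(2)[OF eps(1) s, symmetric])
  also have "\<dots> \<le> \<epsilon> * (2 * C * \<xi>\<^sup>2 + 2 * ((1 + \<xi>) * \<xi>))"
    using nsq_k_subset[OF layer_subset layer_borel] by (simp add: measure_layer algebra_simps)
  finally show "nsq N kt \<le> 2 * C * \<xi>\<^sup>2 + 2 * ((1 + \<xi>) * \<xi>)"
    using eps(1) by (rule mult_left_le_imp_le)
qed

text \<open>The weak form of the statement that \<open>Ht + Bt\<close> has columns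
  \<open>\<epsilon>\<close> times the first and once the second partial derivative of
  \<open>kt\<close>: rescaling the second variable absorbs the prefactor in that direction
  only.\<close>

lemma weak_deriv_k_layer:
  assumes \<phi>: "test_fun (layer 1 \<xi>) \<phi>"
  shows "(\<integral>x. dir_deriv (coord 2) \<phi> x *\<^sub>R kt x \<partial>N)
      = - (\<integral>x. \<phi> x *\<^sub>R column 2 (Ht x + Bt x) \<partial>N)"
    and "\<epsilon> *\<^sub>R (\<integral>x. dir_deriv (coord 1) \<phi> x *\<^sub>R kt x \<partial>N)
      = - (\<integral>x. \<phi> x *\<^sub>R column 1 (Ht x + Bt x) \<partial>N)"
proof -
  define \<psi> where "\<psi> x = \<phi> (stretch (1/\<epsilon>) x)" for x
  note t = test_fun_stretch[OF eps(1) \<phi>, folded \<psi>_def]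
  have \<psi>: "test_fun (layer \<epsilon> \<xi>) \<psi>" using t(1) unfolding \<psi>_def .
  have d1: "dir_deriv (coord 1) \<psi> (stretch \<epsilon> x) = dir_deriv (coord 1) \<phi> x"
    and d2: "dir_deriv (coord 2) \<psi> (stretch \<epsilon> x) = (1/\<epsilon>) * dir_deriv (coord 2) \<phi> x"
    and d0: "\<psi> (stretch \<epsilon> x) = \<phi> x" for x
    using test_fun_stretch(2,3)[OF eps(1) \<phi>, of "stretch \<epsilon> x"] eps
    unfolding \<psi>_def[abs_def] by (simp_all add: stretch_def)
  have mk: "k \<in> borel_measurable (lborel_on (layer \<epsilon> \<xi>))"
    by (intro sqint_measurable sqint_lborel_on_subset(1)[OF sqint_k layer_subset]) auto
  have mj: "weak_deriv Omega (coord j) k \<in> borel_measurable (lborel_on (layer \<epsilon> \<xi>))" for j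
    using weak_deriv_k[of j] loc_integrable_subset[OF _ layer_subset] unfolding has_weak_deriv_def
    by (blast intro: loc_integrable_measurable open_layer)
  have eq: "\<epsilon> *\<^sub>R (\<integral>x. dir_deriv (coord j) \<psi> (stretch \<epsilon> x) *\<^sub>R k (stretch \<epsilon> x) \<partial>N)
     = - (\<epsilon> *\<^sub>R (\<integral>x. \<psi> (stretch \<epsilon> x) *\<^sub>R weak_deriv Omega (coord j) k (stretch \<epsilon> x) \<partial>N))" for j
  proof -
    have td: "test_fun (layer \<epsilon> \<xi>) (dir_deriv (coord j) \<psi>)" by (rule test_fun_dir_deriv[OF \<psi>])
    have [measurable]: "\<psi> \<in> borel_measurable (lborel_on (layer \<epsilon> \<xi>))" "dir_deriv (coord j) \<psi> \<in> borel_measurable (lborel_on (layer \<epsilon> \<xi>))"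
      using test_fun_measurable[OF \<psi>] test_fun_measurable[OF td] by (auto intro!: measurable_restrict_space1)
    note [measurable] = mk mj[of j]
    have "(LBINT x:layer \<epsilon> \<xi>. dir_deriv (coord j) \<psi> x *\<^sub>R k x) = - (LBINT x:layer \<epsilon> \<xi>. \<psi> x *\<^sub>R weak_deriv Omega (coord j) k x)"
      using has_weak_derivD[OF weak_deriv_k[of j] test_fun_mono[OF \<psi> layer_subset]]
      unfolding set_integral_test_fun_subset[OF td layer_subset] set_integral_test_fun_subset[OF \<psi> layer_subset] .
    then show ?thesis
      unfolding set_integral_lborel_on[OF layer_borel]
      by (subst (asm) integral_lborel_on_stretch(1)[OF eps(1)], measurable) 
         (subst (asm) integral_lborel_on_stretch(1)[OF eps(1)], measurable)
  qed
  have col: "\<epsilon> *\<^sub>R weak_deriv Omega (coord j) k (stretch \<epsilon> x) = column j (Ht x + Bt x)" for x j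
  proof -
    interpret L: bounded_linear "\<lambda>A::real^2^2. column j A" by (rule bounded_linear_column)
    show ?thesis by (simp add: Ht_def Bt_def rescale_eq L.add L.scaleR column_H scaleR_right_diff_distrib)
  qed
  have "(\<integral>x. dir_deriv (coord 2) \<phi> x *\<^sub>R kt x \<partial>N)
    = \<epsilon> *\<^sub>R (\<integral>x. dir_deriv (coord 2) \<psi> (stretch \<epsilon> x) *\<^sub>R k (stretch \<epsilon> x) \<partial>N)"
    unfolding integral_scaleR_right[symmetric] d2 kt_def rescale_eq using eps by simp
  also have "\<dots> = - (\<integral>x. \<phi> x *\<^sub>R (\<epsilon> *\<^sub>R weak_deriv Omega (coord 2) k (stretch \<epsilon> x)) \<partial>N)"
    unfolding eq unfolding d0 integral_scaleR_right[symmetric] by (simp add: mult.commute)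
  finally show "(\<integral>x. dir_deriv (coord 2) \<phi> x *\<^sub>R kt x \<partial>N)
      = - (\<integral>x. \<phi> x *\<^sub>R column 2 (Ht x + Bt x) \<partial>N)" unfolding col .
  have "\<epsilon> *\<^sub>R (\<integral>x. dir_deriv (coord 1) \<phi> x *\<^sub>R kt x \<partial>N)
    = \<epsilon> *\<^sub>R (\<integral>x. dir_deriv (coord 1) \<psi> (stretch \<epsilon> x) *\<^sub>R k (stretch \<epsilon> x) \<partial>N)"
    unfolding d1 kt_def rescale_eq ..
  also have "\<dots> = - (\<integral>x. \<phi> x *\<^sub>R (\<epsilon> *\<^sub>R weak_deriv Omega (coord 1) k (stretch \<epsilon> x)) \<partial>N)"
    unfolding eq unfolding d0 integral_scaleR_right[symmetric] by (simp add: mult.commute)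
  finally show "\<epsilon> *\<^sub>R (\<integral>x. dir_deriv (coord 1) \<phi> x *\<^sub>R kt x \<partial>N)
      = - (\<integral>x. \<phi> x *\<^sub>R column 1 (Ht x + Bt x) \<partial>N)" unfolding col .
qed

text \<open>The gradient identity after cutting the layer out of \<open>k\<close>. Both
  \<open>B\<close> and the removed part of \<open>k\<close> live on the layer and are rewritten in
  rescaled variables, where the first becomes the bounded field \<open>Bt\<close> and the second
  keeps an explicit factor \<open>\<epsilon>\<close>.\<close>

lemma weak_deriv_k_Omega:
  assumes \<phi>: "test_fun Omega \<phi>"
  shows "(\<integral>x. dir_deriv (coord j) \<phi> x *\<^sub>R (indicator (Omega - layer \<epsilon> \<xi>) x *\<^sub>R k x) \<partial>lborel_on Omega)
      = - (\<integral>x. \<phi> x *\<^sub>R column j (H x) \<partial>lborel_on Omega)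
        - (\<integral>x. \<phi> (stretch \<epsilon> x) *\<^sub>R column j (Bt x) \<partial>N)
        - \<epsilon> *\<^sub>R (\<integral>x. dir_deriv (coord j) \<phi> (stretch \<epsilon> x) *\<^sub>R kt x \<partial>N)"
proof -
  let ?L = "layer \<epsilon> \<xi>"
  define e where "e = dir_deriv (coord j) \<phi>"
  have te: "test_fun Omega e" unfolding e_def by (rule test_fun_dir_deriv[OF \<phi>])
  have pm: "\<phi> \<in> borel_measurable (lborel_on U)" "e \<in> borel_measurable (lborel_on U)" for U
    using test_fun_measurable[OF \<phi>] test_fun_measurable[OF te] by (auto intro!: measurable_restrict_space1)
  obtain Ce Cp where bd: "\<And>x. \<bar>e x\<bar> \<le> Ce" "\<And>x. \<bar>\<phi> x\<bar> \<le> Cp" using test_fun_bounded[OF te] test_fun_bounded[OF \<phi>] by blast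
  have ik: "integrable (lborel_on Omega) k" "integrable (lborel_on Omega) B" "integrable (lborel_on Omega) H"
    using sqint_k sqint_B sqint_H(1) by (auto intro: sqint_loc_integrable bounded_Omega)
  have icol: "integrable (lborel_on Omega) (\<lambda>x. column j (A x))" if "integrable (lborel_on Omega) A" for A :: "plane \<Rightarrow> real^2^2"
    using that by (rule integrable_bounded_linear[OF bounded_linear_column])
  have iek: "integrable (lborel_on Omega) (\<lambda>x. e x *\<^sub>R k x)"
    by (rule integrable_bounded_scaleR[OF ik(1) pm(2) bd(1)])
  have iH: "integrable (lborel_on Omega) (\<lambda>x. \<phi> x *\<^sub>R column j (H x))"
    by (rule integrable_bounded_scaleR[OF icol[OF ik(3)] pm(1) bd(2)])
  have iB: "integrable (lborel_on Omega) (\<lambda>x. \<phi> x *\<^sub>R column j (B x))"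
    by (rule integrable_bounded_scaleR[OF icol[OF ik(2)] pm(1) bd(2)])
  have iLk: "integrable (lborel_on Omega) (\<lambda>x. indicator ?L x *\<^sub>R (e x *\<^sub>R k x))"
    by (rule integrable_mult_indicator[OF _ iek]) (use layer_subset in \<open>auto simp: sets_restrict_space intro!: image_eqI[of _ _ ?L]\<close>)
  have mL: "k \<in> borel_measurable (lborel_on ?L)" "B \<in> borel_measurable (lborel_on ?L)"
    by (intro sqint_measurable sqint_lborel_on_subset(1)[OF sqint_k layer_subset] sqint_lborel_on_subset(1)[OF sqint_B layer_subset]; simp)+
  have "(\<integral>x. e x *\<^sub>R (indicator (Omega - ?L) x *\<^sub>R k x) \<partial>lborel_on Omega)
      = (\<integral>x. e x *\<^sub>R k x - indicator ?L x *\<^sub>R (e x *\<^sub>R k x) \<partial>lborel_on Omega)"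
    by (intro Bochner_Integration.integral_cong) (auto simp: space_restrict_space indicator_def)
  also have "\<dots> = (\<integral>x. e x *\<^sub>R k x \<partial>lborel_on Omega) - (\<integral>x. indicator ?L x *\<^sub>R (e x *\<^sub>R k x) \<partial>lborel_on Omega)"
    by (rule Bochner_Integration.integral_diff[OF iek iLk])
  also have "(\<integral>x. indicator ?L x *\<^sub>R (e x *\<^sub>R k x) \<partial>lborel_on Omega) = (\<integral>x. e x *\<^sub>R k x \<partial>lborel_on ?L)"
  proof -
    have "indicator Omega x *\<^sub>R (indicator ?L x *\<^sub>R (e x *\<^sub>R k x)) = indicator ?L x *\<^sub>R (e x *\<^sub>R k x)" for x
      using layer_subset by (auto simp: indicator_def)
    then show ?thesis by (simp only: integral_restrict_space Omega_borel layer_borel sets.Int sets.top space_borel space_lborel sets_lborel Int_UNIV_right)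
  qed
  also have "(\<integral>x. e x *\<^sub>R k x \<partial>lborel_on ?L) = \<epsilon> *\<^sub>R (\<integral>x. e (stretch \<epsilon> x) *\<^sub>R kt x \<partial>N)"
    unfolding kt_def rescale_eq
    by (intro integral_lborel_on_stretch(1)[OF eps(1)] borel_measurable_scaleR mL pm)
  also have "(\<integral>x. e x *\<^sub>R k x \<partial>lborel_on Omega) = - (\<integral>x. \<phi> x *\<^sub>R weak_deriv Omega (coord j) k x \<partial>lborel_on Omega)"
    using has_weak_derivD[OF weak_deriv_k[of j] \<phi>] unfolding set_integral_lborel_on[OF Omega_borel] e_def .
  also have "(\<integral>x. \<phi> x *\<^sub>R weak_deriv Omega (coord j) k x \<partial>lborel_on Omega)
     = (\<integral>x. \<phi> x *\<^sub>R column j (H x) + \<phi> x *\<^sub>R column j (B x) \<partial>lborel_on Omega)"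
    by (simp add: column_H scaleR_right_diff_distrib)
  also have "\<dots> = (\<integral>x. \<phi> x *\<^sub>R column j (H x) \<partial>lborel_on Omega) + (\<integral>x. \<phi> x *\<^sub>R column j (B x) \<partial>lborel_on Omega)"
    by (rule Bochner_Integration.integral_add[OF iH iB])
  also have "(\<integral>x. \<phi> x *\<^sub>R column j (B x) \<partial>lborel_on Omega) = (\<integral>x. \<phi> x *\<^sub>R column j (B x) \<partial>lborel_on ?L)"
  proof (rule integral_lborel_on_subset[OF layer_subset Omega_borel layer_borel])
    show "(\<lambda>x. \<phi> x *\<^sub>R column j (B x)) \<in> borel_measurable (lborel_on Omega)" using iB by auto
    have c0: "column j (0::real^2^2) = 0" by (simp add: column_def vec_eq_iff)
    show "AE x in lborel. x \<in> Omega \<longrightarrow> x \<notin> ?L \<longrightarrow> \<phi> x *\<^sub>R column j (B x) = 0"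
      using off_AE by eventually_elim (auto simp: c0)
  qed
  also have "\<dots> = \<epsilon> *\<^sub>R (\<integral>x. \<phi> (stretch \<epsilon> x) *\<^sub>R column j (B (stretch \<epsilon> x)) \<partial>N)"
    by (intro integral_lborel_on_stretch(1)[OF eps(1)] borel_measurable_scaleR mL pm column_measurable)
  also have "\<dots> = (\<integral>x. \<phi> (stretch \<epsilon> x) *\<^sub>R column j (Bt x) \<partial>N)"
  proof -
    interpret L: bounded_linear "\<lambda>A::real^2^2. column j A" by (rule bounded_linear_column)
    show ?thesis unfolding integral_scaleR_right[symmetric] Bt_def rescale_eq by (simp add: L.scaleR mult.commute)
  qed
  finally show ?thesis unfolding e_def[symmetric] by simp
qed

end

section \<open>The curl of a single configuration\<close>

lemma borel_measurable_vec_nth: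
  fixes f :: "'c \<Rightarrow> 'd::euclidean_space ^ 'n"
  shows "f \<in> borel_measurable M \<Longrightarrow> (\<lambda>x. f x $ i) \<in> borel_measurable M"
  by (rule borel_measurable_continuous_on[OF linear_continuous_on[OF bounded_linear_vec_nth]])

lemma sqint_entry:
  fixes f :: "'c \<Rightarrow> 'd::euclidean_space ^ 'n"
  shows "sqint M f \<Longrightarrow> sqint M (\<lambda>x. f x $ i)"
  by (rule sqintI_bound[OF _ sqint_integrable]) (auto intro!: power_mono component_le_norm_cart borel_measurable_vec_nth Finite_Cartesian_Product.norm_nth_le simp: sqint_def)

context layer_state begin

lemma curl_identity:
  assumes "test_fun Omega \<phi>"
  shows "(\<integral>x. \<phi> x * c x $ i \<partial>lborel_on Omega) =
    - (\<integral>x. dir_deriv (coord 1) \<phi> x * B x $ i $ 2 - dir_deriv (coord 2) \<phi> x * B x $ i $ 1 \<partial>lborel_on Omega)"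
  using weak_curl_B assms unfolding has_weak_curl_def has_weak_row_curl_def
  by (simp add: set_integral_lborel_on)

lemma B_entry_measurable: "(\<lambda>x. B x $ i $ j) \<in> borel_measurable (lborel_on Omega)"
  using sqint_measurable[OF sqint_B] by (intro borel_measurable_vec_nth)

text \<open>On an open set where \<open>B\<close> vanishes almost everywhere its distributional curl
  vanishes too. What such an open set misses of the complement of the layer is contained in the four
  lines bounding the layer.\<close>

lemma curl_zero_off_layer: "AE x in lborel. x \<in> Omega \<longrightarrow> x \<notin> layer \<epsilon> \<xi> \<longrightarrow> c x = 0"
proof -
  define V where "V = Omega - ({-\<xi>..1} \<times> {-(\<epsilon> * \<xi> / 2)..\<epsilon> * \<xi> / 2})"
  have Vo: "open V" unfolding V_def by (intro open_Diff open_Omega closed_Times) auto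
  have VO: "V \<subseteq> Omega" by (auto simp: V_def)
  have VL: "V \<inter> layer \<epsilon> \<xi> = {}" by (auto simp: V_def layer_def)
  have Vb [simp]: "V \<in> sets borel" using Vo by simp
  have "AE x in lborel. x \<in> V \<longrightarrow> c x $ i = 0" for i
  proof (rule fundamental_lemma[OF Vo])
    show "loc_integrable V (\<lambda>x. c x $ i)"
      using weak_curl_B loc_integrable_subset[OF _ VO] unfolding has_weak_curl_def has_weak_row_curl_def by blast
    fix \<phi> assume \<phi>: "test_fun V \<phi>"
    have "(LBINT x:V. \<phi> x *\<^sub>R c x $ i) = (LBINT x:Omega. \<phi> x *\<^sub>R c x $ i)"
      by (rule set_integral_test_fun_subset[OF \<phi> VO, symmetric])
    also have "\<dots> = (\<integral>x. \<phi> x * c x $ i \<partial>lborel_on Omega)" by (simp add: set_integral_lborel_on)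
    also have "\<dots> = - (\<integral>x. dir_deriv (coord 1) \<phi> x * B x $ i $ 2 - dir_deriv (coord 2) \<phi> x * B x $ i $ 1 \<partial>lborel_on Omega)"
      by (rule curl_identity[OF test_fun_mono[OF \<phi> VO]])
    also have "(\<integral>x. dir_deriv (coord 1) \<phi> x * B x $ i $ 2 - dir_deriv (coord 2) \<phi> x * B x $ i $ 1 \<partial>lborel_on Omega) = 0"
    proof -
      have td: "test_fun V (dir_deriv (coord j) \<phi>)" for j by (rule test_fun_dir_deriv[OF \<phi>])
      have "AE x in lborel_on Omega. dir_deriv (coord 1) \<phi> x * B x $ i $ 2 - dir_deriv (coord 2) \<phi> x * B x $ i $ 1 = 0"
        unfolding AE_lborel_on[OF Omega_borel] using off_AE
      proof eventually_elim
        case (elim x)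
        show ?case
          by (cases "x \<in> V") (use elim VL test_fun_outside[OF td] in auto)
      qed
      then show ?thesis by (rule integral_eq_zero_AE)
    qed
    finally show "(LBINT x:V. \<phi> x *\<^sub>R c x $ i) = 0" by simp
  qed
  then have "AE x in lborel. \<forall>i. x \<in> V \<longrightarrow> c x $ i = 0" by (subst AE_all_countable) auto
  moreover have "AE x::plane in lborel. fst x \<noteq> -\<xi>" "AE x::plane in lborel. fst x \<noteq> 1"
    using AE_plane_fst[of "\<lambda>s. s \<noteq> -\<xi>", OF AE_lborel_singleton] AE_plane_fst[of "\<lambda>s. s \<noteq> 1", OF AE_lborel_singleton] .

  moreover have "AE x::plane in lborel. snd x \<noteq> -(\<epsilon> * \<xi> / 2)" "AE x::plane in lborel. snd x \<noteq> \<epsilon> * \<xi> / 2"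
    using AE_plane_snd[of "\<lambda>s. s \<noteq> -(\<epsilon> * \<xi> / 2)", OF AE_lborel_singleton]
      AE_plane_snd[of "\<lambda>s. s \<noteq> \<epsilon> * \<xi> / 2", OF AE_lborel_singleton] .
  ultimately show ?thesis
  proof eventually_elim
    case (elim x)
    show ?case
    proof (intro impI)
      assume "x \<in> Omega" "x \<notin> layer \<epsilon> \<xi>"
      then have "x \<in> V" using elim(2-5) by (cases x) (auto simp: V_def layer_def less_le)
      then show "c x = 0" using elim(1) by (simp add: vec_eq_iff)
    qed
  qed
qed

lemma c_measurable_layer: "c \<in> borel_measurable (lborel_on (layer \<epsilon> \<xi>))"
  by (intro sqint_measurable sqint_lborel_on_subset(1)[OF sqint_c(1) layer_subset]) auto

text \<open>Since the curl lives on the layer, rescaling retains the whole prescribed curl.\<close>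

lemma integral_ct: "(\<integral>x. ct x \<partial>N) = (\<integral>x. c x \<partial>lborel_on Omega)"
proof -
  have "(\<integral>x. c x \<partial>lborel_on Omega) = (\<integral>x. c x \<partial>lborel_on (layer \<epsilon> \<xi>))"
    by (rule integral_lborel_on_subset[OF layer_subset Omega_borel layer_borel c_measurable curl_zero_off_layer])
  also have "\<dots> = \<epsilon> *\<^sub>R (\<integral>x. c (stretch \<epsilon> x) \<partial>N)"
    by (rule integral_lborel_on_stretch(1)[OF eps(1) c_measurable_layer])
  also have "\<dots> = (\<integral>x. ct x \<partial>N)"
    unfolding integral_scaleR_right[symmetric] ct_def rescale_eq ..
  finally show ?thesis by simp
qed

lemma Bt_entry: "Bt x $ i $ j = \<epsilon> * B (stretch \<epsilon> x) $ i $ j" and ct_entry: "ct x $ i = \<epsilon> * c (stretch \<epsilon> x) $ i"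
  by (simp_all add: Bt_def ct_def rescale_eq)

text \<open>The point is that \<open>\<psi>\<close> has compact support in \<open>Omega\<close> and
  not in the layer: as \<open>B\<close> and its curl vanish off the layer, no boundary terms arise
  at the top, bottom and left edges.\<close>

lemma curl_identity_layer:
  assumes \<psi>: "test_fun Omega \<psi>"
  shows "(\<integral>x. \<psi> (stretch \<epsilon> x) * ct x $ i \<partial>N) =
    - (\<integral>x. dir_deriv (coord 1) \<psi> (stretch \<epsilon> x) * Bt x $ i $ 2 - dir_deriv (coord 2) \<psi> (stretch \<epsilon> x) * Bt x $ i $ 1 \<partial>N)"
proof -
  have pm: "\<psi> \<in> borel_measurable (lborel_on U)" "dir_deriv (coord j) \<psi> \<in> borel_measurable (lborel_on U)" for U j
    using test_fun_measurable[OF \<psi>] test_fun_measurable[OF test_fun_dir_deriv[OF \<psi>, of "coord j"]]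
    by (intro measurable_restrict_space1; simp)+
  have mB: "(\<lambda>x. B x $ i $ j) \<in> borel_measurable (lborel_on (layer \<epsilon> \<xi>))" for j
    using sqint_measurable[OF sqint_lborel_on_subset(1)[OF sqint_B layer_subset Omega_borel layer_borel]]
    by (intro borel_measurable_vec_nth)
  have m1: "(\<lambda>x. \<psi> x * c x $ i) \<in> borel_measurable (lborel_on Omega)" "(\<lambda>x. \<psi> x * c x $ i) \<in> borel_measurable (lborel_on (layer \<epsilon> \<xi>))"
    by (intro borel_measurable_times pm borel_measurable_vec_nth c_measurable c_measurable_layer)+
  have m2: "(\<lambda>x. dir_deriv (coord 1) \<psi> x * B x $ i $ 2 - dir_deriv (coord 2) \<psi> x * B x $ i $ 1) \<in> borel_measurable (lborel_on Omega)"
    "(\<lambda>x. dir_deriv (coord 1) \<psi> x * B x $ i $ 2 - dir_deriv (coord 2) \<psi> x * B x $ i $ 1) \<in> borel_measurable (lborel_on (layer \<epsilon> \<xi>))"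
    by (intro borel_measurable_diff borel_measurable_times pm mB B_entry_measurable)+
  have "(\<integral>x. \<psi> (stretch \<epsilon> x) * ct x $ i \<partial>N) = \<epsilon> *\<^sub>R (\<integral>x. \<psi> (stretch \<epsilon> x) * c (stretch \<epsilon> x) $ i \<partial>N)"
    unfolding integral_scaleR_right[symmetric] by (simp add: ct_entry mult.left_commute)
  also have "\<dots> = (\<integral>x. \<psi> x * c x $ i \<partial>lborel_on (layer \<epsilon> \<xi>))"
    by (rule integral_lborel_on_stretch(1)[OF eps(1) m1(2), symmetric])
  also have "\<dots> = (\<integral>x. \<psi> x * c x $ i \<partial>lborel_on Omega)"
    by (rule integral_lborel_on_subset[OF layer_subset Omega_borel layer_borel m1(1), symmetric])
      (use curl_zero_off_layer in \<open>auto elim!: eventually_mono\<close>)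
  also have "\<dots> = - (\<integral>x. dir_deriv (coord 1) \<psi> x * B x $ i $ 2 - dir_deriv (coord 2) \<psi> x * B x $ i $ 1 \<partial>lborel_on Omega)"
    by (rule curl_identity[OF \<psi>])
  also have "(\<integral>x. dir_deriv (coord 1) \<psi> x * B x $ i $ 2 - dir_deriv (coord 2) \<psi> x * B x $ i $ 1 \<partial>lborel_on Omega)
    = (\<integral>x. dir_deriv (coord 1) \<psi> x * B x $ i $ 2 - dir_deriv (coord 2) \<psi> x * B x $ i $ 1 \<partial>lborel_on (layer \<epsilon> \<xi>))"
    by (rule integral_lborel_on_subset[OF layer_subset Omega_borel layer_borel m2(1)])
      (use off_AE in \<open>auto elim!: eventually_mono\<close>)
  also have "\<dots> = \<epsilon> *\<^sub>R (\<integral>x. dir_deriv (coord 1) \<psi> (stretch \<epsilon> x) * B (stretch \<epsilon> x) $ i $ 2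
      - dir_deriv (coord 2) \<psi> (stretch \<epsilon> x) * B (stretch \<epsilon> x) $ i $ 1 \<partial>N)"
    by (rule integral_lborel_on_stretch(1)[OF eps(1) m2(2)])
  also have "\<dots> = (\<integral>x. dir_deriv (coord 1) \<psi> (stretch \<epsilon> x) * Bt x $ i $ 2 - dir_deriv (coord 2) \<psi> (stretch \<epsilon> x) * Bt x $ i $ 1 \<partial>N)"
    unfolding integral_scaleR_right[symmetric] by (simp add: Bt_entry algebra_simps)
  finally show ?thesis .
qed

lemma has_weak_curl_Bt: "has_weak_curl \<epsilon> (layer 1 \<xi>) Bt ct"
  unfolding has_weak_curl_def has_weak_row_curl_def
proof (intro allI conjI impI)
  fix i
  show "loc_integrable (layer 1 \<xi>) (\<lambda>x. Bt x $ i)" "loc_integrable (layer 1 \<xi>) (\<lambda>x. ct x $ i)"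
    by (intro sqint_loc_integrable(1)[OF sqint_entry] sqint_Bt sqint_ct layer_borel bounded_layer)+
  fix \<phi> assume \<phi>: "test_fun (layer 1 \<xi>) \<phi>"
  define \<psi> where "\<psi> x = \<phi> (stretch (1/\<epsilon>) x)" for x
  have \<psi>: "test_fun Omega \<psi>" using test_fun_mono[OF test_fun_stretch(1)[OF eps(1) \<phi>] layer_subset] unfolding \<psi>_def .
  have d1: "dir_deriv (coord 1) \<psi> (stretch \<epsilon> x) = dir_deriv (coord 1) \<phi> x"
    and d2: "dir_deriv (coord 2) \<psi> (stretch \<epsilon> x) = (1/\<epsilon>) * dir_deriv (coord 2) \<phi> x"
    and d0: "\<psi> (stretch \<epsilon> x) = \<phi> x" for x
    using test_fun_stretch(2,3)[OF eps(1) \<phi>, of "stretch \<epsilon> x"] eps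
    unfolding \<psi>_def[abs_def] by (simp_all add: stretch_def)
  show "(LBINT x:layer 1 \<xi>. \<phi> x * ct x $ i) =
      - (LBINT x:layer 1 \<xi>. dir_deriv (coord 1) \<phi> x * Bt x $ i $ 2 - (1 / \<epsilon>) * (dir_deriv (coord 2) \<phi> x * Bt x $ i $ 1))"
    using curl_identity_layer[OF \<psi>, of i] unfolding d0 d1 d2 set_integral_lborel_on[OF layer_borel] mult.assoc .
qed

lemma Bt_Hcurl: "Bt \<in> Hcurl \<epsilon> (layer 1 \<xi>)"
  using sqint_Bt sqint_ct has_weak_curl_Bt unfolding Hcurl_def by (auto simp: L2_iff_sqint)

lemma weak_curl_Bt:
  "AE x in lborel. x \<in> layer 1 \<xi> \<longrightarrow> weak_curl \<epsilon> (layer 1 \<xi>) Bt x = ct x"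
  "weak_curl \<epsilon> (layer 1 \<xi>) Bt \<in> borel_measurable N"
proof -
  have w: "has_weak_curl \<epsilon> (layer 1 \<xi>) Bt (weak_curl \<epsilon> (layer 1 \<xi>) Bt)"
  proof -
    have "\<exists>c. has_weak_curl \<epsilon> (layer 1 \<xi>) Bt c" using has_weak_curl_Bt by blast
    then show ?thesis unfolding weak_curl_def by (rule someI_ex)
  qed
  show "AE x in lborel. x \<in> layer 1 \<xi> \<longrightarrow> weak_curl \<epsilon> (layer 1 \<xi>) Bt x = ct x"
    by (rule has_weak_curl_unique[OF open_layer w has_weak_curl_Bt])
  have cm: "(\<lambda>x. weak_curl \<epsilon> (layer 1 \<xi>) Bt x $ i) \<in> borel_measurable N" for i
    using w unfolding has_weak_curl_def has_weak_row_curl_def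
    by (blast intro: loc_integrable_measurable open_layer)
  have "(\<lambda>x. \<Sum>i\<in>UNIV. (weak_curl \<epsilon> (layer 1 \<xi>) Bt x $ i) *\<^sub>R axis i (1::real)) \<in> borel_measurable N"
    by (intro borel_measurable_sum borel_measurable_scaleR cm borel_measurable_const)
  moreover have "(\<Sum>i\<in>UNIV. (y $ i) *\<^sub>R axis i (1::real)) = y" for y :: "real^2"
    by (simp add: vec_eq_iff axis_def if_distrib cong: if_cong)
  ultimately show "weak_curl \<epsilon> (layer 1 \<xi>) Bt \<in> borel_measurable N" by simp
qed

text \<open>A function of the first variable alone is not a test function, but multiplied by
  cut-offs that equal 1 on the layer it becomes one without changing any integral. The right end of
  the layer lies on the boundary of \<open>Omega\<close>, which is why \<open>\<Theta>\<close> has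
  to vanish from some \<open>q < 1\<close> on, whereas its values at the left end remain
  free.\<close>

lemma curl_compatibility:
  assumes \<Theta>: "smooth_fun \<Theta>" and q: "q < 1" "\<And>s. q \<le> s \<Longrightarrow> \<Theta> s = 0"
  shows "(\<integral>x. \<Theta> (fst x) *\<^sub>R ct x \<partial>N) = - (\<integral>x. dir_deriv 1 \<Theta> (fst x) *\<^sub>R column 2 (Bt x) \<partial>N)"
proof -
  \<comment> \<open>The horizontal cut-off rises between \<open>-r\<close> and
    \<open>-\<xi>\<close>, to the left of the layer but still inside \<open>Omega\<close>.\<close>
  define r where "r = (1 + \<xi>) / 2"
  have r: "\<xi> < r" "r < 1" using xi by (auto simp: r_def)
  obtain \<theta> where \<theta>: "smooth_fun \<theta>" "\<And>s. s \<le> -r \<Longrightarrow> \<theta> s = 0" "\<And>s. -\<xi> \<le> s \<Longrightarrow> \<theta> s = 1"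
    using smooth_step[of "-r" "-\<xi>"] r by auto
  obtain \<eta>1 :: "real \<Rightarrow> real" where \<eta>1: "smooth_fun \<eta>1" "\<And>s. s \<le> -3/4 \<Longrightarrow> \<eta>1 s = 0" "\<And>s. -1/2 \<le> s \<Longrightarrow> \<eta>1 s = 1"
    using smooth_step[of "-3/4" "-1/2"] by auto
  obtain \<eta>2 :: "real \<Rightarrow> real" where \<eta>2: "smooth_fun \<eta>2" "\<And>s. s \<le> 1/2 \<Longrightarrow> \<eta>2 s = 0" "\<And>s. 3/4 \<le> s \<Longrightarrow> \<eta>2 s = 1"
    using smooth_step[of "1/2" "3/4"] by auto
  define f where "f s = \<Theta> s * \<theta> s" for s
  define g where "g t = \<eta>1 t * (1 - \<eta>2 t)" for t
  have sf: "smooth_fun f" unfolding f_def[abs_def] by (intro smooth_fun_mult \<Theta> \<theta>)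
  have sg: "smooth_fun g" unfolding g_def[abs_def] by (intro smooth_fun_mult smooth_fun_diff \<eta>1 \<eta>2 smooth_fun_const)
  have tf: "test_fun {-1<..<1} f" unfolding test_fun_def
  proof (intro conjI sf exI[of _ "{-r..max q 0}"] allI impI)
    show "{-r..max q 0} \<subseteq> {-1<..<1}" using r q by auto
    fix s assume "s \<notin> {-r..max q 0}"
    then show "f s = 0" using q(2)[of s] \<theta>(2)[of s] by (auto simp: f_def)
  qed simp
  have tg: "test_fun {-1<..<1} g" unfolding test_fun_def
  proof (intro conjI sg exI[of _ "{-3/4..3/4}"] allI impI)
    fix s :: real assume "s \<notin> {-3/4..3/4}"
    then show "g s = 0" using \<eta>1(2)[of s] \<eta>2(3)[of s] by (auto simp: g_def)
  qed auto
  define \<psi> where "\<psi> x = f (fst x) * g (snd x)" for x :: plane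
  note tp = test_fun_product[OF tf tg, folded \<psi>_def]
  have t\<psi>: "test_fun Omega \<psi>" using tp(1) unfolding Omega_def \<psi>_def .
  have fe: "f s = \<Theta> s" if "-\<xi> < s" for s using that \<theta>(3)[of s] by (simp add: f_def)
  have fd: "dir_deriv 1 f s = dir_deriv 1 \<Theta> s" if "-\<xi> < s" for s
    by (rule dir_deriv_cong_open[of "{-\<xi><..}"]) (use that fe \<Theta> in auto)
  have ge: "g t = 1" if "-1/2 < t" "t < 1/2" for t using that \<eta>1(3)[of t] \<eta>2(2)[of t] by (simp add: g_def)
  have gd: "dir_deriv 1 g t = 0" if "-1/2 < t" "t < 1/2" for t
  proof -
    have "dir_deriv 1 g t = dir_deriv 1 (\<lambda>_. 1) t"
      by (rule dir_deriv_cong_open[of "{-1/2<..<1/2}"]) (use that ge in auto)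
    also have "\<dots> = 0" using dir_derivI[of "\<lambda>_::real. 1::real" "\<lambda>_. 0" t 1] by simp
    finally show ?thesis .
  qed
  \<comment> \<open>The layer has half-height \<open>\<epsilon> * \<xi> / 2\<close>, below
    \<open>1/2\<close>, so it lies where the vertical cut-off is constant.\<close>
  have in_layer: "-\<xi> < fst x \<and> -1/2 < \<epsilon> * snd x \<and> \<epsilon> * snd x < 1/2" if "x \<in> layer 1 \<xi>" for x
  proof -
    have a: "\<bar>snd x\<bar> < \<xi> / 2" "-\<xi> < fst x" using that by (auto simp: layer_def)
    have "\<bar>\<epsilon> * snd x\<bar> = \<epsilon> * \<bar>snd x\<bar>" using eps by (simp add: abs_mult)
    also have "\<dots> \<le> 1 * \<bar>snd x\<bar>" using eps by (intro mult_right_mono) auto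
    finally have "\<bar>\<epsilon> * snd x\<bar> < 1/2" using a xi by linarith
    with a show ?thesis by auto
  qed
  have v0: "\<psi> (stretch \<epsilon> x) = \<Theta> (fst x)" "dir_deriv (coord 1) \<psi> (stretch \<epsilon> x) = dir_deriv 1 \<Theta> (fst x)"
    "dir_deriv (coord 2) \<psi> (stretch \<epsilon> x) = 0" if "x \<in> layer 1 \<xi>" for x
  proof -
    note l = in_layer[OF that]
    show "\<psi> (stretch \<epsilon> x) = \<Theta> (fst x)" using fe ge l by (simp add: \<psi>_def stretch_def)
    show "dir_deriv (coord 1) \<psi> (stretch \<epsilon> x) = dir_deriv 1 \<Theta> (fst x)"
      using test_fun_product(2)[OF tf tg, of "stretch \<epsilon> x"] fd ge l unfolding \<psi>_def[abs_def] by (simp add: stretch_def)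
    show "dir_deriv (coord 2) \<psi> (stretch \<epsilon> x) = 0"
      using test_fun_product(3)[OF tf tg, of "stretch \<epsilon> x"] gd l unfolding \<psi>_def[abs_def] by (simp add: stretch_def)
  qed
  let ?M = "N"
  have sp: "space ?M = layer 1 \<xi>" by (simp add: space_restrict_space)
  have row: "(\<integral>x. \<Theta> (fst x) * ct x $ i \<partial>?M) = - (\<integral>x. dir_deriv 1 \<Theta> (fst x) * Bt x $ i $ 2 \<partial>?M)" for i
  proof -
    have "(\<integral>x. \<Theta> (fst x) * ct x $ i \<partial>?M) = (\<integral>x. \<psi> (stretch \<epsilon> x) * ct x $ i \<partial>?M)"
      by (intro Bochner_Integration.integral_cong refl) (simp add: sp v0)
    also have "\<dots> = - (\<integral>x. dir_deriv (coord 1) \<psi> (stretch \<epsilon> x) * Bt x $ i $ 2 - dir_deriv (coord 2) \<psi> (stretch \<epsilon> x) * Bt x $ i $ 1 \<partial>?M)"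
      by (rule curl_identity_layer[OF t\<psi>])
    also have "(\<integral>x. dir_deriv (coord 1) \<psi> (stretch \<epsilon> x) * Bt x $ i $ 2 - dir_deriv (coord 2) \<psi> (stretch \<epsilon> x) * Bt x $ i $ 1 \<partial>?M)
       = (\<integral>x. dir_deriv 1 \<Theta> (fst x) * Bt x $ i $ 2 \<partial>?M)"
      by (intro Bochner_Integration.integral_cong refl) (simp add: sp v0)
    finally show ?thesis .
  qed
  \<comment> \<open>On the layer these agree with \<open>\<Theta>\<close> and its derivative, and
    they are bounded on the whole plane, as the integrability criterion demands.\<close>
  define \<theta>f where "\<theta>f x = indicator (layer 1 \<xi>) x * \<psi> (stretch \<epsilon> x)" for x :: plane
  define \<theta>d where "\<theta>d x = indicator (layer 1 \<xi>) x * dir_deriv (coord 1) \<psi> (stretch \<epsilon> x)" for x :: plane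
  have [measurable]: "\<psi> \<in> borel_measurable borel" "dir_deriv (coord 1) \<psi> \<in> borel_measurable borel"
    using test_fun_measurable[OF t\<psi>] test_fun_measurable[OF test_fun_dir_deriv[OF t\<psi>]] by auto
  have mf: "\<theta>f \<in> borel_measurable ?M" "\<theta>d \<in> borel_measurable ?M"
    unfolding \<theta>f_def[abs_def] \<theta>d_def[abs_def] by (intro measurable_restrict_space1; measurable)+
  obtain C1 C2 where bd: "\<And>x. \<bar>\<psi> x\<bar> \<le> C1" "\<And>x. \<bar>dir_deriv (coord 1) \<psi> x\<bar> \<le> C2"
    using test_fun_bounded[OF t\<psi>] test_fun_bounded[OF test_fun_dir_deriv[OF t\<psi>]] by blast
  have b: "\<bar>\<theta>f x\<bar> \<le> C1" "\<bar>\<theta>d x\<bar> \<le> C2" for x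
    using bd(1)[of "stretch \<epsilon> x"] bd(2)[of "stretch \<epsilon> x"] by (auto simp: \<theta>f_def \<theta>d_def indicator_def)
  have ict: "integrable ?M ct" and iBt: "integrable ?M Bt"
    by (intro sqint_loc_integrable(2) sqint_ct sqint_Bt layer_borel bounded_layer)+
  have i1: "integrable ?M (\<lambda>x. \<Theta> (fst x) *\<^sub>R ct x)"
  proof -
    have "integrable ?M (\<lambda>x. \<theta>f x *\<^sub>R ct x)" by (rule integrable_bounded_scaleR[OF ict mf(1) b(1)])
    then show ?thesis by (rule Bochner_Integration.integrable_cong[THEN iffD1, rotated -1]) (simp_all add: sp \<theta>f_def v0)
  qed
  have i2: "integrable ?M (\<lambda>x. dir_deriv 1 \<Theta> (fst x) *\<^sub>R column 2 (Bt x))"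
  proof -
    have "integrable ?M (\<lambda>x. \<theta>d x *\<^sub>R column 2 (Bt x))"
      by (rule integrable_bounded_scaleR[OF integrable_bounded_linear[OF bounded_linear_column iBt] mf(2) b(2)])
    then show ?thesis by (rule Bochner_Integration.integrable_cong[THEN iffD1, rotated -1]) (simp_all add: sp \<theta>d_def v0)
  qed
  show ?thesis
  proof (rule vec_eq_iff[THEN iffD2], rule allI)
    fix i
    show "(\<integral>x. \<Theta> (fst x) *\<^sub>R ct x \<partial>?M) $ i = (- (\<integral>x. dir_deriv 1 \<Theta> (fst x) *\<^sub>R column 2 (Bt x) \<partial>?M)) $ i"
      using row[of i] integral_bounded_linear[OF bounded_linear_vec_nth i1, of i] integral_bounded_linear[OF bounded_linear_vec_nth i2, of i]
      by (simp add: column_def)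
  qed
qed

lemma weak_deriv_off_layer:
  assumes V: "open V" "V \<subseteq> Omega" "V \<inter> layer \<epsilon> \<xi> = {}"
  shows "has_weak_deriv V (coord j) (\<lambda>x. indicator (Omega - layer \<epsilon> \<xi>) x *\<^sub>R k x) (\<lambda>x. column j (H x))"
proof -
  have 1: "has_weak_deriv V (coord j) k (\<lambda>x. column j (H x))"
  proof (rule has_weak_deriv_restrict[OF weak_deriv_k[of j] V(2,1)])
    have c0: "column j (0::real^2^2) = 0" by (simp add: column_def vec_eq_iff)
    show "AE x in lborel. x \<in> V \<longrightarrow> weak_deriv Omega (coord j) k x = column j (H x)"
      using off_AE by eventually_elim (use V in \<open>auto simp: column_H c0\<close>)
    show "loc_integrable V (\<lambda>x. column j (H x))"
      by (rule loc_integrable_subset[OF sqint_loc_integrable(1)[OF sqint_column(1)[OF sqint_H(1)] Omega_borel bounded_Omega] V(2)])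
  qed
  show ?thesis
    by (rule has_weak_deriv_cong_on[OF _ _ 1]) (use V in \<open>auto simp: indicator_def\<close>)
qed

end

subsection \<open>One-sided limits\<close>

text \<open>The area bound comes from the ball of radius \<open>r/2\<close> centred at
  \<open>x + (r/2) *\<^sub>R \<nu>\<close>, which fits into the half ball; hence the
  quarter.\<close>

lemma half_ball_facts:
  assumes "r > 0" "norm \<nu> = 1"
  shows "half_ball x r \<nu> \<in> sets borel"
    and "half_ball x r \<nu> \<subseteq> {fst x - r<..<fst x - r + 2 * r} \<times> {snd x - r<..<snd x - r + 2 * r}"
    and "measure lborel (half_ball x r \<nu>) \<ge> (measure lborel (ball (0::plane) 1) / 4) * r\<^sup>2"
    and "emeasure lborel (half_ball x r \<nu>) < \<infinity>"
proof -
  have eq: "half_ball x r \<nu> = ball x r \<inter> {y. 0 < (y - x) \<bullet> \<nu>}" by (auto simp: half_ball_def)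
  have "open {y. 0 < (y - x) \<bullet> \<nu>}" by (intro open_Collect_less continuous_intros)
  then show m: "half_ball x r \<nu> \<in> sets borel" unfolding eq by (intro borel_open open_Int) auto
  show "half_ball x r \<nu> \<subseteq> {fst x - r<..<fst x - r + 2 * r} \<times> {snd x - r<..<snd x - r + 2 * r}"
  proof
    fix y assume "y \<in> half_ball x r \<nu>"
    then have "dist x y < r" by (simp add: eq)
    then have "\<bar>fst x - fst y\<bar> < r" "\<bar>snd x - snd y\<bar> < r"
      using dist_fst_le[of x y] dist_snd_le[of x y] by (auto simp: dist_real_def)
    then show "y \<in> {fst x - r<..<fst x - r + 2 * r} \<times> {snd x - r<..<snd x - r + 2 * r}"
      by (cases y) auto
  qed
  have "bounded (half_ball x r \<nu>)" unfolding eq by (intro bounded_Int) auto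
  then show fin: "emeasure lborel (half_ball x r \<nu>) < \<infinity>" by (rule emeasure_bounded_finite)
  have sub: "ball (x + (r/2) *\<^sub>R \<nu>) (r/2) \<subseteq> half_ball x r \<nu>"
  proof
    fix y assume "y \<in> ball (x + (r/2) *\<^sub>R \<nu>) (r/2)"
    then have n: "norm (y - x - (r/2) *\<^sub>R \<nu>) < r/2" by (simp add: dist_norm norm_minus_commute diff_diff_add)
    have "norm (y - x) \<le> norm (y - x - (r/2) *\<^sub>R \<nu>) + norm ((r/2) *\<^sub>R \<nu>)"
      using norm_triangle_ineq[of "y - x - (r/2) *\<^sub>R \<nu>" "(r/2) *\<^sub>R \<nu>"] by simp
    then have "dist x y < r" using n assms by (simp add: dist_norm norm_minus_commute)
    moreover have "\<bar>(y - x - (r/2) *\<^sub>R \<nu>) \<bullet> \<nu>\<bar> \<le> norm (y - x - (r/2) *\<^sub>R \<nu>) * norm \<nu>" by (rule Cauchy_Schwarz_ineq2)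
    then have "\<bar>(y - x) \<bullet> \<nu> - r/2\<bar> < r/2"
      using n assms by (simp add: inner_diff_left dot_square_norm)
    then have "(y - x) \<bullet> \<nu> > 0" by linarith
    ultimately show "y \<in> half_ball x r \<nu>" by (simp add: eq)
  qed
  have "measure lborel (ball (x + (r/2) *\<^sub>R \<nu>) (r/2)) = measure lborel (ball (0::plane) 1) * (r/2)\<^sup>2"
    using assms content_ball_conv_unit_ball[of "r/2" "x + (r/2) *\<^sub>R \<nu>"] by (simp add: power2_eq_square field_simps)
  moreover have "measure lborel (ball (x + (r/2) *\<^sub>R \<nu>) (r/2)) \<le> measure lborel (half_ball x r \<nu>)"
    using fin m by (intro measure_mono_fmeasurable[OF sub]) (auto simp: fmeasurable_def)
  ultimately show "measure lborel (half_ball x r \<nu>) \<ge> (measure lborel (ball (0::plane) 1) / 4) * r\<^sup>2"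
    by (simp add: power2_eq_square)
qed

text \<open>Absolute continuity of the integral: dominated convergence along the radii
  \<open>1 / Suc n\<close>, then monotonicity in the radius.\<close>

lemma small_square_integral:
  fixes h :: "plane \<Rightarrow> real"
  assumes h: "integrable lborel h" "\<And>x. h x \<ge> 0" and e: "e > 0"
  shows "\<exists>\<rho>>0. \<forall>r. 0 < r \<and> r < \<rho> \<longrightarrow> (LBINT y. indicator ({fst x - r..fst x + r} \<times> {snd x - r..snd x + r}) y * h y) \<le> e"
proof -
  define S where "S r = {fst x - r..fst x + r} \<times> {snd x - r..snd x + r}" for r
  have Sm [measurable]: "S r \<in> sets borel" for r unfolding S_def by (intro borel_closed closed_Times) auto
  have i: "integrable lborel (\<lambda>y. indicator (S r) y * h y)" for r
    using integrable_mult_indicator[of "S r" lborel h] h by simp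
  have "(\<lambda>n. LBINT y. indicator (S (1 / real (Suc n))) y * h y) \<longlonglongrightarrow> (\<integral>y. 0 \<partial>(lborel :: plane measure))"
  proof (rule integral_dominated_convergence[where w=h])
    have [measurable]: "h \<in> borel_measurable borel" using h by auto
    show "(\<lambda>y. indicator (S (1 / real (Suc n))) y * h y) \<in> borel_measurable lborel" for n by measurable
    show "AE y in lborel. norm (indicator (S (1 / real (Suc n))) y * h y) \<le> h y" for n
      using h(2) by (intro AE_I2) (auto simp: indicator_def)
    have "AE y in lborel. y \<noteq> x" by (rule AE_lborel_singleton)
    then show "AE y in lborel. (\<lambda>n. indicator (S (1 / real (Suc n))) y * h y) \<longlonglongrightarrow> 0"
    proof eventually_elim
      case (elim y)
      define t where "t = max \<bar>fst y - fst x\<bar> \<bar>snd y - snd x\<bar>"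
      have "t > 0" using elim by (auto simp: t_def prod_eq_iff)
      have "(\<lambda>n. 1 / real (Suc n)) \<longlonglongrightarrow> 0" using LIMSEQ_inverse_real_of_nat by (simp add: inverse_eq_divide)
      then have "eventually (\<lambda>n. 1 / real (Suc n) < t) sequentially" using \<open>t > 0\<close> by (rule order_tendstoD)
      then have "eventually (\<lambda>n. indicator (S (1 / real (Suc n))) y * h y = 0) sequentially"
        by eventually_elim (cases y, auto simp: S_def t_def indicator_def abs_le_iff max_def split: if_splits)
      then show ?case by (rule tendsto_eventually)
    qed
  qed (use h in auto)
  then have "(\<lambda>n. LBINT y. indicator (S (1 / real (Suc n))) y * h y) \<longlonglongrightarrow> 0" by simp
  from order_tendstoD(2)[OF this e] obtain n where n: "(LBINT y. indicator (S (1 / real (Suc n))) y * h y) < e"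
    by (auto simp: eventually_sequentially)
  show ?thesis
  proof (intro exI[of _ "1 / real (Suc n)"] conjI allI impI)
    fix r assume r: "0 < r \<and> r < 1 / real (Suc n)"
    have "(LBINT y. indicator (S r) y * h y) \<le> (LBINT y. indicator (S (1 / real (Suc n))) y * h y)"
    proof (rule integral_mono[OF i i])
      fix y
      have "S r \<subseteq> S (1 / real (Suc n))" unfolding S_def using r by (intro Sigma_mono) auto
      then show "indicator (S r) y * h y \<le> indicator (S (1 / real (Suc n))) y * h y"
        using h(2)[of y] by (auto simp: indicator_def)
    qed
    with n show "(LBINT y. indicator ({fst x - r..fst x + r} \<times> {snd x - r..snd x + r}) y * h y) \<le> e"
      by (simp add: S_def)
  qed simp
qed

lemma sqint_lborel_imp_on:
  assumes "sqint lborel f" "Q \<in> sets borel" shows "sqint (lborel_on Q) f"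
  using assms integrable_mult_indicator[of Q lborel "\<lambda>x. (norm (f x))\<^sup>2"]
  by (auto simp: sqint_def integrable_restrict_space intro: measurable_restrict_space1)

text \<open>Integrating the bound over a half ball costs a multiple of \<open>r\<close> times the
  integral of \<open>h\<close> over the square of side \<open>2 * r\<close>. As \<open>h\<close> is
  square-integrable, that integral is small compared with \<open>r\<close>, so the cost is small
  compared with the area of the half ball. The remaining error is the oscillation of
  \<open>\<kappa>\<close> at a Lebesgue point.\<close>

lemma trace_limit:
  fixes u :: "plane \<Rightarrow> real^2" and \<kappa> :: "real \<Rightarrow> real^2" and h :: "plane \<Rightarrow> real"
  assumes [measurable]: "u \<in> borel_measurable borel" and \<kappa>: "integrable lborel \<kappa>"
    and h: "integrable lborel h" "integrable lborel (\<lambda>x. (h x)\<^sup>2)" "\<And>x. h x \<ge> 0"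
    and \<nu>: "norm \<nu> = 1" and \<rho>: "\<rho> > 0"
    and bound: "AE y in lborel. y \<in> half_ball (s, 0) \<rho> \<nu> \<longrightarrow>
        norm (u y - \<kappa> (fst y)) \<le> (LBINT t. indicator {-\<bar>snd y\<bar>..\<bar>snd y\<bar>} t * h (fst y, t))"
    and sec: "AE z in lborel. integrable lborel (\<lambda>t. h (z, t))"
    and Leb: "\<And>e. e > 0 \<Longrightarrow> \<exists>\<delta>>0. \<forall>r. 0 < r \<and> r < \<delta> \<longrightarrow> (LBINT y. indicator {s-r..s+r} y * norm (\<kappa> y - \<kappa> s)) \<le> e * r"
  shows "one_sided_approx_limit u (s, 0) \<nu> (\<kappa> s)"
  unfolding one_sided_approx_limit_def
proof (rule tendstoI)
  fix e :: real assume e: "e > 0"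
  define cb where "cb = measure lborel (ball (0::plane) 1) / 4"
  have cb: "cb > 0" unfolding cb_def using content_ball_pos[of 1 "0::plane"] by simp
  \<comment> \<open>The estimate ends with \<open>12 * \<delta> / cb\<close>, where 12 is twice the
    sum of 1 from \<open>\<kappa>\<close> and 5 from \<open>h\<close>.\<close>
  define \<delta> where "\<delta> = e * cb / 40"
  have d: "\<delta> > 0" using e cb by (simp add: \<delta>_def)
  obtain \<rho>1 where \<rho>1: "\<rho>1 > 0" "\<And>r. 0 < r \<Longrightarrow> r < \<rho>1 \<Longrightarrow> (LBINT y. indicator {s-r..s+r} y * norm (\<kappa> y - \<kappa> s)) \<le> \<delta> * r"
    using Leb[OF d] by blast
  obtain \<rho>2 where \<rho>2: "\<rho>2 > 0" "\<And>r. 0 < r \<Longrightarrow> r < \<rho>2 \<Longrightarrow> (LBINT y. indicator ({s - r..s + r} \<times> {- r..r}) y * (h y)\<^sup>2) \<le> \<delta>\<^sup>2"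
    using small_square_integral[OF h(2) _, of "\<delta>\<^sup>2" "(s, 0)"] d by auto
  have [measurable]: "h \<in> borel_measurable borel" "\<kappa> \<in> borel_measurable borel" using h \<kappa> by auto
  have main: "(LBINT y:half_ball (s, 0) r \<nu>. norm (u y - \<kappa> s)) / measure lborel (half_ball (s, 0) r \<nu>) < e"
    if r: "0 < r" "r < \<rho>" "r < \<rho>1" "r < \<rho>2" for r
  proof -
    let ?HB = "half_ball (s, 0) r \<nu>"
    define I where "I = {s-r..s+r}"
    define K where "K = {-r..r}"
    have [measurable]: "I \<in> sets borel" "K \<in> sets borel" by (auto simp: I_def K_def)
    have HBm [measurable]: "?HB \<in> sets borel" by (rule half_ball_facts(1)[OF r(1) \<nu>])
    have HBIK: "?HB \<subseteq> I \<times> K" using half_ball_facts(2)[OF r(1) \<nu>, of "(s, 0)"] by (force simp: I_def K_def)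
    have HB\<rho>: "?HB \<subseteq> half_ball (s, 0) \<rho> \<nu>" using r by (auto simp: half_ball_def)
    define D where "D z = (LBINT t. indicator K t * h (z, t))" for z
    have IKm: "I \<times> K \<in> sets borel" unfolding I_def K_def by (intro borel_closed closed_Times) auto
    have iIKh: "integrable lborel (\<lambda>x. indicator (I \<times> K) x * h x)"
      using integrable_mult_indicator[of "I \<times> K" lborel h] h IKm by simp
    have ind: "indicator (I \<times> K) (z, t) = indicator I z * (indicator K t :: real)" for z t by (simp add: indicator_times)
    have itD: "(LBINT x. indicator (I \<times> K) x * h x) = (LBINT z. indicator I z * D z)"
      unfolding plane_integral_iterated(1)[OF iIKh] ind D_def by (simp add: mult.assoc)
    have iD: "integrable lborel (\<lambda>z. indicator I z * D z)"
      using plane_integral_iterated(2)[OF iIKh] unfolding ind D_def by (simp add: mult.assoc)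
    have i\<kappa>: "integrable lborel (\<lambda>z. indicator I z * norm (\<kappa> z - \<kappa> s))"
    proof -
      have "integrable lborel (\<lambda>z. indicator I z *\<^sub>R \<kappa> z - indicator I z *\<^sub>R \<kappa> s)"
        using \<kappa> by (intro Bochner_Integration.integrable_diff integrable_mult_indicator integrable_scaleR_left integrable_real_indicator)
          (auto simp: I_def emeasure_lborel_Icc_eq)
      from integrable_norm[OF this] show ?thesis by (simp flip: scaleR_diff_right)
    qed
    have iK: "integrable lborel (\<lambda>t. indicator K t :: real)"
      unfolding K_def by (rule integrable_real_indicator) (auto simp: emeasure_lborel_Icc_eq)
    have K2: "(LBINT t. indicator K t) = 2 * r" using r by (simp add: K_def)
    define F where "F z = indicator I z * norm (\<kappa> z - \<kappa> s) + indicator I z * D z" for z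
    have iF: "integrable lborel F" unfolding F_def by (intro Bochner_Integration.integrable_add i\<kappa> iD)
    have iFK: "integrable lborel (\<lambda>x::plane. F (fst x) * indicator K (snd x))"
      using integrable_product_plane[OF iF iK] by simp
    have Fn: "F z \<ge> 0" for z
      unfolding F_def D_def using h(3) by (intro add_nonneg_nonneg mult_nonneg_nonneg Bochner_Integration.integral_nonneg) auto
    have "(LBINT y:?HB. norm (u y - \<kappa> s)) \<le> (LBINT x. F (fst x) * indicator K (snd x))"
      unfolding set_lebesgue_integral_def
    proof (rule integral_mono_AE'[OF iFK])
      show "AE y in lborel. indicator ?HB y *\<^sub>R norm (u y - \<kappa> s) \<le> F (fst y) * indicator K (snd y)"
        using bound AE_plane_fst[OF sec]
      proof eventually_elim
        case (elim y)
        show ?case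
        proof (cases "y \<in> ?HB")
          case True
          then have yI: "fst y \<in> I" "snd y \<in> K" using HBIK by auto
          have "norm (u y - \<kappa> s) \<le> norm (u y - \<kappa> (fst y)) + norm (\<kappa> (fst y) - \<kappa> s)"
            using norm_triangle_ineq[of "u y - \<kappa> (fst y)" "\<kappa> (fst y) - \<kappa> s"] by simp
          moreover have "norm (u y - \<kappa> (fst y)) \<le> (LBINT t. indicator {-\<bar>snd y\<bar>..\<bar>snd y\<bar>} t * h (fst y, t))"
            using elim(1) True HB\<rho> by blast
          moreover have "(LBINT t. indicator {-\<bar>snd y\<bar>..\<bar>snd y\<bar>} t * h (fst y, t)) \<le> D (fst y)"
            unfolding D_def
          proof (rule integral_mono)
            show "integrable lborel (\<lambda>t. indicator {-\<bar>snd y\<bar>..\<bar>snd y\<bar>} t * h (fst y, t))"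
              using integrable_mult_indicator[of "{-\<bar>snd y\<bar>..\<bar>snd y\<bar>}" lborel "\<lambda>t. h (fst y, t)"] elim(2) by simp
            show "integrable lborel (\<lambda>t. indicator K t * h (fst y, t))"
              using integrable_mult_indicator[of K lborel "\<lambda>t. h (fst y, t)"] elim(2) by simp
            show "indicator {-\<bar>snd y\<bar>..\<bar>snd y\<bar>} t * h (fst y, t) \<le> indicator K t * h (fst y, t)" for t
              using yI h(3) by (auto simp: indicator_def K_def)
          qed
          ultimately show ?thesis using True yI by (simp add: F_def)
        qed (use Fn in simp)
      qed
      show "AE y in lborel. 0 \<le> F (fst y) * indicator K (snd y)" using Fn by (intro AE_I2 mult_nonneg_nonneg) auto
    qed
    also have "(LBINT x. F (fst x) * indicator K (snd x)) = (LBINT z. F z * (2 * r))"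
      by (simp only: plane_integral_iterated(1)[OF iFK] fst_conv snd_conv integral_mult_right_zero K2)
    also have "\<dots> = (LBINT z. F z) * (2 * r)" by (rule integral_mult_left_zero)
    also have "(LBINT z. F z) = (LBINT z. indicator I z * norm (\<kappa> z - \<kappa> s)) + (LBINT x. indicator (I \<times> K) x * h x)"
      unfolding F_def itD by (rule Bochner_Integration.integral_add[OF i\<kappa> iD])
    also have "(LBINT z. indicator I z * norm (\<kappa> z - \<kappa> s)) \<le> \<delta> * r"
      unfolding I_def by (rule \<rho>1(2)) (use r in auto)
    also have "(LBINT x. indicator (I \<times> K) x * h x) \<le> 5 * \<delta> * r"
    proof -
      \<comment> \<open>The weight in Young's inequality that balances both terms:
        \<open>4 * r\<^sup>2 * l\<close> gives \<open>4 * \<delta> * r\<close>, and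
        \<open>\<delta>\<^sup>2 / l\<close> gives \<open>\<delta> * r\<close>.\<close>
      define l where "l = \<delta> / r"
      have l: "l > 0" using d r by (simp add: l_def)
      have i2: "integrable lborel (\<lambda>x. indicator (I \<times> K) x * (h x)\<^sup>2)"
        using integrable_mult_indicator[of "I \<times> K" lborel "\<lambda>x. (h x)\<^sup>2"] h IKm by simp
      have eIK: "emeasure lborel (I \<times> K) = ennreal (4 * r\<^sup>2)"
      proof -
        have "emeasure (lborel \<Otimes>\<^sub>M lborel) (I \<times> K) = ennreal (2 * r) * ennreal (2 * r)"
          using r by (subst lborel.emeasure_pair_measure_Times) (auto simp: I_def K_def)
        also have "\<dots> = ennreal (4 * r\<^sup>2)" using r by (simp add: ennreal_mult'[symmetric] power2_eq_square)
        finally show ?thesis by (simp add: lborel_prod)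
      qed
      have i1: "integrable lborel (\<lambda>x. indicator (I \<times> K) x * l)"
        by (intro integrable_mult_left integrable_real_indicator) (use eIK IKm in auto)
      have "(LBINT x. indicator (I \<times> K) x * h x) \<le> (LBINT x. indicator (I \<times> K) x * l + (1/l) * (indicator (I \<times> K) x * (h x)\<^sup>2))"
      proof (rule integral_mono[OF iIKh])
        show "integrable lborel (\<lambda>x. indicator (I \<times> K) x * l + (1/l) * (indicator (I \<times> K) x * (h x)\<^sup>2))"
          by (intro Bochner_Integration.integrable_add i1 integrable_mult_right i2)
        fix x
        have "0 \<le> (l - h x)\<^sup>2" by simp
        then have "2 * (l * h x) \<le> l * l + (h x)\<^sup>2" by (simp add: power2_eq_square algebra_simps)
        moreover have "0 \<le> l * h x" using l h(3) by simp
        ultimately have "l * h x \<le> l * l + (h x)\<^sup>2" by linarith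
        also have "\<dots> = l * (l + (1/l) * (h x)\<^sup>2)" using l by (simp add: distrib_left)
        finally have "h x \<le> l + (1/l) * (h x)\<^sup>2" using l by (rule mult_left_le_imp_le)
        then show "indicator (I \<times> K) x * h x \<le> indicator (I \<times> K) x * l + (1/l) * (indicator (I \<times> K) x * (h x)\<^sup>2)"
          by (simp add: indicator_def)
      qed
      also have "\<dots> = measure lborel (I \<times> K) * l + (1/l) * (LBINT x. indicator (I \<times> K) x * (h x)\<^sup>2)"
        using i1 i2 by simp
      also have "measure lborel (I \<times> K) = 4 * r\<^sup>2" using eIK by (simp add: measure_def)
      also have "(LBINT x. indicator (I \<times> K) x * (h x)\<^sup>2) \<le> \<delta>\<^sup>2"
        unfolding I_def K_def using \<rho>2(2)[of r] r by simp
      finally have "(LBINT x. indicator (I \<times> K) x * h x) \<le> 4 * r\<^sup>2 * l + (1/l) * \<delta>\<^sup>2"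
        using l by (simp add: divide_right_mono)
      also have "\<dots> = 5 * \<delta> * r" using d r by (simp add: l_def power2_eq_square)
      finally show ?thesis .
    qed
    finally have A: "(LBINT y:?HB. norm (u y - \<kappa> s)) \<le> 12 * \<delta> * r\<^sup>2"
      using r by (simp add: power2_eq_square algebra_simps)
    have mHB: "measure lborel ?HB \<ge> cb * r\<^sup>2" using half_ball_facts(3)[OF r(1) \<nu>] by (simp add: cb_def)
    have cr: "cb * r\<^sup>2 > 0" using cb r by simp
    have "0 \<le> (LBINT y:?HB. norm (u y - \<kappa> s))"
      unfolding set_lebesgue_integral_def by (rule Bochner_Integration.integral_nonneg) simp
    then have "(LBINT y:?HB. norm (u y - \<kappa> s)) / measure lborel ?HB \<le> (12 * \<delta> * r\<^sup>2) / (cb * r\<^sup>2)"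
      using A mHB cr by (intro frac_le) auto
    also have "\<dots> = 12 * \<delta> / cb" using r by simp
    also have "\<dots> < e" using cb e by (simp add: \<delta>_def)
    finally show ?thesis .
  qed
  have nn: "0 \<le> (LBINT y:half_ball (s, 0) r \<nu>. norm (u y - \<kappa> s)) / measure lborel (half_ball (s, 0) r \<nu>)" for r
    unfolding set_lebesgue_integral_def by (intro divide_nonneg_nonneg Bochner_Integration.integral_nonneg) auto
  show "eventually (\<lambda>r. dist ((LBINT y:half_ball (s, 0) r \<nu>. norm (u y - \<kappa> s)) / measure lborel (half_ball (s, 0) r \<nu>)) 0 < e) (at_right 0)"
    unfolding eventually_at_right_field
  proof (intro exI[of _ "min \<rho> (min \<rho>1 \<rho>2)"] conjI allI impI)
    show "0 < min \<rho> (min \<rho>1 \<rho>2)" using \<rho> \<rho>1 \<rho>2 by simp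
    fix r assume "0 < r" "r < min \<rho> (min \<rho>1 \<rho>2)"
    then show "dist ((LBINT y:half_ball (s, 0) r \<nu>. norm (u y - \<kappa> s)) / measure lborel (half_ball (s, 0) r \<nu>)) 0 < e"
      using main[of r] nn[of r] by (simp add: dist_real_def)
  qed
qed

text \<open>Two different one-sided values would keep \<open>norm (u y - u z)\<close> of the order
  of \<open>norm (a - b)\<close> for most pairs from opposite half balls, so the double integral of
  its square would be at least of order \<open>r^4\<close>. Poincare's inequality bounds it by
  \<open>r^4\<close> times the gradient energy of a shrinking square, which tends to zero.\<close>

lemma no_jump:
  fixes u :: "plane \<Rightarrow> real^2" and G :: "plane \<Rightarrow> real^2^2"
  assumes um [measurable]: "u \<in> borel_measurable borel" and iu: "integrable lborel u"
    and Gs: "sqint lborel G"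
    and \<rho>: "\<rho> > 0"
    and wd: "\<And>r j. 0 < r \<Longrightarrow> r < \<rho> \<Longrightarrow>
       has_weak_deriv ({fst x - r<..<fst x - r + 2 * r} \<times> {snd x - r<..<snd x - r + 2 * r}) (coord j) u (\<lambda>y. column j (G y))"
    and us: "sqint lborel u" and \<nu>: "norm \<nu> = 1"
    and a: "one_sided_approx_limit u x \<nu> a" and b: "one_sided_approx_limit u x (- \<nu>) b"
  shows "a = b"
proof (rule ccontr)
  assume ab: "a \<noteq> b"
  define cb where "cb = measure lborel (ball (0::plane) 1) / 4"
  have cb: "cb > 0" unfolding cb_def using content_ball_pos[of 1 "0::plane"] by simp
  \<comment> \<open>With this choice the pointwise inequality below has left side
    \<open>7 * \<delta>\<close>, while each of the three terms on its right contributes at most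
    \<open>\<delta>\<close> on average.\<close>
  define \<delta> where "\<delta> = norm (a - b) / 8"
  have d: "\<delta> > 0" using ab by (simp add: \<delta>_def)
  have \<nu>': "norm (- \<nu>) = 1" using \<nu> by simp
  \<comment> \<open>Chosen so that \<open>32 * r^4 * e2 / \<delta>\<close> equals
    \<open>\<delta> * (cb * r\<^sup>2)\<^sup>2\<close>; the 32 is \<open>2 * 2^4\<close> from
    Poincare's inequality on a square of side \<open>2 * r\<close>.\<close>
  define e2 where "e2 = \<delta>\<^sup>2 * cb\<^sup>2 / 32"
  have e2: "e2 > 0" using d cb by (simp add: e2_def)
  obtain \<rho>2 where \<rho>2: "\<rho>2 > 0" "\<And>r. 0 < r \<Longrightarrow> r < \<rho>2 \<Longrightarrow>
      (LBINT y. indicator ({fst x - r..fst x + r} \<times> {snd x - r..snd x + r}) y * (norm (G y))\<^sup>2) \<le> e2"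
    using small_square_integral[OF sqint_integrable[OF Gs] _ e2, of x] by auto
  have "eventually (\<lambda>r. (LBINT y:half_ball x r \<nu>. norm (u y - a)) / measure lborel (half_ball x r \<nu>) < \<delta>) (at_right 0)"
    using a d unfolding one_sided_approx_limit_def by (rule order_tendstoD)
  moreover have "eventually (\<lambda>r. (LBINT y:half_ball x r (-\<nu>). norm (u y - b)) / measure lborel (half_ball x r (-\<nu>)) < \<delta>) (at_right 0)"
    using b d unfolding one_sided_approx_limit_def by (rule order_tendstoD)
  moreover have "eventually (\<lambda>r. r < \<rho>) (at_right 0)" "eventually (\<lambda>r. r < \<rho>2) (at_right 0)" "eventually (\<lambda>r::real. 0 < r) (at_right 0)"
    using \<rho> \<rho>2(1) by (auto simp: eventually_at_right_field)
  ultimately have "eventually (\<lambda>r. (LBINT y:half_ball x r \<nu>. norm (u y - a)) / measure lborel (half_ball x r \<nu>) < \<delta> \<and>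
      (LBINT y:half_ball x r (-\<nu>). norm (u y - b)) / measure lborel (half_ball x r (-\<nu>)) < \<delta> \<and> r < \<rho> \<and> r < \<rho>2 \<and> 0 < r) (at_right 0)"
    by eventually_elim auto
  then obtain r where r: "0 < r" "r < \<rho>" "r < \<rho>2"
    and Ar: "(LBINT y:half_ball x r \<nu>. norm (u y - a)) / measure lborel (half_ball x r \<nu>) < \<delta>"
    and Br: "(LBINT y:half_ball x r (-\<nu>). norm (u y - b)) / measure lborel (half_ball x r (-\<nu>)) < \<delta>"
    using eventually_happens'[of "at_right (0::real)"] by (metis (mono_tags, lifting) trivial_limit_at_right_real)
  define P where "P = half_ball x r \<nu>"
  define N where "N = half_ball x r (-\<nu>)"
  define Q where "Q = {fst x - r<..<fst x - r + 2 * r} \<times> {snd x - r<..<snd x - r + 2 * r}"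
  note hP = half_ball_facts[OF r(1) \<nu>, of x, folded P_def Q_def]
  note hN = half_ball_facts[OF r(1) \<nu>', of x, folded N_def Q_def]
  note [measurable] = hP(1) hN(1)
  have Qm [measurable]: "Q \<in> sets borel" unfolding Q_def by (intro borel_open open_Times) auto
  define mP mN where "mP = measure lborel P" and "mN = measure lborel N"
  have crp: "cb * r\<^sup>2 > 0" using cb r by simp
  have mP: "mP \<ge> cb * r\<^sup>2" "mP > 0" and mN: "mN \<ge> cb * r\<^sup>2" "mN > 0"
    using hP(3) hN(3) crp by (auto simp: mP_def mN_def cb_def)
  have eP: "emeasure lborel P = ennreal mP" and eN: "emeasure lborel N = ennreal mN"
    using hP(4) hN(4) by (simp_all add: mP_def mN_def emeasure_eq_ennreal_measure less_top)
  have iA: "integrable lborel (\<lambda>y. indicator P y *\<^sub>R norm (u y - a))" and iB: "integrable lborel (\<lambda>y. indicator N y *\<^sub>R norm (u y - b))"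
  proof -
    have *: "integrable lborel (\<lambda>y. indicator S y *\<^sub>R norm (u y - v))" if [measurable]: "S \<in> sets borel" and "emeasure lborel S < \<infinity>" for S v
    proof -
      have "integrable lborel (\<lambda>y. indicator S y *\<^sub>R u y - indicator S y *\<^sub>R v)"
        using iu that by (intro Bochner_Integration.integrable_diff integrable_mult_indicator integrable_scaleR_left integrable_real_indicator) auto
      from integrable_norm[OF this] show ?thesis by (simp flip: scaleR_diff_right)
    qed
    show "integrable lborel (\<lambda>y. indicator P y *\<^sub>R norm (u y - a))" "integrable lborel (\<lambda>y. indicator N y *\<^sub>R norm (u y - b))"
      using * hP hN by auto
  qed
  define A B where "A = (LBINT y:P. norm (u y - a))" and "B = (LBINT y:N. norm (u y - b))"
  have A: "A < \<delta> * mP" using Ar mP by (simp add: A_def mP_def P_def divide_less_eq)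
  have B: "B < \<delta> * mN" using Br mN by (simp add: B_def mN_def N_def divide_less_eq)
  have nA: "(\<integral>\<^sup>+y. indicator P y * ennreal (norm (u y - a)) \<partial>lborel) = ennreal A"
  proof -
    have "(\<integral>\<^sup>+y. ennreal (indicator P y *\<^sub>R norm (u y - a)) \<partial>lborel) = ennreal A"
      unfolding A_def set_lebesgue_integral_def using iA by (intro nn_integral_eq_integral) auto
    then show ?thesis by (simp add: indicator_mult_ennreal)
  qed
  have nB: "(\<integral>\<^sup>+y. indicator N y * ennreal (norm (u y - b)) \<partial>lborel) = ennreal B"
  proof -
    have "(\<integral>\<^sup>+y. ennreal (indicator N y *\<^sub>R norm (u y - b)) \<partial>lborel) = ennreal B"
      unfolding B_def set_lebesgue_integral_def using iB by (intro nn_integral_eq_integral) auto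
    then show ?thesis by (simp add: indicator_mult_ennreal)
  qed
  have nP: "(\<integral>\<^sup>+y. indicator P y \<partial>lborel) = ennreal mP" and nN: "(\<integral>\<^sup>+y. indicator N y \<partial>lborel) = ennreal mN"
    using eP eN by simp_all
  define D where "D = (\<integral>\<^sup>+y. \<integral>\<^sup>+z. indicator P y * indicator N z * ennreal ((norm (u y - u z))\<^sup>2) \<partial>lborel \<partial>lborel)"
  have Dle: "D \<le> ennreal (32 * r^4 * e2)"
  proof -
    have s1: "sqint (lborel_on Q) u" and s2: "sqint (lborel_on Q) G"
      using us Gs by (auto intro: sqint_lborel_imp_on)
    note s3 = sqint_column(1)[OF s2]
    have "D \<le> (\<integral>\<^sup>+y. \<integral>\<^sup>+z. ennreal ((norm (u y - u z))\<^sup>2) * indicator Q z \<partial>lborel * indicator Q y \<partial>lborel)"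
      unfolding D_def
    proof (intro nn_integral_mono)
      fix y
      show "(\<integral>\<^sup>+z. indicator P y * indicator N z * ennreal ((norm (u y - u z))\<^sup>2) \<partial>lborel)
        \<le> (\<integral>\<^sup>+z. ennreal ((norm (u y - u z))\<^sup>2) * indicator Q z \<partial>lborel) * indicator Q y"
      proof (cases "y \<in> P")
        case True
        then have "y \<in> Q" using hP(2) by blast
        then show ?thesis using True hN(2) by (auto intro!: nn_integral_mono simp: indicator_def)
      qed simp
    qed
    also have "\<dots> = (\<integral>\<^sup>+y. \<integral>\<^sup>+z. ennreal ((norm (u y - u z))\<^sup>2) \<partial>lborel_on Q \<partial>lborel_on Q)"
      by (simp add: nn_integral_restrict_space)
    also have "\<dots> \<le> ennreal (2 * (2*r)^4 * (nsq (lborel_on Q) (\<lambda>y. column 1 (G y)) + nsq (lborel_on Q) (\<lambda>y. column 2 (G y))))"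
      using r wd[OF r(1,2)] by (intro Poincare_square(1)[OF _ Q_def s1 s3 s3]) (auto simp: Q_def)
    also have "\<dots> \<le> ennreal (32 * r^4 * e2)"
    proof (rule ennreal_leI)
      have "nsq (lborel_on Q) (\<lambda>y. column 1 (G y)) + nsq (lborel_on Q) (\<lambda>y. column 2 (G y)) = nsq (lborel_on Q) G"
        unfolding nsq_def norm_matrix_columns using s3[of 1] s3[of 2] by (simp add: sqint_def)
      also have "\<dots> = (LBINT y. indicator Q y * (norm (G y))\<^sup>2)" by (simp add: nsq_def integral_restrict_space)
      also have "\<dots> \<le> (LBINT y. indicator ({fst x - r..fst x + r} \<times> {snd x - r..snd x + r}) y * (norm (G y))\<^sup>2)"
      proof (rule integral_mono)
        have i: "integrable lborel (\<lambda>y. indicator S y * (norm (G y))\<^sup>2)" if "S \<in> sets borel" for S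
          using integrable_mult_indicator[of S lborel "\<lambda>y. (norm (G y))\<^sup>2"] sqint_integrable[OF Gs] that by simp
        show "integrable lborel (\<lambda>y. indicator Q y * (norm (G y))\<^sup>2)" by (rule i) simp
        show "integrable lborel (\<lambda>y. indicator ({fst x - r..fst x + r} \<times> {snd x - r..snd x + r}) y * (norm (G y))\<^sup>2)"
          by (rule i) (intro borel_closed closed_Times, auto)
      qed (auto simp: Q_def indicator_def)
      also have "\<dots> \<le> e2" using \<rho>2(2) r by simp
      finally show "2 * (2*r)^4 * (nsq (lborel_on Q) (\<lambda>y. column 1 (G y)) + nsq (lborel_on Q) (\<lambda>y. column 2 (G y))) \<le> 32 * r^4 * e2"
        using r by (simp add: power_mult_distrib mult_left_mono)
    qed
    finally show ?thesis .
  qed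
  have pt: "norm (a - b) - \<delta> \<le> norm (u y - a) + norm (u z - b) + (1/\<delta>) * (norm (u y - u z))\<^sup>2" for y z
  proof -
    have "norm (a - b) = norm ((u y - u z) - (u y - a) + (u z - b))" by simp
    also have "\<dots> \<le> norm (u y - u z) + norm (u y - a) + norm (u z - b)"
      using norm_triangle_ineq[of "(u y - u z) - (u y - a)" "u z - b"] norm_triangle_ineq4[of "u y - u z" "u y - a"] by linarith
    finally have 1: "norm (a - b) \<le> norm (u y - u z) + norm (u y - a) + norm (u z - b)" .
    define t where "t = norm (u y - u z)"
    have "0 \<le> (\<delta> - t)\<^sup>2" by simp
    then have "2 * (\<delta> * t) \<le> \<delta> * \<delta> + t\<^sup>2" by (simp add: power2_eq_square algebra_simps)
    moreover have "0 \<le> \<delta> * t" using d by (simp add: t_def)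
    ultimately have "\<delta> * t \<le> \<delta> * \<delta> + t\<^sup>2" by linarith
    also have "\<dots> = \<delta> * (\<delta> + (1/\<delta>) * t\<^sup>2)" using d by (simp add: distrib_left)
    finally have "t \<le> \<delta> + (1/\<delta>) * t\<^sup>2" using d by (rule mult_left_le_imp_le)
    with 1 show ?thesis by (simp add: t_def)
  qed
  have "ennreal (7 * \<delta> * mP * mN) = (\<integral>\<^sup>+y. \<integral>\<^sup>+z. indicator P y * (indicator N z * ennreal (7 * \<delta>)) \<partial>lborel \<partial>lborel)"
    using d mP mN by (simp add: nn_integral_cmult nn_integral_multc nP nN ennreal_mult'[symmetric] ac_simps)
  also have "\<dots> \<le> (\<integral>\<^sup>+y. \<integral>\<^sup>+z. (indicator P y * ennreal (norm (u y - a))) * indicator N z + indicator P y * (indicator N z * ennreal (norm (u z - b)))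
      + ennreal (1/\<delta>) * (indicator P y * indicator N z * ennreal ((norm (u y - u z))\<^sup>2)) \<partial>lborel \<partial>lborel)"
  proof (intro nn_integral_mono)
    fix y z
    have "7 * \<delta> \<le> norm (u y - a) + norm (u z - b) + (1/\<delta>) * (norm (u y - u z))\<^sup>2"
      using pt[of y z] by (simp add: \<delta>_def)
    then have "ennreal (7 * \<delta>) \<le> ennreal (norm (u y - a) + norm (u z - b) + (1/\<delta>) * (norm (u y - u z))\<^sup>2)"
      by (rule ennreal_leI)
    also have "\<dots> = ennreal (norm (u y - a)) + ennreal (norm (u z - b)) + ennreal (1/\<delta>) * ennreal ((norm (u y - u z))\<^sup>2)"
    proof -
      have "ennreal ((1/\<delta>) * (norm (u y - u z))\<^sup>2) = ennreal (1/\<delta>) * ennreal ((norm (u y - u z))\<^sup>2)"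
        using d by (intro ennreal_mult') simp
      then show ?thesis using d by (subst ennreal_plus) (auto simp del: times_divide_eq_left)
    qed
    finally show "indicator P y * (indicator N z * ennreal (7 * \<delta>)) \<le> (indicator P y * ennreal (norm (u y - a))) * indicator N z + indicator P y * (indicator N z * ennreal (norm (u z - b)))
      + ennreal (1/\<delta>) * (indicator P y * indicator N z * ennreal ((norm (u y - u z))\<^sup>2))"
      by (cases "y \<in> P"; cases "z \<in> N") auto
  qed
  also have "\<dots> = (\<integral>\<^sup>+y. (indicator P y * ennreal (norm (u y - a))) * ennreal mN + indicator P y * ennreal B
      + ennreal (1/\<delta>) * (\<integral>\<^sup>+z. indicator P y * indicator N z * ennreal ((norm (u y - u z))\<^sup>2) \<partial>lborel) \<partial>lborel)"
    by (intro nn_integral_cong) (simp add: nn_integral_add nn_integral_cmult nN nB)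
  also have "\<dots> = ennreal A * ennreal mN + ennreal mP * ennreal B + ennreal (1/\<delta>) * D"
  proof -
    have [measurable]: "(\<lambda>y. \<integral>\<^sup>+z. indicator P y * indicator N z * ennreal ((norm (u y - u z))\<^sup>2) \<partial>lborel) \<in> borel_measurable borel"
      by measurable
    show ?thesis by (simp add: nn_integral_add nn_integral_cmult nn_integral_multc nA nP D_def)
  qed
  also have "\<dots> \<le> ennreal A * ennreal mN + ennreal mP * ennreal B + ennreal (1/\<delta>) * ennreal (32 * r^4 * e2)"
    by (intro add_left_mono mult_left_mono Dle) simp
  also have "\<dots> = ennreal (A * mN + mP * B + (1/\<delta>) * (32 * r^4 * e2))"
  proof -
    have "0 \<le> A" "0 \<le> B" unfolding A_def B_def set_lebesgue_integral_def by (intro Bochner_Integration.integral_nonneg; simp)+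
    then show ?thesis using mP mN d e2 r
      by (simp add: ennreal_mult''[symmetric] ennreal_plus[symmetric] del: ennreal_plus)
  qed
  finally have "7 * \<delta> * mP * mN \<le> A * mN + mP * B + (1/\<delta>) * (32 * r^4 * e2)"
  proof -
    assume le: "ennreal (7 * \<delta> * mP * mN) \<le> ennreal (A * mN + mP * B + (1/\<delta>) * (32 * r^4 * e2))"
    have "0 \<le> A" "0 \<le> B" unfolding A_def B_def set_lebesgue_integral_def by (intro Bochner_Integration.integral_nonneg; simp)+
    then have "0 \<le> A * mN + mP * B + (1/\<delta>) * (32 * r^4 * e2)" using mP mN d e2 r by simp
    with le show ?thesis by (subst (asm) ennreal_le_iff) auto
  qed
  moreover have "A * mN \<le> \<delta> * mP * mN" using A mN by simp
  moreover have "mP * B \<le> \<delta> * mP * mN" using B mP by (simp add: mult.left_commute mult.commute)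
  moreover have "(1/\<delta>) * (32 * r^4 * e2) \<le> \<delta> * mP * mN"
  proof -
    have "(1/\<delta>) * (32 * r^4 * e2) = \<delta> * ((cb * r\<^sup>2) * (cb * r\<^sup>2))"
      using d by (simp add: e2_def power2_eq_square power4_eq_xxxx)
    also have "\<dots> \<le> \<delta> * (mP * mN)" using mP mN crp d by (intro mult_left_mono mult_mono) auto
    finally show ?thesis by (simp add: mult.assoc)
  qed
  moreover have "\<delta> * mP * mN > 0" using d mP mN by simp
  ultimately show False by linarith
qed

subsection \<open>Functions with weak gradient off a segment\<close>

lemma integrable_product_plane':
  fixes h :: "real \<Rightarrow> 'b::euclidean_space"
  assumes "integrable lborel e" "integrable lborel h"
  shows "integrable lborel (\<lambda>x::plane. e (snd x) *\<^sub>R h (fst x))"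
  using plane_swap(1)[OF integrable_product_plane[OF assms]] by simp

lemma column_colmat: "column i (colmat j v) = (if i = j then v else 0)"
  by (auto simp: column_def colmat_def vec_eq_iff)

lemma segment_null: "(UNIV :: real set) \<times> {0::real} \<in> null_sets lborel"
proof -
  have "emeasure (lborel \<Otimes>\<^sub>M lborel) ((UNIV :: real set) \<times> {0::real}) = 0"
    by (subst lborel.emeasure_pair_measure_Times) auto
  moreover have "(UNIV :: real set) \<times> {0::real} \<in> sets (lborel \<Otimes>\<^sub>M lborel)" by (intro pair_measureI) auto
  ultimately show ?thesis unfolding lborel_prod by (rule null_setsI)
qed

text \<open>The assumption \<open>rep\<close> says that the distributional derivative of \<open>u\<close> on \<open>Omega\<close> is \<open>G dx\<close> plus
  the line measure with density \<open>J \<otimes> e\<^sub>2\<close> on \<open>layer0 \<xi>\<close>.\<close>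

locale segment_jump =
  fixes \<xi> :: real and u :: "plane \<Rightarrow> real^2" and G :: "plane \<Rightarrow> real^2^2" and J :: "real \<Rightarrow> real^2"
  assumes xi: "0 < \<xi>" "\<xi> < 1"
    and um [measurable]: "u \<in> borel_measurable borel" and uout: "\<And>x. x \<notin> Omega \<Longrightarrow> u x = 0" and us: "sqint lborel u"
    and Gout: "\<And>x. x \<notin> Omega \<Longrightarrow> G x = 0" and Gs: "sqint lborel G"
    and J: "continuous_on UNIV J"
    and rep: "\<And>\<phi> j. test_fun Omega \<phi> \<Longrightarrow>
      (\<integral>x. dir_deriv (coord j) \<phi> x *\<^sub>R u x \<partial>lborel_on Omega) = - (\<integral>x. \<phi> x *\<^sub>R column j (G x) \<partial>lborel_on Omega)
        - (if j = 2 then \<integral>s. indicator {-\<xi><..<1} s *\<^sub>R (\<phi> (s, 0) *\<^sub>R J s) \<partial>lborel else 0)"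
begin

lemma Gm [measurable]: "G \<in> borel_measurable borel" using Gs by (auto simp: sqint_def)
lemma Jm [measurable]: "J \<in> borel_measurable borel" by (rule borel_measurable_continuous_onI[OF J])

lemma integrable_zero_ext:
  fixes f :: "plane \<Rightarrow> 'b::euclidean_space"
  assumes "sqint lborel f" "\<And>x. x \<notin> Omega \<Longrightarrow> f x = 0" shows "integrable lborel f"
proof -
  have "integrable (lborel_on Omega) f"
    by (rule sqint_loc_integrable(2)[OF sqint_lborel_imp_on[OF assms(1)] _ bounded_Omega]) auto
  then have "integrable lborel (\<lambda>x. indicator Omega x *\<^sub>R f x)" by (simp add: integrable_restrict_space)
  moreover have "indicator Omega x *\<^sub>R f x = f x" for x using assms(2)[of x] by (auto simp: indicator_def)
  ultimately show ?thesis by simp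
qed

lemma iu: "integrable lborel u" by (rule integrable_zero_ext[OF us uout])
lemma iG: "integrable lborel G" by (rule integrable_zero_ext[OF Gs Gout])

lemma closure_layer0: "closure (layer0 \<xi>) = {-\<xi>..1} \<times> {0}"
  using xi by (simp add: layer0_def closure_Times)

text \<open>Test functions supported away from the segment do not see the line term.\<close>

lemma weak_deriv_off_segment:
  assumes Q: "open Q" "Q \<subseteq> Omega" "Q \<inter> ({-\<xi>..1} \<times> {0}) = {}"
  shows "has_weak_deriv Q (coord j) u (\<lambda>y. column j (G y))"
  unfolding has_weak_deriv_def
proof (intro conjI allI impI)
  have Qb: "bounded Q" by (rule bounded_subset[OF bounded_Omega Q(2)])
  have Qm: "Q \<in> sets borel" using Q by simp
  show "loc_integrable Q u" by (rule sqint_loc_integrable(1)[OF sqint_lborel_imp_on[OF us Qm] Qm Qb])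
  show "loc_integrable Q (\<lambda>y. column j (G y))"
    by (rule sqint_loc_integrable(1)[OF sqint_lborel_imp_on[OF sqint_column(1)[OF Gs] Qm] Qm Qb])
  fix \<phi> assume \<phi>: "test_fun Q \<phi>"
  have z: "indicator {-\<xi><..<1} s *\<^sub>R (\<phi> (s, 0) *\<^sub>R J s) = 0" for s
  proof (cases "s \<in> {-\<xi><..<1}")
    case True
    then have "(s, 0) \<notin> Q" using Q(3) by auto
    then show ?thesis using test_fun_outside[OF \<phi>] by simp
  qed simp
  show "(LBINT x:Q. dir_deriv (coord j) \<phi> x *\<^sub>R u x) = - (LBINT x:Q. \<phi> x *\<^sub>R column j (G x))"
    using rep[OF test_fun_mono[OF \<phi> Q(2)], of j]
    unfolding z set_integral_lborel_on[OF Omega_borel, symmetric]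
      set_integral_test_fun_subset[OF \<phi> Q(2)] set_integral_test_fun_subset[OF test_fun_dir_deriv[OF \<phi>] Q(2)] by simp
qed

lemma jump_set_subset: "jump_set Omega u \<subseteq> closure (layer0 \<xi>)"
proof
  fix x assume "x \<in> jump_set Omega u"
  then obtain a b \<nu> where x: "x \<in> Omega" and ab: "a \<noteq> b" and \<nu>: "norm \<nu> = 1"
    and l: "one_sided_approx_limit u x \<nu> a" "one_sided_approx_limit u x (- \<nu>) b"
    unfolding jump_set_def by blast
  show "x \<in> closure (layer0 \<xi>)"
  proof (rule ccontr)
    assume nx: "x \<notin> closure (layer0 \<xi>)"
    have "open (Omega - closure (layer0 \<xi>))" by (intro open_Diff open_Omega closed_closure)
    then obtain e where e: "e > 0" "ball x e \<subseteq> Omega - closure (layer0 \<xi>)"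
      using x nx open_contains_ball by blast
    have "a = b"
    proof (rule no_jump[OF um iu Gs _ _ us \<nu> l])
      show "e / 2 > 0" using e by simp
      fix r j assume r: "0 < r" "r < e / 2"
      let ?Q = "{fst x - r<..<fst x - r + 2 * r} \<times> {snd x - r<..<snd x - r + 2 * r}"
      have "?Q \<subseteq> ball x e"
      proof
        fix y assume "y \<in> ?Q"
        then have "\<bar>fst (x - y)\<bar> < r" "\<bar>snd (x - y)\<bar> < r" by auto
        moreover have "norm (x - y) \<le> norm (fst (x - y)) + norm (snd (x - y))"
          using norm_Pair_le[of "fst (x - y)" "snd (x - y)"] by (simp only: prod.collapse)
        ultimately have "norm (x - y) < e" using r by simp
        then show "y \<in> ball x e" by (simp add: dist_norm)
      qed
      then have "?Q \<subseteq> Omega - closure (layer0 \<xi>)" using e(2) by blast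
      then show "has_weak_deriv ?Q (coord j) u (\<lambda>y. column j (G y))"
        unfolding closure_layer0 by (intro weak_deriv_off_segment open_Times) auto
    qed
    with ab show False by simp
  qed
qed

definition JI :: "real \<Rightarrow> real^2" where "JI s = indicator {-\<xi><..<1} s *\<^sub>R J s"
definition g :: "plane \<Rightarrow> real^2" where "g x = column 2 (G x)"

lemma iJI: "integrable lborel JI"
proof -
  have "integrable lborel (\<lambda>s. indicator {-\<xi>..1} s *\<^sub>R J s)"
    by (rule borel_integrable_compact) (auto intro: continuous_on_subset[OF J])
  from integrable_mult_indicator[OF _ this, of "{-\<xi><..<1}"]
  have "integrable lborel (\<lambda>s. indicator {-\<xi><..<1} s *\<^sub>R (indicator {-\<xi>..1} s *\<^sub>R J s))" by simp
  moreover have "indicator {-\<xi><..<1} s *\<^sub>R (indicator {-\<xi>..1} s *\<^sub>R J s) = JI s" for s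
    by (auto simp: JI_def indicator_def)
  ultimately show ?thesis by simp
qed

lemma gs: "sqint lborel g" unfolding g_def[abs_def] by (rule sqint_column(1)[OF Gs])
lemma gout: "x \<notin> Omega \<Longrightarrow> g x = 0" using Gout by (simp add: g_def column_def vec_eq_iff)
lemma ig: "integrable lborel g" by (rule integrable_zero_ext[OF gs gout])

text \<open>A step of height \<open>JI\<close> across the axis contributes exactly the line term to
  the vertical derivative. Once this Heaviside part is subtracted, the remainder is a vertical
  primitive of \<open>g\<close> on the rectangle.\<close>

lemma vertical_structure:
  "\<exists>w. integrable lborel w \<and> (AE x in lborel. x \<in> {-\<xi><..<1} \<times> {-1<..<1} \<longrightarrow>
      u x - indicator {0<..} (snd x) *\<^sub>R JI (fst x) = w (fst x) + (LBINT t:{-1<..<snd x}. g (fst x, t)))"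
proof -
  let ?R = "{-\<xi><..<1::real} \<times> {-1<..<1::real}"
  have Rm [measurable]: "?R \<in> sets borel" by (intro borel_open open_Times) auto
  have RO: "?R \<subseteq> Omega" using xi by (auto simp: Omega_def)
  define q where "q x = indicator {0<..} (snd x) *\<^sub>R JI (fst x)" for x :: plane
  \<comment> \<open>The rectangle ends at height 1, so the step may be cut off there, which makes it
    integrable.\<close>
  have iq0: "integrable lborel (\<lambda>x::plane. (indicator {0<..<1} (snd x) :: real) *\<^sub>R JI (fst x))"
    by (rule integrable_product_plane'[OF integrable_indicator_interval iJI])
  have eq: "indicator ?R x *\<^sub>R q x = indicator {0<..<1} (snd x) *\<^sub>R JI (fst x)" for x
    by (cases x) (auto simp: q_def JI_def indicator_def)
  have iq: "set_integrable lborel ?R q" unfolding set_integrable_def eq by (rule iq0)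
  have iuR: "set_integrable lborel ?R u" "set_integrable lborel ?R g"
    unfolding set_integrable_def using iu ig by (auto intro: integrable_mult_indicator)
  have iv: "set_integrable lborel ?R (\<lambda>x. u x - q x)" by (rule set_integral_diff(1)[OF iuR(1) iq])
  have "\<exists>w. integrable lborel w \<and> (AE x in lborel. x \<in> ?R \<longrightarrow> u x - q x = w (fst x) + (LBINT t:{-1<..<snd x}. g (fst x, t)))"
  proof (rule absolutely_continuous_vertical[OF _ iv iuR(2)])
    fix \<phi> \<eta> :: "real \<Rightarrow> real" assume \<phi>: "test_fun {-\<xi><..<1} \<phi>" and \<eta>: "test_fun {-1<..<1} \<eta>"
    have tR: "test_fun ?R (\<lambda>x. \<phi> (fst x) * \<eta> (snd x))"
      and tR': "test_fun ?R (\<lambda>x. \<phi> (fst x) * dir_deriv 1 \<eta> (snd x))"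
      by (rule test_fun_product(1)[OF \<phi> \<eta>], rule test_fun_product(1)[OF \<phi> test_fun_dir_deriv[OF \<eta>]])
    have r: "(LBINT x:?R. (\<phi> (fst x) * dir_deriv 1 \<eta> (snd x)) *\<^sub>R u x) = - (LBINT x:?R. (\<phi> (fst x) * \<eta> (snd x)) *\<^sub>R g x)
        - (LBINT s. indicator {-\<xi><..<1} s *\<^sub>R ((\<phi> s * \<eta> 0) *\<^sub>R J s))"
      using rep[OF test_fun_mono[OF tR RO], of 2]
      unfolding set_integral_lborel_on[OF Omega_borel, symmetric] test_fun_product(3)[OF \<phi> \<eta>] g_def[symmetric]
        set_integral_test_fun_subset[OF tR RO] set_integral_test_fun_subset[OF tR' RO] by simp
    have iq1: "integrable lborel (\<lambda>x. (\<phi> (fst x) * dir_deriv 1 \<eta> (snd x)) *\<^sub>R (indicator {0<..<1} (snd x) *\<^sub>R JI (fst x)))"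
      by (rule integrable_test_fun_scaleR[OF tR' iq0])
    have eout: "dir_deriv 1 \<eta> t * indicator {0<..<1} t = dir_deriv 1 \<eta> t * indicator {0<..} t" for t
      using test_fun_outside[OF test_fun_dir_deriv[OF \<eta>], of t 1] by (auto simp: indicator_def)
    have "(LBINT x:?R. (\<phi> (fst x) * dir_deriv 1 \<eta> (snd x)) *\<^sub>R q x)
       = (LBINT x. (\<phi> (fst x) * dir_deriv 1 \<eta> (snd x)) *\<^sub>R (indicator ?R x *\<^sub>R q x))"
      unfolding set_lebesgue_integral_def by (simp add: mult.commute)
    also have "\<dots> = (LBINT s. (LBINT t. (dir_deriv 1 \<eta> t * indicator {0<..} t) *\<^sub>R (\<phi> s *\<^sub>R JI s)))"
      unfolding eq plane_integral_iterated(1)[OF iq1] fst_conv snd_conv eout[symmetric]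
      by (simp add: mult.assoc mult.left_commute mult.commute)
    also have "\<dots> = (LBINT s. (- \<eta> 0) *\<^sub>R (\<phi> s *\<^sub>R JI s))"
    proof (rule Bochner_Integration.integral_cong[OF refl])
      fix s
      have "integrable lborel (\<lambda>t. dir_deriv 1 \<eta> t * indicator {0<..} t)"
        using integrable_mult_indicator[of "{0<..}" lborel "dir_deriv 1 \<eta>"] test_fun_integrable[OF test_fun_dir_deriv[OF \<eta>]]
        by (simp add: mult.commute)
      then have "(LBINT t. (dir_deriv 1 \<eta> t * indicator {0<..} t) *\<^sub>R (\<phi> s *\<^sub>R JI s))
         = (LBINT t. dir_deriv 1 \<eta> t * indicator {0<..} t) *\<^sub>R (\<phi> s *\<^sub>R JI s)"
        by (intro integral_scaleR_left)
      \<comment> \<open>The tail integral over the upper half-line is where the value of the test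
        function on the axis comes from.\<close>
      also have "(LBINT t. dir_deriv 1 \<eta> t * indicator {0<..} t) = - \<eta> 0"
        by (rule integral_deriv_tail[OF \<eta>]) simp
      finally show "(LBINT t. (dir_deriv 1 \<eta> t * indicator {0<..} t) *\<^sub>R (\<phi> s *\<^sub>R JI s)) = (- \<eta> 0) *\<^sub>R (\<phi> s *\<^sub>R JI s)" .
    qed
    also have "\<dots> = (LBINT s. - (indicator {-\<xi><..<1} s *\<^sub>R ((\<phi> s * \<eta> 0) *\<^sub>R J s)))"
      by (intro Bochner_Integration.integral_cong refl) (auto simp: JI_def indicator_def mult.commute)
    finally have r2: "(LBINT x:?R. (\<phi> (fst x) * dir_deriv 1 \<eta> (snd x)) *\<^sub>R q x) = - (LBINT s. indicator {-\<xi><..<1} s *\<^sub>R ((\<phi> s * \<eta> 0) *\<^sub>R J s))"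
      by simp
    have i3: "set_integrable lborel ?R (\<lambda>x. (\<phi> (fst x) * dir_deriv 1 \<eta> (snd x)) *\<^sub>R f x)" if "set_integrable lborel ?R f" for f :: "plane \<Rightarrow> real^2"
      using integrable_test_fun_scaleR[OF tR' that[unfolded set_integrable_def]]
      unfolding set_integrable_def by (subst scaleR_left_commute)
    have "(LBINT x:?R. (\<phi> (fst x) * dir_deriv 1 \<eta> (snd x)) *\<^sub>R (u x - q x))
      = (LBINT x:?R. (\<phi> (fst x) * dir_deriv 1 \<eta> (snd x)) *\<^sub>R u x) - (LBINT x:?R. (\<phi> (fst x) * dir_deriv 1 \<eta> (snd x)) *\<^sub>R q x)"
      unfolding scaleR_diff_right by (rule set_integral_diff(2)[OF i3[OF iuR(1)] i3[OF iq]])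
    then show "(LBINT x:?R. (\<phi> (fst x) * dir_deriv 1 \<eta> (snd x)) *\<^sub>R (u x - q x)) = - (LBINT x:?R. (\<phi> (fst x) * \<eta> (snd x)) *\<^sub>R g x)"
      using r r2 by simp
  qed simp
  then show ?thesis unfolding q_def .
qed

text \<open>Evaluating the vertical primitive at height 0 gives the candidates
  \<open>\<kappa>m\<close> and \<open>\<kappa>p\<close> for the two traces, which differ by
  \<open>J\<close>. At a common Lebesgue point of both, the traces are attained in the averaged
  sense over half balls.\<close>

lemma jump_points: "AE s in lborel. s \<in> {-\<xi><..<1} \<longrightarrow> J s \<noteq> 0 \<longrightarrow> (s, 0) \<in> jump_set Omega u"
proof -
  let ?R = "{-\<xi><..<1::real} \<times> {-1<..<1::real}"
  obtain w where w: "integrable lborel w" and wu: "AE x in lborel. x \<in> ?R \<longrightarrow>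
      u x - indicator {0<..} (snd x) *\<^sub>R JI (fst x) = w (fst x) + (LBINT t:{-1<..<snd x}. g (fst x, t))"
    using vertical_structure by blast
  define \<kappa>m where "\<kappa>m s = w s + (LBINT t. indicator {-1<..<0} t *\<^sub>R g (s, t))" for s
  define \<kappa>p where "\<kappa>p s = \<kappa>m s + JI s" for s
  have [measurable]: "g \<in> borel_measurable borel" using ig by auto
  have i0: "integrable lborel (\<lambda>x. indicator {-1<..<0} (snd x) *\<^sub>R g x)"
    by (rule integrable_bounded_scaleR[OF ig, where C=1]) (auto simp: indicator_def)
  have i\<kappa>m: "integrable lborel \<kappa>m" unfolding \<kappa>m_def
    using plane_integral_iterated(2)[OF i0] by (intro Bochner_Integration.integrable_add w) simp
  have i\<kappa>p: "integrable lborel \<kappa>p" unfolding \<kappa>p_def by (intro Bochner_Integration.integrable_add i\<kappa>m iJI)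
  define h where "h x = norm (g x)" for x
  have h: "integrable lborel h" "integrable lborel (\<lambda>x. (h x)\<^sup>2)" "\<And>x. h x \<ge> 0"
    unfolding h_def using ig sqint_integrable[OF gs] by auto
  have secg: "AE z in lborel. integrable lborel (\<lambda>t. g (z, t))" by (rule plane_integral_iterated(3)[OF ig])
  have sech: "AE z in lborel. integrable lborel (\<lambda>t. h (z, t))" by (rule plane_integral_iterated(3)[OF h(1)])
  have bnd: "AE y in lborel. y \<in> ?R \<longrightarrow> (snd y > 0 \<longrightarrow>
      norm (u y - \<kappa>p (fst y)) \<le> (LBINT t. indicator {-\<bar>snd y\<bar>..\<bar>snd y\<bar>} t * h (fst y, t))) \<and>
      (snd y < 0 \<longrightarrow> norm (u y - \<kappa>m (fst y)) \<le> (LBINT t. indicator {-\<bar>snd y\<bar>..\<bar>snd y\<bar>} t * h (fst y, t)))"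
    using wu AE_plane_fst[OF secg] AE_plane_fst[OF sech]
  proof eventually_elim
    case (elim y)
    show ?case
    proof (intro impI)
      assume y: "y \<in> ?R"
      have ii: "integrable lborel (\<lambda>t. indicator S t *\<^sub>R g (fst y, t))" if "S \<in> sets borel" for S
        using elim(2) that by (intro integrable_mult_indicator) auto
      have "norm ((LBINT t:{-1<..<snd y}. g (fst y, t)) - (LBINT t. indicator {-1<..<0} t *\<^sub>R g (fst y, t)))
        = norm (LBINT t. indicator {-1<..<snd y} t *\<^sub>R g (fst y, t) - indicator {-1<..<0} t *\<^sub>R g (fst y, t))"
        unfolding set_lebesgue_integral_def using ii by simp
      also have "\<dots> \<le> (LBINT t. indicator {-\<bar>snd y\<bar>..\<bar>snd y\<bar>} t * h (fst y, t))"
      proof (rule order_trans[OF integral_norm_bound], rule integral_mono)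
        show "integrable lborel (\<lambda>t. norm (indicator {-1<..<snd y} t *\<^sub>R g (fst y, t) - indicator {-1<..<0} t *\<^sub>R g (fst y, t)))"
          by (intro integrable_norm Bochner_Integration.integrable_diff ii) auto
        show "integrable lborel (\<lambda>t. indicator {-\<bar>snd y\<bar>..\<bar>snd y\<bar>} t * h (fst y, t))"
          using integrable_mult_indicator[of "{-\<bar>snd y\<bar>..\<bar>snd y\<bar>}" lborel "\<lambda>t. h (fst y, t)"] elim(3) by simp
        show "norm (indicator {-1<..<snd y} t *\<^sub>R g (fst y, t) - indicator {-1<..<0} t *\<^sub>R g (fst y, t))
           \<le> indicator {-\<bar>snd y\<bar>..\<bar>snd y\<bar>} t * h (fst y, t)" for t
          by (auto simp: indicator_def h_def)
      qed
      finally have D: "norm ((LBINT t:{-1<..<snd y}. g (fst y, t)) - (LBINT t. indicator {-1<..<0} t *\<^sub>R g (fst y, t)))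
         \<le> (LBINT t. indicator {-\<bar>snd y\<bar>..\<bar>snd y\<bar>} t * h (fst y, t))" .
      have uy: "u y = indicator {0<..} (snd y) *\<^sub>R JI (fst y) + (w (fst y) + (LBINT t:{-1<..<snd y}. g (fst y, t)))"
        using elim(1) y by (metis add.commute diff_add_cancel)
      have eq1: "u y - \<kappa>p (fst y) = (LBINT t:{-1<..<snd y}. g (fst y, t)) - (LBINT t. indicator {-1<..<0} t *\<^sub>R g (fst y, t))" if "snd y > 0"
        unfolding uy using that by (simp add: \<kappa>p_def \<kappa>m_def)
      have eq2: "u y - \<kappa>m (fst y) = (LBINT t:{-1<..<snd y}. g (fst y, t)) - (LBINT t. indicator {-1<..<0} t *\<^sub>R g (fst y, t))" if "snd y < 0"
        unfolding uy using that by (simp add: \<kappa>m_def)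
      show "(snd y > 0 \<longrightarrow>
        norm (u y - \<kappa>p (fst y)) \<le> (LBINT t. indicator {-\<bar>snd y\<bar>..\<bar>snd y\<bar>} t * h (fst y, t))) \<and>
        (snd y < 0 \<longrightarrow> norm (u y - \<kappa>m (fst y)) \<le> (LBINT t. indicator {-\<bar>snd y\<bar>..\<bar>snd y\<bar>} t * h (fst y, t)))"
        by (intro conjI impI) (simp_all only: eq1 eq2 D)
    qed
  qed
  show ?thesis
    using Lebesgue_point[OF i\<kappa>m, of "-\<xi>" 1] Lebesgue_point[OF i\<kappa>p, of "-\<xi>" 1]
  proof eventually_elim
    case (elim s)
    show ?case
    proof (intro impI)
      assume s: "s \<in> {-\<xi><..<1}" and Js: "J s \<noteq> 0"
      \<comment> \<open>Keeps the half balls above and below the open segment; being less than 1, it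
        also keeps them inside the rectangle.\<close>
      define \<rho> where "\<rho> = min (s + \<xi>) (1 - s)"
      have \<rho>: "\<rho> > 0" "\<rho> < 1" using s xi by (auto simp: \<rho>_def min_def)
      have sub: "half_ball (s, 0) \<rho> \<nu> \<subseteq> ?R" for \<nu>
      proof
        fix y assume "y \<in> half_ball (s, 0) \<rho> \<nu>"
        then have "dist (s, 0) y < \<rho>" by (simp add: half_ball_def)
        then have "\<bar>s - fst y\<bar> < \<rho>" "\<bar>snd y\<bar> < \<rho>"
          using dist_fst_le[of "(s, 0)" y] dist_snd_le[of "(s, 0)" y] by (auto simp: dist_real_def)
        then show "y \<in> ?R" using \<rho> by (cases y) (auto simp: \<rho>_def)
      qed
      have up: "half_ball (s, 0) \<rho> (0, 1) \<subseteq> {y. snd y > 0}" and dn: "half_ball (s, 0) \<rho> (- (0, 1)) \<subseteq> {y. snd y < 0}"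
        by (auto simp: half_ball_def inner_prod_def)
      have "one_sided_approx_limit u (s, 0) (0, 1) (\<kappa>p s)"
      proof (rule trace_limit[OF um i\<kappa>p h _ \<rho>(1) _ sech])
        show "AE y in lborel. y \<in> half_ball (s, 0) \<rho> (0, 1) \<longrightarrow>
          norm (u y - \<kappa>p (fst y)) \<le> (LBINT t. indicator {-\<bar>snd y\<bar>..\<bar>snd y\<bar>} t * h (fst y, t))"
          using bnd by eventually_elim (use sub up in blast)
      qed (use elim(2) s in \<open>auto simp: norm_Pair\<close>)
      moreover have "one_sided_approx_limit u (s, 0) (- (0, 1)) (\<kappa>m s)"
      proof (rule trace_limit[OF um i\<kappa>m h _ \<rho>(1) _ sech])
        show "AE y in lborel. y \<in> half_ball (s, 0) \<rho> (- (0, 1)) \<longrightarrow>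
          norm (u y - \<kappa>m (fst y)) \<le> (LBINT t. indicator {-\<bar>snd y\<bar>..\<bar>snd y\<bar>} t * h (fst y, t))"
          using bnd by eventually_elim (use sub dn in blast)
      qed (use elim(1) s in \<open>auto simp: norm_Pair\<close>)
      moreover have "\<kappa>p s \<noteq> \<kappa>m s" using Js s by (simp add: \<kappa>p_def JI_def)
      moreover have "(s, 0) \<in> Omega" using s xi by (auto simp: Omega_def)
      moreover have "norm ((0, 1) :: plane) = 1" by (simp add: norm_Pair)
      ultimately show "(s, 0) \<in> jump_set Omega u" unfolding jump_set_def by blast
    qed
  qed
qed

text \<open>The singular part is the image of the density \<open>norm (J s)\<close> under the
  embedding of the line as the axis, with polar direction \<open>\<tau> \<otimes> e\<^sub>2\<close>.
  It charges only points where \<open>J\<close> does not vanish, and almost all of these are jump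
  points, so no Cantor part is left.\<close>

theorem SBV_unit: 
  assumes mod: "AE x in lborel. x \<in> Omega \<longrightarrow> u x \<in> sphere 0 1"
  shows "u \<in> SBV Omega (sphere 0 1)"
proof -
  \<comment> \<open>The default vector at zeros of \<open>J\<close> makes \<open>\<tau>\<close> a
    unit field everywhere, while \<open>norm (J s) *\<^sub>R \<tau> s = J s\<close> remains
    true.\<close>
  define \<tau> where "\<tau> s = (if J s = 0 then axis 1 1 else (1 / norm (J s)) *\<^sub>R J s)" for s
  define \<sigma> where "\<sigma> x = colmat 2 (\<tau> (fst x))" for x :: plane
  define d where "d s = indicator {-\<xi><..<1} s * norm (J s)" for s
  define \<mu>0 where "\<mu>0 = density lborel (\<lambda>s. ennreal (d s))"
  define \<mu> where "\<mu> = distr \<mu>0 borel (\<lambda>s. (s, 0::real))"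
  have \<tau>m [measurable]: "\<tau> \<in> borel_measurable borel" unfolding \<tau>_def[abs_def] by measurable
  have dm [measurable]: "d \<in> borel_measurable borel" unfolding d_def[abs_def] by measurable
  have pm [measurable]: "(\<lambda>s::real. (s, 0::real)) \<in> borel_measurable borel"
    by (intro borel_measurable_continuous_onI continuous_intros)
  have pm0: "(\<lambda>s. (s, 0::real)) \<in> measurable \<mu>0 borel" using pm by (simp add: \<mu>0_def)
  have dn: "d s \<ge> 0" for s by (simp add: d_def)
  have id: "integrable lborel d"
    using integrable_norm[OF iJI] by (simp add: JI_def d_def[abs_def])
  have J\<tau>: "norm (J s) *\<^sub>R \<tau> s = J s" for s by (simp add: \<tau>_def)
  have n\<tau>: "norm (\<tau> s) = 1" for s by (simp add: \<tau>_def norm_axis_1)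
  have n\<sigma>: "norm (\<sigma> x) = 1" for x by (simp add: \<sigma>_def norm_colmat n\<tau>)
  have AEmu: "(AE x in \<mu>. P x) \<longleftrightarrow> (AE s in \<mu>0. P (s, 0))" if "{x. P x} \<in> sets borel" for P
    unfolding \<mu>_def using that pm0 by (subst AE_distr_iff) auto
  have AEmu0: "(AE s in \<mu>0. P s) \<longleftrightarrow> (AE s in lborel. 0 < d s \<longrightarrow> P s)" for P
    unfolding \<mu>0_def by (subst AE_density) auto
  have dpos: "0 < d s \<Longrightarrow> s \<in> {-\<xi><..<1} \<and> J s \<noteq> 0" for s
    by (cases "s \<in> {-\<xi><..<1}") (auto simp: d_def)
  have BV: "has_BV_deriv Omega u G \<mu> \<sigma>"
    unfolding has_BV_deriv_def
  proof (intro conjI allI impI)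
    show "G \<in> L1 Omega" unfolding L1_def set_integrable_def using iG by (auto intro: integrable_mult_indicator)
    show "sets \<mu> = sets borel" by (simp add: \<mu>_def)
    have "emeasure \<mu>0 (space \<mu>0) = ennreal (integral\<^sup>L lborel d)"
      unfolding \<mu>0_def using nn_integral_eq_integral[OF id] dn by (simp add: emeasure_density)
    then have "finite_measure \<mu>0" by (intro finite_measureI) simp
    then show "finite_measure \<mu>" unfolding \<mu>_def by (rule finite_measure.finite_measure_distr[OF _ pm0])
    have "{x. x \<in> Omega} \<in> sets borel" by simp
    moreover have "AE s in lborel. 0 < d s \<longrightarrow> (s, 0) \<in> Omega"
    proof (intro AE_I2 impI)
      fix s assume "0 < d s"
      from dpos[OF this] show "(s, 0) \<in> Omega" using xi by (simp add: Omega_def)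
    qed
    ultimately show "AE x in \<mu>. x \<in> Omega" using AEmu AEmu0 by blast
    show "\<exists>S\<in>null_sets lborel. AE x in \<mu>. x \<in> S"
    proof (rule bexI[OF _ segment_null])
      have "{x::plane. x \<in> UNIV \<times> {0}} \<in> sets borel" using segment_null by auto
      from AEmu[OF this] show "AE x in \<mu>. x \<in> UNIV \<times> {0}" by simp
    qed
    show "\<sigma> \<in> borel_measurable borel" unfolding \<sigma>_def[abs_def] by measurable
    show "AE x in \<mu>. norm (\<sigma> x) = 1" by (simp add: n\<sigma>)
    fix \<phi> j assume \<phi>: "test_fun Omega \<phi>"
    have [measurable]: "\<phi> \<in> borel_measurable borel" by (rule test_fun_measurable[OF \<phi>])
    have "(\<integral>x. \<phi> x *\<^sub>R column j (\<sigma> x) \<partial>\<mu>) = (\<integral>s. \<phi> (s, 0) *\<^sub>R column j (\<sigma> (s, 0)) \<partial>\<mu>0)"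
      unfolding \<mu>_def by (rule integral_distr[OF pm0]) (unfold \<sigma>_def, measurable)
    also have "\<dots> = (LBINT s. d s *\<^sub>R (\<phi> (s, 0) *\<^sub>R column j (\<sigma> (s, 0))))"
      unfolding \<mu>0_def using dn by (intro integral_density) (auto simp: \<sigma>_def)
    also have "\<dots> = (if j = 2 then \<integral>s. indicator {-\<xi><..<1} s *\<^sub>R (\<phi> (s, 0) *\<^sub>R J s) \<partial>lborel else 0)"
    proof (cases "j = 2")
      case True
      have "d s *\<^sub>R (\<phi> (s, 0) *\<^sub>R column 2 (\<sigma> (s, 0))) = indicator {-\<xi><..<1} s *\<^sub>R (\<phi> (s, 0) *\<^sub>R J s)" for s
      proof -
        have "d s *\<^sub>R (\<phi> (s, 0) *\<^sub>R column 2 (\<sigma> (s, 0))) = indicator {-\<xi><..<1} s *\<^sub>R (\<phi> (s, 0) *\<^sub>R (norm (J s) *\<^sub>R \<tau> s))"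
          by (simp add: d_def \<sigma>_def column_colmat mult.commute)
        then show ?thesis by (simp only: J\<tau>)
      qed
      then show ?thesis using True by simp
    qed (simp add: \<sigma>_def column_colmat)
    finally show "(LBINT x:Omega. dir_deriv (coord j) \<phi> x *\<^sub>R u x) =
       - ((LBINT x:Omega. \<phi> x *\<^sub>R column j (G x)) + (LINT x|\<mu>. \<phi> x *\<^sub>R column j (\<sigma> x)))"
      using rep[OF \<phi>, of j] by (simp add: set_integral_lborel_on)
  qed
  moreover have "AE x in \<mu>. x \<in> jump_set Omega u"
  proof -
    have "AE s in lborel. 0 < d s \<longrightarrow> (s, 0) \<in> jump_set Omega u"
      using jump_points by eventually_elim (use dpos in blast)
    \<comment> \<open>Borel measurability of the jump set is not at hand, so the exceptional
      parameters are enclosed in a Borel null set \<open>N\<close> before the statement is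
      transported to \<open>\<mu>\<close>.\<close>
    from AE_E[OF this] obtain N where N: "{s. \<not> (0 < d s \<longrightarrow> (s, 0) \<in> jump_set Omega u)} \<subseteq> N" "emeasure lborel N = 0" "N \<in> sets lborel" by auto
    have Nm: "N \<in> sets borel" using N(3) by simp
    have "{x::plane. snd x = 0 \<and> 0 < d (fst x) \<and> fst x \<notin> N} \<in> sets borel" using Nm by measurable
    from AEmu[OF this] have "AE x in \<mu>. snd x = 0 \<and> 0 < d (fst x) \<and> fst x \<notin> N"
      unfolding AEmu0 using AE_not_in[of N lborel] N by (auto simp: null_sets_def elim!: eventually_mono)
    then show ?thesis
    proof eventually_elim
      case (elim x)
      then have "(fst x, 0) \<in> jump_set Omega u" using N(1) by blast
      then show ?case using elim by (cases x) simp
    qed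
  qed
  moreover have "u \<in> L1 Omega" unfolding L1_def set_integrable_def using iu by (auto intro: integrable_mult_indicator)
  ultimately show ?thesis unfolding SBV_def using mod by blast
qed

end

subsection \<open>Weak limits\<close>

definition wconv :: "'a measure \<Rightarrow> (nat \<Rightarrow> 'a \<Rightarrow> 'b::euclidean_space) \<Rightarrow> ('a \<Rightarrow> 'b) \<Rightarrow> bool" where
  "wconv M f g \<longleftrightarrow> (\<forall>h. sqint M h \<longrightarrow> (\<lambda>n. ip M (f n) h) \<longlonglongrightarrow> ip M g h)"

lemma wconv_subseq: "wconv M f g \<Longrightarrow> strict_mono r \<Longrightarrow> wconv M (\<lambda>n. f (r n)) g"
  unfolding wconv_def using LIMSEQ_subseq_LIMSEQ[of "\<lambda>n. ip M (f n) h" for h] by (fastforce simp: o_def)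

lemma wconv_add:
  assumes "wconv M f g" "wconv M f' g'" "\<And>n. sqint M (f n)" "\<And>n. sqint M (f' n)" "sqint M g" "sqint M g'"
  shows "wconv M (\<lambda>n x. f n x + f' n x) (\<lambda>x. g x + g' x)"
  using assms unfolding wconv_def by (auto simp: ip_add_left intro!: tendsto_add)

lemma wconv_zero:
  assumes "\<And>n. sqint M (f n)" "(\<lambda>n. nsq M (f n)) \<longlonglongrightarrow> 0"
  shows "wconv M f (\<lambda>x. 0)"
  unfolding wconv_def
proof (intro allI impI)
  fix h :: "'a \<Rightarrow> 'b" assume h: "sqint M h"
  have "(\<lambda>n. ip M (f n) h) \<longlonglongrightarrow> 0"
  proof (rule Lim_null_comparison)
    show "eventually (\<lambda>n. norm (ip M (f n) h) \<le> sqrt (nsq M (f n)) * sqrt (nsq M h)) sequentially"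
      using abs_ip_le[OF assms(1) h] by simp
    have "(\<lambda>n. sqrt (nsq M (f n)) * sqrt (nsq M h)) \<longlonglongrightarrow> sqrt 0 * sqrt (nsq M h)" by (intro tendsto_intros assms)
    then show "(\<lambda>n. sqrt (nsq M (f n)) * sqrt (nsq M h)) \<longlonglongrightarrow> 0" by simp
  qed
  then show "(\<lambda>n. ip M (f n) h) \<longlonglongrightarrow> ip M (\<lambda>x. 0) h" by (simp add: ip_def)
qed

lemma sqint_colmat: "sqint M h \<Longrightarrow> sqint M (\<lambda>x. colmat j (h x))"
  by (rule sqintI_bound[OF _ sqint_integrable]) (auto simp: norm_colmat)

lemma wconv_column:
  fixes f :: "nat \<Rightarrow> 'a \<Rightarrow> real^2^2"
  assumes "wconv M f g" shows "wconv M (\<lambda>n x. column j (f n x)) (\<lambda>x. column j (g x))"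
  unfolding wconv_def
proof (intro allI impI)
  fix h :: "'a \<Rightarrow> real^2" assume h: "sqint M h"
  have "ip M (\<lambda>x. column j (A x)) h = ip M A (\<lambda>x. colmat j (h x))" for A
    by (simp add: ip_def inner_colmat)
  then show "(\<lambda>n. ip M (\<lambda>x. column j (f n x)) h) \<longlonglongrightarrow> ip M (\<lambda>x. column j (g x)) h"
    using assms sqint_colmat[OF h] unfolding wconv_def by simp
qed

lemma sqint_scaleR_const: "sqint M (\<phi> :: _ \<Rightarrow> real) \<Longrightarrow> sqint M (\<lambda>x. \<phi> x *\<^sub>R b)" for b :: "'b::euclidean_space"
  by (auto simp: sqint_def power_mult_distrib)

lemma integrable_scaleR_sqint:
  fixes f :: "'a \<Rightarrow> 'b::euclidean_space"
  assumes "sqint M (\<phi> :: 'a \<Rightarrow> real)" "sqint M f" shows "integrable M (\<lambda>x. \<phi> x *\<^sub>R f x)"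
proof (rule Bochner_Integration.integrable_bound)
  show "integrable M (\<lambda>x. (norm (\<phi> x))\<^sup>2 + (norm (f x))\<^sup>2)" using assms by (auto simp: sqint_def)
  show "(\<lambda>x. \<phi> x *\<^sub>R f x) \<in> borel_measurable M" using assms by auto
  show "AE x in M. norm (\<phi> x *\<^sub>R f x) \<le> norm ((norm (\<phi> x))\<^sup>2 + (norm (f x))\<^sup>2)"
  proof (rule AE_I2)
    fix x show "norm (\<phi> x *\<^sub>R f x) \<le> norm ((norm (\<phi> x))\<^sup>2 + (norm (f x))\<^sup>2)"
      using abs_inner_le_power2[of "norm (\<phi> x)" "norm (f x)"] by simp
  qed
qed

text \<open>Testing against a basis vector \<open>b\<close> turns the vector-valued integral into a
  pairing with \<open>\<phi> n x *\<^sub>R b\<close>, a strongly convergent sequence.\<close>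

lemma wconv_scaleR_moving:
  fixes f :: "nat \<Rightarrow> 'a \<Rightarrow> 'b::euclidean_space" and \<phi> :: "nat \<Rightarrow> 'a \<Rightarrow> real"
  assumes w: "wconv M f g" and f: "\<And>n. sqint M (f n)" "sqint M g" and K: "\<And>n. nsq M (f n) \<le> K"
    and \<phi>: "\<And>n. sqint M (\<phi> n)" "sqint M \<phi>0" and s: "(\<lambda>n. nsq M (\<lambda>x. \<phi> n x - \<phi>0 x)) \<longlonglongrightarrow> 0"
  shows "(\<lambda>n. \<integral>x. \<phi> n x *\<^sub>R f n x \<partial>M) \<longlonglongrightarrow> (\<integral>x. \<phi>0 x *\<^sub>R g x \<partial>M)"
proof (rule iffD2[OF tendsto_componentwise_iff], rule ballI)
  fix b :: 'b assume b: "b \<in> Basis"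
  have e: "(\<integral>x. \<psi> x *\<^sub>R F x \<partial>M) \<bullet> b = ip M F (\<lambda>x. \<psi> x *\<^sub>R b)" if "sqint M \<psi>" "sqint M F" for \<psi> F
    unfolding ip_def integral_inner_left[OF integrable_scaleR_sqint[OF that], symmetric] by (simp only: inner_scaleR_left inner_scaleR_right)
  have "nsq M (\<lambda>x. \<phi> n x *\<^sub>R b - \<phi>0 x *\<^sub>R b) = nsq M (\<lambda>x. \<phi> n x - \<phi>0 x)" for n
    unfolding nsq_def scaleR_left_diff_distrib[symmetric] norm_scaleR using b by simp
  then have s': "(\<lambda>n. nsq M (\<lambda>x. \<phi> n x *\<^sub>R b - \<phi>0 x *\<^sub>R b)) \<longlonglongrightarrow> 0" using s by (simp only:)
  have "(\<lambda>n. ip M (f n) (\<lambda>x. \<phi> n x *\<^sub>R b)) \<longlonglongrightarrow> ip M g (\<lambda>x. \<phi>0 x *\<^sub>R b)"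
    using w unfolding wconv_def
    by (intro tendsto_ip_weak_strong[OF f K _ _ _ s'] sqint_scaleR_const \<phi>) blast
  then show "(\<lambda>n. (\<integral>x. \<phi> n x *\<^sub>R f n x \<partial>M) \<bullet> b) \<longlonglongrightarrow> (\<integral>x. \<phi>0 x *\<^sub>R g x \<partial>M) \<bullet> b"
    by (simp only: e[OF \<phi>(1) f(1)] e[OF \<phi>(2) f(2)])
qed

lemma wconv_scaleR:
  fixes f :: "nat \<Rightarrow> 'a \<Rightarrow> 'b::euclidean_space" and \<phi> :: "'a \<Rightarrow> real"
  assumes "wconv M f g" "\<And>n. sqint M (f n)" "sqint M g" "\<And>n. nsq M (f n) \<le> K" "sqint M \<phi>"
  shows "(\<lambda>n. \<integral>x. \<phi> x *\<^sub>R f n x \<partial>M) \<longlonglongrightarrow> (\<integral>x. \<phi> x *\<^sub>R g x \<partial>M)"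
  by (rule wconv_scaleR_moving[OF assms(1-4) assms(5) assms(5)]) (simp add: nsq_def)

lemma sqint_bounded:
  fixes \<phi> :: "'a \<Rightarrow> real"
  assumes "finite_measure M" "\<phi> \<in> borel_measurable M" "\<And>x. x \<in> space M \<Longrightarrow> \<bar>\<phi> x\<bar> \<le> K"
  shows "sqint M \<phi>"
  unfolding sqint_def
proof
  interpret finite_measure M by fact
  show "integrable M (\<lambda>x. (norm (\<phi> x))\<^sup>2)"
  proof (rule integrable_const_bound[of _ "K\<^sup>2"])
    show "AE x in M. norm ((norm (\<phi> x))\<^sup>2) \<le> K\<^sup>2"
    proof (rule AE_I2)
      fix x assume "x \<in> space M"
      then have "\<bar>\<phi> x\<bar>\<^sup>2 \<le> K\<^sup>2" by (intro power_mono assms(3)) auto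
      then show "norm ((norm (\<phi> x))\<^sup>2) \<le> K\<^sup>2" by simp
    qed
  qed (use assms in measurable)
qed fact

lemma finite_layer: "finite_measure (lborel_on (layer \<epsilon> \<xi>))" and finite_Omega: "finite_measure (lborel_on Omega)"
  by (intro finite_measure_lborel_on bounded_layer bounded_Omega layer_borel Omega_borel)+

lemma test_fun_sqint:
  assumes "test_fun U \<phi>" "finite_measure (lborel_on V)" shows "sqint (lborel_on V) \<phi>"
proof -
  obtain K where "\<And>x. \<bar>\<phi> x\<bar> \<le> K" using test_fun_bounded[OF assms(1)] by blast
  then show ?thesis
    by (intro sqint_bounded[OF assms(2), where K=K] measurable_restrict_space1) (use test_fun_measurable[OF assms(1)] in auto)
qed

text \<open>\<open>stretch 0\<close> is the projection onto the axis, so the limiting test function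
  is the trace on the segment, extended constantly across the layer.\<close>

lemma test_fun_flatten:
  assumes \<phi>: "test_fun U \<phi>" and e: "\<epsilon> \<longlonglongrightarrow> 0"
  shows "\<And>\<epsilon>. sqint (lborel_on (layer 1 \<xi>)) (\<lambda>x. \<phi> (stretch \<epsilon> x))"
    and "(\<lambda>n. nsq (lborel_on (layer 1 \<xi>)) (\<lambda>x. \<phi> (stretch (\<epsilon> n) x) - \<phi> (stretch 0 x))) \<longlonglongrightarrow> 0"
proof -
  let ?M = "lborel_on (layer 1 \<xi>)"
  interpret finite_measure ?M by (rule finite_layer)
  have [measurable]: "\<phi> \<in> borel_measurable borel" by (rule test_fun_measurable[OF \<phi>])
  obtain K where K: "\<And>x. \<bar>\<phi> x\<bar> \<le> K" using test_fun_bounded[OF \<phi>] by blast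
  have m: "(\<lambda>x. \<phi> (stretch e x)) \<in> borel_measurable ?M" for e by (rule measurable_restrict_space1) simp
  show "sqint ?M (\<lambda>x. \<phi> (stretch \<epsilon> x))" for \<epsilon>
    by (rule sqint_bounded[OF finite_layer m K])
  have "(\<lambda>n. \<integral>x. (norm (\<phi> (stretch (\<epsilon> n) x) - \<phi> (stretch 0 x)))\<^sup>2 \<partial>?M) \<longlonglongrightarrow> (\<integral>x. 0 \<partial>?M)"
  proof (rule integral_dominated_convergence[where w="\<lambda>_. (2 * K)\<^sup>2"])
    show "(\<lambda>x. (norm (\<phi> (stretch (\<epsilon> n) x) - \<phi> (stretch 0 x)))\<^sup>2) \<in> borel_measurable ?M" for n
      using m by measurable
    show "AE x in ?M. (\<lambda>n. (norm (\<phi> (stretch (\<epsilon> n) x) - \<phi> (stretch 0 x)))\<^sup>2) \<longlonglongrightarrow> 0"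
    proof (rule AE_I2)
      fix x
      have "(\<lambda>n. stretch (\<epsilon> n) x) \<longlonglongrightarrow> stretch 0 x" unfolding stretch_def by (intro tendsto_intros e)
      moreover have "isCont \<phi> (stretch 0 x)"
        using test_fun_continuous[OF \<phi>, of UNIV] unfolding continuous_on_eq_continuous_at[OF open_UNIV] by blast
      ultimately have "(\<lambda>n. \<phi> (stretch (\<epsilon> n) x)) \<longlonglongrightarrow> \<phi> (stretch 0 x)" by (rule isCont_tendsto_compose[rotated])
      then have "(\<lambda>n. (norm (\<phi> (stretch (\<epsilon> n) x) - \<phi> (stretch 0 x)))\<^sup>2) \<longlonglongrightarrow> (norm (\<phi> (stretch 0 x) - \<phi> (stretch 0 x)))\<^sup>2"
        by (intro tendsto_intros)
      then show "(\<lambda>n. (norm (\<phi> (stretch (\<epsilon> n) x) - \<phi> (stretch 0 x)))\<^sup>2) \<longlonglongrightarrow> 0" by simp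
    qed
    show "AE x in ?M. norm ((norm (\<phi> (stretch (\<epsilon> n) x) - \<phi> (stretch 0 x)))\<^sup>2) \<le> (2 * K)\<^sup>2" for n
    proof (rule AE_I2)
      fix x
      have "norm (\<phi> (stretch (\<epsilon> n) x) - \<phi> (stretch 0 x)) \<le> 2 * K"
        using K[of "stretch (\<epsilon> n) x"] K[of "stretch 0 x"] by simp
      then have "(norm (\<phi> (stretch (\<epsilon> n) x) - \<phi> (stretch 0 x)))\<^sup>2 \<le> (2 * K)\<^sup>2" by (intro power_mono) auto
      then show "norm ((norm (\<phi> (stretch (\<epsilon> n) x) - \<phi> (stretch 0 x)))\<^sup>2) \<le> (2 * K)\<^sup>2" by simp
    qed
  qed auto
  then show "(\<lambda>n. nsq ?M (\<lambda>x. \<phi> (stretch (\<epsilon> n) x) - \<phi> (stretch 0 x))) \<longlonglongrightarrow> 0" by (simp add: nsq_def)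
qed

text \<open>The variant of the tail formula for primitives normalised at the right end; such a
  \<open>\<Theta>\<close> may be nonzero all the way to the left.\<close>

lemma smooth_tail_integral:
  fixes \<Theta> \<psi> :: "real \<Rightarrow> real"
  assumes "\<And>x. (\<Theta> has_real_derivative \<psi> x) (at x)" "continuous_on UNIV \<psi>" "\<And>s. q \<le> s \<Longrightarrow> \<Theta> s = 0" "\<And>s. q < s \<Longrightarrow> \<psi> s = 0"
  shows "(LBINT x. \<psi> x * indicator {t<..} x) = - \<Theta> t"
proof -
  define r where "r = max t q"
  have [measurable]: "\<psi> \<in> borel_measurable borel" by (rule borel_measurable_continuous_onI[OF assms(2)])
  have "(LBINT x. \<psi> x * indicator {t..r} x) = \<Theta> r - \<Theta> t"
    using assms(1,2) by (intro integral_FTC_Icc_real) (auto simp: continuous_on_eq_continuous_at r_def)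
  moreover have "\<Theta> r = 0" using assms(3) by (auto simp: r_def)
  moreover have "(LBINT x. \<psi> x * indicator {t..r} x) = (LBINT x. \<psi> x * indicator {t<..} x)"
  proof (rule integral_cong_AE)
    have "AE x in lborel. x \<noteq> t" by (rule AE_lborel_singleton)
    then show "AE x in lborel. \<psi> x * indicator {t..r} x = \<psi> x * indicator {t<..} x"
      by eventually_elim (use assms(4) in \<open>auto simp: indicator_def r_def max_def split: if_splits\<close>)
  qed measurable
  ultimately show ?thesis by simp
qed

section \<open>The sequence, its weakly convergent subsequence and the limit fields\<close>

locale layer_sequence =
  fixes W :: "real \<Rightarrow> real" and \<xi> C C0 :: real and \<epsilon> :: "nat \<Rightarrow> real"
    and k :: "nat \<Rightarrow> plane \<Rightarrow> real^2" and B :: "nat \<Rightarrow> plane \<Rightarrow> real^2^2"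
  assumes st: "\<And>n. layer_state W \<xi> C C0 (\<epsilon> n) (k n) (B n)"
    and eps0: "\<epsilon> \<longlonglongrightarrow> 0"
    and total: "\<And>n. norm (\<integral>x. weak_curl 1 Omega (B n) x \<partial>lborel_on Omega) = 2"
begin

sublocale S: layer_state W \<xi> C C0 "\<epsilon> n" "k n" "B n" for n by (rule st)

abbreviation Lay :: "plane set" where "Lay \<equiv> layer 1 \<xi>"

definition kx :: "nat \<Rightarrow> plane \<Rightarrow> real^2" where
  "kx n x = indicator (Omega - layer (\<epsilon> n) \<xi>) x *\<^sub>R k n x"

definition KO :: real where "KO = 2 * (C * \<xi>\<^sup>2) + 2 * measure lborel Omega"

lemma xi: "0 < \<xi>" "\<xi> < 1" using S.xi by auto

lemma sqint_kx: "sqint (lborel_on Omega) (kx n)" "nsq (lborel_on Omega) (kx n) \<le> KO"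
proof -
  have [measurable]: "k n \<in> borel_measurable (lborel_on Omega)" using S.sqint_k by auto
  have m: "kx n \<in> borel_measurable (lborel_on Omega)"
  proof -
    have "(\<lambda>x. indicator (Omega - layer (\<epsilon> n) \<xi>) x :: real) \<in> borel_measurable (lborel_on Omega)"
      by (rule measurable_restrict_space1) simp
    then show ?thesis unfolding kx_def[abs_def] using S.sqint_k[of n] by (intro borel_measurable_scaleR) auto
  qed
  have le: "(norm (kx n x))\<^sup>2 \<le> (norm (k n x))\<^sup>2" for x by (simp add: kx_def indicator_def)
  show s: "sqint (lborel_on Omega) (kx n)"
    by (rule sqintI_bound[OF m sqint_integrable[OF S.sqint_k] le])
  have "nsq (lborel_on Omega) (kx n) \<le> nsq (lborel_on Omega) (k n)"
    unfolding nsq_def by (rule integral_mono[OF sqint_integrable[OF s] sqint_integrable[OF S.sqint_k] le])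
  also have "\<dots> \<le> 2 * (C * (\<epsilon> n * \<xi>\<^sup>2)) + 2 * measure lborel Omega"
    by (rule S.nsq_k_subset) auto
  also have "\<dots> \<le> KO"
  proof -
    have "\<epsilon> n * \<xi>\<^sup>2 \<le> 1 * \<xi>\<^sup>2" using S.eps[of n] by (intro mult_right_mono) auto
    then have "C * (\<epsilon> n * \<xi>\<^sup>2) \<le> C * \<xi>\<^sup>2" using S.C by (simp add: mult_left_mono)
    then show ?thesis by (simp add: KO_def)
  qed
  finally show "nsq (lborel_on Omega) (kx n) \<le> KO" .
qed

lemma extraction:
  "\<exists>r k0 H0 kt0 B0 \<alpha>. strict_mono (r :: nat \<Rightarrow> nat) \<and>
    sqint (lborel_on Omega) k0 \<and> wconv (lborel_on Omega) (\<lambda>n. kx (r n)) k0 \<and>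
    sqint (lborel_on Omega) H0 \<and> wconv (lborel_on Omega) (\<lambda>n. S.H (r n)) H0 \<and>
    sqint (lborel_on Lay) kt0 \<and> wconv (lborel_on Lay) (\<lambda>n. S.kt (r n)) kt0 \<and>
    sqint (lborel_on Lay) B0 \<and> wconv (lborel_on Lay) (\<lambda>n. S.Bt (r n)) B0 \<and>
    sqint (lborel_on Lay) \<alpha> \<and> wconv (lborel_on Lay) (\<lambda>n. S.ct (r n)) \<alpha>"
proof -
  \<comment> \<open>Five successive extractions; each weak convergence survives the later
    ones.\<close>
  obtain r1 k0 where 1: "strict_mono (r1 :: nat \<Rightarrow> nat)" "sqint (lborel_on Omega) k0" "wconv (lborel_on Omega) (\<lambda>n. kx (r1 n)) k0"
    using weak_compactness[of "lborel_on Omega" kx, OF sqint_kx] unfolding wconv_def by blast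
  obtain r2 H0 where 2: "strict_mono (r2 :: nat \<Rightarrow> nat)" "sqint (lborel_on Omega) H0" "wconv (lborel_on Omega) (\<lambda>n. S.H (r1 (r2 n))) H0"
    using weak_compactness[of "lborel_on Omega" "\<lambda>n. S.H (r1 n)", OF S.sqint_H] unfolding wconv_def by blast
  obtain r3 kt0 where 3: "strict_mono (r3 :: nat \<Rightarrow> nat)" "sqint (lborel_on Lay) kt0" "wconv (lborel_on Lay) (\<lambda>n. S.kt (r1 (r2 (r3 n)))) kt0"
    using weak_compactness[of "lborel_on Lay" "\<lambda>n. S.kt (r1 (r2 n))", OF S.sqint_kt] unfolding wconv_def by blast
  obtain r4 B0 where 4: "strict_mono (r4 :: nat \<Rightarrow> nat)" "sqint (lborel_on Lay) B0" "wconv (lborel_on Lay) (\<lambda>n. S.Bt (r1 (r2 (r3 (r4 n))))) B0"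
    using weak_compactness[of "lborel_on Lay" "\<lambda>n. S.Bt (r1 (r2 (r3 n)))", OF S.sqint_Bt] unfolding wconv_def by blast
  obtain r5 \<alpha> where 5: "strict_mono (r5 :: nat \<Rightarrow> nat)" "sqint (lborel_on Lay) \<alpha>" "wconv (lborel_on Lay) (\<lambda>n. S.ct (r1 (r2 (r3 (r4 (r5 n)))))) \<alpha>"
    using weak_compactness[of "lborel_on Lay" "\<lambda>n. S.ct (r1 (r2 (r3 (r4 n))))", OF S.sqint_ct] unfolding wconv_def by blast
  note c = strict_mono_o[unfolded o_def]
  have s5: "strict_mono (\<lambda>n. r5 n)" using 5 by simp
  have s4: "strict_mono (\<lambda>n. r4 (r5 n))" by (rule c[OF 4(1) s5])
  have s3: "strict_mono (\<lambda>n. r3 (r4 (r5 n)))" by (rule c[OF 3(1) s4])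
  have s2: "strict_mono (\<lambda>n. r2 (r3 (r4 (r5 n))))" by (rule c[OF 2(1) s3])
  have s1: "strict_mono (\<lambda>n. r1 (r2 (r3 (r4 (r5 n)))))" by (rule c[OF 1(1) s2])
  show ?thesis
    by (rule exI[of _ "\<lambda>n. r1 (r2 (r3 (r4 (r5 n))))"], rule exI[of _ k0], rule exI[of _ H0], rule exI[of _ kt0], rule exI[of _ B0], rule exI[of _ \<alpha>])
      (intro conjI s1 1(2) 2(2) 3(2) 4(2) 5(2) 5(3) wconv_subseq[OF 1(3) s2] wconv_subseq[OF 2(3) s3] wconv_subseq[OF 3(3) s4] wconv_subseq[OF 4(3) s5])
qed

end

text \<open>Convergence is assumed along the full sequence, the extraction having been made
  beforehand. The limits are normalised to vanish outside their domains, so that Fubini can be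
  applied to them on the whole plane.\<close>

locale layer_limit = layer_sequence +
  fixes k0 :: "plane \<Rightarrow> real^2" and H0 :: "plane \<Rightarrow> real^2^2" and kt0 :: "plane \<Rightarrow> real^2"
    and B0 :: "plane \<Rightarrow> real^2^2" and \<alpha> :: "plane \<Rightarrow> real^2"
  assumes k0: "sqint lborel k0" "\<And>x. x \<notin> Omega \<Longrightarrow> k0 x = 0" "wconv (lborel_on Omega) kx k0"
    and H0: "sqint lborel H0" "\<And>x. x \<notin> Omega \<Longrightarrow> H0 x = 0" "wconv (lborel_on Omega) S.H H0"
    and kt0: "sqint lborel kt0" "\<And>x. x \<notin> Lay \<Longrightarrow> kt0 x = 0" "wconv (lborel_on Lay) S.kt kt0"
    and B0: "sqint lborel B0" "\<And>x. x \<notin> Lay \<Longrightarrow> B0 x = 0" "wconv (lborel_on Lay) S.Bt B0"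
    and \<alpha>: "sqint lborel \<alpha>" "\<And>x. x \<notin> Lay \<Longrightarrow> \<alpha> x = 0" "wconv (lborel_on Lay) S.ct \<alpha>"
begin

abbreviation M where "M \<equiv> lborel_on Omega"
abbreviation N where "N \<equiv> lborel_on Lay"

lemma sq: "sqint M k0" "sqint M H0" "sqint N kt0" "sqint N B0" "sqint N \<alpha>"
  using k0 H0 kt0 B0 \<alpha> by (auto intro: sqint_lborel_imp_on)

definition d2 :: "plane \<Rightarrow> real^2" where "d2 x = column 2 (B0 x)"

lemma d2: "sqint lborel d2" "sqint N d2" "\<And>x. x \<notin> Lay \<Longrightarrow> d2 x = 0"
  unfolding d2_def[abs_def] using B0(2) by (intro sqint_column(1) B0 sq, intro sqint_column(1) B0 sq, simp add: column_def vec_eq_iff)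

lemma integrable_zero_ext_layer:
  fixes f :: "plane \<Rightarrow> 'b::euclidean_space"
  assumes "sqint lborel f" "\<And>x. x \<notin> Lay \<Longrightarrow> f x = 0" shows "integrable lborel f"
proof -
  have "integrable N f"
    by (rule sqint_loc_integrable(2)[OF sqint_lborel_imp_on[OF assms(1)] _ bounded_layer]) auto
  then have "integrable lborel (\<lambda>x. indicator Lay x *\<^sub>R f x)" by (simp add: integrable_restrict_space)
  moreover have "indicator Lay x *\<^sub>R f x = f x" for x using assms(2)[of x] by (auto simp: indicator_def)
  ultimately show ?thesis by simp
qed

lemma int_lborel: "integrable lborel \<alpha>" "integrable lborel d2" "integrable lborel kt0"
  by (intro integrable_zero_ext_layer \<alpha> d2 kt0; assumption)+

lemma integral_N:
  fixes f :: "plane \<Rightarrow> 'b::euclidean_space"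
  assumes "\<And>x. x \<notin> Lay \<Longrightarrow> f x = 0" shows "integral\<^sup>L N (\<lambda>x. \<phi> x *\<^sub>R f x) = (LBINT x. \<phi> x *\<^sub>R f x)"
proof -
  have "indicator Lay x *\<^sub>R (\<phi> x *\<^sub>R f x) = \<phi> x *\<^sub>R f x" for x using assms[of x] by (auto simp: indicator_def)
  then show ?thesis
    unfolding set_integral_lborel_on[OF layer_borel, symmetric] set_lebesgue_integral_def by (simp only:)
qed

lemma Ht_wconv: "wconv N S.Ht (\<lambda>x. 0)"
proof (rule wconv_zero[OF S.sqint_Ht(1)])
  have "(\<lambda>n. \<epsilon> n * C) \<longlonglongrightarrow> 0 * C" by (intro tendsto_intros eps0)
  then have "(\<lambda>n. \<epsilon> n * C) \<longlonglongrightarrow> 0" by simp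
  then show "(\<lambda>n. nsq N (S.Ht n)) \<longlonglongrightarrow> 0"
    by (rule tendsto_sandwich[OF _ _ tendsto_const, rotated 2]) (simp_all add: S.sqint_Ht(2))
qed

lemma HB_wconv: "wconv N (\<lambda>n x. S.Ht n x + S.Bt n x) B0"
  using wconv_add[OF Ht_wconv B0(3) S.sqint_Ht(1) S.sqint_Bt(1) sqint_zero sq(4)] by simp

lemma HB_sqint: "sqint N (\<lambda>x. S.Ht n x + S.Bt n x)" "nsq N (\<lambda>x. S.Ht n x + S.Bt n x) \<le> 2 * C + 2 * S.KB"
proof -
  show "sqint N (\<lambda>x. S.Ht n x + S.Bt n x)" by (intro sqint_add S.sqint_Ht S.sqint_Bt)
  have "nsq N (\<lambda>x. S.Ht n x + S.Bt n x) \<le> 2 * nsq N (S.Ht n) + 2 * nsq N (S.Bt n)"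
    by (intro nsq_add_le S.sqint_Ht S.sqint_Bt)
  moreover have "\<epsilon> n * C \<le> 1 * C" using S.eps[of n] S.C by (intro mult_right_mono) auto
  ultimately show "nsq N (\<lambda>x. S.Ht n x + S.Bt n x) \<le> 2 * C + 2 * S.KB"
    using S.sqint_Ht(2)[of n] S.sqint_Bt(2)[of n] by linarith
qed

lemma HB_column:
  assumes "sqint N \<phi>"
  shows "(\<lambda>n. \<integral>x. \<phi> x *\<^sub>R column j (S.Ht n x + S.Bt n x) \<partial>N) \<longlonglongrightarrow> (\<integral>x. \<phi> x *\<^sub>R column j (B0 x) \<partial>N)"
proof (rule wconv_scaleR[OF wconv_column[OF HB_wconv] sqint_column(1)[OF HB_sqint(1)] sqint_column(1)[OF sq(4)] _ assms])
  show "nsq N (\<lambda>x. column j (S.Ht n x + S.Bt n x)) \<le> 2 * C + 2 * S.KB" for n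
    using sqint_column(2)[OF HB_sqint(1)] HB_sqint(2) by (rule order_trans)
qed

lemma kt_scaleR: "sqint N \<phi> \<Longrightarrow> (\<lambda>n. \<integral>x. \<phi> x *\<^sub>R S.kt n x \<partial>N) \<longlonglongrightarrow> (\<integral>x. \<phi> x *\<^sub>R kt0 x \<partial>N)"
  by (rule wconv_scaleR[OF kt0(3) S.sqint_kt(1) sq(3) S.sqint_kt(2)])

text \<open>Against a fixed test function the first column of the rescaled gradient is
  \<open>\<epsilon> n\<close> times a convergent integral.\<close>

lemma B0_column1: "AE x in lborel. column 1 (B0 x) = 0"
proof -
  have "AE x in lborel. x \<in> Lay \<longrightarrow> column 1 (B0 x) = 0"
  proof (rule fundamental_lemma[OF open_layer])
    show "loc_integrable Lay (\<lambda>x. column 1 (B0 x))"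
      by (rule sqint_loc_integrable(1)[OF sqint_column(1)[OF sq(4)] layer_borel bounded_layer])
    fix \<phi> assume \<phi>: "test_fun Lay \<phi>"
    have "(\<lambda>n. \<epsilon> n *\<^sub>R (\<integral>x. dir_deriv (coord 1) \<phi> x *\<^sub>R S.kt n x \<partial>N)) \<longlonglongrightarrow> 0 *\<^sub>R (\<integral>x. dir_deriv (coord 1) \<phi> x *\<^sub>R kt0 x \<partial>N)"
      by (intro tendsto_scaleR eps0 kt_scaleR test_fun_sqint[OF test_fun_dir_deriv[OF \<phi>] finite_layer])
    moreover have "(\<lambda>n. - (\<integral>x. \<phi> x *\<^sub>R column 1 (S.Ht n x + S.Bt n x) \<partial>N)) \<longlonglongrightarrow> - (\<integral>x. \<phi> x *\<^sub>R column 1 (B0 x) \<partial>N)"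
      by (intro tendsto_minus HB_column test_fun_sqint[OF \<phi> finite_layer])
    ultimately have "- (\<integral>x. \<phi> x *\<^sub>R column 1 (B0 x) \<partial>N) = 0"
      unfolding S.weak_deriv_k_layer(2)[OF \<phi>] scaleR_zero_left by (rule LIMSEQ_unique[rotated])
    then show "(LBINT x:Lay. \<phi> x *\<^sub>R column 1 (B0 x)) = 0" by (simp add: set_integral_lborel_on)
  qed
  then show ?thesis by eventually_elim (use B0(2) in \<open>auto simp: column_def vec_eq_iff\<close>)
qed

lemma weak_deriv_kt0: "has_weak_deriv Lay (coord 2) kt0 d2"
  unfolding has_weak_deriv_def
proof (intro conjI allI impI)
  show "loc_integrable Lay kt0" "loc_integrable Lay d2"
    by (rule sqint_loc_integrable(1)[OF sq(3) layer_borel bounded_layer], rule sqint_loc_integrable(1)[OF d2(2) layer_borel bounded_layer])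
  fix \<phi> assume \<phi>: "test_fun Lay \<phi>"
  have "(\<lambda>n. \<integral>x. dir_deriv (coord 2) \<phi> x *\<^sub>R S.kt n x \<partial>N) \<longlonglongrightarrow> (\<integral>x. dir_deriv (coord 2) \<phi> x *\<^sub>R kt0 x \<partial>N)"
    by (intro kt_scaleR test_fun_sqint[OF test_fun_dir_deriv[OF \<phi>] finite_layer])
  moreover have "(\<lambda>n. - (\<integral>x. \<phi> x *\<^sub>R column 2 (S.Ht n x + S.Bt n x) \<partial>N)) \<longlonglongrightarrow> - (\<integral>x. \<phi> x *\<^sub>R column 2 (B0 x) \<partial>N)"
    by (intro tendsto_minus HB_column test_fun_sqint[OF \<phi> finite_layer])
  ultimately have "(\<integral>x. dir_deriv (coord 2) \<phi> x *\<^sub>R kt0 x \<partial>N) = - (\<integral>x. \<phi> x *\<^sub>R column 2 (B0 x) \<partial>N)"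
    unfolding S.weak_deriv_k_layer(1)[OF \<phi>] by (rule LIMSEQ_unique)
  then show "(LBINT x:Lay. dir_deriv (coord 2) \<phi> x *\<^sub>R kt0 x) = - (LBINT x:Lay. \<phi> x *\<^sub>R d2 x)"
    by (simp add: set_integral_lborel_on d2_def)
qed

definition a :: "real \<Rightarrow> real^2" where "a t = (LBINT y. \<alpha> (t, y))"
definition b :: "real \<Rightarrow> real^2" where "b t = (LBINT y. d2 (t, y))"
text \<open>Defined from the curl, so that continuity holds by construction and the value at 1 is
  the total curl; the agreement with the fibre integral \<open>b\<close>, only almost everywhere, is
  proved afterwards.\<close>

definition J :: "real \<Rightarrow> real^2" where "J s = (LBINT t. indicator {..<s} t *\<^sub>R a t)"

lemma ia: "integrable lborel a" and ib: "integrable lborel b"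
  unfolding a_def[abs_def] b_def[abs_def] by (rule plane_integral_iterated(2)[OF int_lborel(1)], rule plane_integral_iterated(2)[OF int_lborel(2)])

lemma a_out: "t \<notin> {-\<xi><..<1} \<Longrightarrow> a t = 0" and b_out: "t \<notin> {-\<xi><..<1} \<Longrightarrow> b t = 0"
proof -
  assume t: "t \<notin> {-\<xi><..<1}"
  have "\<alpha> (t, y) = 0" "d2 (t, y) = 0" for y using t by (auto intro!: \<alpha>(2) d2(3) simp: layer_def)
  then show "a t = 0" "b t = 0" by (simp_all add: a_def b_def)
qed

lemma J_continuous: "continuous_on UNIV J"
proof (rule continuous_at_imp_continuous_on, rule ballI)
  fix s :: real
  have [measurable]: "a \<in> borel_measurable borel" using ia by auto
  show "isCont J s"
    unfolding continuous_at_sequentially o_def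
  proof (intro allI impI)
    fix x assume x: "x \<longlonglongrightarrow> s"
    show "(\<lambda>n. J (x n)) \<longlonglongrightarrow> J s" unfolding J_def
    proof (rule integral_dominated_convergence[where w="\<lambda>t. norm (a t)"])
      show "AE t in lborel. norm (indicator {..<x n} t *\<^sub>R a t) \<le> norm (a t)" for n
        by (intro AE_I2) (auto simp: indicator_def)
      have "AE t in lborel. t \<noteq> s" by (rule AE_lborel_singleton)
      then show "AE t in lborel. (\<lambda>n. indicator {..<x n} t *\<^sub>R a t) \<longlonglongrightarrow> indicator {..<s} t *\<^sub>R a t"
      proof eventually_elim
        case (elim t)
        consider "t < s" | "s < t" using elim by linarith
        then have "eventually (\<lambda>n. indicator {..<x n} t *\<^sub>R a t = indicator {..<s} t *\<^sub>R a t) sequentially"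
        proof cases
          case 1
          from order_tendstoD(1)[OF x 1] show ?thesis by eventually_elim (use 1 in auto)
        next
          case 2
          from order_tendstoD(2)[OF x 2] show ?thesis by eventually_elim (use 2 in auto)
        qed
        then show ?case by (rule tendsto_eventually)
      qed
    qed (use ia in auto)
  qed
qed

lemma curl_limit:
  assumes \<Theta>: "smooth_fun \<Theta>" and q: "q < 1" "\<And>s. q \<le> s \<Longrightarrow> \<Theta> s = 0"
  shows "(\<integral>x. \<Theta> (fst x) *\<^sub>R \<alpha> x \<partial>N) = - (\<integral>x. dir_deriv 1 \<Theta> (fst x) *\<^sub>R d2 x \<partial>N)"
proof -
  have sp: "space N = Lay" by (simp add: space_restrict_space)
  \<comment> \<open>A smooth function of the first variable may be unbounded on the line, but it is
    bounded over the closed base of the layer.\<close>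
  have sq1: "sqint N (\<lambda>x. f (fst x))" if f: "smooth_fun f" for f
  proof -
    have "compact (f ` {-\<xi>..1})" by (intro compact_continuous_image smooth_fun_continuous f) auto
    then obtain K where K: "\<And>s. s \<in> {-\<xi>..1} \<Longrightarrow> norm (f s) \<le> K" using compact_imp_bounded bounded_iff by (metis imageI)
    have "(\<lambda>x. f (fst x)) \<in> borel_measurable N"
    proof (rule measurable_restrict_space1)
      have [measurable]: "f \<in> borel_measurable borel" by (intro borel_measurable_continuous_onI smooth_fun_continuous f)
      show "(\<lambda>x::plane. f (fst x)) \<in> borel_measurable lborel" by simp
    qed
    moreover have "\<bar>f (fst x)\<bar> \<le> K" if "x \<in> space N" for x using K[of "fst x"] that unfolding sp by (auto simp: layer_def)
    ultimately show ?thesis by (rule sqint_bounded[OF finite_layer])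
  qed
  have "(\<lambda>n. \<integral>x. \<Theta> (fst x) *\<^sub>R S.ct n x \<partial>N) \<longlonglongrightarrow> (\<integral>x. \<Theta> (fst x) *\<^sub>R \<alpha> x \<partial>N)"
    by (rule wconv_scaleR[OF \<alpha>(3) S.sqint_ct(1) sq(5) S.sqint_ct(2) sq1[OF \<Theta>]])
  moreover have "(\<lambda>n. - (\<integral>x. dir_deriv 1 \<Theta> (fst x) *\<^sub>R column 2 (S.Bt n x) \<partial>N)) \<longlonglongrightarrow> - (\<integral>x. dir_deriv 1 \<Theta> (fst x) *\<^sub>R column 2 (B0 x) \<partial>N)"
  proof (intro tendsto_minus wconv_scaleR[OF wconv_column[OF B0(3)] sqint_column(1)[OF S.sqint_Bt(1)] sqint_column(1)[OF sq(4)] _ sq1[OF smooth_fun_dir_deriv[OF \<Theta>]]])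
    show "nsq N (\<lambda>x. column 2 (S.Bt n x)) \<le> S.KB" for n
      using sqint_column(2)[OF S.sqint_Bt(1)] S.sqint_Bt(2) by (rule order_trans)
  qed
  moreover have "(\<integral>x. \<Theta> (fst x) *\<^sub>R S.ct n x \<partial>N) = - (\<integral>x. dir_deriv 1 \<Theta> (fst x) *\<^sub>R column 2 (S.Bt n x) \<partial>N)" for n
    by (rule S.curl_compatibility[OF \<Theta> q])
  ultimately show ?thesis
    unfolding d2_def by (simp only: LIMSEQ_unique)
qed

text \<open>A test function \<open>\<psi>\<close> has a primitive \<open>\<Theta>\<close> that
  vanishes to the right of its support. The limit curl identity for \<open>\<Theta>\<close> pairs
  \<open>\<psi>\<close> with \<open>b\<close> on one side and \<open>\<Theta>\<close> with
  \<open>a\<close> on the other, and the triangle swap turns the latter into \<open>\<psi>\<close>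
  against \<open>J\<close>. Since \<open>\<psi>\<close> need not have mean zero,
  \<open>\<Theta>\<close> is free at the left end, and this is what fixes the additive constant:
  \<open>J\<close> starts from zero at \<open>-\<xi>\<close>.\<close>

lemma J_eq_b: "AE s in lborel. s \<in> {-\<xi><..<1} \<longrightarrow> J s = b s"
proof -
  have "AE s in lborel. s \<in> {-\<xi><..<1} \<longrightarrow> J s - b s = 0"
  proof (rule fundamental_lemma)
    have iJ: "set_integrable lborel A J" if "compact A" for A
      unfolding set_integrable_def by (rule borel_integrable_compact[OF that continuous_on_subset[OF J_continuous]]) auto
    have ibA: "set_integrable lborel A b" if "compact A" for A
      unfolding set_integrable_def using that by (intro integrable_mult_indicator ib) (auto intro: borel_closed compact_imp_closed)
    show "loc_integrable {-\<xi><..<1} (\<lambda>s. J s - b s)" unfolding loc_integrable_def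
      by (auto intro!: set_integral_diff iJ ibA)
    fix \<psi> assume \<psi>: "test_fun {-\<xi><..<1} \<psi>"
    have xi1: "-\<xi> < 1" using xi by simp
    obtain p q where pq: "-\<xi> < p" "p \<le> q" "q < 1" "\<And>x. x \<notin> {p..q} \<Longrightarrow> \<psi> x = 0"
      using test_fun_interval_support[OF \<psi> xi1] by blast
    obtain F where F: "\<And>x. (F has_real_derivative \<psi> x) (at x)" "smooth_fun F"
      using smooth_primitive[OF test_fun_smooth[OF \<psi>]] by blast
    define \<Theta> where "\<Theta> s = F s - F q" for s
    have \<Theta>: "smooth_fun \<Theta>" unfolding \<Theta>_def[abs_def] by (intro smooth_fun_diff F smooth_fun_const)
    have \<Theta>d: "(\<Theta> has_real_derivative \<psi> x) (at x)" for x unfolding \<Theta>_def[abs_def] by (auto intro!: derivative_eq_intros F)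
    have \<Theta>0: "\<Theta> s = 0" if "q \<le> s" for s
    proof (cases "s = q")
      case False
      then have "q < s" using that by simp
      moreover have "(F has_real_derivative 0) (at y)" if "q < y" for y using F(1)[of y] pq(4)[of y] that by simp
      moreover have "continuous_on {q..s} F" by (rule smooth_fun_continuous[OF F(2)])
      ultimately show ?thesis using DERIV_isconst_end[of q s F] by (simp add: \<Theta>_def)
    qed (simp add: \<Theta>_def)
    have tail: "(LBINT x. \<psi> x * indicator {t<..} x) = - \<Theta> t" for t
      by (rule smooth_tail_integral[of \<Theta> \<psi> q]) (use \<Theta>d \<Theta>0 pq test_fun_continuous[OF \<psi>] in auto)
    have cl: "(LBINT x. \<Theta> (fst x) *\<^sub>R \<alpha> x) = - (LBINT x. \<psi> (fst x) *\<^sub>R d2 x)"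
      using curl_limit[OF \<Theta> pq(3) \<Theta>0] dir_deriv_real[OF \<Theta>d] integral_N[OF \<alpha>(2), where \<phi>="\<lambda>x. \<Theta> (fst x)"] integral_N[OF d2(3), where \<phi>="\<lambda>x. \<psi> (fst x)"]
      by simp
    obtain KP where KP: "\<And>x. \<bar>\<psi> x\<bar> \<le> KP" using test_fun_bounded[OF \<psi>] by blast
    have [measurable]: "\<psi> \<in> borel_measurable borel" "\<Theta> \<in> borel_measurable borel"
      using test_fun_measurable[OF \<psi>] by (auto intro!: borel_measurable_continuous_onI smooth_fun_continuous \<Theta>)
    have i1: "integrable lborel (\<lambda>x. \<psi> (fst x) *\<^sub>R d2 x)"
      by (rule integrable_bounded_scaleR[OF int_lborel(2) _ KP]) simp
    have "compact (\<Theta> ` {-\<xi>..1})" by (intro compact_continuous_image smooth_fun_continuous \<Theta>) auto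
    then obtain KT where KT: "\<And>s. s \<in> {-\<xi>..1} \<Longrightarrow> norm (\<Theta> s) \<le> KT" using compact_imp_bounded bounded_iff by (metis imageI)
    have i2: "integrable lborel (\<lambda>x. \<Theta> (fst x) *\<^sub>R \<alpha> x)"
    proof (rule Bochner_Integration.integrable_bound)
      show "integrable lborel (\<lambda>x. KT * norm (\<alpha> x))" using int_lborel(1) by auto
      show "(\<lambda>x. \<Theta> (fst x) *\<^sub>R \<alpha> x) \<in> borel_measurable lborel" using int_lborel(1) by measurable
      show "AE x in lborel. norm (\<Theta> (fst x) *\<^sub>R \<alpha> x) \<le> norm (KT * norm (\<alpha> x))"
      proof (rule AE_I2)
        fix x
        show "norm (\<Theta> (fst x) *\<^sub>R \<alpha> x) \<le> norm (KT * norm (\<alpha> x))"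
        proof (cases "x \<in> Lay")
          case True
          then have "\<bar>\<Theta> (fst x)\<bar> \<le> KT" using KT[of "fst x"] by (auto simp: layer_def)
          then have "\<bar>\<Theta> (fst x)\<bar> \<le> \<bar>KT\<bar>" by simp
          then show ?thesis by (simp add: abs_mult mult_right_mono)
        qed (simp add: \<alpha>(2))
      qed
    qed
    have "(LBINT s. \<psi> s *\<^sub>R J s) = (LBINT t. (- \<Theta> t) *\<^sub>R a t)"
      unfolding J_def integral_triangle_swap[OF ia test_fun_integrable[OF \<psi>]] tail ..
    also have "\<dots> = - (LBINT t. \<Theta> t *\<^sub>R a t)" by simp
    also have "(LBINT t. \<Theta> t *\<^sub>R a t) = (LBINT x. \<Theta> (fst x) *\<^sub>R \<alpha> x)"
      unfolding plane_integral_iterated(1)[OF i2] a_def by (simp flip: integral_scaleR_right)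
    also have "- \<dots> = (LBINT x. \<psi> (fst x) *\<^sub>R d2 x)" using cl by simp
    also have "\<dots> = (LBINT s. \<psi> s *\<^sub>R b s)"
      unfolding plane_integral_iterated(1)[OF i1] b_def by (simp flip: integral_scaleR_right)
    finally have e: "(LBINT s. \<psi> s *\<^sub>R J s) = (LBINT s. \<psi> s *\<^sub>R b s)" .
    have i3: "integrable lborel (\<lambda>s. \<psi> s *\<^sub>R b s)" by (rule integrable_test_fun_scaleR[OF \<psi> ib])
    have i4: "integrable lborel (\<lambda>s. \<psi> s *\<^sub>R J s)"
    proof -
      have "integrable lborel (\<lambda>s. \<psi> s *\<^sub>R (indicator {-\<xi>..1} s *\<^sub>R J s))"
        by (rule integrable_test_fun_scaleR[OF \<psi>]) (use iJ[of "{-\<xi>..1}"] in \<open>simp add: set_integrable_def\<close>)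
      moreover have "\<psi> s *\<^sub>R (indicator {-\<xi>..1} s *\<^sub>R J s) = \<psi> s *\<^sub>R J s" for s
        using test_fun_outside[OF \<psi>, of s] by (cases "s \<in> {-\<xi><..<1}") auto
      ultimately show ?thesis by (simp only:)
    qed
    have "(LBINT s:{-\<xi><..<1}. \<psi> s *\<^sub>R (J s - b s)) = (LBINT s. \<psi> s *\<^sub>R J s - \<psi> s *\<^sub>R b s)"
      unfolding set_lebesgue_integral_def
    proof (rule Bochner_Integration.integral_cong[OF refl])
      fix s show "indicator {-\<xi><..<1} s *\<^sub>R \<psi> s *\<^sub>R (J s - b s) = \<psi> s *\<^sub>R J s - \<psi> s *\<^sub>R b s"
        using test_fun_outside[OF \<psi>, of s] by (cases "s \<in> {-\<xi><..<1}") (auto simp: scaleR_diff_right)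
    qed
    also have "\<dots> = 0" using i3 i4 e by simp
    finally show "(LBINT s:{-\<xi><..<1}. \<psi> s *\<^sub>R (J s - b s)) = 0" .
  qed simp
  then show ?thesis by eventually_elim auto
qed

text \<open>The layer has finite measure, so the constant 1 is admissible in the weak convergence of
  the curls and the total curl is preserved.\<close>

lemma norm_J1: "norm (J 1) = 2"
proof -
  have "J 1 = (LBINT t. a t)" unfolding J_def
    by (intro Bochner_Integration.integral_cong refl) (use a_out in \<open>auto simp: indicator_def\<close>)
  also have "\<dots> = (LBINT x. \<alpha> x)" unfolding a_def by (rule plane_integral_iterated(1)[OF int_lborel(1), symmetric])
  also have "\<dots> = (\<integral>x. 1 *\<^sub>R \<alpha> x \<partial>N)" using integral_N[OF \<alpha>(2), where \<phi>="\<lambda>_. 1"] by simp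
  finally have J1: "J 1 = (\<integral>x. 1 *\<^sub>R \<alpha> x \<partial>N)" .
  have one: "sqint N (\<lambda>x. 1 :: real)" by (rule sqint_bounded[OF finite_layer, where K=1]) auto
  have "(\<lambda>n. \<integral>x. 1 *\<^sub>R S.ct n x \<partial>N) \<longlonglongrightarrow> J 1"
    unfolding J1 by (rule wconv_scaleR[OF \<alpha>(3) S.sqint_ct(1) sq(5) S.sqint_ct(2) one])
  then have "(\<lambda>n. norm (\<integral>x. 1 *\<^sub>R S.ct n x \<partial>N)) \<longlonglongrightarrow> norm (J 1)" by (rule tendsto_norm)
  moreover have "norm (\<integral>x. 1 *\<^sub>R S.ct n x \<partial>N) = 2" for n
    using total[of n] unfolding S.integral_ct[symmetric] S.c_def[symmetric] by simp
  ultimately have "(\<lambda>n::nat. 2::real) \<longlonglongrightarrow> norm (J 1)" by simp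
  then show ?thesis by (simp add: LIMSEQ_const_iff)
qed

text \<open>Every term of the identity on \<open>Omega\<close> passes to the limit. The moving test
  functions on the layer converge strongly to their trace on the axis, so the \<open>B\<close> term
  becomes the line integral of \<open>\<phi> (s, 0)\<close> against \<open>b\<close>, which is
  \<open>J\<close> almost everywhere; the part of \<open>k\<close> inside the layer disappears
  through its factor \<open>\<epsilon> n\<close>.\<close>

lemma k0_representation:
  assumes \<phi>: "test_fun Omega \<phi>"
  shows "(\<integral>x. dir_deriv (coord j) \<phi> x *\<^sub>R k0 x \<partial>M) = - (\<integral>x. \<phi> x *\<^sub>R column j (H0 x) \<partial>M)
        - (if j = 2 then \<integral>s. indicator {-\<xi><..<1} s *\<^sub>R (\<phi> (s, 0) *\<^sub>R J s) \<partial>lborel else 0)"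
proof -
  define e where "e = dir_deriv (coord j) \<phi>"
  have te: "test_fun Omega e" unfolding e_def by (rule test_fun_dir_deriv[OF \<phi>])
  have l1: "(\<lambda>n. \<integral>x. e x *\<^sub>R kx n x \<partial>M) \<longlonglongrightarrow> (\<integral>x. e x *\<^sub>R k0 x \<partial>M)"
    by (rule wconv_scaleR[OF k0(3) sqint_kx(1) sq(1) sqint_kx(2) test_fun_sqint[OF te finite_Omega]])
  have l2: "(\<lambda>n. \<integral>x. \<phi> x *\<^sub>R column j (S.H n x) \<partial>M) \<longlonglongrightarrow> (\<integral>x. \<phi> x *\<^sub>R column j (H0 x) \<partial>M)"
  proof (rule wconv_scaleR[OF wconv_column[OF H0(3)] sqint_column(1)[OF S.sqint_H(1)] sqint_column(1)[OF sq(2)] _ test_fun_sqint[OF \<phi> finite_Omega]])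
    show "nsq M (\<lambda>x. column j (S.H n x)) \<le> C" for n
      using sqint_column(2)[OF S.sqint_H(1)] S.sqint_H(2) by (rule order_trans)
  qed
  have l3: "(\<lambda>n. \<integral>x. \<phi> (stretch (\<epsilon> n) x) *\<^sub>R column j (S.Bt n x) \<partial>N) \<longlonglongrightarrow> (\<integral>x. \<phi> (stretch 0 x) *\<^sub>R column j (B0 x) \<partial>N)"
  proof (rule wconv_scaleR_moving[OF wconv_column[OF B0(3)] sqint_column(1)[OF S.sqint_Bt(1)] sqint_column(1)[OF sq(4)] _
      test_fun_flatten(1)[OF \<phi> eps0] test_fun_flatten(1)[OF \<phi> eps0] test_fun_flatten(2)[OF \<phi> eps0]])
    show "nsq N (\<lambda>x. column j (S.Bt n x)) \<le> S.KB" for n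
      using sqint_column(2)[OF S.sqint_Bt(1)] S.sqint_Bt(2) by (rule order_trans)
  qed
  have "(\<lambda>n. \<integral>x. e (stretch (\<epsilon> n) x) *\<^sub>R S.kt n x \<partial>N) \<longlonglongrightarrow> (\<integral>x. e (stretch 0 x) *\<^sub>R kt0 x \<partial>N)"
    by (rule wconv_scaleR_moving[OF kt0(3) S.sqint_kt(1) sq(3) S.sqint_kt(2)
      test_fun_flatten(1)[OF te eps0] test_fun_flatten(1)[OF te eps0] test_fun_flatten(2)[OF te eps0]])
  then have "(\<lambda>n. \<epsilon> n *\<^sub>R (\<integral>x. e (stretch (\<epsilon> n) x) *\<^sub>R S.kt n x \<partial>N)) \<longlonglongrightarrow> 0 *\<^sub>R (\<integral>x. e (stretch 0 x) *\<^sub>R kt0 x \<partial>N)"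
    by (intro tendsto_scaleR eps0)
  then have l4: "(\<lambda>n. \<epsilon> n *\<^sub>R (\<integral>x. e (stretch (\<epsilon> n) x) *\<^sub>R S.kt n x \<partial>N)) \<longlonglongrightarrow> 0" by simp
  have eq: "(\<integral>x. e x *\<^sub>R kx n x \<partial>M) = - (\<integral>x. \<phi> x *\<^sub>R column j (S.H n x) \<partial>M)
        - (\<integral>x. \<phi> (stretch (\<epsilon> n) x) *\<^sub>R column j (S.Bt n x) \<partial>N)
        - \<epsilon> n *\<^sub>R (\<integral>x. e (stretch (\<epsilon> n) x) *\<^sub>R S.kt n x \<partial>N)" for n
    using S.weak_deriv_k_Omega[OF \<phi>, of j n] unfolding kx_def e_def .
  have "(\<lambda>n. \<integral>x. e x *\<^sub>R kx n x \<partial>M) \<longlonglongrightarrow> - (\<integral>x. \<phi> x *\<^sub>R column j (H0 x) \<partial>M) - (\<integral>x. \<phi> (stretch 0 x) *\<^sub>R column j (B0 x) \<partial>N) - 0"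
    unfolding eq by (intro tendsto_diff tendsto_minus l2 l3 l4)
  from LIMSEQ_unique[OF l1 this]
  have main: "(\<integral>x. e x *\<^sub>R k0 x \<partial>M) = - (\<integral>x. \<phi> x *\<^sub>R column j (H0 x) \<partial>M) - (\<integral>x. \<phi> (stretch 0 x) *\<^sub>R column j (B0 x) \<partial>N)" by simp
  have "(\<integral>x. \<phi> (stretch 0 x) *\<^sub>R column j (B0 x) \<partial>N) = (if j = 2 then \<integral>s. indicator {-\<xi><..<1} s *\<^sub>R (\<phi> (s, 0) *\<^sub>R J s) \<partial>lborel else 0)"
  proof (cases "j = 2")
    case False
    then have j: "j = 1" using exhaust_2[of j] by blast
    have "AE x in N. \<phi> (stretch 0 x) *\<^sub>R column 1 (B0 x) = 0"
      unfolding AE_lborel_on[OF layer_borel] using B0_column1 by eventually_elim auto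
    then show ?thesis unfolding j by (simp add: integral_eq_zero_AE)
  next
    case True
    have [measurable]: "\<phi> \<in> borel_measurable borel" by (rule test_fun_measurable[OF \<phi>])
    obtain K where K: "\<And>x. \<bar>\<phi> x\<bar> \<le> K" using test_fun_bounded[OF \<phi>] by blast
    have i: "integrable lborel (\<lambda>x. \<phi> (stretch 0 x) *\<^sub>R d2 x)"
      by (rule integrable_bounded_scaleR[OF int_lborel(2) _ K]) simp
    have m: "(\<lambda>s. \<phi> (s, 0)) \<in> borel_measurable borel"
      by (intro borel_measurable_continuous_onI continuous_on_compose2[OF test_fun_continuous[OF \<phi>, of UNIV]] continuous_intros) auto
    have "(\<integral>x. \<phi> (stretch 0 x) *\<^sub>R column j (B0 x) \<partial>N) = (LBINT x. \<phi> (stretch 0 x) *\<^sub>R d2 x)"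
      unfolding True d2_def[symmetric] by (rule integral_N[OF d2(3)])
    also have "\<dots> = (LBINT s. \<phi> (s, 0) *\<^sub>R b s)"
      unfolding plane_integral_iterated(1)[OF i] b_def by (simp add: stretch_def)
    also have "\<dots> = (LBINT s. indicator {-\<xi><..<1} s *\<^sub>R (\<phi> (s, 0) *\<^sub>R J s))"
    proof (rule integral_cong_AE)
      have [measurable]: "J \<in> borel_measurable borel" "b \<in> borel_measurable borel"
        using ib by (auto intro: borel_measurable_continuous_onI[OF J_continuous])
      show "(\<lambda>s. \<phi> (s, 0) *\<^sub>R b s) \<in> borel_measurable lborel"
        "(\<lambda>s. indicator {-\<xi><..<1} s *\<^sub>R (\<phi> (s, 0) *\<^sub>R J s)) \<in> borel_measurable lborel"
        using m by (simp_all add: borel_measurable_scaleR)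
      show "AE s in lborel. \<phi> (s, 0) *\<^sub>R b s = indicator {-\<xi><..<1} s *\<^sub>R (\<phi> (s, 0) *\<^sub>R J s)"
        using J_eq_b
      proof eventually_elim
        case (elim s)
        then show ?case using b_out[of s] by (cases "s \<in> {-\<xi><..<1}") auto
      qed
    qed
    finally show ?thesis using True by simp
  qed
  with main show ?thesis unfolding e_def by simp
qed

sublocale J: segment_jump \<xi> k0 H0 J
proof
  show "0 < \<xi>" "\<xi> < 1" by (fact xi)+
  show "k0 \<in> borel_measurable borel" using k0(1) by (auto simp: sqint_def)
  show "x \<notin> Omega \<Longrightarrow> k0 x = 0" "x \<notin> Omega \<Longrightarrow> H0 x = 0" for x by (fact k0(2), fact H0(2))
  show "sqint lborel k0" "sqint lborel H0" by (fact k0(1), fact H0(1))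
  show "continuous_on UNIV J" by (fact J_continuous)
qed (rule k0_representation)

end

lemma has_weak_deriv_diff:
  assumes 1: "has_weak_deriv U v f g" and 2: "has_weak_deriv U v f' g'"
  shows "has_weak_deriv U v (\<lambda>x. f x - f' x) (\<lambda>x. g x - g' x)"
  unfolding has_weak_deriv_def
proof (intro conjI allI impI)
  have l: "loc_integrable U f" "loc_integrable U f'" "loc_integrable U g" "loc_integrable U g'"
    using 1 2 unfolding has_weak_deriv_def by blast+
  show "loc_integrable U (\<lambda>x. f x - f' x)" "loc_integrable U (\<lambda>x. g x - g' x)"
    using l unfolding loc_integrable_def by (auto intro: set_integral_diff)
  fix \<phi> assume \<phi>: "test_fun U \<phi>"
  note s = set_integrable_test_fun[OF test_fun_dir_deriv[OF \<phi>]] set_integrable_test_fun[OF \<phi>]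
  show "(LBINT x:U. dir_deriv v \<phi> x *\<^sub>R (f x - f' x)) = - (LBINT x:U. \<phi> x *\<^sub>R (g x - g' x))"
    unfolding scaleR_diff_right set_integral_diff(2)[OF s(1)[OF l(1)] s(1)[OF l(2)]] set_integral_diff(2)[OF s(2)[OF l(3)] s(2)[OF l(4)]]
      has_weak_derivD[OF 1 \<phi>] has_weak_derivD[OF 2 \<phi>] by simp
qed

text \<open>The converse of absolute continuity in one variable. The constant \<open>w\<close> is
  annihilated because the derivative of a test function has mean zero, and the primitive is
  integrated by parts through the triangle swap.\<close>

lemma has_weak_deriv_real:
  fixes f g :: "real \<Rightarrow> 'b::euclidean_space"
  assumes cd: "c < d" and f: "integrable lborel f" and g: "integrable lborel g"
    and rep: "AE y in lborel. y \<in> {c<..<d} \<longrightarrow> f y = w + (LBINT t:{c<..<y}. g t)"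
  shows "has_weak_deriv {c<..<d} 1 f g"
  unfolding has_weak_deriv_def
proof (intro conjI allI impI)
  show "loc_integrable {c<..<d} f" "loc_integrable {c<..<d} g"
    unfolding loc_integrable_def set_integrable_def using f g by (auto intro!: integrable_mult_indicator borel_compact)
  fix \<eta> :: "real \<Rightarrow> real" assume \<eta>: "test_fun {c<..<d} \<eta>"
  define e where "e = dir_deriv 1 \<eta>"
  have te: "test_fun {c<..<d} e" unfolding e_def by (rule test_fun_dir_deriv[OF \<eta>])
  define G where "G t = indicator {c<..<d} t *\<^sub>R g t" for t
  have iG: "integrable lborel G" unfolding G_def[abs_def] by (rule integrable_mult_indicator[OF _ g]) simp
  have [measurable]: "f \<in> borel_measurable borel" "G \<in> borel_measurable borel" "e \<in> borel_measurable borel"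
    using f iG test_fun_measurable[OF te] by auto
  define P where "P y = (LBINT t. indicator {..<y} t *\<^sub>R G t)" for y
  have Pm [measurable]: "P \<in> borel_measurable borel"
  proof -
    have "P = (\<lambda>y. LBINT t. (if t < y then G t else 0))"
      unfolding P_def by (intro ext Bochner_Integration.integral_cong) (auto simp: indicator_def)
    then show ?thesis by simp
  qed
  have P: "(LBINT t:{c<..<y}. g t) = P y" if "y \<in> {c<..<d}" for y
    unfolding P_def set_lebesgue_integral_def
    by (intro Bochner_Integration.integral_cong refl) (use that in \<open>auto simp: G_def indicator_def\<close>)
  have ae: "AE y in lborel. indicator {c<..<d} y *\<^sub>R (e y *\<^sub>R f y) = e y *\<^sub>R (w + P y)"
    using rep
  proof eventually_elim
    case (elim y)
    then show ?case using P[of y] test_fun_outside[OF te, of y] by (cases "y \<in> {c<..<d}") auto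
  qed
  have i1: "integrable lborel (\<lambda>y. e y *\<^sub>R w)" by (intro integrable_scaleR_left test_fun_integrable[OF te])
  have "integrable lborel (\<lambda>y. indicator {c<..<d} y *\<^sub>R (e y *\<^sub>R f y))"
    by (intro integrable_mult_indicator integrable_test_fun_scaleR[OF te f]) simp
  then have i2: "integrable lborel (\<lambda>y. e y *\<^sub>R (w + P y))"
    by (rule integrable_cong_AE_imp[OF _ _ ae]) simp
  have i3: "integrable lborel (\<lambda>y. e y *\<^sub>R P y)"
    using Bochner_Integration.integrable_diff[OF i2 i1] by (simp add: scaleR_add_right)
  have z: "(LBINT y. e y) = 0"
  proof -
    have "e y * indicator {c<..} y = e y" for y
      using test_fun_outside[OF te, of y] by (auto simp: indicator_def)
    then have "(LBINT y. e y) = (LBINT y. e y * indicator {c<..} y)" by (simp only:)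
    then show ?thesis
      using integral_deriv_tail[OF \<eta> cd, of c] test_fun_outside[OF \<eta>, of c] unfolding e_def by simp
  qed
  have "(LBINT y:{c<..<d}. e y *\<^sub>R f y) = (LBINT y. e y *\<^sub>R (w + P y))"
    unfolding set_lebesgue_integral_def by (rule integral_cong_AE[OF _ _ ae]) simp_all
  also have "\<dots> = (LBINT y. e y *\<^sub>R w) + (LBINT y. e y *\<^sub>R P y)"
    unfolding scaleR_add_right by (rule Bochner_Integration.integral_add[OF i1 i3])
  also have "(LBINT y. e y *\<^sub>R w) = 0" using z integral_scaleR_left[of w lborel e] test_fun_integrable[OF te] by simp
  also have "(LBINT y. e y *\<^sub>R P y) = (LBINT t. (- \<eta> t) *\<^sub>R G t)"
    unfolding P_def integral_triangle_swap[OF iG test_fun_integrable[OF te]] unfolding e_def integral_deriv_tail[OF \<eta> cd] ..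
  also have "0 + \<dots> = - (LBINT t. \<eta> t *\<^sub>R G t)" by simp
  also have "(LBINT t. \<eta> t *\<^sub>R G t) = (LBINT t:{c<..<d}. \<eta> t *\<^sub>R g t)"
    unfolding set_lebesgue_integral_def G_def by (intro Bochner_Integration.integral_cong refl) (auto simp: indicator_def)
  finally show "(LBINT y:{c<..<d}. dir_deriv 1 \<eta> y *\<^sub>R f y) = - (LBINT t:{c<..<d}. \<eta> t *\<^sub>R g t)"
    unfolding e_def .
qed

section \<open>Strong convergence, unit modulus and the sections of the limit\<close>

lemma weak_L2_iff:
  assumes "U \<in> sets borel"
  shows "weak_L2 U f g \<longleftrightarrow> (\<forall>n. sqint (lborel_on U) (f n)) \<and> sqint (lborel_on U) g \<and> wconv (lborel_on U) f g"
  unfolding weak_L2_def wconv_def ip_def Ball_def L2_iff_sqint[OF assms] set_integral_lborel_on[OF assms] ..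

definition strip :: "nat \<Rightarrow> plane set" where
  "strip m = Omega \<inter> {x. \<bar>snd x\<bar> < 1 / real (Suc m)}"

lemma strip_borel [simp, measurable]: "strip m \<in> sets borel"
proof -
  have "open {x::plane. \<bar>snd x\<bar> < 1 / real (Suc m)}" by (intro open_Collect_less continuous_intros)
  then show ?thesis unfolding strip_def by simp
qed

lemma strip_integral_tendsto_0:
  fixes h :: "plane \<Rightarrow> real"
  assumes h: "integrable lborel h"
  shows "(\<lambda>m. LBINT y. indicator (strip m) y *\<^sub>R h y) \<longlonglongrightarrow> 0"
proof -
  have [measurable]: "h \<in> borel_measurable borel" using h by auto
  have "(\<lambda>m. LBINT y. indicator (strip m) y *\<^sub>R h y) \<longlonglongrightarrow> (\<integral>y. 0 \<partial>(lborel :: plane measure))"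
  proof (rule integral_dominated_convergence[where w="\<lambda>y. norm (h y)"])
    show "AE y in lborel. norm (indicator (strip m) y *\<^sub>R h y) \<le> norm (h y)" for m
      by (intro AE_I2) (auto simp: indicator_def)
    have "AE y::plane in lborel. snd y \<noteq> 0" by (rule AE_plane_snd[OF AE_lborel_singleton])
    then show "AE y in lborel. (\<lambda>m. indicator (strip m) y *\<^sub>R h y) \<longlonglongrightarrow> 0"
    proof eventually_elim
      case (elim y)
      have "(\<lambda>m. 1 / real (Suc m)) \<longlonglongrightarrow> 0" using LIMSEQ_inverse_real_of_nat by (simp add: inverse_eq_divide)
      then have "eventually (\<lambda>m. 1 / real (Suc m) < \<bar>snd y\<bar>) sequentially"
        using elim by (intro order_tendstoD) auto
      then have "eventually (\<lambda>m. indicator (strip m) y *\<^sub>R h y = 0) sequentially"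
        by eventually_elim (auto simp: strip_def indicator_def)
      then show ?case by (rule tendsto_eventually)
    qed
  qed (use h in auto)
  then show ?thesis by simp
qed

lemma sqint_indicator:
  assumes "finite_measure (lborel_on V)" "A \<in> sets borel"
  shows "sqint (lborel_on V) (indicator A :: _ \<Rightarrow> real)"
proof (rule sqint_bounded[OF assms(1), where K=1])
  show "(indicator A :: _ \<Rightarrow> real) \<in> borel_measurable (lborel_on V)"
    using assms(2) by (intro measurable_restrict_space1 borel_measurable_indicator) simp
qed (auto simp: indicator_def)

context layer_limit
begin

lemma Q_integral:
  fixes f :: "plane \<Rightarrow> 'b::euclidean_space"
  assumes "Q \<subseteq> Omega" "Q \<in> sets borel"
  shows "integral\<^sup>L (lborel_on Q) f = (\<integral>x. indicator Q x *\<^sub>R f x \<partial>M)"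
proof -
  have "indicator Q x *\<^sub>R f x = indicator Omega x *\<^sub>R (indicator Q x *\<^sub>R f x)" for x using assms(1) by (auto simp: indicator_def)
  then show ?thesis
    unfolding set_integral_lborel_on[OF assms(2), symmetric] set_integral_lborel_on[OF Omega_borel, symmetric] set_lebesgue_integral_def
    by (simp only:)
qed

lemma eps_small: "e > 0 \<Longrightarrow> eventually (\<lambda>n. \<epsilon> n < e) sequentially"
  using order_tendstoD(2)[OF eps0] .

text \<open>By closeness of the modulus to 1, the mass of \<open>kx n\<close> near the axis is at
  most twice the area of the strip plus a term of order \<open>\<epsilon> n\<close>, and the single
  function \<open>k0\<close> has little mass on thin strips.\<close>

lemma tight:
  assumes e: "e > 0"
  shows "\<exists>\<delta>>0. eventually (\<lambda>n. nsq (lborel_on (Omega \<inter> {x. \<bar>snd x\<bar> < \<delta>})) (\<lambda>x. kx n x - k0 x) \<le> e) sequentially"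
proof -
  have mi: "(LBINT y. indicator (strip m) y *\<^sub>R (indicator Omega y :: real)) = measure lborel (strip m)" for m
  proof -
    have "indicator (strip m) y *\<^sub>R (indicator Omega y :: real) = indicator (strip m) y" for y
      by (auto simp: strip_def indicator_def)
    then have "(LBINT y. indicator (strip m) y *\<^sub>R (indicator Omega y :: real)) = (LBINT y. indicator (strip m) y)" by (simp only:)
    then show ?thesis by simp
  qed
  have "integrable lborel (indicator Omega :: plane \<Rightarrow> real)"
    using emeasure_bounded_finite[OF bounded_Omega] by (simp add: integrable_indicator_iff)
  from strip_integral_tendsto_0[OF this] have 1: "(\<lambda>m. measure lborel (strip m)) \<longlonglongrightarrow> 0" unfolding mi .
  have "(norm (indicator (strip m) x *\<^sub>R k0 x))\<^sup>2 = indicator (strip m) x *\<^sub>R (norm (k0 x))\<^sup>2" for m x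
    by (simp add: indicator_def)
  then have ni: "(LBINT y. indicator (strip m) y *\<^sub>R (norm (k0 y))\<^sup>2) = nsq (lborel_on (strip m)) k0" for m
    unfolding nsq_lborel_on[OF strip_borel] unfolding nsq_def by (simp only:)
  from strip_integral_tendsto_0[OF sqint_integrable[OF k0(1)]]
  have 2: "(\<lambda>m. nsq (lborel_on (strip m)) k0) \<longlonglongrightarrow> 0" unfolding ni .
  have "(\<lambda>m. 4 * measure lborel (strip m) + 2 * nsq (lborel_on (strip m)) k0) \<longlonglongrightarrow> 4 * 0 + 2 * 0"
    by (intro tendsto_intros 1 2)
  then have "eventually (\<lambda>m. 4 * measure lborel (strip m) + 2 * nsq (lborel_on (strip m)) k0 < e/2) sequentially"
    using e by (intro order_tendstoD) auto
  then obtain m where m: "4 * measure lborel (strip m) + 2 * nsq (lborel_on (strip m)) k0 < e/2"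
    using eventually_happens'[OF sequentially_bot] by blast
  have "(\<lambda>n. 4 * (C * (\<epsilon> n * \<xi>\<^sup>2))) \<longlonglongrightarrow> 4 * (C * (0 * \<xi>\<^sup>2))" by (intro tendsto_intros eps0)
  then have "(\<lambda>n. 4 * (C * (\<epsilon> n * \<xi>\<^sup>2))) \<longlonglongrightarrow> 0" by (simp only: mult_zero_left mult_zero_right)
  then have "eventually (\<lambda>n. 4 * (C * (\<epsilon> n * \<xi>\<^sup>2)) < e/2) sequentially"
    by (rule order_tendstoD(2)) (use e in simp)
  then have "eventually (\<lambda>n. nsq (lborel_on (strip m)) (\<lambda>x. kx n x - k0 x) \<le> e) sequentially"
  proof eventually_elim
    case (elim n)
    have sub: "strip m \<subseteq> Omega" by (auto simp: strip_def)
    note r = sqint_lborel_on_subset(1)[OF _ sub Omega_borel strip_borel]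
    have le: "(norm (kx n x))\<^sup>2 \<le> (norm (k n x))\<^sup>2" for x by (simp add: kx_def indicator_def)
    have "nsq (lborel_on (strip m)) (\<lambda>x. kx n x - k0 x) \<le> 2 * nsq (lborel_on (strip m)) (kx n) + 2 * nsq (lborel_on (strip m)) k0"
      by (rule nsq_diff_le[OF r[OF sqint_kx(1)] r[OF sq(1)]])
    moreover have "nsq (lborel_on (strip m)) (kx n) \<le> nsq (lborel_on (strip m)) (k n)"
      unfolding nsq_def by (rule integral_mono[OF sqint_integrable[OF r[OF sqint_kx(1)]] sqint_integrable[OF r[OF S.sqint_k]] le])
    moreover have "nsq (lborel_on (strip m)) (k n) \<le> 2 * (C * (\<epsilon> n * \<xi>\<^sup>2)) + 2 * measure lborel (strip m)"
      by (rule S.nsq_k_subset[OF sub strip_borel])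
    ultimately show ?case using m elim by linarith
  qed
  then show ?thesis unfolding strip_def by (intro exI[of _ "1 / real (Suc m)"] conjI) simp_all
qed

text \<open>Off the axis \<open>kx n - k0\<close> eventually has the gradient
  \<open>S.H n - H0\<close>, which is bounded in L2: a square at positive distance from the axis is
  missed by the layer for large \<open>n\<close>, and \<open>k0\<close> has no singular part
  there.\<close>

lemma kx_strong: "(\<lambda>n. nsq M (\<lambda>x. kx n x - k0 x)) \<longlonglongrightarrow> 0"
proof (rule strong_convergence_off_line)
  let ?g = "\<lambda>j n x. column j (S.H n x) - column j (H0 x)"
  show "sqint M (\<lambda>x. kx n x - k0 x)" for n by (intro sqint_diff sqint_kx sq)
  show "sqint M (?g 1 n)" "sqint M (?g 2 n)" for n by (intro sqint_diff sqint_column(1) S.sqint_H sq)+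
  have g: "nsq M (?g j n) \<le> 2 * C + 2 * nsq M H0" for j n
  proof -
    have "nsq M (?g j n) \<le> 2 * nsq M (\<lambda>x. column j (S.H n x)) + 2 * nsq M (\<lambda>x. column j (H0 x))"
      by (intro nsq_diff_le sqint_column(1) S.sqint_H sq)
    moreover have "nsq M (\<lambda>x. column j (S.H n x)) \<le> C" using sqint_column(2)[OF S.sqint_H(1)] S.sqint_H(2) by (rule order_trans)
    moreover have "nsq M (\<lambda>x. column j (H0 x)) \<le> nsq M H0" by (rule sqint_column(2)[OF sq(2)])
    ultimately show ?thesis by linarith
  qed
  show "nsq M (?g 1 n) + nsq M (?g 2 n) \<le> 4 * C + 4 * nsq M H0" for n
    using g[of 1 n] g[of 2 n] by linarith
  show "\<exists>\<delta>>0. eventually (\<lambda>n. nsq (lborel_on (Omega \<inter> {x. \<bar>snd x\<bar> < \<delta>})) (\<lambda>x. kx n x - k0 x) \<le> e) sequentially" if "e > 0" for e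
    by (rule tight[OF that])
  fix p q s :: real
  let ?Q = "{p<..<p+s} \<times> {q<..<q+s}"
  assume s: "0 < s" and Q: "?Q \<subseteq> Omega"
  have Qo: "open ?Q" by (intro open_Times) auto
  then have Qb: "?Q \<in> sets borel" by simp
  have ind: "sqint M (indicator ?Q :: plane \<Rightarrow> real)"
    by (rule sqint_indicator[OF finite_Omega Qb])
  show "(\<lambda>n. \<integral>x. kx n x - k0 x \<partial>lborel_on ?Q) \<longlonglongrightarrow> 0"
  proof -
    have "(\<lambda>n. \<integral>x. indicator ?Q x *\<^sub>R kx n x \<partial>M) \<longlonglongrightarrow> (\<integral>x. indicator ?Q x *\<^sub>R k0 x \<partial>M)"
      by (rule wconv_scaleR[OF k0(3) sqint_kx(1) sq(1) sqint_kx(2) ind])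
    then have "(\<lambda>n. (\<integral>x. kx n x \<partial>lborel_on ?Q) - (\<integral>x. k0 x \<partial>lborel_on ?Q)) \<longlonglongrightarrow> 0"
      unfolding Q_integral[OF Q Qb] by (rule LIM_zero)
    moreover have "(\<integral>x. kx n x - k0 x \<partial>lborel_on ?Q) = (\<integral>x. kx n x \<partial>lborel_on ?Q) - (\<integral>x. k0 x \<partial>lborel_on ?Q)" for n
      by (intro Bochner_Integration.integral_diff sqint_loc_integrable(2)[OF _ Qb bounded_subset[OF bounded_Omega Q]]
        sqint_lborel_on_subset(1)[OF _ Q Omega_borel Qb] sqint_kx sq)
    ultimately show ?thesis by (simp only:)
  qed
  assume q: "0 < q \<or> q + s < 0"
  \<comment> \<open>The distance of the square from the axis.\<close>
  define c where "c = (if 0 < q then q else - (q + s))"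
  have c: "c > 0" using q by (auto simp: c_def)
  have Qc: "c < \<bar>snd x\<bar>" if "x \<in> ?Q" for x using that q s by (auto simp: c_def)
  from eps_small[OF c]
  show "eventually (\<lambda>n. has_weak_deriv ?Q (coord 1) (\<lambda>x. kx n x - k0 x) (?g 1 n) \<and>
      has_weak_deriv ?Q (coord 2) (\<lambda>x. kx n x - k0 x) (?g 2 n)) sequentially"
  proof eventually_elim
    case (elim n)
    have "?Q \<inter> layer (\<epsilon> n) \<xi> = {}"
    proof -
      have "x \<notin> layer (\<epsilon> n) \<xi>" if "x \<in> ?Q" for x
      proof
        assume "x \<in> layer (\<epsilon> n) \<xi>"
        then have "\<bar>snd x\<bar> < \<epsilon> n * \<xi> / 2" by (auto simp: layer_def)
        also have "\<dots> \<le> \<epsilon> n * 1" using xi S.eps(1)[of n] by (simp add: field_simps)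
        finally show False using Qc[OF that] elim by simp
      qed
      then show ?thesis by blast
    qed
    from S.weak_deriv_off_layer[OF Qo Q this]
    have "has_weak_deriv ?Q (coord j) (kx n) (\<lambda>x. column j (S.H n x))" for j unfolding kx_def[abs_def] .
    moreover have "?Q \<inter> ({-\<xi>..1} \<times> {0}) = {}" using q by auto
    from J.weak_deriv_off_segment[OF Qo Q this]
    have "has_weak_deriv ?Q (coord j) k0 (\<lambda>x. column j (H0 x))" for j .
    ultimately show ?case by (intro conjI has_weak_deriv_diff)
  qed
qed

text \<open>Outside the layer \<open>kx n\<close> has the modulus of \<open>k n\<close>; inside it
  is 0, a defect of 1 that is paid for by the area of the layer. Strong convergence passes the
  vanishing defect on to \<open>k0\<close>.\<close>

lemma k0_unit: "AE x in lborel. x \<in> Omega \<longrightarrow> k0 x \<in> sphere 0 1"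
proof -
  have sn: "sqint M (\<lambda>x. norm (f x) - 1)" if "sqint M f" for f :: "plane \<Rightarrow> real^2"
  proof (rule sqint_diff)
    show "sqint M (\<lambda>x. norm (f x))" using that by (auto simp: sqint_def)
    show "sqint M (\<lambda>x. 1::real)" by (rule sqint_bounded[OF finite_Omega, where K=1]) auto
  qed
  have il: "sqint M (indicator (layer (\<epsilon> n) \<xi>) :: plane \<Rightarrow> real)" for n
    by (rule sqint_indicator[OF finite_Omega layer_borel])
  have nl: "nsq M (indicator (layer (\<epsilon> n) \<xi>) :: plane \<Rightarrow> real) = (1 + \<xi>) * (\<epsilon> n * \<xi>)" for n
  proof -
    have "(norm (indicator Omega x *\<^sub>R (indicator (layer (\<epsilon> n) \<xi>) x :: real)))\<^sup>2 = indicator (layer (\<epsilon> n) \<xi>) x" for x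
      using S.layer_subset[of n] by (auto simp: indicator_def)
    then have "nsq M (indicator (layer (\<epsilon> n) \<xi>) :: plane \<Rightarrow> real) = (LBINT x. indicator (layer (\<epsilon> n) \<xi>) x)"
      unfolding nsq_lborel_on[OF Omega_borel] unfolding nsq_def by (simp only:)
    then have "nsq M (indicator (layer (\<epsilon> n) \<xi>) :: plane \<Rightarrow> real) = measure lborel (layer (\<epsilon> n) \<xi>)" by simp
    then show ?thesis using S.measure_layer[of n] by simp
  qed
  have b: "nsq M (\<lambda>x. norm (k0 x) - 1) \<le> 2 * nsq M (\<lambda>x. kx n x - k0 x) + 2 * (C * (\<epsilon> n * \<xi>\<^sup>2) + (1 + \<xi>) * (\<epsilon> n * \<xi>))" for n
  proof -
    have p: "(norm (norm (k0 x) - 1))\<^sup>2 \<le> 2 * (norm (kx n x - k0 x))\<^sup>2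
        + 2 * ((norm (norm (k n x) - 1))\<^sup>2 + (norm (indicator (layer (\<epsilon> n) \<xi>) x :: real))\<^sup>2)" if "x \<in> Omega" for x
    proof -
      have *: "r \<le> 2 * w + 2 * (u + v)" if "s \<le> u + v" "r \<le> 2 * t + 2 * s" "t \<le> w" for r s t u v w :: real
        using that by argo
      have "(norm (norm (kx n x) - 1))\<^sup>2 \<le> (norm (norm (k n x) - 1))\<^sup>2 + (norm (indicator (layer (\<epsilon> n) \<xi>) x :: real))\<^sup>2"
        using that by (simp add: kx_def indicator_def)
      moreover have "(norm (norm (k0 x) - 1))\<^sup>2 \<le> 2 * (norm (norm (k0 x) - norm (kx n x)))\<^sup>2 + 2 * (norm (norm (kx n x) - 1))\<^sup>2"
        using norm_add_power2_le[of "norm (k0 x) - norm (kx n x)" "norm (kx n x) - 1"] by simp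
      moreover have "(norm (norm (k0 x) - norm (kx n x)))\<^sup>2 \<le> (norm (kx n x - k0 x))\<^sup>2"
        using norm_triangle_ineq3[of "kx n x" "k0 x"] by (intro power_mono) (auto simp: abs_minus_commute)
      ultimately show ?thesis by (rule *)
    qed
    note i = sqint_integrable[OF sqint_diff[OF sqint_kx(1) sq(1)], of n] sqint_integrable[OF S.sqint_modulus(1), of n] sqint_integrable[OF il, of n]
    have "nsq M (\<lambda>x. norm (k0 x) - 1) \<le> (\<integral>x. 2 * (norm (kx n x - k0 x))\<^sup>2
        + 2 * ((norm (norm (k n x) - 1))\<^sup>2 + (norm (indicator (layer (\<epsilon> n) \<xi>) x :: real))\<^sup>2) \<partial>M)"
      unfolding nsq_def
      by (rule integral_mono[OF sqint_integrable[OF sn[OF sq(1)]]])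
        (intro Bochner_Integration.integrable_add integrable_mult_right i, rule p, simp add: space_restrict_space)
    also have "\<dots> = 2 * nsq M (\<lambda>x. kx n x - k0 x) + 2 * (nsq M (\<lambda>x. norm (k n x) - 1) + nsq M (indicator (layer (\<epsilon> n) \<xi>) :: plane \<Rightarrow> real))"
      using i unfolding nsq_def by (simp del: real_norm_def)
    also have "\<dots> \<le> 2 * nsq M (\<lambda>x. kx n x - k0 x) + 2 * (C * (\<epsilon> n * \<xi>\<^sup>2) + (1 + \<xi>) * (\<epsilon> n * \<xi>))"
      unfolding nl by (intro add_mono mult_left_mono order_refl S.sqint_modulus(2)) simp
    finally show ?thesis .
  qed
  have "(\<lambda>n. 2 * nsq M (\<lambda>x. kx n x - k0 x) + 2 * (C * (\<epsilon> n * \<xi>\<^sup>2) + (1 + \<xi>) * (\<epsilon> n * \<xi>))) \<longlonglongrightarrow> 2 * 0 + 2 * (C * (0 * \<xi>\<^sup>2) + (1 + \<xi>) * (0 * \<xi>))"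
    by (intro tendsto_intros kx_strong eps0)
  from LIMSEQ_le_const[OF this] b have "nsq M (\<lambda>x. norm (k0 x) - 1) \<le> 0" by auto
  then have "nsq M (\<lambda>x. norm (k0 x) - 1) = 0" by (simp add: antisym)
  from nsq_zero_AE[OF sn[OF sq(1)] this] show ?thesis
    unfolding AE_lborel_on[OF Omega_borel] by eventually_elim simp
qed

text \<open>\<open>kt0\<close> is weakly differentiable in the second variable only, and this is
  what absolute continuity on vertical lines asks for. Almost every section is thus a primitive, and
  Fubini makes the section and its derivative square-integrable.\<close>

lemma sections:
  "AE s in lborel. s \<in> {-\<xi><..<1} \<longrightarrow> (\<lambda>y. kt0 (s, y)) \<in> W12 {-\<xi>/2<..<\<xi>/2}
     \<and> has_weak_deriv {-\<xi>/2<..<\<xi>/2} 1 (\<lambda>y. kt0 (s, y)) (\<lambda>y. d2 (s, y))"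
proof -
  define I where "I = {-\<xi>/2<..<\<xi>/2}"
  have L: "{-\<xi><..<1} \<times> I = Lay" by (simp add: layer_def I_def)
  have cd: "-\<xi>/2 < \<xi>/2" using xi by simp
  have wd: "(LBINT x:Lay. (\<phi> (fst x) * dir_deriv 1 \<eta> (snd x)) *\<^sub>R kt0 x) = - (LBINT x:Lay. (\<phi> (fst x) * \<eta> (snd x)) *\<^sub>R d2 x)"
    if \<phi>: "test_fun {-\<xi><..<1} \<phi>" and \<eta>: "test_fun I \<eta>" for \<phi> \<eta> :: "real \<Rightarrow> real"
    using has_weak_derivD[OF weak_deriv_kt0 test_fun_product(1)[OF \<phi> \<eta>, unfolded L]]
    unfolding test_fun_product(3)[OF \<phi> \<eta>] .
  obtain w where w: "AE x in lborel. x \<in> Lay \<longrightarrow> kt0 x = w (fst x) + (LBINT t:{-\<xi>/2<..<snd x}. d2 (fst x, t))"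
    using absolutely_continuous_vertical[where a="-\<xi>" and b=1 and c="-\<xi>/2" and d="\<xi>/2" and u=kt0 and g=d2, folded I_def, unfolded L,
      OF cd sqint_loc_integrable(3)[OF sq(3) layer_borel bounded_layer] sqint_loc_integrable(3)[OF d2(2) layer_borel bounded_layer] wd]
    by blast
  from w
  have "AE s in lborel. AE y in lborel. (s, y) \<in> Lay \<longrightarrow> kt0 (s, y) = w s + (LBINT t:{-\<xi>/2<..<y}. d2 (s, t))"
    using lborel_pair.AE_pair[of "\<lambda>x. x \<in> Lay \<longrightarrow> kt0 x = w (fst x) + (LBINT t:{-\<xi>/2<..<snd x}. d2 (fst x, t))"]
    unfolding lborel_prod fst_conv snd_conv by blast
  with plane_integral_iterated(3)[OF int_lborel(3)] plane_integral_iterated(3)[OF int_lborel(2)]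
    plane_integral_iterated(3)[OF sqint_integrable[OF kt0(1)]] plane_integral_iterated(3)[OF sqint_integrable[OF d2(1)]]
  show ?thesis unfolding I_def[symmetric]
  proof eventually_elim
    case (elim s)
    show ?case
    proof
      assume s: "s \<in> {-\<xi><..<1}"
      have wd: "has_weak_deriv I 1 (\<lambda>y. kt0 (s, y)) (\<lambda>y. d2 (s, y))"
        unfolding I_def
      proof (rule has_weak_deriv_real[where w="w s"])
        show "-\<xi>/2 < \<xi>/2" using xi by simp
        show "AE y in lborel. y \<in> {-\<xi>/2<..<\<xi>/2} \<longrightarrow> kt0 (s, y) = w s + (LBINT t:{-\<xi>/2<..<y}. d2 (s, t))"
          using elim(5) s unfolding L[symmetric] I_def by simp
      qed fact+
      have Ib: "I \<in> sets borel" by (simp add: I_def)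
      have "sqint lborel (\<lambda>y. kt0 (s, y))" "sqint lborel (\<lambda>y. d2 (s, y))" using elim(1-4) by (auto simp: sqint_def)
      then have "(\<lambda>y. kt0 (s, y)) \<in> L2 I" "(\<lambda>y. d2 (s, y)) \<in> L2 I"
        unfolding L2_iff_sqint[OF Ib] by (auto intro: sqint_lborel_imp_on[OF _ Ib])
      with wd show "(\<lambda>y. kt0 (s, y)) \<in> W12 I \<and> has_weak_deriv I 1 (\<lambda>y. kt0 (s, y)) (\<lambda>y. d2 (s, y))"
        unfolding W12_def by auto
    qed
  qed
qed

lemma section_integral:
  fixes f :: "plane \<Rightarrow> real^2"
  assumes "\<And>x. x \<notin> Lay \<Longrightarrow> f x = 0"
  shows "(LBINT y:{-\<xi>/2<..<\<xi>/2}. f (s, y)) = (LBINT y. f (s, y))"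
  unfolding set_lebesgue_integral_def
  by (intro Bochner_Integration.integral_cong refl) (use assms in \<open>auto simp: layer_def indicator_def\<close>)

lemma J_formula:
  assumes "s \<in> {-\<xi><..<1}"
  shows "J s = (LBINT t:{-\<xi><..<s}. (LBINT y:{-\<xi>/2<..<\<xi>/2}. \<alpha> (t, y)))"
proof -
  have "(LBINT y:{-\<xi>/2<..<\<xi>/2}. \<alpha> (t, y)) = a t" for t
    unfolding a_def by (rule section_integral) (rule \<alpha>(2))
  moreover have "indicator {..<s} t *\<^sub>R a t = indicator {-\<xi><..<s} t *\<^sub>R a t" for t
    using a_out[of t] assms by (auto simp: indicator_def)
  ultimately show ?thesis unfolding J_def set_lebesgue_integral_def by (simp only:)
qed

lemma second_column_d2: "AE x in lborel. B0 x = second_column d2 x"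
  using B0_column1
proof eventually_elim
  case (elim x)
  then show ?case by (simp add: vec_eq_iff column_def second_column_def d2_def forall_2)
qed

theorem layer_limit_properties:
  "strong_L2 Omega (\<lambda>n x. indicator (Omega - layer (\<epsilon> n) \<xi>) x *\<^sub>R k n x) k0"
  "k0 \<in> SBV Omega (sphere 0 1)"
  "jump_set Omega k0 \<subseteq> closure (layer0 \<xi>)"
  "has_weak_deriv Lay (coord 2) kt0 d2"
  "weak_L2 Lay (\<lambda>n. rescale (\<epsilon> n) (k n)) kt0"
  "weak_L2 Lay (\<lambda>n x. \<epsilon> n *\<^sub>R rescale (\<epsilon> n) (B n) x) (second_column d2)"
  "(\<lambda>x. \<epsilon> n *\<^sub>R rescale (\<epsilon> n) (B n) x) \<in> Hcurl (\<epsilon> n) Lay"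
  "weak_L2 Lay (\<lambda>n. weak_curl (\<epsilon> n) Lay (\<lambda>x. \<epsilon> n *\<^sub>R rescale (\<epsilon> n) (B n) x)) \<alpha>"
  "AE s in lborel. s \<in> {-\<xi><..<1} \<longrightarrow> (\<lambda>y. kt0 (s, y)) \<in> W12 {-\<xi>/2<..<\<xi>/2}
     \<and> has_weak_deriv {-\<xi>/2<..<\<xi>/2} 1 (\<lambda>y. kt0 (s, y)) (\<lambda>y. d2 (s, y))"
  "continuous_on {-\<xi>..1} J"
  "AE s in lborel. s \<in> {-\<xi><..<1} \<longrightarrow> J s = (LBINT y:{-\<xi>/2<..<\<xi>/2}. d2 (s, y))"
  "\<forall>s\<in>{-\<xi><..<1}. J s = (LBINT t:{-\<xi><..<s}. (LBINT y:{-\<xi>/2<..<\<xi>/2}. \<alpha> (t, y)))"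
  "norm (J 1) = 2"
proof -
  show "strong_L2 Omega (\<lambda>n x. indicator (Omega - layer (\<epsilon> n) \<xi>) x *\<^sub>R k n x) k0"
    unfolding strong_L2_def kx_def[symmetric] L2_iff_sqint[OF Omega_borel] set_integral_lborel_on[OF Omega_borel]
    using sqint_kx(1) sq(1) kx_strong unfolding nsq_def by blast
  show "k0 \<in> SBV Omega (sphere 0 1)" by (rule J.SBV_unit[OF k0_unit])
  show "jump_set Omega k0 \<subseteq> closure (layer0 \<xi>)" by (rule J.jump_set_subset)
  show "has_weak_deriv Lay (coord 2) kt0 d2" by (rule weak_deriv_kt0)
  have kt: "rescale (\<epsilon> n) (k n) = S.kt n" for n by (simp add: S.kt_def)
  have Bt: "(\<lambda>x. \<epsilon> n *\<^sub>R rescale (\<epsilon> n) (B n) x) = S.Bt n" for n by (simp add: S.Bt_def fun_eq_iff)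
  show "weak_L2 Lay (\<lambda>n. rescale (\<epsilon> n) (k n)) kt0"
    unfolding kt weak_L2_iff[OF layer_borel] by (intro conjI allI S.sqint_kt sq kt0)
  have sc: "sqint N (second_column d2)"
    unfolding second_column_eq[abs_def] by (rule sqint_colmat[OF d2(2)])
  have ae: "AE x in N. B0 x = second_column d2 x"
    unfolding AE_lborel_on[OF layer_borel] using second_column_d2 by eventually_elim simp
  have "ip N B0 h = ip N (second_column d2) h" if "sqint N h" for h
    by (rule ip_cong_AE[OF _ _ _ ae]) (use sq(4) sc that in \<open>auto simp: sqint_def\<close>)
  then have "wconv N S.Bt (second_column d2)" using B0(3) unfolding wconv_def by simp
  then show "weak_L2 Lay (\<lambda>n x. \<epsilon> n *\<^sub>R rescale (\<epsilon> n) (B n) x) (second_column d2)"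
    unfolding Bt weak_L2_iff[OF layer_borel] by (intro conjI allI S.sqint_Bt sc)
  show "(\<lambda>x. \<epsilon> n *\<^sub>R rescale (\<epsilon> n) (B n) x) \<in> Hcurl (\<epsilon> n) Lay" unfolding Bt by (rule S.Bt_Hcurl)
  \<comment> \<open>\<open>weak_curl\<close> is a choice and agrees with the explicit
    \<open>S.ct n\<close> only almost everywhere, which pairings do not notice.\<close>
  let ?c = "\<lambda>n. weak_curl (\<epsilon> n) Lay (S.Bt n)"
  have cae: "AE x in N. S.ct n x = ?c n x" for n
    unfolding AE_lborel_on[OF layer_borel] using S.weak_curl_Bt(1)[of n] by eventually_elim simp
  have cm: "S.ct n \<in> borel_measurable N" for n using S.sqint_ct(1)[of n] by (simp add: sqint_def)
  have cs: "sqint N (?c n)" for n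
    by (rule sqint_cong_AE[OF S.weak_curl_Bt(2) S.sqint_ct(1)]) (use cae in \<open>auto simp: eq_commute\<close>)
  have "ip N (S.ct n) h = ip N (?c n) h" if "sqint N h" for h n
    by (rule ip_cong_AE[OF cm S.weak_curl_Bt(2) _ cae]) (use that in \<open>auto simp: sqint_def\<close>)
  then have "wconv N ?c \<alpha>" using \<alpha>(3) unfolding wconv_def by simp
  then show "weak_L2 Lay (\<lambda>n. weak_curl (\<epsilon> n) Lay (\<lambda>x. \<epsilon> n *\<^sub>R rescale (\<epsilon> n) (B n) x)) \<alpha>"
    unfolding Bt weak_L2_iff[OF layer_borel] by (intro conjI allI cs sq)
  show "AE s in lborel. s \<in> {-\<xi><..<1} \<longrightarrow> (\<lambda>y. kt0 (s, y)) \<in> W12 {-\<xi>/2<..<\<xi>/2}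
     \<and> has_weak_deriv {-\<xi>/2<..<\<xi>/2} 1 (\<lambda>y. kt0 (s, y)) (\<lambda>y. d2 (s, y))" by (rule sections)
  show "continuous_on {-\<xi>..1} J" by (rule continuous_on_subset[OF J_continuous]) simp
  show "AE s in lborel. s \<in> {-\<xi><..<1} \<longrightarrow> J s = (LBINT y:{-\<xi>/2<..<\<xi>/2}. d2 (s, y))"
  proof -
    have "(LBINT y:{-\<xi>/2<..<\<xi>/2}. d2 (s, y)) = b s" for s
      unfolding b_def by (rule section_integral) (rule d2(3))
    with J_eq_b show ?thesis by (simp only:)
  qed
  show "\<forall>s\<in>{-\<xi><..<1}. J s = (LBINT t:{-\<xi><..<s}. (LBINT y:{-\<xi>/2<..<\<xi>/2}. \<alpha> (t, y)))"
    using J_formula by blast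
  show "norm (J 1) = 2" by (rule norm_J1)
qed

end

section \<open>Passage to a subsequence and conclusion\<close>

lemma wconv_zero_ext:
  assumes "U \<in> sets borel"
  shows "wconv (lborel_on U) f (\<lambda>x. indicator U x *\<^sub>R g x) \<longleftrightarrow> wconv (lborel_on U) f g"
proof -
  have "ip (lborel_on U) (\<lambda>x. indicator U x *\<^sub>R g x) h = ip (lborel_on U) g h" for h
    unfolding ip_def by (rule Bochner_Integration.integral_cong) (auto simp: space_restrict_space)
  then show ?thesis unfolding wconv_def by simp
qed

theorem theorem4p1:
  fixes W :: "real \<Rightarrow> real"
    and \<xi> C :: real
    and \<epsilon> :: "nat \<Rightarrow> real"
    and k :: "nat \<Rightarrow> plane \<Rightarrow> real^2"
    and B :: "nat \<Rightarrow> plane \<Rightarrow> real^2^2"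
  assumes "admissible_potential W"
    and "0 < \<xi>" and "\<xi> < 1"
    and "\<And>n. \<epsilon> n > 0" and "\<epsilon> \<longlonglongrightarrow> 0"
    and "\<And>n. k n \<in> W12 Omega"
    and "\<And>n. B n \<in> Hcurl 1 Omega"
    and "\<And>n. AE x in lborel. x \<in> Omega - layer (\<epsilon> n) \<xi> \<longrightarrow> B n x = 0"
    and "\<And>n. norm (LINT x:Omega|lborel. weak_curl 1 Omega (B n) x) = 2"
    and "\<And>n. energy W (\<epsilon> n) \<xi> (k n) (B n) \<le> ennreal C"
  shows "\<exists>(r :: nat \<Rightarrow> nat) k0 kt d2kt \<alpha> J.
      strict_mono r
    \<comment> \<open>(i)\<close>
    \<and> strong_L2 Omega
        (\<lambda>n x. indicator (Omega - layer (\<epsilon> (r n)) \<xi>) x *\<^sub>R k (r n) x) k0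
    \<and> k0 \<in> SBV Omega (sphere 0 1)
    \<and> jump_set Omega k0 \<subseteq> closure (layer0 \<xi>)
    \<comment> \<open>(ii), where \<open>d2kt\<close> is the weak derivative of \<open>kt\<close> in the second variable\<close>
    \<and> has_weak_deriv (layer 1 \<xi>) (coord 2) kt d2kt
    \<and> weak_L2 (layer 1 \<xi>) (\<lambda>n. rescale (\<epsilon> (r n)) (k (r n))) kt
    \<and> weak_L2 (layer 1 \<xi>) (\<lambda>n x. \<epsilon> (r n) *\<^sub>R rescale (\<epsilon> (r n)) (B (r n)) x) (second_column d2kt)
    \<and> (\<forall>n. (\<lambda>x. \<epsilon> (r n) *\<^sub>R rescale (\<epsilon> (r n)) (B (r n)) x) \<in> Hcurl (\<epsilon> (r n)) (layer 1 \<xi>))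
    \<and> weak_L2 (layer 1 \<xi>)
        (\<lambda>n. weak_curl (\<epsilon> (r n)) (layer 1 \<xi>)
               (\<lambda>x. \<epsilon> (r n) *\<^sub>R rescale (\<epsilon> (r n)) (B (r n)) x)) \<alpha>
    \<comment> \<open>(iii), where \<open>J\<close> is the continuous representative of the jump of \<open>kt\<close>\<close>
    \<and> (AE s in lborel. s \<in> {-\<xi><..<1} \<longrightarrow>
         (\<lambda>y. kt (s, y)) \<in> W12 {-\<xi>/2<..<\<xi>/2}
         \<and> has_weak_deriv {-\<xi>/2<..<\<xi>/2} 1 (\<lambda>y. kt (s, y)) (\<lambda>y. d2kt (s, y)))
    \<and> continuous_on {-\<xi>..1} J
    \<and> (AE s in lborel. s \<in> {-\<xi><..<1} \<longrightarrow> J s = (LINT y:{-\<xi>/2<..<\<xi>/2}|lborel. d2kt (s, y)))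
    \<and> (\<forall>s\<in>{-\<xi><..<1}. J s =
         (LINT t:{-\<xi><..<s}|lborel. (LINT y:{-\<xi>/2<..<\<xi>/2}|lborel. \<alpha> (t, y))))
    \<and> norm (J 1) = 2"
proof -
  have W: "\<And>x. x \<ge> 0 \<Longrightarrow> W x \<ge> 0" "continuous_on {0..} W"
    using assms(1) unfolding admissible_potential_def by blast+
  obtain C0 where C0: "C0 > 0" "\<And>x. x \<ge> 0 \<Longrightarrow> x\<^sup>2 / C0 - C0 \<le> W x"
    using assms(1) unfolding admissible_potential_def by blast
  \<comment> \<open>Dropping finitely many indices secures \<open>\<epsilon> n < 1\<close>; the loss
    is absorbed by the subsequence.\<close>
  obtain N where N: "\<And>n. N \<le> n \<Longrightarrow> \<epsilon> n < 1"
    using order_tendstoD(2)[OF assms(5) zero_less_one] unfolding eventually_sequentially by blast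
  \<comment> \<open>\<open>ennreal C\<close> is 0 for negative \<open>C\<close>, so \<open>C\<close>
    may be replaced by its positive part.\<close>
  have energy: "energy W (\<epsilon> n) \<xi> (k n) (B n) \<le> ennreal (max C 0)" for n
    using assms(10)[of n] by (rule order_trans) (simp add: ennreal_leI)
  have st: "layer_state W \<xi> (max C 0) C0 (\<epsilon> n) (k n) (B n)" if "N \<le> n" for n
    by unfold_locales (use W C0 assms(2-4,6-8) N[OF that] energy[of n] in auto)
  have total: "norm (\<integral>x. weak_curl 1 Omega (B n) x \<partial>lborel_on Omega) = 2" for n
    using assms(9)[of n] unfolding set_integral_lborel_on[OF Omega_borel] .
  have sequence: "layer_sequence W \<xi> (max C 0) C0 (\<lambda>n. \<epsilon> (r n)) (\<lambda>n. k (r n)) (\<lambda>n. B (r n))"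
    if "strict_mono r" "\<And>n. N \<le> r n" for r
    using st[OF that(2)] LIMSEQ_subseq_LIMSEQ[OF assms(5) that(1)] total
    by (intro layer_sequence.intro) (simp_all add: o_def)
  interpret Q: layer_sequence W \<xi> "max C 0" C0 "\<lambda>n. \<epsilon> (n + N)" "\<lambda>n. k (n + N)" "\<lambda>n. B (n + N)"
    by (rule sequence) (auto simp: strict_mono_def)
  obtain q k0 H0 kt0 B0 \<alpha> where q: "strict_mono (q :: nat \<Rightarrow> nat)"
    and k0: "sqint (lborel_on Omega) k0" "wconv (lborel_on Omega) (\<lambda>n. Q.kx (q n)) k0"
    and H0: "sqint (lborel_on Omega) H0" "wconv (lborel_on Omega) (\<lambda>n. Q.S.H (q n)) H0"
    and kt0: "sqint (lborel_on (layer 1 \<xi>)) kt0" "wconv (lborel_on (layer 1 \<xi>)) (\<lambda>n. Q.S.kt (q n)) kt0"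
    and B0: "sqint (lborel_on (layer 1 \<xi>)) B0" "wconv (lborel_on (layer 1 \<xi>)) (\<lambda>n. Q.S.Bt (q n)) B0"
    and \<alpha>: "sqint (lborel_on (layer 1 \<xi>)) \<alpha>" "wconv (lborel_on (layer 1 \<xi>)) (\<lambda>n. Q.S.ct (q n)) \<alpha>"
    using Q.extraction by blast
  \<comment> \<open>The extraction was made along the shifted sequence; undoing the shift expresses
    it in the original indices.\<close>
  define r where "r n = q n + N" for n
  have r: "strict_mono r" "\<And>n. N \<le> r n" using q by (auto simp: r_def strict_mono_def)
  interpret R: layer_sequence W \<xi> "max C 0" C0 "\<lambda>n. \<epsilon> (r n)" "\<lambda>n. k (r n)" "\<lambda>n. B (r n)"
    by (rule sequence[OF r])
  have fields: "Q.kx (q n) = R.kx n" "Q.S.H (q n) = R.S.H n" "Q.S.kt (q n) = R.S.kt n"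
      "Q.S.Bt (q n) = R.S.Bt n" "Q.S.ct (q n) = R.S.ct n" for n
    unfolding R.kx_def[abs_def] Q.kx_def[abs_def] unfolding r_def by (rule refl)+
  \<comment> \<open>Extending the limits by zero changes no pairing over the restricted measures and
    meets the normalisation that the limit locale requires.\<close>
  interpret layer_limit W \<xi> "max C 0" C0 "\<lambda>n. \<epsilon> (r n)" "\<lambda>n. k (r n)" "\<lambda>n. B (r n)"
    "\<lambda>x. indicator Omega x *\<^sub>R k0 x" "\<lambda>x. indicator Omega x *\<^sub>R H0 x" "\<lambda>x. indicator (layer 1 \<xi>) x *\<^sub>R kt0 x"
    "\<lambda>x. indicator (layer 1 \<xi>) x *\<^sub>R B0 x" "\<lambda>x. indicator (layer 1 \<xi>) x *\<^sub>R \<alpha> x"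
  proof unfold_locales
    show "sqint lborel (\<lambda>x. indicator Omega x *\<^sub>R k0 x)" "sqint lborel (\<lambda>x. indicator Omega x *\<^sub>R H0 x)"
      "sqint lborel (\<lambda>x. indicator (layer 1 \<xi>) x *\<^sub>R kt0 x)" "sqint lborel (\<lambda>x. indicator (layer 1 \<xi>) x *\<^sub>R B0 x)"
      "sqint lborel (\<lambda>x. indicator (layer 1 \<xi>) x *\<^sub>R \<alpha> x)"
      using k0(1) H0(1) kt0(1) B0(1) \<alpha>(1) unfolding sqint_lborel_on[OF Omega_borel] sqint_lborel_on[OF layer_borel] by blast+
  qed (use k0(2) H0(2) kt0(2) B0(2) \<alpha>(2) in \<open>simp_all add: fields wconv_zero_ext\<close>)
  show ?thesis
    by (rule exI[of _ r], rule exI[of _ "\<lambda>x. indicator Omega x *\<^sub>R k0 x"], rule exI[of _ "\<lambda>x. indicator (layer 1 \<xi>) x *\<^sub>R kt0 x"],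
        rule exI[of _ d2], rule exI[of _ "\<lambda>x. indicator (layer 1 \<xi>) x *\<^sub>R \<alpha> x"], rule exI[of _ J])
      (intro conjI allI; rule r(1) layer_limit_properties)
qed

end
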